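(* Let $d\ge1$, let $f:\mathbb{R}^d\to\mathbb{R}$ be a bounded continuous function and let $F$ be its Poisson extension to $\mathbb{R}^{d+1}_+$. Assume that $\nabla F$ is weakly quasiregular. (1) If $f\in\Lambda_*(\mathbb{R}^d)$, then $\mathrm{Dim}(\mathcal{D}(f)\cap Q)=d$ for any cube $Q\subset\mathbb{R}^d$. (2) If $f\in\lambda_*(\mathbb{R}^d)$, then $\mathrm{Dim}(\mathcal{D}_0(f)\cap Q)=d$ for any cube $Q\subset\mathbb{R}^d$.
   Context: $\mathbb{R}^{d+1}_+=\{(x,y):x\in\mathbb{R}^d,\ y>0\}$; the Poisson extension of $f$ is $F(x,y)=c_d\int_{\mathbb{R}^d}\frac{y\,f(z)}{(|x-z|^2+y^2)^{(d+1)/2}}\,dz$, with $c_d$ normalizing the kernel to have integral one. $\mathrm{Dim}$ denotes Hausdorff dimension; $l(Q)$ is the sidelength of a cube $Q$ (with sides parallel to the axes). Zygmund class: a bounded continuous $f:\mathbb{R}^d\to\mathbb{R}$ is in $\Lambda_*(\mathbb{R}^d)$ if $\|f\|_*=\sup_{x\in\mathbb{R}^d,\,h\in\mathbb{R}^d\setminus\{0\}}\frac{|f(x+h)+f(x-h)-2f(x)|}{|h|}<\infty$. Small Zygmund class: a bounded continuous $f$ is in $\lambda_*(\mathbb{R}^d)$ if $\sup_x\frac{|f(x+h)+f(x-h)-2f(x)|}{|h|}\to0$ as $|h|\to0$. $\mathcal{D}(f)=\{x\in\mathbb{R}^d:\limsup_{|h|\to0}\frac{|f(x+h)-f(x)|}{|h|}<\infty\}$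 and $\mathcal{D}_0(f)=\{x\in\mathbb{R}^d: f\text{ is differentiable at }x\}$. Weak quasiregularity: with $HF$ the $(d+1)\times(d+1)$ Hessian matrix of $F$ and $(HF)e$ the matrix $HF$ applied to the vector $e$, $\nabla F$ is weakly quasiregular if there exist an integer $N\ge2$ and $\gamma\ge1$ such that for every cube $Q\subset\mathbb{R}^d$ $$\int_{C_{1/N}(Q)}\max_{|e|=1}|(HF)e(x,y)|^2\,dx\,dy\le\gamma^2\min_{|e|=1}\int_{C_{1/N}(Q)}|(HF)e(x,y)|^2\,dx\,dy,$$ where $C_{1/N}(Q)=Q\times[l(Q)/N,\,l(Q)]$ and the max and min are over unit vectors $e\in\mathbb{R}^{d+1}$. *)

theory Defs
  imports "HOL-Analysis.Analysis"
begin

text \<open>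
  The case distinction implements the usual convention \<open>(diam U)\<^sup>0 = 1\<close> for nonempty \<open>U\<close>
  (in the library \<open>0 powr 0 = 0\<close>).
\<close>

definition hausdorff_gauge :: "real \<Rightarrow> 'a::metric_space set \<Rightarrow> ennreal" where
  "hausdorff_gauge s U =
     (if U = {} then 0 else if s = 0 then 1 else ennreal (diameter U powr s))"

text \<open>
  Boundedness of the covering sets is required explicitly, because the real-valued
  \<^const>\<open>diameter\<close> is unspecified on unbounded sets.
\<close>

definition delta_covers :: "real \<Rightarrow> 'a::metric_space set \<Rightarrow> (nat \<Rightarrow> 'a set) set" where
  "delta_covers \<delta> A =
     {U. A \<subseteq> (\<Union>i. U i) \<and> (\<forall>i. bounded (U i) \<and> diameter (U i) \<le> \<delta>)}"

definition hausdorff_premeasure :: "real \<Rightarrow> real \<Rightarrow> 'a::metric_space set \<Rightarrow> ennreal" where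
  "hausdorff_premeasure \<delta> s A = (INF U \<in> delta_covers \<delta> A. \<Sum>i. hausdorff_gauge s (U i))"

definition hausdorff_measure :: "real \<Rightarrow> 'a::metric_space set \<Rightarrow> ennreal" where
  "hausdorff_measure s A = (SUP \<delta> \<in> {0<..}. hausdorff_premeasure \<delta> s A)"

definition hausdorff_dim :: "'a::metric_space set \<Rightarrow> ennreal" where
  "hausdorff_dim A = Inf {ennreal s | s. 0 \<le> s \<and> hausdorff_measure s A = 0}"

definition cube :: "real ^ 'n \<Rightarrow> real \<Rightarrow> (real ^ 'n) set" where
  "cube a l = cbox a (a + (\<chi> i. l))"

definition upper_box :: "nat \<Rightarrow> real ^ 'n \<Rightarrow> real \<Rightarrow> ((real ^ 'n) \<times> real) set" where
  "upper_box N a l = cube a l \<times> {l / real N..l}"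

text \<open>
  The integral of \<open>y / (|z|\<^sup>2 + y\<^sup>2)\<^bsup>(d+1)/2\<^esup>\<close> over \<open>z\<close> does not depend on \<open>y > 0\<close>
  (substitute \<open>z = y w\<close>), so the constant is read off at \<open>y = 1\<close>.
\<close>

definition poisson_const :: "'n::finite itself \<Rightarrow> real" where
  "poisson_const _ =
     1 / (LINT z::real^'n|lborel. 1 / ((norm z)\<^sup>2 + 1) powr ((real CARD('n) + 1) / 2))"

definition poisson_extension :: "(real ^ 'n \<Rightarrow> real) \<Rightarrow> (real ^ 'n) \<times> real \<Rightarrow> real" where
  "poisson_extension f = (\<lambda>(x, y). poisson_const TYPE('n) *
     (LINT z|lborel. y * f z / ((norm (x - z))\<^sup>2 + y\<^sup>2) powr ((real CARD('n) + 1) / 2)))"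

definition partial :: "'a::euclidean_space \<Rightarrow> ('a \<Rightarrow> real) \<Rightarrow> 'a \<Rightarrow> real" where
  "partial b F p = deriv (\<lambda>t. F (p + t *\<^sub>R b)) 0"

text \<open>
  The Hessian matrix at \<open>p\<close>, with rows and columns indexed by the standard basis, applied to \<open>e\<close>.
\<close>

definition hessian_apply :: "('a::euclidean_space \<Rightarrow> real) \<Rightarrow> 'a \<Rightarrow> 'a \<Rightarrow> 'a" where
  "hessian_apply F p e =
     (\<Sum>b\<in>Basis. (\<Sum>c\<in>Basis. partial b (partial c F) p * (e \<bullet> c)) *\<^sub>R b)"

text \<open>
  Since \<^term>\<open>hessian_apply F p\<close> is linear and the unit sphere is compact, the supremum is a
  maximum. For \<open>F\<close> smooth on the open upper half-space, as every Poisson extension of a bounded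
  continuous function is, both integrals converge and the infimum of the quadratic form over the
  sphere is a minimum.
\<close>

definition weakly_quasiregular_gradient :: "((real ^ 'n) \<times> real \<Rightarrow> real) \<Rightarrow> bool" where
  "weakly_quasiregular_gradient F \<longleftrightarrow>
     (\<exists>N::nat. \<exists>\<gamma>::real. N \<ge> 2 \<and> \<gamma> \<ge> 1 \<and> (\<forall>a l. l > 0 \<longrightarrow>
        (LINT p : upper_box N a l | lborel. (SUP e \<in> sphere 0 1. (norm (hessian_apply F p e))\<^sup>2))
        \<le> \<gamma>\<^sup>2 * (INF e \<in> sphere 0 1.
              (LINT p : upper_box N a l | lborel. (norm (hessian_apply F p e))\<^sup>2))))"

definition second_diff_quot :: "('a::real_normed_vector \<Rightarrow> real) \<Rightarrow> 'a \<Rightarrow> 'a \<Rightarrow> real" where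
  "second_diff_quot f x h = \<bar>f (x + h) + f (x - h) - 2 * f x\<bar> / norm h"

definition zygmund_class :: "('a::real_normed_vector \<Rightarrow> real) set" where
  "zygmund_class = {f. bounded (range f) \<and> continuous_on UNIV f \<and>
     (SUP x. SUP h \<in> - {0}. ennreal (second_diff_quot f x h)) < \<infinity>}"

text \<open>
  The real supremum below is taken over a bounded set, as \<open>f\<close> is bounded and \<open>h \<noteq> 0\<close>.
\<close>

definition small_zygmund_class :: "('a::real_normed_vector \<Rightarrow> real) set" where
  "small_zygmund_class = {f. bounded (range f) \<and> continuous_on UNIV f \<and>
     ((\<lambda>h. SUP x. second_diff_quot f x h) \<longlongrightarrow> 0) (at 0)}"

definition lip_points :: "('a::real_normed_vector \<Rightarrow> real) \<Rightarrow> 'a set" where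
  "lip_points f = {x. Limsup (at 0) (\<lambda>h. ereal (\<bar>f (x + h) - f x\<bar> / norm h)) < \<infinity>}"

definition diff_points :: "('a::real_normed_vector \<Rightarrow> real) \<Rightarrow> 'a set" where
  "diff_points f = {x. f differentiable (at x)}"

end

(*
  Let kappa(y) bound y |D^2 F| at height y; it is bounded for f in the Zygmund class and tends to 0
  with y in the small one, and |f(x+h) - f(x) - grad_x F(x,|h|) h| <= C kappa |h|.  So it suffices
  to find many points x over which U = grad_x F stays bounded, respectively converges, as y -> 0.

  On the N-adic tree of cubes U behaves like a martingale with increments O(kappa).  Green's
  formula for F_e^2 on Q x (h, l) compares the variance of the component of U along e with the
  energy of grad F_e, and weak quasiregularity makes these energies comparable for all unit
  vectors e.  Hence if U, started at a cube, leaves a ball of radius R >> kappa on half of the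
  cube, then for every direction e a fixed fraction rho of the cube consists of disjoint subcubes
  on which it has left with e-component <= - rho R; aiming e at a fixed centre z keeps U within
  distance 4 R / rho of z.  Since the subcubes are at least m levels deeper (m large as
  R / kappa is), iterating this selection yields a Cantor set of dimension as close to d as we
  please.  If instead U stays in the ball on half of a cube, that half itself is the desired set.
  For the small class, R is halved and z is moved each time kappa has become small enough.
*)

theory Submission imports Defs "HOL-Library.Sublist" begin

section \<open>Homogeneous kernels\<close>

text \<open>Three obstacles shape the details. The Hessian bound comes from symmetrising the
  convolution about its centre, which needs an even kernel; the mixed derivative has an odd one, so
  it is recovered by integrating a third derivative from infinity, where boundedness of
  \<open>f\<close> supplies the decay. \<open>U\<close> is not exactly a martingale: Green's formula
  leaves lateral errors, O(\<kappa>) in the mean and O(\<kappa> R) in the second moment, while exits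
  force a total variance of order R^2. Hence R must exceed a fixed multiple \<open>Lam\<close> of
  \<kappa>. All cells of one stopping family are compared at the same bottom height h, so that
  bottom integrals add up exactly and only the energy between the root and the stopping cells
  remains. That region is a union of boxes from the quasiregularity condition, which transfers
  energy from one direction to another. No measure is built on the Cantor set. A cover is turned
  into a finite family of words, whose weight is bounded below by counting; the loss factor \<rho>
  per selection is repaid by the factor N^((d-s) m) gained over m levels.\<close>

lemma has_derivative_along:
  assumes "\<And>p. snd p > 0 \<Longrightarrow> ((\<lambda>t. G (p + t *\<^sub>R b)) has_real_derivative G' p) (at 0)"
    and "snd (p + s *\<^sub>R b) > 0"
  shows "((\<lambda>t. G (p + t *\<^sub>R b)) has_real_derivative G' (p + s *\<^sub>R b)) (at (s::real))"
proof -
  have "((\<lambda>t. G (p + (s + t) *\<^sub>R b)) has_real_derivative G' (p + s *\<^sub>R b)) (at 0)"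
    using assms(1)[OF assms(2)] by (simp add: algebra_simps)
  then show ?thesis
    using DERIV_at_within_shift[of "\<lambda>t. G (p + t *\<^sub>R b)" _ s 0 UNIV] by simp
qed

text \<open>A class of kernels, homogeneous of degree -m, that contains the Poisson kernel and is
  closed under \<open>partial\<close>, so that decay, continuity, differentiability and symmetry of
  second derivatives can all be proved by induction on the construction. Rule \<open>cong\<close>
  makes values at the origin irrelevant; there \<open>powr\<close> and \<open>deriv\<close> only
  give default values.\<close>

inductive hom_kernel :: "real \<Rightarrow> ('a::euclidean_space \<Rightarrow> real) \<Rightarrow> bool" where
  npow: "hom_kernel m (\<lambda>v. norm v powr (-m))"
| lin: "hom_kernel m k \<Longrightarrow> hom_kernel (m - 1) (\<lambda>v. (v \<bullet> c) * k v)"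
| add: "hom_kernel m k \<Longrightarrow> hom_kernel m k' \<Longrightarrow> hom_kernel m (\<lambda>v. k v + k' v)"
| scale: "hom_kernel m k \<Longrightarrow> hom_kernel m (\<lambda>v. r * k v)"
| cong: "hom_kernel m k \<Longrightarrow> (\<And>v. v \<noteq> 0 \<Longrightarrow> k v = k' v) \<Longrightarrow> hom_kernel m k'"

lemma hom_kernel_bound:
  assumes "hom_kernel m k"
  shows "\<exists>C\<ge>0. \<forall>v. v \<noteq> 0 \<longrightarrow> \<bar>k v\<bar> \<le> C * norm v powr (-m)"
  using assms
proof induction
  case (npow m) then show ?case by (intro exI[of _ 1]) auto
next
  case (lin m k c)
  then obtain C where C: "C \<ge> 0" "\<And>v. v \<noteq> 0 \<Longrightarrow> \<bar>k v\<bar> \<le> C * norm v powr (-m)" by auto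
  have "\<bar>(v \<bullet> c) * k v\<bar> \<le> (norm c * C) * norm v powr (-(m-1))" if "v \<noteq> 0" for v
  proof -
    have "\<bar>(v \<bullet> c) * k v\<bar> \<le> (norm v * norm c) * (C * norm v powr (-m))"
      unfolding abs_mult using C that by (intro mult_mono Cauchy_Schwarz_ineq2) auto
    also have "\<dots> = (norm c * C) * (norm v powr 1 * norm v powr (-m))" by simp
    also have "norm v powr 1 * norm v powr (-m) = norm v powr (-(m-1))"
      by (simp only: powr_add[symmetric]) simp
    finally show ?thesis .
  qed
  then show ?case using C by (intro exI[of _ "norm c * C"]) auto
next
  case (add m k k')
  then obtain C C' where C: "C \<ge> 0" "\<And>v. v \<noteq> 0 \<Longrightarrow> \<bar>k v\<bar> \<le> C * norm v powr (-m)"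
    "C' \<ge> 0" "\<And>v. v \<noteq> 0 \<Longrightarrow> \<bar>k' v\<bar> \<le> C' * norm v powr (-m)" by auto
  have "\<bar>k v + k' v\<bar> \<le> (C + C') * norm v powr (-m)" if "v \<noteq> 0" for v
    using C(2)[OF that] C(4)[OF that] by (simp add: algebra_simps)
  then show ?case using C by (intro exI[of _ "C + C'"]) auto
next
  case (scale m k r)
  then obtain C where C: "C \<ge> 0" "\<And>v. v \<noteq> 0 \<Longrightarrow> \<bar>k v\<bar> \<le> C * norm v powr (-m)" by auto
  have "\<bar>r * k v\<bar> \<le> (\<bar>r\<bar> * C) * norm v powr (-m)" if "v \<noteq> 0" for v
    using C(2)[OF that] by (simp add: abs_mult mult_left_mono mult.assoc)
  then show ?case using C by (intro exI[of _ "\<bar>r\<bar> * C"]) auto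
next
  case (cong m k k') then show ?case by auto
qed

lemma hom_kernel_continuous:
  assumes "hom_kernel m k"
  shows "continuous_on (-{0}) k"
  using assms
proof induction
  case (cong m k k') then show ?case by (metis ComplD continuous_on_cong singletonI)
qed (auto intro!: continuous_intros)

text \<open>Writing |u|^s as (u . u)^(s/2) reduces this to the derivative of a quadratic polynomial
  in t.\<close>

lemma norm_powr_deriv:
  fixes v b :: "'a::euclidean_space"
  assumes "v \<noteq> 0"
  shows "((\<lambda>t. norm (v + t *\<^sub>R b) powr s) has_real_derivative s * ((v \<bullet> b) * norm v powr (s - 2))) (at 0)"
proof -
  have eq: "norm u powr s = (u \<bullet> u) powr (s/2)" for u :: 'a
    by (cases "u = 0") (auto simp: dot_square_norm powr_half_sqrt powr_powr simp flip: powr_numeral)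
  have "((\<lambda>t. ((v + t *\<^sub>R b) \<bullet> (v + t *\<^sub>R b))) has_real_derivative 2 * (v \<bullet> b)) (at 0)"
    by (auto simp: inner_add_left inner_add_right inner_commute intro!: derivative_eq_intros)
  from DERIV_chain2[OF has_real_derivative_powr this, of "s/2"]
  have "((\<lambda>t. ((v + t *\<^sub>R b) \<bullet> (v + t *\<^sub>R b)) powr (s/2)) has_real_derivative
     s/2 * ((v \<bullet> v) powr (s/2 - 1)) * (2 * (v \<bullet> b))) (at 0)" using assms by simp
  moreover have "(v \<bullet> v) powr (s/2 - 1) = norm v powr (s - 2)"
    using eq by (simp add: dot_square_norm powr_powr algebra_simps flip: powr_numeral)
  ultimately show ?thesis unfolding eq by (simp add: algebra_simps)
qed

text \<open>The existential form lets the induction produce the derivative kernel together with its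
  degree; \<open>hom_kernel_partial\<close> then identifies it with \<open>partial\<close> away from
  the origin.\<close>

lemma hom_kernel_deriv_ex:
  assumes "hom_kernel m k"
  shows "\<exists>k'. hom_kernel (m+1) k' \<and> (\<forall>v. v \<noteq> 0 \<longrightarrow> ((\<lambda>t. k (v + t *\<^sub>R b)) has_real_derivative k' v) (at 0))"
  using assms
proof induction
  case (npow m)
  have "hom_kernel (m+2-1) (\<lambda>v. (v \<bullet> b) * norm v powr (-(m+2)))"
    by (rule hom_kernel.lin[OF hom_kernel.npow])
  then have h: "hom_kernel (m+1) (\<lambda>v. (-m) * ((v \<bullet> b) * norm v powr (-m-2)))"
    by (intro hom_kernel.scale) (simp add: algebra_simps)
  show ?case
    using h norm_powr_deriv[where s="-m" and b=b] by (intro exI conjI allI impI) auto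
next
  case (lin m k c)
  then obtain k' where k': "hom_kernel (m+1) k'"
     "\<And>v. v \<noteq> 0 \<Longrightarrow> ((\<lambda>t. k (v + t *\<^sub>R b)) has_real_derivative k' v) (at 0)" by auto
  have h: "hom_kernel (m-1+1) (\<lambda>v. (b \<bullet> c) * k v + (v \<bullet> c) * k' v)"
    using hom_kernel.add[OF hom_kernel.scale[OF lin(1), of "b \<bullet> c"] hom_kernel.lin[OF k'(1), of c, simplified]] by simp
  show ?case
    by (intro exI conjI allI impI, rule h)
       (auto intro!: derivative_eq_intros k'(2) simp: inner_add_left algebra_simps)
next
  case (add m k l)
  then obtain k' l' where k': "hom_kernel (m+1) k'" "hom_kernel (m+1) l'"
     "\<And>v. v \<noteq> 0 \<Longrightarrow> ((\<lambda>t. k (v + t *\<^sub>R b)) has_real_derivative k' v) (at 0)"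
     "\<And>v. v \<noteq> 0 \<Longrightarrow> ((\<lambda>t. l (v + t *\<^sub>R b)) has_real_derivative l' v) (at 0)" by auto
  show ?case
    by (intro exI conjI allI impI, rule hom_kernel.add[OF k'(1,2)]) (auto intro!: derivative_eq_intros k'(3-))
next
  case (scale m k r)
  then obtain k' where k': "hom_kernel (m+1) k'"
     "\<And>v. v \<noteq> 0 \<Longrightarrow> ((\<lambda>t. k (v + t *\<^sub>R b)) has_real_derivative k' v) (at 0)" by auto
  show ?case
    by (intro exI conjI allI impI, rule hom_kernel.scale[OF k'(1), of r]) (auto intro!: derivative_eq_intros k'(2))
next
  case (cong m k k2)
  then obtain k' where k': "hom_kernel (m+1) k'"
     "\<And>v. v \<noteq> 0 \<Longrightarrow> ((\<lambda>t. k (v + t *\<^sub>R b)) has_real_derivative k' v) (at 0)" by auto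
  have "((\<lambda>t. k2 (v + t *\<^sub>R b)) has_real_derivative k' v) (at 0)" if "v \<noteq> 0" for v
  proof (rule has_field_derivative_transform_within_open[OF k'(2)[OF that], where S="{t. v + t *\<^sub>R b \<noteq> 0}"])
    show "open {t. v + t *\<^sub>R b \<noteq> 0}" by (intro open_Collect_neq continuous_intros)
  qed (use that cong in auto)
  then show ?case using k'(1) by blast
qed

lemma hom_kernel_partial:
  assumes "hom_kernel m k"
  shows "hom_kernel (m+1) (partial b k)"
    and "v \<noteq> 0 \<Longrightarrow> ((\<lambda>t. k (v + t *\<^sub>R b)) has_real_derivative partial b k v) (at 0)"
proof -
  obtain k' where k': "hom_kernel (m+1) k'"
     "\<And>v. v \<noteq> 0 \<Longrightarrow> ((\<lambda>t. k (v + t *\<^sub>R b)) has_real_derivative k' v) (at 0)"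
    using hom_kernel_deriv_ex[OF assms] by blast
  have eq: "k' v = partial b k v" if "v \<noteq> 0" for v
    unfolding partial_def using DERIV_imp_deriv[OF k'(2)[OF that]] by simp
  show "hom_kernel (m+1) (partial b k)" by (rule hom_kernel.cong[OF k'(1)]) (rule eq)
  show "v \<noteq> 0 \<Longrightarrow> ((\<lambda>t. k (v + t *\<^sub>R b)) has_real_derivative partial b k v) (at 0)"
    using k'(2) eq by simp
qed

lemma partial_cong_open:
  assumes "open S" "p \<in> S" "\<And>q. q \<in> S \<Longrightarrow> F q = G q"
  shows "partial b F p = partial b G p"
  unfolding partial_def
proof (rule deriv_cong_ev[OF _ refl])
  have "open ((\<lambda>t::real. p + t *\<^sub>R b) -` S)"
    using assms(1) by (intro open_vimage continuous_intros) auto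
  then have "\<forall>\<^sub>F t in nhds (0::real). t \<in> (\<lambda>t. p + t *\<^sub>R b) -` S"
    by (rule eventually_nhds_in_open) (use assms in simp)
  then show "\<forall>\<^sub>F t in nhds 0. F (p + t *\<^sub>R b) = G (p + t *\<^sub>R b)"
    by eventually_elim (use assms in auto)
qed

text \<open>By induction on the kernel: in every case the second derivative is expanded into a
  formula that is symmetric in b and c, given symmetry for the constituents.\<close>

lemma hom_kernel_partial_commute:
  assumes "hom_kernel m k" "v \<noteq> 0"
  shows "partial b (partial c k) v = partial c (partial b k) v"
  using assms
proof (induction arbitrary: v)
  have pe: "partial b k v = x" if "((\<lambda>t. k (v + t *\<^sub>R b)) has_real_derivative x) (at 0)" for b k v x
    using DERIV_imp_deriv[OF that] by (simp add: partial_def)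
  have on: "open (-{0::'a})" by (intro open_Compl) simp
  {
    case (npow m)
    have 1: "partial c (\<lambda>v. norm v powr (-m)) u = (-m) * ((u \<bullet> c) * norm u powr (-m-2))" if "u \<noteq> 0" for u c :: 'a
      by (rule pe, rule norm_powr_deriv[OF that])
    have "partial b (partial c (\<lambda>v. norm v powr (-m))) v
       = (-m) * ((b \<bullet> c) * norm v powr (-m-2) + (v \<bullet> c) * ((-m-2) * ((v \<bullet> b) * norm v powr (-m-2-2))))" for b c
    proof -
      have "partial b (partial c (\<lambda>v. norm v powr (-m))) v
        = partial b (\<lambda>u. (-m) * ((u \<bullet> c) * norm u powr (-m-2))) v"
        by (rule partial_cong_open[OF on]) (use npow 1 in auto)
      also have "\<dots> = (-m) * ((b \<bullet> c) * norm v powr (-m-2) + (v \<bullet> c) * ((-m-2) * ((v \<bullet> b) * norm v powr (-m-2-2))))"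
      proof (rule pe)
        have "((\<lambda>t. (v + t *\<^sub>R b) \<bullet> c) has_real_derivative b \<bullet> c) (at 0)"
          by (auto intro!: derivative_eq_intros simp: inner_add_left)
        from DERIV_cmult[OF DERIV_mult[OF this norm_powr_deriv[OF npow, where s="-m-2"]], where c="-m"]
        show "((\<lambda>t. - m * ((v + t *\<^sub>R b) \<bullet> c * norm (v + t *\<^sub>R b) powr (- m - 2))) has_real_derivative
           (-m) * ((b \<bullet> c) * norm v powr (-m-2) + (v \<bullet> c) * ((-m-2) * ((v \<bullet> b) * norm v powr (-m-2-2))))) (at 0)"
          by (simp add: mult.commute)
      qed
      finally show ?thesis .
    qed
    then show ?case by (simp add: inner_commute)
  next
    case (lin m k e)
    note d1 = hom_kernel_partial(2)[OF lin.hyps] 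
    note d2 = hom_kernel_partial(2)[OF hom_kernel_partial(1)[OF lin.hyps]]
    have 1: "partial c (\<lambda>v. (v \<bullet> e) * k v) u = (c \<bullet> e) * k u + (u \<bullet> e) * partial c k u" if "u \<noteq> 0" for u c
      by (rule pe) (use that in \<open>auto intro!: derivative_eq_intros d1 simp: inner_add_left\<close>)
    have "partial b (partial c (\<lambda>v. (v \<bullet> e) * k v)) v
       = (c \<bullet> e) * partial b k v + (b \<bullet> e) * partial c k v + (v \<bullet> e) * partial b (partial c k) v" for b c
    proof -
      have "partial b (partial c (\<lambda>v. (v \<bullet> e) * k v)) v
        = partial b (\<lambda>u. (c \<bullet> e) * k u + (u \<bullet> e) * partial c k u) v"
        by (rule partial_cong_open[OF on]) (use lin 1 in auto)
      also have "\<dots> = (c \<bullet> e) * partial b k v + (b \<bullet> e) * partial c k v + (v \<bullet> e) * partial b (partial c k) v"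
        by (rule pe) (use lin in \<open>auto intro!: derivative_eq_intros d1 d2 simp: inner_add_left\<close>)
      finally show ?thesis .
    qed
    then show ?case using lin by simp
  next
    case (add m k l)
    note d1 = hom_kernel_partial(2)[OF add.hyps(1)] hom_kernel_partial(2)[OF add.hyps(2)]
    note d2 = hom_kernel_partial(2)[OF hom_kernel_partial(1)[OF add.hyps(1)]]
       hom_kernel_partial(2)[OF hom_kernel_partial(1)[OF add.hyps(2)]]
    have 1: "partial c (\<lambda>v. k v + l v) u = partial c k u + partial c l u" if "u \<noteq> 0" for u c
      by (rule pe) (use that in \<open>auto intro!: derivative_eq_intros d1\<close>)
    have "partial b (partial c (\<lambda>v. k v + l v)) v = partial b (partial c k) v + partial b (partial c l) v" for b c
    proof -
      have "partial b (partial c (\<lambda>v. k v + l v)) v = partial b (\<lambda>u. partial c k u + partial c l u) v"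
        by (rule partial_cong_open[OF on]) (use add 1 in auto)
      also have "\<dots> = partial b (partial c k) v + partial b (partial c l) v"
        by (rule pe) (use add in \<open>auto intro!: derivative_eq_intros d2\<close>)
      finally show ?thesis .
    qed
    then show ?case using add by simp
  next
    case (scale m k r)
    note d1 = hom_kernel_partial(2)[OF scale.hyps(1)]
    note d2 = hom_kernel_partial(2)[OF hom_kernel_partial(1)[OF scale.hyps(1)]]
    have 1: "partial c (\<lambda>v. r * k v) u = r * partial c k u" if "u \<noteq> 0" for u c
      by (rule pe) (use that in \<open>auto intro!: derivative_eq_intros d1\<close>)
    have "partial b (partial c (\<lambda>v. r * k v)) v = r * partial b (partial c k) v" for b c
    proof -
      have "partial b (partial c (\<lambda>v. r * k v)) v = partial b (\<lambda>u. r * partial c k u) v"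
        by (rule partial_cong_open[OF on]) (use scale 1 in auto)
      also have "\<dots> = r * partial b (partial c k) v"
        by (rule pe) (use scale in \<open>auto intro!: derivative_eq_intros d2\<close>)
      finally show ?thesis .
    qed
    then show ?case using scale by simp
  next
    case (cong m k k')
    have "partial b (partial c k') v = partial b (partial c k) v" for b c
    proof (rule partial_cong_open[OF on])
      fix q :: 'a assume "q \<in> - {0}"
      then show "partial c k' q = partial c k q"
        by (intro partial_cong_open[OF on]) (use cong in auto)
    qed (use cong in auto)
    then show ?case using cong by simp
  }
qed

section \<open>The Poisson extension and its derivatives\<close>

lemma lborel_integral_affine:
  fixes g :: "'a::euclidean_space \<Rightarrow> real"
  assumes "c \<noteq> 0" "integrable lborel g"
  shows "integrable lborel (\<lambda>x. g (t + c *\<^sub>R x))"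
    and "(LINT x|lborel. g x) = \<bar>c\<bar> ^ DIM('a) * (LINT x|lborel. g (t + c *\<^sub>R x))"
proof -
  have [measurable]: "g \<in> borel_measurable borel" using assms(2) by auto
  have eq: "lborel = density (distr lborel borel (\<lambda>x::'a. t + c *\<^sub>R x)) (\<lambda>_. ennreal (\<bar>c\<bar> ^ DIM('a)))"
    using lborel_affine[OF assms(1), of t] by simp
  have "integrable (density (distr lborel borel (\<lambda>x::'a. t + c *\<^sub>R x)) (\<lambda>_. ennreal (\<bar>c\<bar> ^ DIM('a)))) g"
    using assms(2) eq by simp
  then show "integrable lborel (\<lambda>x. g (t + c *\<^sub>R x))"
    using assms(1) by (subst (asm) integrable_density) (auto simp: integrable_distr_eq)
  have "(LINT x|lborel. g x) = (LINT x|density (distr lborel borel (\<lambda>x::'a. t + c *\<^sub>R x)) (\<lambda>_. ennreal (\<bar>c\<bar> ^ DIM('a))). g x)"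
    using eq by simp
  also have "\<dots> = \<bar>c\<bar> ^ DIM('a) * (LINT x|lborel. g (t + c *\<^sub>R x))"
    by (subst integral_density) (auto simp: integral_distr)
  finally show "(LINT x|lborel. g x) = \<bar>c\<bar> ^ DIM('a) * (LINT x|lborel. g (t + c *\<^sub>R x))" .
qed

lemma dyadic_shell:
  fixes r :: real assumes "r \<ge> 1" shows "\<exists>k::nat. 2 ^ k \<le> r \<and> r < 2 ^ Suc k"
proof -
  define k where "k = nat \<lfloor>log 2 r\<rfloor>"
  have "log 2 r \<ge> 0" using assms by simp
  then have k: "real k \<le> log 2 r" "log 2 r < real k + 1" unfolding k_def by linarith+
  have "2 powr real k \<le> r" using k assms by (subst le_log_iff[symmetric]) auto
  moreover have "r < 2 powr (real k + 1)" using k assms by (subst log_less_iff[symmetric]) auto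
  ultimately show ?thesis by (intro exI[of _ k]) (auto simp: powr_realpow powr_add)
qed

text \<open>Dyadic shells: where |(z,1)| lies between 2^k and 2^(k+1) the integrand is at most 2^(-k
  m) and z lies in the box \<open>B k\<close> of volume (4 * 2^k)^d, d the dimension. The shells sum
  to a geometric series of ratio 2^(d-m) < 1.\<close>

lemma integrable_norm_powr_unit_height:
  assumes "m > real DIM('a)"
  shows "integrable lborel (\<lambda>z::'a::euclidean_space. norm (z, 1::real) powr (-m))"
proof (rule integrableI_bounded)
  let ?D = "DIM('a)"
  define q where "q = 2 powr (real ?D - m)"
  define B where "B = (\<lambda>k::nat. cbox (- (2 ^ Suc k) *\<^sub>R One) ((2 ^ Suc k) *\<^sub>R One :: 'a))"
  define T where "T = (\<lambda>(k::nat) z::'a. ennreal ((2 ^ k) powr (-m)) * indicator (B k) z)"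
  have q: "0 \<le> q" "q < 1" using assms by (auto simp: q_def powr_less_one)
  have mpos: "m > 0" using assms by (metis of_nat_0_le_iff order_le_less_trans)
  have norm1: "norm (z, 1::real) \<ge> 1" "norm (z, 1::real) \<ge> norm z" for z :: 'a
    using norm_snd_le[of "1::real" z] norm_fst_le[of z "1::real"] by auto
  have in_ball: "z \<in> B k" if "norm z \<le> 2 ^ Suc k" for k z
    unfolding B_def mem_box
  proof (intro ballI)
    fix i :: 'a assume i: "i \<in> Basis"
    then have "\<bar>z \<bullet> i\<bar> \<le> 2 ^ Suc k" using Basis_le_norm[OF i, of z] that by linarith
    then show "(- (2 ^ Suc k) *\<^sub>R One) \<bullet> i \<le> z \<bullet> i \<and> z \<bullet> i \<le> ((2 ^ Suc k) *\<^sub>R One) \<bullet> i"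
      using i unfolding abs_le_iff by (simp del: power_Suc)
  qed
  have pt: "ennreal (norm (norm (z, 1::real) powr (-m))) \<le> (\<Sum>k. T k z)" for z :: 'a
  proof -
    obtain k where k: "2 ^ k \<le> norm (z, 1::real)" "norm (z,1::real) < 2 ^ Suc k"
      using dyadic_shell[OF norm1(1)] by blast
    have "norm (z, 1::real) powr (-m) \<le> (2 ^ k) powr (-m)"
      using k(1) mpos by (intro powr_mono2') auto
    moreover have "z \<in> B k" by (rule in_ball) (use k norm1(2)[of z] in linarith)
    ultimately have "ennreal (norm (norm (z, 1::real) powr (-m))) \<le> T k z"
      by (simp add: T_def ennreal_leI)
    also have "\<dots> \<le> (\<Sum>k. T k z)" using sum_le_suminf[of "\<lambda>k. T k z" "{k}"] by simp
    finally show ?thesis .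
  qed
  have [measurable]: "T k \<in> borel_measurable lborel" for k unfolding T_def B_def by measurable
  have em: "emeasure lborel (B k) = ennreal ((2 * 2 ^ Suc k) ^ ?D)" for k
    unfolding B_def
    by (subst emeasure_lborel_cbox) (auto simp: inner_diff_left algebra_simps prod_constant simp del: power_Suc)
  have nn: "(\<integral>\<^sup>+ z. T k z \<partial>lborel) = ennreal (4 ^ ?D * q ^ k)" for k
  proof -
    have "(\<integral>\<^sup>+ z. T k z \<partial>lborel) = ennreal ((2 ^ k) powr (-m)) * emeasure lborel (B k)"
      unfolding T_def by (rule nn_integral_cmult_indicator) (simp add: B_def)
    also have "\<dots> = ennreal ((2 ^ k) powr (-m) * (2 * 2 ^ Suc k) ^ ?D)"
      unfolding em by (simp add: ennreal_mult)
    also have "(2 ^ k) powr (-m) * (2 * 2 ^ Suc k) ^ ?D = 4 ^ ?D * q ^ k"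
    proof -
      have "(2 * 2 ^ Suc k) ^ ?D = 4 ^ ?D * (2 powr real k) powr (real ?D)"
        by (simp add: powr_realpow power_mult_distrib)
      moreover have "(2 ^ k) powr (-m) = (2 powr real k) powr (-m)" by (simp add: powr_realpow)
      moreover have "(2 powr real k) powr (-m) * (2 powr real k) powr (real ?D) = q ^ k"
        by (simp add: q_def powr_powr powr_add[symmetric] powr_realpow[symmetric] algebra_simps)
      ultimately show ?thesis by simp
    qed
    finally show ?thesis .
  qed
  have "(\<integral>\<^sup>+ z. ennreal (norm (norm (z::'a, 1::real) powr (-m))) \<partial>lborel) \<le> (\<integral>\<^sup>+ z. (\<Sum>k. T k z) \<partial>lborel)"
    by (rule nn_integral_mono) (use pt in auto)
  also have "\<dots> = (\<Sum>k. ennreal (4 ^ ?D * q ^ k))"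
    by (subst nn_integral_suminf) (auto simp: nn)
  also have "\<dots> < \<infinity>"
    using q by (subst suminf_ennreal2) (auto intro!: summable_mult summable_geometric)
  finally show "(\<integral>\<^sup>+ z. ennreal (norm (norm (z::'a, 1::real) powr (-m))) \<partial>lborel) < \<infinity>" .
qed measurable

text \<open>For m = d + 1 this is the reciprocal of \<open>poisson_const\<close>; other exponents m
  > d measure the kernels that arise by differentiation or by multiplication with powers of
  |h|.\<close>

definition pow_mass :: "'n::finite itself \<Rightarrow> real \<Rightarrow> real" where
  "pow_mass _ m = (LINT z::real^'n|lborel. norm (z, 1::real) powr (-m))"

text \<open>The substitution u = (x - z) / y reduces height y to height 1: the integrand contributes
  y^(-m) and the volume y^d.\<close>

lemma norm_powr_slice:
  fixes p :: "(real^'n) \<times> real"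
  assumes "m > real CARD('n)" "snd p > 0"
  shows "integrable lborel (\<lambda>z. norm (p - (z, 0)) powr (-m))"
    and "(LINT z|lborel. norm (p - (z, 0)) powr (-m)) = snd p powr (real CARD('n) - m) * pow_mass TYPE('n) m"
proof -
  obtain x y where p: "p = (x, y)" by (cases p)
  with assms have y: "y > 0" by simp
  define G where "G = (\<lambda>u::real^'n. y powr (-m) * norm (u, 1::real) powr (-m))"
  have iG: "integrable lborel G" unfolding G_def
    using integrable_norm_powr_unit_height[where 'a="real^'n"] assms by (intro integrable_mult_right) auto
  have eq: "G ((1/y) *\<^sub>R x + (-1/y) *\<^sub>R z) = norm (p - (z, 0)) powr (-m)" for z
  proof -
    have "p - (z, 0) = y *\<^sub>R ((1/y) *\<^sub>R x + (-1/y) *\<^sub>R z, 1)" using y p by (simp add: algebra_simps)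
    then have "norm (p - (z,0)) = y * norm ((1/y) *\<^sub>R x + (-1/y) *\<^sub>R z, 1::real)" using y by (metis abs_of_pos norm_scaleR)
    then show ?thesis using y by (simp add: G_def powr_mult)
  qed
  show "integrable lborel (\<lambda>z. norm (p - (z, 0)) powr (-m))"
    using lborel_integral_affine(1)[OF _ iG, of "-1/y" "(1/y) *\<^sub>R x"] y unfolding eq by simp
  have "(LINT u|lborel. G u) = (1/y) ^ CARD('n) * (LINT z|lborel. norm (p - (z, 0)) powr (-m))"
    using lborel_integral_affine(2)[OF _ iG, of "-1/y" "(1/y) *\<^sub>R x"] y unfolding eq by simp
  moreover have "(LINT u|lborel. G u) = y powr (-m) * pow_mass TYPE('n) m"
    unfolding G_def pow_mass_def by simp
  ultimately show "(LINT z|lborel. norm (p - (z, 0)) powr (-m)) = snd p powr (real CARD('n) - m) * pow_mass TYPE('n) m"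
    using y p by (simp add: field_simps powr_diff powr_minus powr_realpow)
qed

text \<open>A general kernel in place of the Poisson kernel, because every derivative of the
  extension has this form; \<open>(z, 0)\<close> is a boundary point.\<close>

definition conv_kernel :: "((real^'n) \<times> real \<Rightarrow> real) \<Rightarrow> (real^'n \<Rightarrow> real) \<Rightarrow> (real^'n) \<times> real \<Rightarrow> real" where
  "conv_kernel k f p = (LINT z|lborel. k (p - (z, 0)) * f z)"

lemma height_le_norm: "snd p > 0 \<Longrightarrow> snd p \<le> norm (p - (z, 0))" for p :: "'a::real_normed_vector \<times> real"
  using norm_snd_le[of "snd p" "fst p - z"] by (cases p) auto

lemma slice_nonzero: "snd p > 0 \<Longrightarrow> p - (z, 0) \<noteq> 0" for p :: "'a::real_normed_vector \<times> real"
  by (cases p) (auto simp: zero_prod_def)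

lemma hom_kernel_slice_measurable:
  fixes k :: "'a::euclidean_space \<times> real \<Rightarrow> real"
  assumes "hom_kernel m k" "snd p > 0"
  shows "(\<lambda>z. k (p - (z, 0))) \<in> borel_measurable borel"
proof (rule borel_measurable_continuous_onI)
  show "continuous_on UNIV (\<lambda>z. k (p - (z, 0)))"
    by (rule continuous_on_compose2[OF hom_kernel_continuous[OF assms(1)]])
       (use slice_nonzero[OF assms(2)] in \<open>auto intro!: continuous_intros\<close>)
qed

text \<open>Moving p by at most half its height shrinks the distance to a boundary point by a factor
  of at most 2, because that distance is at least the height. This gives the integrable majorant for
  limits under the integral sign.\<close>

lemma hom_kernel_dominated:
  fixes k :: "'a::euclidean_space \<times> real \<Rightarrow> real"
  assumes "hom_kernel m k" "m \<ge> 0"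
  shows "\<exists>C\<ge>0. \<forall>p q z. snd p > 0 \<longrightarrow> norm (q - p) \<le> snd p / 2 \<longrightarrow>
      \<bar>k (q - (z, 0))\<bar> \<le> C * norm (p - (z, 0)) powr (-m)"
proof -
  obtain C where C: "C \<ge> 0" "\<And>v. v \<noteq> 0 \<Longrightarrow> \<bar>k v\<bar> \<le> C * norm v powr (-m)"
    using hom_kernel_bound[OF assms(1)] by auto
  have "\<bar>k (q - (z, 0))\<bar> \<le> (C * 2 powr m) * norm (p - (z, 0)) powr (-m)"
    if "snd p > 0" "norm (q - p) \<le> snd p / 2" for p q :: "'a \<times> real" and z
  proof -
    have "norm (p - (z,0)) \<le> norm (q - (z,0)) + norm (q - p)"
      using norm_triangle_ineq4[of "q - (z,0)" "q - p"] by (simp add: algebra_simps)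
    then have n: "norm (q - (z, 0)) \<ge> norm (p - (z,0)) / 2"
      using height_le_norm[OF that(1), of z] that(2) by linarith
    have pos: "norm (p - (z,0)) > 0" using slice_nonzero[OF that(1), of z] by simp
    then have "q - (z,0) \<noteq> 0" using n by auto
    then have "\<bar>k (q - (z, 0))\<bar> \<le> C * norm (q - (z,0)) powr (-m)" by (rule C)
    also have "\<dots> \<le> C * (norm (p - (z,0)) / 2) powr (-m)"
      using n pos assms(2) C(1) by (intro mult_left_mono powr_mono2') auto
    also have "\<dots> = (C * 2 powr m) * norm (p - (z, 0)) powr (-m)"
      by (simp add: powr_divide powr_minus field_simps)
    finally show ?thesis .
  qed
  then show ?thesis using C(1) by (intro exI[of _ "C * 2 powr m"]) auto
qed

locale bounded_continuous =
  fixes f :: "real^'n \<Rightarrow> real" and B :: real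
  assumes cont: "continuous_on UNIV f" and bdd: "\<And>x. \<bar>f x\<bar> \<le> B"
begin

lemma meas [measurable]: "f \<in> borel_measurable borel"
  using cont by (rule borel_measurable_continuous_onI)

lemma B_nonneg: "B \<ge> 0" using bdd[of 0] by linarith

lemma conv_integrable:
  fixes p :: "(real^'n) \<times> real"
  assumes "hom_kernel m k" "m > real CARD('n)" "snd p > 0"
  shows "integrable lborel (\<lambda>z. k (p - (z, 0)) * f z)"
proof -
  obtain C where C: "C \<ge> 0" "\<And>v. v \<noteq> 0 \<Longrightarrow> \<bar>k v\<bar> \<le> C * norm v powr (-m)"
    using hom_kernel_bound[OF assms(1)] by auto
  note [measurable] = hom_kernel_slice_measurable[OF assms(1,3)]
  show ?thesis
  proof (rule Bochner_Integration.integrable_bound)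
    show "integrable lborel (\<lambda>z. C * B * norm (p - (z, 0)) powr (-m))"
      using norm_powr_slice(1)[OF assms(2,3)] by simp
    have "\<bar>k (p - (z, 0)) * f z\<bar> \<le> (C * norm (p - (z, 0)) powr (-m)) * B" for z
      unfolding abs_mult using C slice_nonzero[OF assms(3)] bdd by (intro mult_mono) auto
    then show "AE z in lborel. norm (k (p - (z, 0)) * f z) \<le> norm (C * B * norm (p - (z, 0)) powr (-m))"
      using C B_nonneg by (auto simp: mult_ac)
  qed measurable
qed

lemma conv_bound:
  fixes p :: "(real^'n) \<times> real"
  assumes "hom_kernel m k" "m > real CARD('n)" 
    and C: "C \<ge> 0" "\<And>v. v \<noteq> 0 \<Longrightarrow> \<bar>k v\<bar> \<le> C * norm v powr (-m)"
    and p: "snd p > 0"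
  shows "\<bar>conv_kernel k f p\<bar> \<le> B * (C * pow_mass TYPE('n) m * snd p powr (real CARD('n) - m))"
proof -
  have "\<bar>conv_kernel k f p\<bar> \<le> (LINT z|lborel. \<bar>k (p - (z, 0)) * f z\<bar>)"
    unfolding conv_kernel_def by (rule integral_abs_bound)
  also have "\<dots> \<le> (LINT z|lborel. C * B * norm (p - (z, 0)) powr (-m))"
  proof (rule integral_mono)
    show "integrable lborel (\<lambda>z. \<bar>k (p - (z, 0)) * f z\<bar>)"
      using conv_integrable[OF assms(1,2) p] by simp
    show "integrable lborel (\<lambda>z. C * B * norm (p - (z, 0)) powr (-m))"
      using norm_powr_slice(1)[OF assms(2) p] by simp
    have "\<bar>k (p - (z, 0)) * f z\<bar> \<le> (C * norm (p - (z, 0)) powr (-m)) * B" for z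
      unfolding abs_mult using C slice_nonzero[OF p] bdd by (intro mult_mono) auto
    then show "\<bar>k (p - (z, 0)) * f z\<bar> \<le> C * B * norm (p - (z, 0)) powr (-m)" for z
      by (simp add: mult_ac)
  qed
  also have "\<dots> = C * B * (snd p powr (real CARD('n) - m) * pow_mass TYPE('n) m)"
    using norm_powr_slice(2)[OF assms(2) p] by simp
  finally show ?thesis by (simp add: mult_ac)
qed

text \<open>Difference quotients are dominated through the differentiated kernel, of degree -(m+1).
  Integrability against the kernel itself is a separate hypothesis because the Poisson kernel has m
  = d, where |v|^(-m) is not integrable over a slice.\<close>

lemma conv_deriv:
  fixes p :: "(real^'n) \<times> real"
  assumes k: "hom_kernel m k" and m: "m + 1 > real CARD('n)"
    and int: "\<And>q. snd q > 0 \<Longrightarrow> integrable lborel (\<lambda>z. k (q - (z, 0)) * f z)"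
    and p: "snd p > 0"
  shows "((\<lambda>t. conv_kernel k f (p + t *\<^sub>R b)) has_real_derivative conv_kernel (partial b k) f p) (at 0)"
proof -
  note k' = hom_kernel_partial(1)[OF k, of b]
  have m0: "m + 1 \<ge> 0" using m of_nat_0_le_iff[of "CARD('n)"] by linarith
  obtain C where C: "C \<ge> 0" "\<And>p q z. snd p > 0 \<Longrightarrow> norm (q - p) \<le> snd p / 2 \<Longrightarrow>
      \<bar>partial b k (q - (z, 0))\<bar> \<le> C * norm (p - (z, 0)) powr (-(m+1))"
    using hom_kernel_dominated[OF k' m0] by auto
  \<comment> \<open>The \<open>+ 1\<close> keeps r positive when b = 0; for |t| at most r the point
    p + t b stays within half the height of p.\<close>
  define r where "r = snd p / (2 * (norm b + 1))"
  have r: "r > 0" using p by (auto simp: r_def intro!: divide_pos_pos add_nonneg_pos)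
  have small: "norm ((p + t *\<^sub>R b) - p) \<le> snd p / 2" if "\<bar>t\<bar> \<le> r" for t
  proof -
    have "\<bar>t\<bar> * norm b \<le> r * (norm b + 1)" using that by (intro mult_mono) auto
    also have "\<dots> = snd p / 2"
    proof -
      have "norm b + 1 \<noteq> 0" using norm_ge_zero[of b] by linarith
      then show ?thesis by (simp add: r_def del: right_diff_distrib distrib_left) (simp add: field_simps)
    qed
    finally show ?thesis by simp
  qed
  have up: "snd (p + t *\<^sub>R b) > 0" if "\<bar>t\<bar> \<le> r" for t
  proof -
    have "\<bar>t * snd b\<bar> \<le> snd p / 2" using small[OF that] norm_snd_le[of "snd (t *\<^sub>R b)" "fst (t *\<^sub>R b)"]
      by (simp only: prod.collapse) simp
    then show ?thesis using p by simp
  qed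
  define Q where "Q = (\<lambda>t z. (k (p + t *\<^sub>R b - (z, 0)) - k (p - (z, 0))) / t * f z)"
  \<comment> \<open>Mean value bound: the difference quotient is at most the supremum of the
    derivative kernel along the segment.\<close>
  have Qb: "\<bar>Q t z\<bar> \<le> C * B * norm (p - (z, 0)) powr (-(m+1))" if "\<bar>t\<bar> \<le> r" for t z
  proof -
    have der: "((\<lambda>s. k (p + s *\<^sub>R b - (z, 0))) has_field_derivative partial b k (p + s *\<^sub>R b - (z, 0))) (at s within {-r..r})"
      if "s \<in> {-r..r}" for s
    proof -
      have "p + s *\<^sub>R b - (z,0) \<noteq> 0" using slice_nonzero[OF up] that by auto
      from hom_kernel_partial(2)[OF k this, of b]
      have "((\<lambda>t. k (p + (s + t) *\<^sub>R b - (z, 0))) has_real_derivative partial b k (p + s *\<^sub>R b - (z, 0))) (at 0)"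
        by (simp add: algebra_simps)
      then have "((\<lambda>s. k (p + s *\<^sub>R b - (z, 0))) has_real_derivative partial b k (p + s *\<^sub>R b - (z, 0))) (at s)"
        using DERIV_at_within_shift[of "\<lambda>s. k (p + s *\<^sub>R b - (z, 0))" _ s 0 UNIV] by simp
      then show ?thesis by (rule has_field_derivative_at_within)
    qed
    have "norm (k (p + t *\<^sub>R b - (z, 0)) - k (p + 0 *\<^sub>R b - (z, 0)))
        \<le> (C * norm (p - (z, 0)) powr (-(m+1))) * norm (t - 0)"
    proof (rule field_differentiable_bound[OF _ der])
      show "norm (partial b k (p + s *\<^sub>R b - (z, 0))) \<le> C * norm (p - (z, 0)) powr (-(m+1))" if "s \<in> {-r..r}" for s
        using C(2)[OF p small[of s], of z] that by auto
    qed (use that r in auto)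
    then have "\<bar>k (p + t *\<^sub>R b - (z, 0)) - k (p - (z, 0))\<bar> \<le> (C * norm (p - (z, 0)) powr (-(m+1))) * \<bar>t\<bar>" by simp
    then have "\<bar>(k (p + t *\<^sub>R b - (z, 0)) - k (p - (z, 0))) / t\<bar> \<le> C * norm (p - (z, 0)) powr (-(m+1))"
      using C(1) by (cases "t = 0") (auto simp: field_simps)
    then have "\<bar>Q t z\<bar> \<le> (C * norm (p - (z, 0)) powr (-(m+1))) * B"
      unfolding Q_def abs_mult using bdd C(1) by (intro mult_mono) auto
    then show ?thesis by (simp add: mult_ac)
  qed
  have Qint: "(LINT z|lborel. Q t z) = (conv_kernel k f (p + t *\<^sub>R b) - conv_kernel k f p) / t" if "\<bar>t\<bar> \<le> r" for t
  proof -
    have "(LINT z|lborel. Q t z) = (LINT z|lborel. (k (p + t *\<^sub>R b - (z, 0)) * f z - k (p - (z, 0)) * f z) / t)"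
      by (simp add: Q_def algebra_simps diff_divide_distrib)
    also have "\<dots> = (conv_kernel k f (p + t *\<^sub>R b) - conv_kernel k f p) / t"
      unfolding conv_kernel_def using int[OF up[OF that]] int[OF p] by simp
    finally show ?thesis .
  qed
  have lim: "((\<lambda>t. (conv_kernel k f (p + t *\<^sub>R b) - conv_kernel k f p) / t) \<longlongrightarrow> conv_kernel (partial b k) f p) (at 0)"
    unfolding tendsto_at_iff_sequentially comp_def
  proof (intro allI impI)
    fix X :: "nat \<Rightarrow> real" assume X: "\<forall>i. X i \<in> UNIV - {0}" "X \<longlonglongrightarrow> 0"
    obtain N where N: "\<And>i. i \<ge> N \<Longrightarrow> \<bar>X i\<bar> \<le> r"
      using X(2) r unfolding lim_sequentially dist_real_def by (metis diff_zero less_imp_le)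
    have "(\<lambda>i. LINT z|lborel. Q (X (i + N)) z) \<longlonglongrightarrow> (LINT z|lborel. partial b k (p - (z, 0)) * f z)"
    proof (rule integral_dominated_convergence)
      show "(\<lambda>z. partial b k (p - (z, 0)) * f z) \<in> borel_measurable lborel"
        using hom_kernel_slice_measurable[OF k' p] by measurable
      show "Q (X (i + N)) \<in> borel_measurable lborel" for i
        unfolding Q_def using hom_kernel_slice_measurable[OF k p] hom_kernel_slice_measurable[OF k up[OF N[of "i+N"]]]
        by measurable
      show "integrable lborel (\<lambda>z. C * B * norm (p - (z, 0)) powr (-(m+1)))"
        using norm_powr_slice(1)[OF m p] by simp
      show "AE z in lborel. norm (Q (X (i + N)) z) \<le> C * B * norm (p - (z, 0)) powr (-(m+1))" for i
        using Qb[OF N] by auto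
      show "AE z in lborel. (\<lambda>i. Q (X (i + N)) z) \<longlonglongrightarrow> partial b k (p - (z, 0)) * f z"
      proof (rule AE_I2)
        fix z
        have "((\<lambda>t. k (p - (z, 0) + t *\<^sub>R b)) has_real_derivative partial b k (p - (z,0))) (at 0)"
          by (rule hom_kernel_partial(2)[OF k slice_nonzero[OF p]])
        then have "((\<lambda>t. (k (p + t *\<^sub>R b - (z, 0)) - k (p - (z, 0))) / t) \<longlongrightarrow> partial b k (p - (z,0))) (at 0)"
          unfolding DERIV_def by (simp add: algebra_simps)
        then have "(\<lambda>i. (k (p + X (i+N) *\<^sub>R b - (z, 0)) - k (p - (z, 0))) / X (i+N)) \<longlonglongrightarrow> partial b k (p - (z,0))"
          unfolding tendsto_at_iff_sequentially comp_def
          using X LIMSEQ_ignore_initial_segment[OF X(2), of N] by (auto dest!: spec[of _ "\<lambda>i. X (i+N)"])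
        then show "(\<lambda>i. Q (X (i + N)) z) \<longlonglongrightarrow> partial b k (p - (z, 0)) * f z"
          unfolding Q_def by (intro tendsto_mult_right)
      qed
    qed
    then have "(\<lambda>i. (conv_kernel k f (p + X (i+N) *\<^sub>R b) - conv_kernel k f p) / X (i+N)) \<longlonglongrightarrow> conv_kernel (partial b k) f p"
      using Qint[OF N] by (simp add: conv_kernel_def[symmetric])
    then show "(\<lambda>i. (conv_kernel k f (p + X i *\<^sub>R b) - conv_kernel k f p) / X i) \<longlonglongrightarrow> conv_kernel (partial b k) f p"
      by (rule LIMSEQ_offset)
  qed
  then show ?thesis unfolding DERIV_def by simp
qed

lemma conv_continuous:
  assumes k: "hom_kernel m k" and m: "m > real CARD('n)"
  shows "continuous_on {p. snd p > 0} (conv_kernel k f)"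
  unfolding continuous_on_sequentially comp_def
proof (intro ballI allI impI)
  fix p and X :: "nat \<Rightarrow> (real^'n) \<times> real"
  assume "p \<in> {p. snd p > 0}" and X: "(\<forall>n. X n \<in> {p. snd p > 0}) \<and> X \<longlonglongrightarrow> p"
  then have p: "snd p > 0" and up: "\<And>i. snd (X i) > 0" by auto
  have m0: "m \<ge> 0" using m of_nat_0_le_iff[of "CARD('n)"] by linarith
  obtain C where C: "C \<ge> 0" "\<And>p q z. snd p > 0 \<Longrightarrow> norm (q - p) \<le> snd p / 2 \<Longrightarrow>
      \<bar>k (q - (z, 0))\<bar> \<le> C * norm (p - (z, 0)) powr (-m)"
    using hom_kernel_dominated[OF k m0] by auto
  obtain N where N: "\<And>i. i \<ge> N \<Longrightarrow> norm (X i - p) \<le> snd p / 2"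
    using X p unfolding lim_sequentially dist_norm by (metis half_gt_zero less_imp_le)
  have "(\<lambda>i. conv_kernel k f (X (i + N))) \<longlonglongrightarrow> conv_kernel k f p"
    unfolding conv_kernel_def
  proof (rule integral_dominated_convergence)
    show "(\<lambda>z. k (p - (z, 0)) * f z) \<in> borel_measurable lborel"
      using hom_kernel_slice_measurable[OF k p] by measurable
    show "(\<lambda>z. k (X (i+N) - (z, 0)) * f z) \<in> borel_measurable lborel" for i
      using hom_kernel_slice_measurable[OF k up] by measurable
    show "integrable lborel (\<lambda>z. C * B * norm (p - (z, 0)) powr (-m))"
      using norm_powr_slice(1)[OF m p] by simp
    have "\<bar>k (X (i+N) - (z, 0)) * f z\<bar> \<le> (C * norm (p - (z, 0)) powr (-m)) * B" for i z
      unfolding abs_mult using C(2)[OF p N] C(1) bdd by (intro mult_mono) auto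
    then show "AE z in lborel. norm (k (X (i+N) - (z, 0)) * f z) \<le> C * B * norm (p - (z, 0)) powr (-m)" for i
      by (auto simp: mult_ac)
    show "AE z in lborel. (\<lambda>i. k (X (i+N) - (z, 0)) * f z) \<longlonglongrightarrow> k (p - (z, 0)) * f z"
    proof (rule AE_I2, rule tendsto_mult_right)
      fix z
      have "(\<lambda>i. X (i+N) - (z,0)) \<longlonglongrightarrow> p - (z,0)"
        using X LIMSEQ_ignore_initial_segment[of X p N] by (intro tendsto_intros) auto
      then show "(\<lambda>i. k (X (i+N) - (z, 0))) \<longlonglongrightarrow> k (p - (z, 0))"
        by (rule continuous_on_tendsto_compose[OF hom_kernel_continuous[OF k]])
          (use slice_nonzero[OF p] slice_nonzero[OF up] in auto)
    qed
  qed
  then show "(\<lambda>i. conv_kernel k f (X i)) \<longlonglongrightarrow> conv_kernel k f p" by (rule LIMSEQ_offset)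
qed

end

lemma hom_kernel_differentiable:
  assumes "hom_kernel m k" "v \<noteq> 0"
  shows "k differentiable (at v)"
  using assms
proof (induction arbitrary: v)
  case (npow m)
  have "((\<lambda>v. norm v powr (-m)) has_derivative
     (\<lambda>h. norm v powr (-m) * (0 * ln (norm v) + (h \<bullet> sgn v) * (-m) / norm v))) (at v)"
    using npow by (intro has_derivative_powr has_derivative_norm has_derivative_const) auto
  then show ?case unfolding differentiable_def by blast
next
  case (lin m k c)
  have "(\<lambda>v. v \<bullet> c) differentiable (at v)"
    by (intro bounded_linear_imp_differentiable bounded_linear_inner_left)
  with lin show ?case by (auto intro: differentiable_mult)
next
  case (cong m k k')
  have "k differentiable (at v)" using cong by blast
  then show ?case unfolding differentiable_def
    using has_derivative_transform_within_open[of k _ v UNIV "-{0}" k'] cong by (auto intro: open_Compl)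
qed (auto intro!: derivative_intros)

text \<open>\<open>partial\<close> is a one-dimensional derivative, so linearity in the direction is
  not automatic; it comes from total differentiability.\<close>

lemma differentiable_partial_expand:
  assumes "k differentiable (at v)"
  shows "partial b k v = (\<Sum>c\<in>Basis. (b \<bullet> c) * partial c k v)"
proof -
  obtain D where D: "(k has_derivative D) (at v)" using assms by (auto simp: differentiable_def)
  have eq: "partial b k v = D b" for b
  proof -
    have "((\<lambda>t. v + t *\<^sub>R b) has_derivative (\<lambda>t. t *\<^sub>R b)) (at (0::real))"
      by (auto intro!: derivative_eq_intros)
    moreover have "(k has_derivative D) (at (v + 0 *\<^sub>R b))" using D by simp
    ultimately have "((\<lambda>t. k (v + t *\<^sub>R b)) has_derivative (\<lambda>t. D (t *\<^sub>R b))) (at (0::real))"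
      using has_derivative_compose by blast
    moreover have "(\<lambda>t. D (t *\<^sub>R b)) = (*) (D b)"
      by (simp add: linear_scale[OF has_derivative_linear[OF D]] fun_eq_iff)
    ultimately have "((\<lambda>t. k (v + t *\<^sub>R b)) has_real_derivative D b) (at 0)"
      unfolding has_field_derivative_def by simp
    then show ?thesis unfolding partial_def by (rule DERIV_imp_deriv)
  qed
  have "D b = D (\<Sum>c\<in>Basis. (b \<bullet> c) *\<^sub>R c)" by (simp add: euclidean_representation)
  also have "\<dots> = (\<Sum>c\<in>Basis. (b \<bullet> c) * D c)"
    using has_derivative_linear[OF D] by (simp add: linear_sum linear_scale)
  finally show ?thesis by (simp add: eq)
qed

lemma partial_eqI: "((\<lambda>t. k (v + t *\<^sub>R b)) has_real_derivative x) (at 0) \<Longrightarrow> partial b k v = x"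
  unfolding partial_def by (rule DERIV_imp_deriv)

text \<open>Up to a constant this is a derivative of the fundamental solution |v|^(2-s), s the
  dimension (of the logarithm if s = 2). Summed over the basis, the three terms of the second
  derivative carry the factors -2s, -s^2 and s(s+2), which cancel.\<close>

lemma coordinate_power_harmonic:
  fixes e v :: "'a::euclidean_space"
  assumes "v \<noteq> 0"
  defines "k \<equiv> \<lambda>v::'a. (v \<bullet> e) * norm v powr (- real DIM('a))"
  shows "(\<Sum>b\<in>Basis. partial b (partial b k) v) = 0"
proof -
  define s where "s = real DIM('a)"
  have on: "open (-{0::'a})" by (intro open_Compl) simp
  have lin: "((\<lambda>t. (v + t *\<^sub>R b) \<bullet> c) has_real_derivative b \<bullet> c) (at 0)" for v b c :: 'a
    by (auto intro!: derivative_eq_intros simp: inner_add_left)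
  have 1: "partial b k u = (b \<bullet> e) * norm u powr (-s) + (u \<bullet> e) * ((-s) * ((u \<bullet> b) * norm u powr (-s-2)))"
    if "u \<noteq> 0" for u b
    unfolding k_def s_def[symmetric]
    using DERIV_mult[OF lin[of u b e] norm_powr_deriv[OF that, where s="-s" and b=b]] by (intro partial_eqI) (simp add: algebra_simps)
  have 2: "partial b (partial b k) v = 
      -2 * s * norm v powr (-s-2) * ((e \<bullet> b) * (v \<bullet> b)) - s * (v \<bullet> e) * norm v powr (-s-2) * (b \<bullet> b)
       + s * (s+2) * (v \<bullet> e) * norm v powr (-s-4) * ((v \<bullet> b) * (v \<bullet> b))" for b
  proof -
    have "partial b (partial b k) v = partial b (\<lambda>u. (b \<bullet> e) * norm u powr (-s) + (u \<bullet> e) * ((-s) * ((u \<bullet> b) * norm u powr (-s-2)))) v"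
      by (rule partial_cong_open[OF on]) (use assms 1 in auto)
    also have "\<dots> = (b \<bullet> e) * ((-s) * ((v \<bullet> b) * norm v powr (-s-2)))
        + ((b \<bullet> e) * ((-s) * ((v \<bullet> b) * norm v powr (-s-2)))
        + (-s) * ((b \<bullet> b) * norm v powr (-s-2) + ((-s-2) * ((v \<bullet> b) * norm v powr (-s-2-2))) * (v \<bullet> b)) * (v \<bullet> e))"
      using DERIV_add[OF DERIV_cmult[OF norm_powr_deriv[OF assms(1), where s="-s" and b=b], where c="b \<bullet> e"]
        DERIV_mult[OF lin[of v b e] DERIV_cmult[OF DERIV_mult[OF lin[of v b b] norm_powr_deriv[OF assms(1), where s="-s-2" and b=b]], where c="-s"]]]
      by (intro partial_eqI) simp
    also have "-s-2-2 = -s-4" by simp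
    finally show ?thesis by (simp add: algebra_simps inner_commute)
  qed
  have i1: "(\<Sum>b\<in>Basis. (e \<bullet> b) * (v \<bullet> b)) = v \<bullet> e" using euclidean_inner[of e v] by (simp add: inner_commute)
  have i2: "(\<Sum>b\<in>Basis. (v \<bullet> b) * (v \<bullet> b)) = (norm v)\<^sup>2" by (simp add: euclidean_inner[of v v, symmetric] dot_square_norm)
  have i3: "(\<Sum>b\<in>(Basis::'a set). b \<bullet> b) = s" by (simp add: s_def)
  have n: "norm v powr (-s-4) * (norm v)\<^sup>2 = norm v powr (-s-2)"
  proof -
    have "norm v powr (-s-4) * (norm v)\<^sup>2 = norm v powr (-s-4) * norm v powr 2" using assms(1) by simp
    also have "\<dots> = norm v powr (-s-4+2)" by (simp only: powr_add)
    also have "-s-4+2 = -s-2" by simp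
    finally show ?thesis .
  qed
  have "(\<Sum>b\<in>Basis. partial b (partial b k) v) = 
      -2 * s * norm v powr (-s-2) * (v \<bullet> e) - s * (v \<bullet> e) * norm v powr (-s-2) * s
       + s * (s+2) * (v \<bullet> e) * (norm v powr (-s-4) * (norm v)\<^sup>2)"
    unfolding 2 sum.distrib sum_subtractf sum_distrib_left[symmetric] i1 i2 i3 by simp
  also have "\<dots> = 0" unfolding n by (simp add: algebra_simps)
  finally show ?thesis .
qed

text \<open>The exponent is the dimension d + 1 of the half-space, as in
  \<open>coordinate_power_harmonic\<close>; the linear factor y makes the degree -d.\<close>

definition poisson_kernel :: "(real^'n) \<times> real \<Rightarrow> real" where
  "poisson_kernel v = poisson_const TYPE('n) * ((v \<bullet> (0, 1)) * norm v powr (- real DIM((real^'n) \<times> real)))"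

lemma poisson_kernel_hom: "hom_kernel (real CARD('n)) (poisson_kernel :: (real^'n) \<times> real \<Rightarrow> real)"
proof -
  have "hom_kernel (real CARD('n) + 1 - 1) (\<lambda>v::(real^'n) \<times> real. (v \<bullet> (0, 1)) * norm v powr (- (real CARD('n) + 1)))"
    by (intro hom_kernel.lin hom_kernel.npow)
  from hom_kernel.scale[OF this, of "poisson_const TYPE('n)"]
  show ?thesis unfolding poisson_kernel_def[abs_def] by (simp add: add.commute)
qed

lemma poisson_kernel_partial_commute:
  fixes v :: "(real^'n) \<times> real"
  shows "v \<noteq> 0 \<Longrightarrow> partial b (partial c poisson_kernel) v = partial c (partial b poisson_kernel) v"
  by (rule hom_kernel_partial_commute[OF poisson_kernel_hom])

lemma poisson_kernel_harmonic:
  fixes v :: "(real^'n) \<times> real"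
  assumes "v \<noteq> 0"
  shows "(\<Sum>b\<in>Basis. partial b (partial b poisson_kernel) v) = 0"
proof -
  define k where "k = (\<lambda>v :: (real^'n) \<times> real. (v \<bullet> (0, 1)) * norm v powr (- real DIM((real^'n) \<times> real)))"
  have on: "open (-{0::(real^'n) \<times> real})" by (intro open_Compl) simp
  have "hom_kernel (real CARD('n) + 1 - 1) (\<lambda>v::(real^'n) \<times> real. (v \<bullet> (0, 1)) * norm v powr (- (real CARD('n) + 1)))"
    by (intro hom_kernel.lin hom_kernel.npow)
  then have k: "hom_kernel (real CARD('n)) k" by (simp add: k_def[abs_def] add.commute)
  have pk: "poisson_kernel = (\<lambda>v. poisson_const TYPE('n) * k v)" by (simp add: fun_eq_iff poisson_kernel_def k_def)
  have 1: "partial b poisson_kernel u = poisson_const TYPE('n) * partial b k u" if "u \<noteq> 0" for b u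
    unfolding pk by (intro partial_eqI DERIV_cmult hom_kernel_partial(2)[OF k that])
  have "partial b (partial b poisson_kernel) v = poisson_const TYPE('n) * partial b (partial b k) v" for b
  proof -
    have "partial b (partial b poisson_kernel) v = partial b (\<lambda>u. poisson_const TYPE('n) * partial b k u) v"
      by (rule partial_cong_open[OF on]) (use assms 1 in auto)
    also have "\<dots> = poisson_const TYPE('n) * partial b (partial b k) v"
      by (intro partial_eqI DERIV_cmult hom_kernel_partial(2)[OF hom_kernel_partial(1)[OF k] assms])
    finally show ?thesis .
  qed
  then show ?thesis
    using coordinate_power_harmonic[OF assms, of "(0,1)"] by (simp add: k_def sum_distrib_left[symmetric])
qed

text \<open>A derivative of a harmonic function is harmonic: the three derivatives are commuted
  until the Laplacian acts on the kernel first.\<close>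

lemma poisson_kernel_partial_harmonic:
  fixes v :: "(real^'n) \<times> real"
  assumes v: "v \<noteq> 0"
  shows "(\<Sum>b\<in>Basis. partial b (partial b (partial c poisson_kernel)) v) = 0"
proof -
  have on: "open (-{0::(real^'n) \<times> real})" by (intro open_Compl) simp
  note h1 = hom_kernel_partial(1)[OF poisson_kernel_hom]
  note h2 = hom_kernel_partial(1)[OF h1]
  have "partial b (partial b (partial c poisson_kernel)) v = partial c (partial b (partial b poisson_kernel)) v" for b
  proof -
    have "partial b (partial b (partial c poisson_kernel)) v = partial b (partial c (partial b poisson_kernel)) v"
      by (rule partial_cong_open[OF on]) (use v in \<open>simp_all add: poisson_kernel_partial_commute[of _ b c]\<close>)
    also have "\<dots> = partial c (partial b (partial b poisson_kernel)) v"
      by (rule hom_kernel_partial_commute[OF h1 v])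
    finally show ?thesis .
  qed
  then have "(\<Sum>b\<in>Basis. partial b (partial b (partial c poisson_kernel)) v)
     = (\<Sum>b\<in>Basis. partial c (partial b (partial b poisson_kernel)) v)" by simp
  also have "\<dots> = partial c (\<lambda>u. \<Sum>b\<in>Basis. partial b (partial b poisson_kernel) u) v"
    by (rule partial_eqI[symmetric], rule DERIV_sum, rule hom_kernel_partial(2)[OF h2 v])
  also have "\<dots> = partial c (\<lambda>u. 0) v"
    by (rule partial_cong_open[OF on]) (use v poisson_kernel_harmonic in auto)
  also have "\<dots> = 0" by (rule partial_eqI) simp
  finally show ?thesis .
qed

lemma poisson_kernel_apply:
  "poisson_kernel (z, y) = poisson_const TYPE('n) * (y * norm (z :: real^'n, y) powr (- (real CARD('n) + 1)))"
  by (simp add: poisson_kernel_def add.commute)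

lemma norm_pair_powr:
  "norm (z, y) powr (- s) = 1 / ((norm z)\<^sup>2 + y\<^sup>2) powr (s / 2)" for z :: "'a::real_normed_vector" and y :: real
  by (simp add: norm_Pair powr_half_sqrt[symmetric] powr_powr powr_minus_divide)

lemma poisson_extension_conv:
  fixes f :: "real^'n \<Rightarrow> real"
  shows "poisson_extension f = conv_kernel poisson_kernel f"
proof
  fix p :: "(real^'n) \<times> real"
  obtain x y where p: "p = (x, y)" by (cases p)
  show "poisson_extension f p = conv_kernel poisson_kernel f p"
    unfolding p poisson_extension_def conv_kernel_def prod.case
    by (subst integral_mult_right_zero[symmetric], rule Bochner_Integration.integral_cong)
       (auto simp: poisson_kernel_apply norm_pair_powr[where s="real CARD('n) + 1", simplified])
qed

lemma pow_mass_pos: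
  assumes "m > real CARD('n::finite)" shows "pow_mass TYPE('n) m > 0"
proof -
  have int: "integrable lborel (\<lambda>z::real^'n. norm (z, 1::real) powr (-m))"
    by (rule integrable_norm_powr_unit_height) (use assms in simp)
  have nz: "(z, 1::real) \<noteq> 0" for z :: "real^'n" by (simp add: zero_prod_def)
  have "pow_mass TYPE('n) m \<ge> 0" unfolding pow_mass_def by (intro integral_nonneg_AE) auto
  moreover have "pow_mass TYPE('n) m \<noteq> 0"
  proof
    assume "pow_mass TYPE('n) m = 0"
    then have "AE z::real^'n in lborel. norm (z, 1::real) powr (-m) = 0"
      unfolding pow_mass_def by (subst (asm) integral_nonneg_eq_0_iff_AE[OF int]) auto
    then have "AE z::real^'n in lborel. False" using nz by simp
    then show False by (simp add: AE_iff_null emeasure_lborel_UNIV null_sets_def)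
  qed
  ultimately show ?thesis by simp
qed

lemma poisson_const_eq: "poisson_const TYPE('n::finite) = 1 / pow_mass TYPE('n) (real CARD('n) + 1)"
  unfolding poisson_const_def pow_mass_def
  by (simp add: norm_pair_powr[where s="real CARD('n) + 1" and y=1, simplified])

context bounded_continuous begin

text \<open>Degree -d is the borderline excluded by \<open>conv_integrable\<close>, but at fixed
  height the linear factor is the constant y, and what remains has degree -(d+1).\<close>

lemma poisson_kernel_integrable:
  assumes "snd q > 0" shows "integrable lborel (\<lambda>z. poisson_kernel (q - (z, 0)) * f z)"
proof -
  have "integrable lborel (\<lambda>z. norm (q - (z, 0)) powr (-(real CARD('n) + 1)) * f z)"
    using conv_integrable[OF hom_kernel.npow _ assms, of "real CARD('n) + 1"] by simp
  then have "integrable lborel (\<lambda>z. (poisson_const TYPE('n) * snd q) * (norm (q - (z, 0)) powr (-(real CARD('n) + 1)) * f z))"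
    by (rule integrable_mult_right)
  then show ?thesis
    by (cases q) (simp add: poisson_kernel_apply mult_ac)
qed

lemma conv_step:
  fixes p :: "(real^'n) \<times> real"
  assumes k: "hom_kernel m k" "m + 1 > real CARD('n)"
    "\<And>q. snd q > 0 \<Longrightarrow> integrable lborel (\<lambda>z. k (q - (z, 0)) * f z)"
   and G: "\<And>q. snd q > 0 \<Longrightarrow> G q = conv_kernel k f q" and p: "snd p > 0"
  shows "partial b G p = conv_kernel (partial b k) f p"
    and "((\<lambda>t. G (p + t *\<^sub>R b)) has_real_derivative partial b G p) (at 0)"
proof -
  have op: "open {t::real. snd (p + t *\<^sub>R b) > 0}"
    by (intro open_Collect_less continuous_intros)
  have d: "((\<lambda>t. G (p + t *\<^sub>R b)) has_real_derivative conv_kernel (partial b k) f p) (at 0)"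
    by (rule has_field_derivative_transform_within_open[OF conv_deriv[OF k p] op]) (use p G in auto)
  then show "partial b G p = conv_kernel (partial b k) f p" by (rule partial_eqI)
  with d show "((\<lambda>t. G (p + t *\<^sub>R b)) has_real_derivative partial b G p) (at 0)" by simp
qed

abbreviation "F \<equiv> poisson_extension f"

lemmas pk1 = hom_kernel_partial(1)[OF poisson_kernel_hom]
lemmas pk2 = hom_kernel_partial(1)[OF pk1]
lemmas pk3 = hom_kernel_partial(1)[OF pk2]

lemma F1:
  assumes "snd p > 0"
  shows "partial b F p = conv_kernel (partial b poisson_kernel) f p"
    and "((\<lambda>t. F (p + t *\<^sub>R b)) has_real_derivative partial b F p) (at 0)"
  using conv_step[OF poisson_kernel_hom _ poisson_kernel_integrable _ assms, of F b]
  by (simp_all add: poisson_extension_conv)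

text \<open>From the first derivative on, the kernels have degree below -d, so
  \<open>conv_integrable\<close> supplies the integrability that \<open>conv_step\<close> asks
  for.\<close>

lemma F2:
  assumes "snd p > 0"
  shows "partial b (partial c F) p = conv_kernel (partial b (partial c poisson_kernel)) f p"
    and "((\<lambda>t. partial c F (p + t *\<^sub>R b)) has_real_derivative partial b (partial c F) p) (at 0)"
  using conv_step[OF pk1 _ conv_integrable[OF pk1] F1(1) assms, where b=b] by simp_all

lemma F3:
  assumes "snd p > 0"
  shows "partial a (partial b (partial c F)) p = conv_kernel (partial a (partial b (partial c poisson_kernel))) f p"
    and "((\<lambda>t. partial b (partial c F) (p + t *\<^sub>R a)) has_real_derivative partial a (partial b (partial c F)) p) (at 0)"
  using conv_step[OF pk2 _ conv_integrable[OF pk2] F2(1) assms, where b=a] by simp_all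

lemma F_continuous:
  "continuous_on {p. snd p > 0} (partial c F)"
  "continuous_on {p. snd p > 0} (partial b (partial c F))"
  "continuous_on {p. snd p > 0} (partial a (partial b (partial c F)))"
  using conv_continuous[OF pk1] conv_continuous[OF pk2] conv_continuous[OF pk3]
  by (auto simp: F1(1) F2(1) F3(1) cong: continuous_on_cong_simp)

lemma conv_cong:
  assumes "snd p > 0" "\<And>v. v \<noteq> 0 \<Longrightarrow> k v = k' v" shows "conv_kernel k f p = conv_kernel k' f p"
  unfolding conv_kernel_def using assms(2)[OF slice_nonzero[OF assms(1)]] by simp

lemma F2_commute: "snd p > 0 \<Longrightarrow> partial b (partial c F) p = partial c (partial b F) p"
  by (simp add: F2(1) poisson_kernel_partial_commute cong: conv_cong)

lemma F3_commute: "snd p > 0 \<Longrightarrow> partial a (partial b (partial c F)) p = partial b (partial a (partial c F)) p"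
  by (simp add: F3(1) hom_kernel_partial_commute[OF pk1] cong: conv_cong)

lemma conv_sum:
  assumes "\<And>i. i \<in> I \<Longrightarrow> hom_kernel m (k i)" "m > real CARD('n)" "snd p > 0"
  shows "conv_kernel (\<lambda>v. \<Sum>i\<in>I. r i * k i v) f p = (\<Sum>i\<in>I. r i * conv_kernel (k i) f p)"
  unfolding conv_kernel_def sum_distrib_right
  by (subst Bochner_Integration.integral_sum)
     (auto simp: mult.assoc intro!: conv_integrable[OF assms(1) assms(2,3)])

lemma partial_F_harmonic:
  assumes "snd p > 0"
  shows "(\<Sum>b\<in>Basis. partial b (partial b (partial c F)) p) = 0"
proof -
  have "(\<Sum>b\<in>Basis. partial b (partial b (partial c F)) p)
     = conv_kernel (\<lambda>v. \<Sum>b\<in>Basis. 1 * partial b (partial b (partial c poisson_kernel)) v) f p"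
    unfolding F3(1)[OF assms] by (subst conv_sum[OF pk3 _ assms]) auto
  also have "\<dots> = conv_kernel (\<lambda>v. 0) f p"
    by (rule conv_cong[OF assms]) (simp add: poisson_kernel_partial_harmonic)
  finally show ?thesis by (simp add: conv_kernel_def)
qed

lemma F_expand:
  assumes "snd p > 0"
  shows "partial b F p = (\<Sum>a\<in>Basis. (b \<bullet> a) * partial a F p)"
    and "partial b (partial c F) p = (\<Sum>a\<in>Basis. (b \<bullet> a) * partial a (partial c F) p)"
proof -
  have "partial b F p = conv_kernel (\<lambda>v. \<Sum>a\<in>Basis. (b \<bullet> a) * partial a poisson_kernel v) f p"
    unfolding F1(1)[OF assms]
    by (rule conv_cong[OF assms]) (rule differentiable_partial_expand[OF hom_kernel_differentiable[OF poisson_kernel_hom]])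
  also have "\<dots> = (\<Sum>a\<in>Basis. (b \<bullet> a) * partial a F p)"
    unfolding F1(1)[OF assms] by (rule conv_sum[OF pk1 _ assms]) auto
  finally show "partial b F p = (\<Sum>a\<in>Basis. (b \<bullet> a) * partial a F p)" .
  have "partial b (partial c F) p = conv_kernel (\<lambda>v. \<Sum>a\<in>Basis. (b \<bullet> a) * partial a (partial c poisson_kernel) v) f p"
    unfolding F2(1)[OF assms]
    by (rule conv_cong[OF assms]) (rule differentiable_partial_expand[OF hom_kernel_differentiable[OF pk1]])
  also have "\<dots> = (\<Sum>a\<in>Basis. (b \<bullet> a) * partial a (partial c F) p)"
    unfolding F2(1)[OF assms] by (rule conv_sum[OF pk2 _ assms]) auto
  finally show "partial b (partial c F) p = (\<Sum>a\<in>Basis. (b \<bullet> a) * partial a (partial c F) p)" .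
qed

end

section \<open>Hessian bounds\<close>

text \<open>Covers both classes: D = 0 for the Zygmund class, A arbitrarily small for the small one.
  Any exponent strictly between 1 and 2 would serve in place of 3/2: below 2 the product with a
  kernel of degree -(d+2) is integrable over a slice, above 1 the resulting bound is o(1/y) as y
  tends to 0.\<close>

definition second_diff_bound :: "real \<Rightarrow> real \<Rightarrow> ('a::real_normed_vector \<Rightarrow> real) \<Rightarrow> bool" where
  "second_diff_bound A D f \<longleftrightarrow> (\<forall>x h. \<bar>f (x + h) + f (x - h) - 2 * f x\<bar> \<le> A * norm h + D * norm h powr (3/2))"

definition reflect :: "'a::real_vector \<times> real \<Rightarrow> 'a \<times> real" where
  "reflect v = (- fst v, snd v)"

lemma reflect_simps: "reflect (v + t *\<^sub>R b) = reflect v + t *\<^sub>R reflect b" "reflect (reflect v) = v"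
  "reflect v = 0 \<longleftrightarrow> v = 0" "norm (reflect w) = norm (w :: 'b::real_normed_vector \<times> real)"
  by (auto simp: reflect_def prod_eq_iff norm_prod_def)

lemma partial_minus:
  assumes "hom_kernel m k" "v \<noteq> 0" shows "partial (- b) k v = - partial b k v"
proof (rule partial_eqI)
  have "((\<lambda>t. k (v + t *\<^sub>R b)) has_real_derivative partial b k v) (at (- 0))"
    using hom_kernel_partial(2)[OF assms] by simp
  then show "((\<lambda>t. k (v + t *\<^sub>R - b)) has_real_derivative - partial b k v) (at 0)"
    by (subst (asm) DERIV_mirror) simp
qed

lemma partial_reflect:
  fixes k :: "'a::euclidean_space \<times> real \<Rightarrow> real"
  assumes k: "hom_kernel m k" and s: "\<And>v. v \<noteq> 0 \<Longrightarrow> k (reflect v) = s * k v" and v: "v \<noteq> 0"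
  shows "partial (reflect b) k (reflect v) = s * partial b k v"
proof (rule partial_eqI)
  have op: "open {t::real. v + t *\<^sub>R b \<noteq> 0}" by (intro open_Collect_neq continuous_intros)
  show "((\<lambda>t. k (reflect v + t *\<^sub>R reflect b)) has_real_derivative s * partial b k v) (at 0)"
    by (rule has_field_derivative_transform_within_open[OF DERIV_cmult[OF hom_kernel_partial(2)[OF k v]] op])
       (use v s in \<open>auto simp flip: reflect_simps(1)\<close>)
qed

lemma poisson_kernel_reflect: "poisson_kernel (reflect v) = poisson_kernel v"
  by (simp add: poisson_kernel_def reflect_simps) (simp add: reflect_def inner_prod_def)

text \<open>Under reflection of x each horizontal derivative changes the parity and the vertical one
  preserves it, so two derivatives of the same type leave the even Poisson kernel even. A mixed
  derivative is odd and therefore excluded.\<close>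

lemma poisson_kernel_partial_even:
  fixes v :: "(real^'n) \<times> real"
  assumes v: "v \<noteq> 0" and bc: "(b = (b', 0) \<and> c = (c', 0)) \<or> (b = (0,1) \<and> c = (0,1))"
  shows "partial b (partial c poisson_kernel) (reflect v) = partial b (partial c poisson_kernel) v"
proof -
  have e1: "poisson_kernel (reflect v) = 1 * poisson_kernel v" for v :: "(real^'n) \<times> real"
    by (simp add: poisson_kernel_reflect)
  show ?thesis using bc
proof
  assume bc: "b = (b', 0) \<and> c = (c', 0)"
  then have r: "reflect b = - b" "reflect c = - c" by (auto simp: reflect_def)
  have pr: "u = reflect (reflect u)" for u :: "(real^'n) \<times> real" by (simp add: reflect_simps)
  have 1: "partial c poisson_kernel (reflect u) = (-1) * partial c poisson_kernel u" if "u \<noteq> 0" for u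
    using partial_reflect[OF poisson_kernel_hom e1 that, where b=c]
      partial_minus[OF poisson_kernel_hom, of "reflect u" c] that r by (simp add: reflect_simps)
  show ?thesis
    using partial_reflect[OF hom_kernel_partial(1)[OF poisson_kernel_hom] 1 v, where b=b]
      partial_minus[OF hom_kernel_partial(1)[OF poisson_kernel_hom, where b=c], of "reflect v" b] v r by (simp add: reflect_simps)
next
  assume bc: "b = (0, 1) \<and> c = (0, 1)"
  then have r: "reflect b = b" "reflect c = c" by (auto simp: reflect_def)
  have 1: "partial c poisson_kernel (reflect u) = 1 * partial c poisson_kernel u" if "u \<noteq> 0" for u
    using partial_reflect[OF poisson_kernel_hom e1 that, where b=c] r by simp
  show ?thesis
    using partial_reflect[OF hom_kernel_partial(1)[OF poisson_kernel_hom] 1 v, where b=b] r by simp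
qed
qed

lemma conv_poisson_kernel_one:
  fixes q :: "(real^'n) \<times> real"
  assumes "snd q > 0" shows "conv_kernel poisson_kernel (\<lambda>_. 1) q = 1"
proof -
  obtain x y where q: "q = (x, y)" by (cases q)
  have "conv_kernel poisson_kernel (\<lambda>_. 1) q
     = (LINT z|lborel. (poisson_const TYPE('n) * y) * norm (q - (z, 0)) powr (- (real CARD('n) + 1)))"
    unfolding conv_kernel_def by (simp add: q poisson_kernel_apply mult.assoc)
  also have "\<dots> = (poisson_const TYPE('n) * y) * (y powr (real CARD('n) - (real CARD('n) + 1)) * pow_mass TYPE('n) (real CARD('n) + 1))"
    using norm_powr_slice(2)[OF _ assms, of "real CARD('n) + 1"] q by simp
  also have "\<dots> = 1"
    using assms q pow_mass_pos[of "real CARD('n) + 1", where 'n='n] by (simp add: poisson_const_eq powr_minus field_simps)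
  finally show ?thesis .
qed

text \<open>The extension of the constant 1 is constant, and its second derivatives are these
  convolutions.\<close>

lemma conv_poisson_kernel_partial_one:
  fixes q :: "(real^'n) \<times> real"
  assumes "snd q > 0"
  shows "conv_kernel (partial b (partial c poisson_kernel)) (\<lambda>_. 1) q = 0"
proof -
  interpret bounded_continuous "\<lambda>_::real^'n. 1::real" 1 by unfold_locales auto
  have F1c: "F p = 1" if "snd p > 0" for p
    using conv_poisson_kernel_one[OF that] by (simp add: poisson_extension_conv)
  have op: "open {p::(real^'n) \<times> real. snd p > 0}" by (intro open_Collect_less continuous_intros)
  have 1: "partial c F p = 0" if "snd p > 0" for p
  proof -
    have "partial c F p = partial c (\<lambda>_. 1) p" by (rule partial_cong_open[OF op]) (use that F1c in auto)
    then show ?thesis using partial_eqI[of "\<lambda>_. 1" p c 0] by simp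
  qed
  have "partial b (partial c F) q = partial b (\<lambda>_. 0) q" by (rule partial_cong_open[OF op]) (use assms 1 in auto)
  then have "partial b (partial c F) q = 0" using partial_eqI[of "\<lambda>_. 0" q b 0] by simp
  then show ?thesis using F2(1)[OF assms] by simp
qed

text \<open>Landau-type interpolation: the function \<phi>(t) - \<phi>(-t) - 2 t \<phi>'(0) has
  derivative at most D on [0,y], and its value at y weighs \<phi>'(0) against the bound A.\<close>

lemma deriv_from_second_difference:
  fixes \<phi> :: "real \<Rightarrow> real"
  assumes d: "\<And>t. (\<phi> has_real_derivative \<phi>' t) (at t)"
    and A: "\<And>t. \<bar>\<phi> t\<bar> \<le> A" and y: "y > 0"
    and D: "\<And>t. 0 \<le> t \<Longrightarrow> t \<le> y \<Longrightarrow> \<bar>\<phi>' t + \<phi>' (-t) - 2 * \<phi>' 0\<bar> \<le> D"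
  shows "\<bar>\<phi>' 0\<bar> \<le> A / y + D / 2"
proof -
  define \<psi> where "\<psi> = (\<lambda>t. \<phi> t - \<phi> (-t) - 2 * t * \<phi>' 0)"
  have m: "((\<lambda>t. \<phi> (-t)) has_real_derivative - \<phi>' (-t)) (at t)" for t
    using d[of "-t"] by (subst (asm) DERIV_mirror) simp
  have der: "(\<psi> has_real_derivative (\<phi>' t + \<phi>' (-t) - 2 * \<phi>' 0)) (at t)" for t
    unfolding \<psi>_def by (auto intro!: derivative_eq_intros d m)
  have "norm (\<psi> y - \<psi> 0) \<le> D * norm (y - 0)"
    by (rule field_differentiable_bound[where S="{0..y}" and f'="\<lambda>t. \<phi>' t + \<phi>' (-t) - 2 * \<phi>' 0"])
       (use der D y in \<open>auto intro: has_field_derivative_at_within\<close>)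
  then have "\<bar>\<psi> y\<bar> \<le> D * y" using y by (simp add: \<psi>_def)
  then have "\<bar>2 * y * \<phi>' 0\<bar> \<le> 2 * A + D * y"
    using A[of y] A[of "-y"] unfolding \<psi>_def by linarith
  then have "2 * y * \<bar>\<phi>' 0\<bar> \<le> 2 * A + D * y" using y by (simp add: abs_mult)
  then show ?thesis using y by (simp add: field_simps)
qed

context bounded_continuous begin

text \<open>The reflection z -> 2x - z fixes the kernel, whose integral is zero, so twice the
  convolution is the integral of the kernel against f(z) + f(2x - z) - 2 f(x). As |z - x| is at most
  |p - (z,0)|, this improves the degree -(d+2) by one power in the A-term and by 3/2 in the
  D-term.\<close>

lemma even_kernel_conv_bound:
  fixes p :: "(real^'n) \<times> real"
  assumes k: "hom_kernel (real CARD('n) + 2) k"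
    and even: "\<And>v. v \<noteq> 0 \<Longrightarrow> k (reflect v) = k v"
    and one: "\<And>q. snd q > 0 \<Longrightarrow> conv_kernel k (\<lambda>_. 1) q = 0"
  shows "\<exists>C\<ge>0. \<forall>A D p. A \<ge> 0 \<longrightarrow> D \<ge> 0 \<longrightarrow> second_diff_bound A D f \<longrightarrow> snd p > 0 \<longrightarrow>
     \<bar>conv_kernel k f p\<bar> \<le> C * (A / snd p + D / sqrt (snd p))"
proof -
  obtain C where C: "C \<ge> 0" "\<And>v. v \<noteq> 0 \<Longrightarrow> \<bar>k v\<bar> \<le> C * norm v powr (-(real CARD('n) + 2))"
    using hom_kernel_bound[OF k] by auto
  define M1 where "M1 = pow_mass TYPE('n) (real CARD('n) + 1)"
  define M2 where "M2 = pow_mass TYPE('n) (real CARD('n) + 1/2)"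
  have M: "M1 > 0" "M2 > 0" unfolding M1_def M2_def by (intro pow_mass_pos; simp)+
  have "\<bar>conv_kernel k f p\<bar> \<le> C * (M1 + M2) * (A / snd p + D / sqrt (snd p))"
    if AD: "A \<ge> 0" "D \<ge> 0" and Z: "second_diff_bound A D f" and p: "snd p > 0" for A D p
  proof -
    obtain x y where xy: "p = (x, y)" by (cases p)
    define g where "g = (\<lambda>z. k (p - (z, 0)) * f z)"
    have ig: "integrable lborel g" unfolding g_def by (rule conv_integrable[OF k _ p]) simp
    have refl: "p - (2 *\<^sub>R x + (-1) *\<^sub>R z, 0) = reflect (p - (z, 0))" for z
      by (simp add: reflect_def xy scaleR_2)
    have g2: "g (2 *\<^sub>R x + (-1) *\<^sub>R z) = k (p - (z, 0)) * f (2 *\<^sub>R x - z)" for z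
      unfolding g_def refl using even[OF slice_nonzero[OF p]] by simp
    have ig2: "integrable lborel (\<lambda>z. k (p - (z, 0)) * f (2 *\<^sub>R x - z))"
      and eq2: "(LINT z|lborel. g z) = (LINT z|lborel. k (p - (z, 0)) * f (2 *\<^sub>R x - z))"
      using lborel_integral_affine[OF _ ig, of "-1" "2 *\<^sub>R x"] unfolding g2 by simp_all
    interpret one: bounded_continuous "\<lambda>_::real^'n. 1::real" 1 by unfold_locales auto
    have i1: "integrable lborel (\<lambda>z. k (p - (z, 0)))" using one.conv_integrable[OF k _ p] by simp
    have z1: "(LINT z|lborel. k (p - (z, 0))) = 0" using one[OF p] by (simp add: conv_kernel_def)
    have "2 * conv_kernel k f p = (LINT z|lborel. g z) + (LINT z|lborel. k (p - (z, 0)) * f (2 *\<^sub>R x - z))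
        - 2 * f x * (LINT z|lborel. k (p - (z, 0)))"
      unfolding z1 eq2[symmetric] by (simp add: conv_kernel_def g_def)
    also have "\<dots> = (LINT z|lborel. g z + k (p - (z, 0)) * f (2 *\<^sub>R x - z) - 2 * f x * k (p - (z, 0)))"
      using ig ig2 i1 by simp
    also have "\<dots> = (LINT z|lborel. k (p - (z, 0)) * (f z + f (2 *\<^sub>R x - z) - 2 * f x))"
      unfolding g_def by (simp add: algebra_simps)
    finally have eq: "2 * conv_kernel k f p = (LINT z|lborel. k (p - (z, 0)) * (f z + f (2 *\<^sub>R x - z) - 2 * f x))" .
    have "\<bar>2 * conv_kernel k f p\<bar> \<le> (LINT z|lborel. \<bar>k (p - (z, 0)) * (f z + f (2 *\<^sub>R x - z) - 2 * f x)\<bar>)"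
      unfolding eq by (rule integral_abs_bound)
    also have "\<dots> \<le> (LINT z|lborel. C * A * norm (p - (z, 0)) powr (-(real CARD('n) + 1)) + C * D * norm (p - (z, 0)) powr (-(real CARD('n) + 1/2)))"
    proof (rule integral_mono)
      have "(\<lambda>z. k (p - (z, 0)) * (f z + f (2 *\<^sub>R x - z) - 2 * f x)) = (\<lambda>z. g z + k (p - (z, 0)) * f (2 *\<^sub>R x - z) - 2 * f x * k (p - (z, 0)))"
        by (auto simp: g_def algebra_simps)
      then show "integrable lborel (\<lambda>z. \<bar>k (p - (z, 0)) * (f z + f (2 *\<^sub>R x - z) - 2 * f x)\<bar>)"
        using ig ig2 i1 by simp
      show "integrable lborel (\<lambda>z. C * A * norm (p - (z, 0)) powr (-(real CARD('n) + 1)) + C * D * norm (p - (z, 0)) powr (-(real CARD('n) + 1/2)))"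
        using norm_powr_slice(1)[OF _ p, of "real CARD('n) + 1"] norm_powr_slice(1)[OF _ p, of "real CARD('n) + 1/2"] by simp
      fix z
      define n where "n = norm (p - (z, 0))"
      have n: "n > 0" using slice_nonzero[OF p, of z] by (simp add: n_def)
      have zn: "norm (z - x) \<le> n" unfolding n_def xy using norm_fst_le[of "x - z" y] by (simp add: norm_minus_commute)
      have "\<bar>f z + f (2 *\<^sub>R x - z) - 2 * f x\<bar> \<le> A * norm (z - x) + D * norm (z - x) powr (3/2)"
        using Z[unfolded second_diff_bound_def, rule_format, of x "z - x"] by (simp add: scaleR_2 algebra_simps)
      also have "\<dots> \<le> A * n + D * n powr (3/2)"
        using zn AD by (intro add_mono mult_left_mono powr_mono2) auto
      finally have 1: "\<bar>f z + f (2 *\<^sub>R x - z) - 2 * f x\<bar> \<le> A * n + D * n powr (3/2)" .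
      have "\<bar>k (p - (z, 0)) * (f z + f (2 *\<^sub>R x - z) - 2 * f x)\<bar> \<le> (C * n powr (-(real CARD('n) + 2))) * (A * n + D * n powr (3/2))"
        unfolding abs_mult using C(2)[OF slice_nonzero[OF p, of z]] 1 C(1) by (intro mult_mono) (auto simp: n_def)
      also have "\<dots> = C * A * (n powr (-(real CARD('n) + 2)) * n powr 1) + C * D * (n powr (-(real CARD('n) + 2)) * n powr (3/2))"
        using n by (simp add: algebra_simps)
      also have "\<dots> = C * A * n powr (-(real CARD('n) + 1)) + C * D * n powr (-(real CARD('n) + 1/2))"
      proof -
        have "-(real CARD('n) + 2) + 1 = -(real CARD('n) + 1)" "-(real CARD('n) + 2) + 3/2 = -(real CARD('n) + 1/2)" by simp_all
        then show ?thesis by (simp only: powr_add[symmetric])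
      qed
      finally show "\<bar>k (p - (z, 0)) * (f z + f (2 *\<^sub>R x - z) - 2 * f x)\<bar> \<le>
        C * A * norm (p - (z, 0)) powr (-(real CARD('n) + 1)) + C * D * norm (p - (z, 0)) powr (-(real CARD('n) + 1/2))"
        by (simp only: n_def)
    qed
    also have "\<dots> = C * A * (y powr (-1) * M1) + C * D * (y powr (-1/2) * M2)"
      using norm_powr_slice[OF _ p, of "real CARD('n) + 1"] norm_powr_slice[OF _ p, of "real CARD('n) + 1/2"]
      by (simp add: M1_def M2_def xy)
    also have "\<dots> = C * (M1 * (A / y) + M2 * (D / sqrt y))"
      using p xy by (simp add: powr_minus powr_half_sqrt field_simps flip: powr_minus_divide)
    also have "\<dots> \<le> C * ((M1 + M2) * (A / y) + (M1 + M2) * (D / sqrt y))"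
      using M C(1) AD p xy by (intro mult_left_mono add_mono mult_right_mono) auto
    finally have "\<bar>conv_kernel k f p\<bar> \<le> C * ((M1 + M2) * (A / y) + (M1 + M2) * (D / sqrt y))" by linarith
    then show ?thesis using xy by (simp add: algebra_simps add_divide_distrib)
  qed
  then show ?thesis using C(1) M by (intro exI[of _ "C * (M1 + M2)"]) auto
qed

text \<open>Convolution commutes with horizontal translation, so the left side is the convolution of
  k with f(x+h) + f(x-h) - 2 f(x), to which \<open>conv_bound\<close> applies with E as the
  bound.\<close>

lemma conv_second_difference:
  fixes p :: "(real^'n) \<times> real"
  assumes k: "hom_kernel m k" "m > real CARD('n)"
  shows "\<exists>C\<ge>0. \<forall>h p E. (\<forall>x. \<bar>f (x + h) + f (x - h) - 2 * f x\<bar> \<le> E) \<longrightarrow> snd p > 0 \<longrightarrow>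
    \<bar>conv_kernel k f (p + (h, 0)) + conv_kernel k f (p - (h, 0)) - 2 * conv_kernel k f p\<bar>
      \<le> C * E * snd p powr (real CARD('n) - m)"
proof -
  obtain C where C: "C \<ge> 0" "\<And>v. v \<noteq> 0 \<Longrightarrow> \<bar>k v\<bar> \<le> C * norm v powr (-m)"
    using hom_kernel_bound[OF k(1)] by auto
  have "\<bar>conv_kernel k f (p + (h, 0)) + conv_kernel k f (p - (h, 0)) - 2 * conv_kernel k f p\<bar>
      \<le> (C * pow_mass TYPE('n) m) * E * snd p powr (real CARD('n) - m)"
    if E: "\<forall>x. \<bar>f (x + h) + f (x - h) - 2 * f x\<bar> \<le> E" and p: "snd p > 0" for h p E
  proof -
    have shift: "integrable lborel (\<lambda>z. k (p - (z, 0)) * f (z + h))"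
       "conv_kernel k f (p + (h, 0)) = (LINT z|lborel. k (p - (z, 0)) * f (z + h))" for h
    proof -
      have up: "snd (p + (h, 0)) > 0" using p by simp
      have e: "p + (h, 0) - (h + 1 *\<^sub>R z, 0) = p - (z, 0)" for z by (simp add: prod_eq_iff)
      show "integrable lborel (\<lambda>z. k (p - (z, 0)) * f (z + h))"
       "conv_kernel k f (p + (h, 0)) = (LINT z|lborel. k (p - (z, 0)) * f (z + h))"
        using lborel_integral_affine[OF _ conv_integrable[OF k up], of 1 h] unfolding conv_kernel_def e
        by (simp_all add: add.commute)
    qed
    interpret g: bounded_continuous "\<lambda>x. f (x + h) + f (x - h) - 2 * f x" E
      by unfold_locales (use E in \<open>auto intro!: continuous_intros continuous_on_compose2[OF cont]\<close>)
    have "conv_kernel k (\<lambda>x. f (x + h) + f (x - h) - 2 * f x) p =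
      (LINT z|lborel. k (p - (z, 0)) * f (z + h) + k (p - (z, 0)) * f (z + - h) - 2 * (k (p - (z, 0)) * f z))"
      unfolding conv_kernel_def by (simp add: algebra_simps)
    also have "\<dots> = conv_kernel k f (p + (h, 0)) + conv_kernel k f (p + (- h, 0)) - 2 * conv_kernel k f p"
      unfolding shift(2) using shift(1)[of h] shift(1)[of "-h"] conv_integrable[OF k p]
      by (simp add: conv_kernel_def)
    also have "p + (- h, 0) = p - (h, 0)" by (simp add: prod_eq_iff)
    finally have "conv_kernel k f (p + (h, 0)) + conv_kernel k f (p - (h, 0)) - 2 * conv_kernel k f p
       = conv_kernel k (\<lambda>x. f (x + h) + f (x - h) - 2 * f x) p" by simp
    then show ?thesis using g.conv_bound[OF k C p] by (simp add: mult_ac)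
  qed
  moreover have "C * pow_mass TYPE('n) m \<ge> 0" using C(1) pow_mass_pos[OF k(2)] by simp
  ultimately show ?thesis by blast
qed


lemma Basis_prod_cases:
  assumes "b \<in> (Basis :: ((real^'n) \<times> real) set)"
  obtains i where "b = (i, 0)" "i \<in> Basis" | "b = (0, 1)"
  using assms by (auto simp: Basis_prod_def)

lemma even_hessian_bound:
  assumes bc: "(b = (b', 0) \<and> c = (c', 0)) \<or> (b = (0::real^'n,1::real) \<and> c = (0,1))"
  shows "\<exists>C\<ge>0. \<forall>A D p. A \<ge> 0 \<longrightarrow> D \<ge> 0 \<longrightarrow> second_diff_bound A D f \<longrightarrow> snd p > 0 \<longrightarrow>
     \<bar>partial b (partial c F) p\<bar> \<le> C * (A / snd p + D / sqrt (snd p))"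
proof -
  have h: "hom_kernel (real CARD('n) + 2) (partial b (partial c poisson_kernel))"
    using pk2[of b c] by (simp add: add.assoc)
  show ?thesis
    using even_kernel_conv_bound[OF h poisson_kernel_partial_even[OF _ bc] conv_poisson_kernel_partial_one]
    by (simp add: F2(1))
qed

lemma mixed_hessian_bound:
  fixes i :: "real^'n"
  assumes i: "norm i = 1"
  shows "\<exists>C\<ge>0. \<forall>A D p. A \<ge> 0 \<longrightarrow> D \<ge> 0 \<longrightarrow> second_diff_bound A D f \<longrightarrow> snd p > 0 \<longrightarrow>
     \<bar>partial (i, 0) (partial (0, 1) F) p\<bar> \<le> C * (A / snd p + D / sqrt (snd p))"
proof -
  let ?y = "(0::real^'n, 1::real)" and ?i = "(i, 0::real)"
  define d where "d = real CARD('n)"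
  obtain C1 where C1: "C1 \<ge> 0" "\<And>A D p. A \<ge> 0 \<Longrightarrow> D \<ge> 0 \<Longrightarrow> second_diff_bound A D f \<Longrightarrow> snd p > 0 \<Longrightarrow>
     \<bar>partial ?y (partial ?y F) p\<bar> \<le> C1 * (A / snd p + D / sqrt (snd p))"
    using even_hessian_bound[of ?y _ ?y] by blast
  have h3: "hom_kernel (d + 3) (partial ?i (partial ?y (partial ?y poisson_kernel)))"
    using pk3[of ?i ?y ?y] by (simp add: add.assoc d_def)
  have h2: "hom_kernel (d + 2) (partial ?i (partial ?y poisson_kernel))"
    using pk2[of ?i ?y] by (simp add: add.assoc d_def)
  obtain C3 where C3: "C3 \<ge> 0" "\<And>h p E. (\<And>x. \<bar>f (x + h) + f (x - h) - 2 * f x\<bar> \<le> E) \<Longrightarrow> snd p > 0 \<Longrightarrow>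
    \<bar>partial ?i (partial ?y (partial ?y F)) (p + (h, 0)) + partial ?i (partial ?y (partial ?y F)) (p - (h, 0))
       - 2 * partial ?i (partial ?y (partial ?y F)) p\<bar> \<le> C3 * E * snd p powr (-3)"
  proof -
    obtain C where C: "C \<ge> 0" "\<forall>h p E. (\<forall>x. \<bar>f (x + h) + f (x - h) - 2 * f x\<bar> \<le> E) \<longrightarrow> snd p > 0 \<longrightarrow>
    \<bar>conv_kernel (partial ?i (partial ?y (partial ?y poisson_kernel))) f (p + (h, 0))
     + conv_kernel (partial ?i (partial ?y (partial ?y poisson_kernel))) f (p - (h, 0))
     - 2 * conv_kernel (partial ?i (partial ?y (partial ?y poisson_kernel))) f p\<bar>
      \<le> C * E * snd p powr (real CARD('n) - (d + 3))"
      using conv_second_difference[OF h3] by (auto simp: d_def)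
    show ?thesis
    proof (rule that[OF C(1)])
      fix h :: "real^'n" and p :: "(real^'n) \<times> real" and E :: real
      assume "\<And>x. \<bar>f (x + h) + f (x - h) - 2 * f x\<bar> \<le> E" "snd p > 0"
      then show "\<bar>partial ?i (partial ?y (partial ?y F)) (p + (h, 0)) + partial ?i (partial ?y (partial ?y F)) (p - (h, 0))
       - 2 * partial ?i (partial ?y (partial ?y F)) p\<bar> \<le> C * E * snd p powr (-3)"
        using C(2)[rule_format, of h E p] by (simp add: F3(1) d_def)
    qed
  qed
  define C4 where "C4 = C1 + C3 / 2"
  have C4: "C4 \<ge> 0" using C1 C3 by (simp add: C4_def)
  have third: "\<bar>partial ?i (partial ?y (partial ?y F)) p\<bar> \<le> C4 * (A / (snd p)\<^sup>2 + D / (snd p * sqrt (snd p)))"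
    if AD: "A \<ge> 0" "D \<ge> 0" "second_diff_bound A D f" and p: "snd p > 0" for A D p
  proof -
    define y where "y = snd p"
    have y: "y > 0" using p by (simp add: y_def)
    have up: "snd (p + t *\<^sub>R ?i) > 0" for t using p by simp
    \<comment> \<open>Interpolation along direction i with step y: the even case bounds the vertical
      second derivative, and \<open>conv_second_difference\<close> with E = A y + D y^(3/2) bounds
      the second difference of its derivative.\<close>
    have st: "\<bar>partial ?i (partial ?y (partial ?y F)) (p + 0 *\<^sub>R ?i)\<bar>
       \<le> (C1 * (A / y + D / sqrt y)) / y + (C3 * (A * y + D * y powr (3/2)) * y powr (-3)) / 2"
    proof (rule deriv_from_second_difference[where \<phi>="\<lambda>t. partial ?y (partial ?y F) (p + t *\<^sub>R ?i)"
          and \<phi>'="\<lambda>t. partial ?i (partial ?y (partial ?y F)) (p + t *\<^sub>R ?i)"])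
      show "((\<lambda>t. partial ?y (partial ?y F) (p + t *\<^sub>R ?i)) has_real_derivative
         partial ?i (partial ?y (partial ?y F)) (p + t *\<^sub>R ?i)) (at t)" for t
        by (rule has_derivative_along[OF F3(2) up])
      show "\<bar>partial ?y (partial ?y F) (p + t *\<^sub>R ?i)\<bar> \<le> C1 * (A / y + D / sqrt y)" for t
        using C1(2)[OF AD up[of t]] by (simp add: y_def)
      fix t :: real assume t: "0 \<le> t" "t \<le> y"
      have E: "\<bar>f (x + t *\<^sub>R i) + f (x - t *\<^sub>R i) - 2 * f x\<bar> \<le> A * y + D * y powr (3/2)" for x
      proof -
        have "\<bar>f (x + t *\<^sub>R i) + f (x - t *\<^sub>R i) - 2 * f x\<bar> \<le> A * norm (t *\<^sub>R i) + D * norm (t *\<^sub>R i) powr (3/2)"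
          using AD(3) unfolding second_diff_bound_def by blast
        also have "\<dots> \<le> A * y + D * y powr (3/2)"
          using t i AD by (intro add_mono mult_left_mono powr_mono2) auto
        finally show ?thesis .
      qed
      have e: "p + (t *\<^sub>R i, 0) = p + t *\<^sub>R ?i" "p - (t *\<^sub>R i, 0) = p + (- t) *\<^sub>R ?i" "p + 0 *\<^sub>R ?i = p"
        by (simp_all add: prod_eq_iff)
      show "\<bar>partial ?i (partial ?y (partial ?y F)) (p + t *\<^sub>R ?i) +
         partial ?i (partial ?y (partial ?y F)) (p + - t *\<^sub>R ?i) -
         2 * partial ?i (partial ?y (partial ?y F)) (p + 0 *\<^sub>R ?i)\<bar>
         \<le> C3 * (A * y + D * y powr (3/2)) * y powr (-3)"
        using C3(2)[OF E p] unfolding e y_def .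
    qed (rule y)
    have e1: "y powr (3/2) * y powr (-3) = 1 / (y * sqrt y)"
    proof -
      have "y powr (3/2) * y powr (-3) = y powr (-(1 + 1/2))" by (simp add: powr_add[symmetric])
      also have "\<dots> = 1 / (y powr 1 * y powr (1/2))" by (simp only: powr_minus_divide powr_add)
      finally show ?thesis using y by (simp add: powr_half_sqrt)
    qed
    have e2: "y * y powr (-3) = 1 / y\<^sup>2"
      using y by (simp add: powr_minus powr_numeral power2_eq_square power3_eq_cube field_simps)
    have "C3 * (A * y + D * y powr (3/2)) * y powr (-3) = C3 * (A * (y * y powr (-3)) + D * (y powr (3/2) * y powr (-3)))"
      by (simp add: algebra_simps)
    also have "\<dots> = C3 * (A / y\<^sup>2 + D / (y * sqrt y))" unfolding e1 e2 by simp
    finally have e5: "C3 * (A * y + D * y powr (3/2)) * y powr (-3) = C3 * (A / y\<^sup>2 + D / (y * sqrt y))" .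
    have "p + 0 *\<^sub>R ?i = p" by (simp add: prod_eq_iff)
    note st' = st[unfolded this e5]
    have "C1 * (A / y + D / sqrt y) / y = C1 * ((A / y + D / sqrt y) / y)" by simp
    also have "(A / y + D / sqrt y) / y = A / y\<^sup>2 + D / (y * sqrt y)"
      by (simp add: add_divide_distrib power2_eq_square mult.commute)
    finally show ?thesis using st' unfolding y_def[symmetric] C4_def by (simp add: distrib_right)
  qed
  \<comment> \<open>Decay from the sup bound of f alone. K depends on that bound, but only the limit
    0 at infinity is read off from it.\<close>
  obtain K where K: "K \<ge> 0" "\<And>p. snd p > 0 \<Longrightarrow> \<bar>partial ?i (partial ?y F) p\<bar> \<le> K * snd p powr (-2)"
  proof -
    obtain C where C: "C \<ge> 0" "\<And>v. v \<noteq> 0 \<Longrightarrow> \<bar>partial ?i (partial ?y poisson_kernel) v\<bar> \<le> C * norm v powr (-(d+2))"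
      using hom_kernel_bound[OF h2] by auto
    have d2: "d + 2 > real CARD('n)" by (simp add: d_def)
    show ?thesis
    proof (rule that[of "B * (C * pow_mass TYPE('n) (d+2))"])
      show "0 \<le> B * (C * pow_mass TYPE('n) (d + 2))" using C(1) B_nonneg pow_mass_pos[OF d2] by simp
      fix p :: "(real^'n) \<times> real" assume p: "snd p > 0"
      have e: "real CARD('n) - (d+2) = -2" by (simp add: d_def)
      show "\<bar>partial ?i (partial ?y F) p\<bar> \<le> B * (C * pow_mass TYPE('n) (d+2)) * snd p powr (-2)"
        using conv_bound[OF h2 d2 C p] unfolding F2(1)[OF p] e by (simp add: mult_ac)
    qed
  qed
  have "\<bar>partial ?i (partial ?y F) p\<bar> \<le> (2 * C4) * (A / snd p + D / sqrt (snd p))"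
    if AD: "A \<ge> 0" "D \<ge> 0" "second_diff_bound A D f" and p: "snd p > 0" for A D p
  proof -
    obtain x y where xy: "p = (x, y)" by (cases p)
    have y: "y > 0" using p xy by simp
    define g where "g = (\<lambda>t. partial ?i (partial ?y F) (x, t))"
    \<comment> \<open>-G' is exactly the bound \<open>third\<close> for the derivative of g, so g -
      G and -g - G are nondecreasing in the height and their values at y are controlled by the limit
      at infinity.\<close>
    define G where "G = (\<lambda>t. C4 * (A / t + 2 * D / sqrt t))"
    have sh: "(x, 0) + t *\<^sub>R ?y = (x, t)" for t by (simp add: prod_eq_iff)
    have dg: "(g has_real_derivative partial ?i (partial ?y (partial ?y F)) (x, t)) (at t)" if "t > 0" for t
    proof -
      have "((\<lambda>t. partial ?i (partial ?y F) ((x, 0) + t *\<^sub>R ?y)) has_real_derivative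
          partial ?y (partial ?i (partial ?y F)) ((x, 0) + t *\<^sub>R ?y)) (at t)"
        by (rule has_derivative_along[OF F3(2)]) (use that in \<open>auto simp: sh\<close>)
      then show ?thesis using F3_commute[of "(x,t)" ?y ?i ?y] that unfolding sh g_def by simp
    qed
    have dG: "(G has_real_derivative - C4 * (A / t\<^sup>2 + D / (t * sqrt t))) (at t)" if "t > 0" for t
      unfolding G_def using that
      by (auto intro!: derivative_eq_intros simp: field_simps power2_eq_square)
    have key: "s * g y \<le> G y" if s: "\<bar>s\<bar> = 1" for s
    proof -
      have mono: "s * g y - G y \<le> s * g T - G T" if T: "T \<ge> y" for T
      proof (rule DERIV_nonneg_imp_nondecreasing[OF T])
        fix t assume t: "y \<le> t" "t \<le> T"
        have "((\<lambda>t. s * g t - G t) has_real_derivative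
           s * partial ?i (partial ?y (partial ?y F)) (x, t) - (- C4 * (A / t\<^sup>2 + D / (t * sqrt t)))) (at t)"
          using t y by (intro DERIV_diff DERIV_cmult dg dG) auto
        moreover have "\<bar>s * partial ?i (partial ?y (partial ?y F)) (x, t)\<bar> \<le> C4 * (A / t\<^sup>2 + D / (t * sqrt t))"
          using third[OF AD, of "(x,t)"] t y s by (simp add: abs_mult)
        ultimately show "\<exists>z. ((\<lambda>t. s * g t - G t) has_real_derivative z) (at t) \<and> 0 \<le> z"
          by (intro exI conjI) (assumption, linarith)
      qed
      have "s * g y - G y \<le> K * T powr (-2)" if T: "T \<ge> y" for T
      proof -
        have "s * g T \<le> \<bar>s * g T\<bar>" by simp
        also have "\<dots> = \<bar>g T\<bar>" using s by (simp add: abs_mult)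
        also have "\<dots> \<le> K * T powr (-2)" using K(2)[of "(x,T)"] T y by (simp add: g_def)
        finally show ?thesis using mono[OF T] T y AD C4 unfolding G_def
          by (smt (verit, best) divide_nonneg_nonneg mult_nonneg_nonneg real_sqrt_ge_zero)
      qed
      then have ev: "\<forall>\<^sub>F T in at_top. s * g y - G y \<le> K * T powr (-2)"
        by (auto simp: eventually_at_top_linorder)
      have "((\<lambda>T. K * T powr (-2)) \<longlongrightarrow> K * 0) at_top"
        by (intro tendsto_mult_left tendsto_neg_powr filterlim_ident) auto
      from tendsto_lowerbound[OF this ev] show ?thesis by simp
    qed
    have "\<bar>g y\<bar> \<le> G y" using key[of 1] key[of "-1"] by (simp add: abs_le_iff)
    also have "\<dots> \<le> (2 * C4) * (A / y + D / sqrt y)"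
    proof -
      have "0 \<le> A / y" using AD y by simp
      moreover have "a + 2 * d \<le> 2 * (a + d)" if "0 \<le> a" for a d :: real using that by simp
      ultimately have "A / y + 2 * (D / sqrt y) \<le> 2 * (A / y + D / sqrt y)" by blast
      from mult_left_mono[OF this C4] show ?thesis unfolding G_def
        by (simp add: mult.assoc mult.left_commute[of 2 C4])
    qed
    finally show ?thesis by (simp add: g_def xy)
  qed
  then show ?thesis using C4 by (intro exI[of _ "2 * C4"]) auto
qed

lemma hessian_bound:
  "\<exists>C\<ge>0. \<forall>A D p b c. A \<ge> 0 \<longrightarrow> D \<ge> 0 \<longrightarrow> second_diff_bound A D f \<longrightarrow> snd p > 0 \<longrightarrow> b \<in> Basis \<longrightarrow> c \<in> Basis \<longrightarrow>
     \<bar>partial b (partial c F) p\<bar> \<le> C * (A / snd p + D / sqrt (snd p))"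
proof -
  have ex: "\<exists>C\<ge>0. \<forall>A D p. A \<ge> 0 \<longrightarrow> D \<ge> 0 \<longrightarrow> second_diff_bound A D f \<longrightarrow> snd p > 0 \<longrightarrow>
     \<bar>partial b (partial c F) p\<bar> \<le> C * (A / snd p + D / sqrt (snd p))" 
    if "b \<in> Basis" "c \<in> Basis" for b c
    using that(1)
  proof (cases rule: Basis_prod_cases)
    case (1 i)
    show ?thesis using that(2)
    proof (cases rule: Basis_prod_cases)
      case (1 j) with \<open>b = (i, 0)\<close> show ?thesis by (intro even_hessian_bound) auto
    next
      case 2 with 1 show ?thesis using mixed_hessian_bound[of i] by simp
    qed
  next
    case 2
    show ?thesis using that(2)
    proof (cases rule: Basis_prod_cases)
      case (1 j) with 2 show ?thesis using mixed_hessian_bound[of j]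
        by (simp add: F2_commute[of _ "(0,1)" "(j,0)"])
    next
      case 2 with \<open>b = (0,1)\<close> show ?thesis by (intro even_hessian_bound) auto
    qed
  qed
  then obtain C where C: "\<And>b c. b \<in> Basis \<Longrightarrow> c \<in> Basis \<Longrightarrow> C b c \<ge> 0 \<and> (\<forall>A D p. A \<ge> 0 \<longrightarrow> D \<ge> 0 \<longrightarrow> second_diff_bound A D f \<longrightarrow> snd p > 0 \<longrightarrow>
     \<bar>partial b (partial c F) p\<bar> \<le> C b c * (A / snd p + D / sqrt (snd p)))"
    by metis
  define M where "M = (\<Sum>b\<in>Basis. \<Sum>c\<in>Basis. C b c)"
  have le: "C b c \<le> M" if "b \<in> Basis" "c \<in> Basis" for b c
  proof -
    have "C b c \<le> (\<Sum>c\<in>Basis. C b c)" by (rule member_le_sum) (use that C in auto)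
    also have "\<dots> \<le> M" unfolding M_def
      by (rule member_le_sum[of b Basis "\<lambda>b. \<Sum>c\<in>Basis. C b c"]) (use that C in \<open>auto intro!: sum_nonneg\<close>)
    finally show ?thesis .
  qed
  have "M \<ge> 0" unfolding M_def using C by (intro sum_nonneg) auto
  moreover have "\<bar>partial b (partial c F) p\<bar> \<le> M * (A / snd p + D / sqrt (snd p))"
    if "A \<ge> 0" "D \<ge> 0" "second_diff_bound A D f" "snd p > 0" "b \<in> Basis" "c \<in> Basis" for A D p b c
  proof -
    have "\<bar>partial b (partial c F) p\<bar> \<le> C b c * (A / snd p + D / sqrt (snd p))" using C that by blast
    also have "\<dots> \<le> M * (A / snd p + D / sqrt (snd p))"
      using le that by (intro mult_right_mono) auto
    finally show ?thesis .
  qed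
  ultimately show ?thesis by blast
qed

end

section \<open>Increments of the boundary function\<close>

lemma poisson_kernel_scale:
  fixes v :: "(real^'n) \<times> real"
  assumes "y > 0"
  shows "poisson_kernel (y *\<^sub>R v) * y ^ CARD('n) = poisson_kernel v"
proof -
  have "y powr (real CARD('n) + 1) = y ^ CARD('n) * y" using assms by (simp add: powr_add powr_realpow)
  then have "y * y powr (- (real CARD('n) + 1)) * y ^ CARD('n) = 1"
    unfolding powr_minus using assms by (simp add: field_simps)
  then have "(y * y powr (- (real CARD('n) + 1)) * y ^ CARD('n)) * poisson_kernel v = poisson_kernel v" by simp
  then show ?thesis using assms
    by (simp add: poisson_kernel_def powr_mult mult_ac add.commute del: powr_minus_divide)
qed

lemma sum_Basis_half_space:
  fixes g :: "(real^'n) \<times> real \<Rightarrow> 'z::comm_monoid_add"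
  shows "(\<Sum>a\<in>Basis. g a) = (\<Sum>i\<in>UNIV. g (axis i 1, 0)) + g (0, 1)"
proof -
  have v: "(Basis :: (real^'n) set) = (\<lambda>i. axis i 1) ` UNIV" by (auto simp: Basis_vec_def)
  have B: "(Basis :: ((real^'n) \<times> real) set) = (\<lambda>i. (axis i 1, 0)) ` UNIV \<union> {(0, 1)}"
    unfolding Basis_prod_def v by auto
  have inj: "inj (\<lambda>i::'n. (axis i (1::real), 0::real))" by (auto simp: inj_on_def axis_eq_axis)
  show ?thesis unfolding B
    by (subst sum.union_disjoint) (auto simp: sum.reindex[OF inj])
qed

lemma ln_le_2_sqrt: "s > 0 \<Longrightarrow> ln s \<le> 2 * sqrt s" for s :: real
proof -
  assume s: "s > 0"
  have "ln s = 2 * ln (sqrt s)" using s by (simp add: ln_sqrt)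
  also have "\<dots> \<le> 2 * (sqrt s - 1)" using s by (intro mult_left_mono ln_le_minus_one) auto
  finally show ?thesis by simp
qed

text \<open>The natural bound is c ln (y / t); the weaker square root is used because it can be
  integrated down to 0 with an elementary primitive.\<close>

lemma log_growth_bound:
  fixes \<theta> :: "real \<Rightarrow> real"
  assumes d: "\<And>t. 0 < t \<Longrightarrow> t \<le> y \<Longrightarrow> (\<theta> has_real_derivative \<theta>' t) (at t)"
    and b: "\<And>t. 0 < t \<Longrightarrow> t \<le> y \<Longrightarrow> \<bar>\<theta>' t\<bar> \<le> c / t"
    and t: "0 < t" "t \<le> y"
  shows "\<bar>\<theta> y - \<theta> t\<bar> \<le> 2 * c * sqrt (y / t)"
proof -
  have "0 \<le> c / t" using b[OF t] by linarith
  then have c: "c \<ge> 0" using t by (simp add: zero_le_divide_iff)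
  have 1: "s * \<theta> y - c * ln y \<le> s * \<theta> t - c * ln t" if s: "\<bar>s\<bar> = 1" for s
  proof (rule DERIV_nonpos_imp_nonincreasing[OF t(2)])
    fix u assume u: "t \<le> u" "u \<le> y"
    have "((\<lambda>u. s * \<theta> u - c * ln u) has_real_derivative s * \<theta>' u - c * (1 / u)) (at u)"
      using u t by (auto intro!: derivative_eq_intros d)
    moreover have "s * \<theta>' u \<le> c / u"
    proof -
      have "s * \<theta>' u \<le> \<bar>s * \<theta>' u\<bar>" by simp
      also have "\<dots> = \<bar>\<theta>' u\<bar>" using s by (simp add: abs_mult)
      also have "\<dots> \<le> c / u" using b[of u] u t by simp
      finally show ?thesis .
    qed
    ultimately show "\<exists>z. ((\<lambda>u. s * \<theta> u - c * ln u) has_real_derivative z) (at u) \<and> z \<le> 0"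
      by (intro exI conjI) (assumption, simp)
  qed
  have "\<bar>\<theta> y - \<theta> t\<bar> \<le> c * (ln y - ln t)" using 1[of 1] 1[of "-1"] by (simp add: abs_le_iff algebra_simps)
  also have "ln y - ln t = ln (y / t)" using t by (simp add: ln_div)
  also have "c * ln (y / t) \<le> c * (2 * sqrt (y / t))" using c t by (intro mult_left_mono ln_le_2_sqrt) auto
  finally show ?thesis by simp
qed

text \<open>Two integrations from the top: the bound c / t on the second derivative lets the first
  derivative grow at most like \<open>sqrt (y / t)\<close>, which is integrable at 0, so the
  increment down to the boundary is still of order y.\<close>

lemma boundary_increment_bound:
  fixes \<theta> :: "real \<Rightarrow> real"
  assumes d: "\<And>t. 0 < t \<Longrightarrow> t \<le> y \<Longrightarrow> (\<theta> has_real_derivative \<theta>' t) (at t)"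
    and d2: "\<And>t. 0 < t \<Longrightarrow> t \<le> y \<Longrightarrow> (\<theta>' has_real_derivative \<theta>'' t) (at t)"
    and b: "\<And>t. 0 < t \<Longrightarrow> t \<le> y \<Longrightarrow> \<bar>\<theta>'' t\<bar> \<le> c / t"
    and a: "\<bar>\<theta>' y\<bar> \<le> a" and t: "0 < t" "t \<le> y"
  shows "\<bar>\<theta> y - \<theta> t\<bar> \<le> (a + 4 * c) * y"
proof -
  have y: "y > 0" using t by linarith
  have "0 \<le> c / y" using b[of y] y by linarith
  then have c: "c \<ge> 0" using y by (simp add: zero_le_divide_iff)
  have a0: "a \<ge> 0" using a by linarith
  have 1: "\<bar>\<theta>' u\<bar> \<le> a + 2 * c * sqrt (y / u)" if "0 < u" "u \<le> y" for u
    using log_growth_bound[OF d2 b that] a by linarith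
  have 2: "s * \<theta> y - (a * y + 4 * c * sqrt y * sqrt y) \<le> s * \<theta> t - (a * t + 4 * c * sqrt y * sqrt t)" if s: "\<bar>s\<bar> = 1" for s
  proof (rule DERIV_nonpos_imp_nonincreasing[OF t(2)])
    fix u assume u: "t \<le> u" "u \<le> y"
    have "((\<lambda>u. s * \<theta> u - (a * u + 4 * c * sqrt y * sqrt u)) has_real_derivative s * \<theta>' u - (a + 4 * c * sqrt y * (inverse (sqrt u) / 2))) (at u)"
      using u t by (auto intro!: derivative_eq_intros d)
    moreover have "4 * c * sqrt y * (inverse (sqrt u) / 2) = 2 * c * sqrt (y / u)"
      by (simp add: real_sqrt_divide field_simps)
    moreover have "s * \<theta>' u \<le> \<bar>\<theta>' u\<bar>" using s by (metis abs_ge_self abs_mult mult_1)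
    ultimately show "\<exists>z. ((\<lambda>u. s * \<theta> u - (a * u + 4 * c * sqrt y * sqrt u)) has_real_derivative z) (at u) \<and> z \<le> 0"
      using 1[of u] u t by (intro exI conjI) (assumption, linarith)
  qed
  have nn: "a * t + 4 * c * sqrt y * sqrt t \<ge> 0" using a0 c t y by simp
  have "\<bar>\<theta> y - \<theta> t\<bar> \<le> a * y + 4 * c * sqrt y * sqrt y" using 2[of 1] 2[of "-1"] nn by (simp add: abs_le_iff)
  also have "4 * c * sqrt y * sqrt y = 4 * c * y" using y by (simp add: mult.assoc)
  finally show ?thesis by (simp add: algebra_simps)
qed

context bounded_continuous begin

text \<open>After the substitution z = x - y u the kernel no longer depends on y and has integral 1;
  dominated convergence then uses continuity of f at x and the bound B.\<close>

lemma poisson_boundary_limit: "((\<lambda>y. F (x, y)) \<longlongrightarrow> f x) (at_right 0)"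
  unfolding tendsto_at_iff_sequentially comp_def
proof (intro allI impI)
  fix Y :: "nat \<Rightarrow> real" assume Y: "\<forall>i. Y i \<in> {0<..} - {0}" "Y \<longlonglongrightarrow> 0"
  then have Yp: "Y i > 0" for i by auto
  define k where "k = (\<lambda>u::real^'n. poisson_kernel (u, 1::real))"
  have eq: "F (x, y) = (LINT u|lborel. k u * f (x + (- y) *\<^sub>R u))"
    and int: "integrable lborel (\<lambda>u. k u * f (x + (- y) *\<^sub>R u))" if y: "y > 0" for y
  proof -
    have i: "integrable lborel (\<lambda>z. poisson_kernel ((x, y) - (z, 0)) * f z)"
      by (rule poisson_kernel_integrable) (use y in simp)
    have e: "poisson_kernel ((x, y) - (x + (- y) *\<^sub>R u, 0)) * y ^ CARD('n) = k u" for u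
    proof -
      have "(x, y) - (x + (- y) *\<^sub>R u, 0) = y *\<^sub>R (u, 1::real)" by simp
      then show ?thesis using poisson_kernel_scale[OF y, of "(u, 1)"] by (simp add: k_def)
    qed
    have "F (x, y) = y ^ CARD('n) * (LINT u|lborel. poisson_kernel ((x, y) - (x + (- y) *\<^sub>R u, 0)) * f (x + (- y) *\<^sub>R u))"
      unfolding poisson_extension_conv conv_kernel_def
      by (subst lborel_integral_affine(2)[OF _ i, of "-y" x]) (use y in auto)
    also have "\<dots> = (LINT u|lborel. (poisson_kernel ((x, y) - (x + (- y) *\<^sub>R u, 0)) * y ^ CARD('n)) * f (x + (- y) *\<^sub>R u))"
      by (subst integral_mult_right_zero[symmetric]) (simp add: mult_ac)
    finally show "F (x, y) = (LINT u|lborel. k u * f (x + (- y) *\<^sub>R u))" unfolding e .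
    have "integrable lborel (\<lambda>u. y ^ CARD('n) * (poisson_kernel ((x, y) - (x + (- y) *\<^sub>R u, 0)) * f (x + (- y) *\<^sub>R u)))"
      by (intro integrable_mult_right lborel_integral_affine(1)[OF _ i]) (use y in auto)
    then have "integrable lborel (\<lambda>u. (poisson_kernel ((x, y) - (x + (- y) *\<^sub>R u, 0)) * y ^ CARD('n)) * f (x + (- y) *\<^sub>R u))"
      by (simp add: mult_ac)
    then show "integrable lborel (\<lambda>u. k u * f (x + (- y) *\<^sub>R u))" unfolding e .
  qed
  interpret one: bounded_continuous "\<lambda>_::real^'n. 1::real" 1 by unfold_locales auto
  have refl: "poisson_kernel ((0, 1) - (z, 0)) = k z" for z :: "real^'n"
    using poisson_kernel_reflect[of "(z, 1)"] by (simp add: reflect_def k_def)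
  have ik: "integrable lborel k" using one.poisson_kernel_integrable[of "(0,1)"] unfolding refl by simp
  have k1: "(LINT u|lborel. k u) = 1"
    using conv_poisson_kernel_one[of "(0::real^'n,1)"] unfolding conv_kernel_def refl by simp
  have "(\<lambda>i. LINT u|lborel. k u * f (x + (- Y i) *\<^sub>R u)) \<longlonglongrightarrow> (LINT u|lborel. k u * f x)"
  proof (rule integral_dominated_convergence)
    show "integrable lborel (\<lambda>u. B * \<bar>k u\<bar>)" using ik by simp
    show "(\<lambda>u. k u * f x) \<in> borel_measurable lborel" using ik by auto
    show "(\<lambda>u. k u * f (x + (- Y i) *\<^sub>R u)) \<in> borel_measurable lborel" for i using int[OF Yp] by auto
    show "AE u in lborel. norm (k u * f (x + (- Y i) *\<^sub>R u)) \<le> B * \<bar>k u\<bar>" for i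
      using mult_left_mono[OF bdd abs_ge_zero[of "k _"]] by (intro AE_I2) (simp add: abs_mult mult.commute[of B])
    show "AE u in lborel. (\<lambda>i. k u * f (x + (- Y i) *\<^sub>R u)) \<longlonglongrightarrow> k u * f x"
    proof (rule AE_I2, rule tendsto_mult_left)
      fix u
      have "(\<lambda>i. x + (- Y i) *\<^sub>R u) \<longlonglongrightarrow> x + (- 0) *\<^sub>R u" by (intro tendsto_intros Y(2))
      then show "(\<lambda>i. f (x + (- Y i) *\<^sub>R u)) \<longlonglongrightarrow> f x"
        using continuous_on_tendsto_compose[OF cont, of _ x] by simp
    qed
  qed
  then show "(\<lambda>i. F (x, Y i)) \<longlonglongrightarrow> f x" using eq[OF Yp] k1 by simp
qed

definition grad :: "(real^'n) \<times> real \<Rightarrow> real^'n" where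
  "grad p = (\<chi> i. partial (axis i 1, 0) F p)"

text \<open>\<kappa> is the constant of the overview, valid up to height l. Entries in the standard
  basis suffice, as other directions are expanded by \<open>F_expand\<close>.\<close>

definition hess_le :: "real \<Rightarrow> real \<Rightarrow> bool" where
  "hess_le \<kappa> l \<longleftrightarrow> (\<forall>x y b c. 0 < y \<longrightarrow> y \<le> l \<longrightarrow> b \<in> Basis \<longrightarrow> c \<in> Basis \<longrightarrow> \<bar>partial b (partial c F) (x, y)\<bar> \<le> \<kappa> / y)"

lemma hess_leD: "hess_le \<kappa> l \<Longrightarrow> 0 < y \<Longrightarrow> y \<le> l \<Longrightarrow> b \<in> Basis \<Longrightarrow> c \<in> Basis \<Longrightarrow> \<bar>partial b (partial c F) (x, y)\<bar> \<le> \<kappa> / y"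
  unfolding hess_le_def by blast

lemma hess_le_nonneg: "hess_le \<kappa> l \<Longrightarrow> l > 0 \<Longrightarrow> \<kappa> \<ge> 0"
  using hess_leD[of \<kappa> l l "(0,1)" "(0,1)" 0] by (auto simp: Basis_prod_def zero_le_divide_iff dest: order_trans[OF abs_ge_zero])

lemma hess_dir_bound:
  assumes h: "hess_le \<kappa> l" and y: "0 < y" "y \<le> l" and c: "c \<in> Basis"
  shows "\<bar>partial b (partial c F) (x, y)\<bar> \<le> (real CARD('n) + 1) * norm b * \<kappa> / y"
proof -
  have "\<bar>partial b (partial c F) (x, y)\<bar> = \<bar>\<Sum>a\<in>Basis. (b \<bullet> a) * partial a (partial c F) (x, y)\<bar>"
    using F_expand(2)[of "(x,y)" b c] y by simp
  also have "\<dots> \<le> (\<Sum>a\<in>(Basis :: ((real^'n) \<times> real) set). norm b * (\<kappa> / y))"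
  proof (rule order_trans[OF sum_abs sum_mono])
    fix a :: "(real^'n) \<times> real" assume a: "a \<in> Basis"
    show "\<bar>(b \<bullet> a) * partial a (partial c F) (x, y)\<bar> \<le> norm b * (\<kappa> / y)"
      unfolding abs_mult by (intro mult_mono hess_leD[OF h y a c] Basis_le_norm[OF a]) auto
  qed
  finally show ?thesis by (simp add: add.commute)
qed

lemma partial_F_horizontal_diff:
  assumes h: "hess_le \<kappa> l" and y: "0 < y" "y \<le> l" and c: "c \<in> Basis"
  shows "\<bar>partial c F (x + h, y) - partial c F (x, y)\<bar> \<le> (real CARD('n) + 1) * norm h * \<kappa> / y"
proof -
  have sh: "(x, y) + t *\<^sub>R (h, 0) = (x + t *\<^sub>R h, y)" for t by simp
  have "norm (partial c F ((x, y) + 1 *\<^sub>R (h, 0)) - partial c F ((x, y) + 0 *\<^sub>R (h, 0))) \<le> ((real CARD('n) + 1) * norm h * \<kappa> / y) * norm (1 - 0 :: real)"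
  proof (rule field_differentiable_bound[where S=UNIV and f'="\<lambda>t. partial (h,0) (partial c F) ((x, y) + t *\<^sub>R (h, 0))"])
    show "((\<lambda>t. partial c F ((x, y) + t *\<^sub>R (h, 0))) has_field_derivative partial (h, 0) (partial c F) ((x, y) + t *\<^sub>R (h, 0))) (at t)" for t
      by (rule has_derivative_along[OF F2(2)]) (use y in \<open>simp_all add: algebra_simps\<close>)
    show "norm (partial (h, 0) (partial c F) ((x, y) + t *\<^sub>R (h, 0))) \<le> (real CARD('n) + 1) * norm h * \<kappa> / y" for t :: real
      using hess_dir_bound[OF h y c, of "(h,0)"] unfolding sh by simp
  qed auto
  then show ?thesis by simp
qed

lemma partial_F_vertical_diff:
  assumes h: "hess_le \<kappa> l" and t: "0 < t" "t \<le> y" "y \<le> l" and c: "c \<in> Basis"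
  shows "\<bar>partial c F (x, y) - partial c F (x, t)\<bar> \<le> 2 * \<kappa> * sqrt (y / t)"
proof (rule log_growth_bound[OF _ _ t(1,2)])
  have sh: "(x, 0) + t *\<^sub>R (0, 1) = (x, t)" for t :: real by simp
  fix u assume u: "0 < u" "u \<le> y"
  show "((\<lambda>u. partial c F (x, u)) has_real_derivative partial (0, 1) (partial c F) (x, u)) (at u)"
    using has_derivative_along[OF F2(2), of "(x, 0)" u "(0,1)" c] u unfolding sh by simp
  show "\<bar>partial (0, 1) (partial c F) (x, u)\<bar> \<le> \<kappa> / u"
    by (rule hess_leD[OF h]) (use u t c in \<open>auto simp: Basis_prod_def\<close>)
qed

text \<open>Compare along the rectangle of height |h| over the segment from x to x + h: along the
  top edge the gradient varies by O(\<kappa>), and the two vertical sides are treated together as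
  one function of the height.\<close>

lemma increment_approx:
  assumes h: "hess_le \<kappa> l" and hl: "h \<noteq> 0" "norm h \<le> l"
  shows "\<bar>f (x + h) - f x - grad (x, norm h) \<bullet> h\<bar> \<le> (2 * (real CARD('n) + 1)\<^sup>2 + 8) * \<kappa> * norm h"
proof -
  define D where "D = real CARD('n) + 1"
  define y where "y = norm h"
  have y: "0 < y" "y \<le> l" using hl by (auto simp: y_def)
  have k: "\<kappa> \<ge> 0" using hess_le_nonneg[OF h] y by linarith
  have D1: "D \<ge> 1" by (simp add: D_def)
  have e1: "(0, 1) \<in> (Basis :: ((real^'n) \<times> real) set)" by (simp add: Basis_prod_def)
  have sh: "(x, y) + t *\<^sub>R (h, 0) = (x + t *\<^sub>R h, y)" for t by simp
  have gr: "partial (h, 0) F (u, y) = grad (u, y) \<bullet> h" for u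
  proof -
    have "partial (h, 0) F (u, y) = (\<Sum>a\<in>Basis. ((h, 0) \<bullet> a) * partial a F (u, y))"
      using F_expand(1)[of "(u,y)" "(h,0)"] y by simp
    also have "\<dots> = (\<Sum>i\<in>UNIV. h $ i * partial (axis i 1, 0) F (u, y))"
      unfolding sum_Basis_half_space by (simp add: inner_axis)
    finally show ?thesis by (simp add: grad_def inner_vec_def mult.commute)
  qed
  define dF where "dF = (\<lambda>t. partial (h,0) F ((x, y) + t *\<^sub>R (h, 0)))"
  have osc: "\<bar>dF t - dF 0\<bar> \<le> D\<^sup>2 * \<kappa> * y" if t: "0 \<le> t" "t \<le> 1" for t
  proof -
    have "dF t - dF 0 = (\<Sum>a\<in>Basis. ((h, 0) \<bullet> a) * (partial a F (x + t *\<^sub>R h, y) - partial a F (x, y)))"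
      unfolding dF_def sh using F_expand(1)[of "(x + t *\<^sub>R h,y)" "(h,0)"] F_expand(1)[of "(x,y)" "(h,0)"] y
      by (simp add: sum_subtractf algebra_simps)
    also have "\<bar>\<dots>\<bar> \<le> (\<Sum>a\<in>(Basis :: ((real^'n) \<times> real) set). y * (D * y * \<kappa> / y))"
    proof (rule order_trans[OF sum_abs sum_mono])
      fix a :: "(real^'n) \<times> real" assume a: "a \<in> Basis"
      have "\<bar>partial a F (x + t *\<^sub>R h, y) - partial a F (x, y)\<bar> \<le> D * norm (t *\<^sub>R h) * \<kappa> / y"
        unfolding D_def by (rule partial_F_horizontal_diff[OF h y a])
      also have "\<dots> \<le> D * y * \<kappa> / y"
        using t k D1 y by (intro divide_right_mono mult_right_mono mult_left_mono) (auto simp: y_def mult_left_le_one_le)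
      finally have 1: "\<bar>partial a F (x + t *\<^sub>R h, y) - partial a F (x, y)\<bar> \<le> D * y * \<kappa> / y" .
      have 2: "\<bar>(h, 0) \<bullet> a\<bar> \<le> y" using Basis_le_norm[OF a, of "(h, 0)"] by (simp add: y_def)
      show "\<bar>((h, 0) \<bullet> a) * (partial a F (x + t *\<^sub>R h, y) - partial a F (x, y))\<bar> \<le> y * (D * y * \<kappa> / y)"
        unfolding abs_mult using 1 2 y by (intro mult_mono) auto
    qed
    also have "\<dots> = D\<^sup>2 * \<kappa> * y" using y by (simp add: D_def power2_eq_square)
    finally show ?thesis .
  qed
  have "norm ((F ((x, y) + 1 *\<^sub>R (h, 0)) - 1 * dF 0) - (F ((x, y) + 0 *\<^sub>R (h, 0)) - 0 * dF 0)) \<le> (D\<^sup>2 * \<kappa> * y) * norm (1 - 0 :: real)"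
  proof (rule field_differentiable_bound[where S="{0..1}" and f'="\<lambda>t. dF t - dF 0"])
    fix t :: real assume t: "t \<in> {0..1}"
    have "((\<lambda>t. F ((x, y) + t *\<^sub>R (h, 0))) has_real_derivative dF t) (at t)"
      unfolding dF_def by (rule has_derivative_along[OF F1(2)]) (use y in \<open>simp_all add: algebra_simps\<close>)
    then show "((\<lambda>t. F ((x, y) + t *\<^sub>R (h, 0)) - t * dF 0) has_field_derivative dF t - dF 0) (at t within {0..1})"
      by (auto intro!: derivative_eq_intros intro: has_field_derivative_at_within)
    show "norm (dF t - dF 0) \<le> D\<^sup>2 * \<kappa> * y" using osc t by simp
  qed auto
  then have A: "\<bar>F (x + h, y) - F (x, y) - grad (x, y) \<bullet> h\<bar> \<le> D\<^sup>2 * \<kappa> * y"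
    using gr[of x] by (simp add: dF_def)
  \<comment> \<open>The difference of the two columns is taken because the vertical derivative of F
    is not itself controlled by \<kappa>, whereas its difference between x + h and x at height |h|
    is.\<close>
  define \<theta> where "\<theta> = (\<lambda>t. F (x + h, t) - F (x, t))"
  define \<theta>' where "\<theta>' = (\<lambda>t. partial (0,1) F (x + h, t) - partial (0,1) F (x, t))"
  have V: "(u, 0) + t *\<^sub>R (0, 1) = (u, t)" for t :: real and u :: "real^'n" by simp
  have B1: "\<bar>\<theta> y - \<theta> t\<bar> \<le> (D * \<kappa> + 4 * (2 * \<kappa>)) * y" if t: "0 < t" "t \<le> y" for t
  proof (rule boundary_increment_bound[OF _ _ _ _ t])
    fix t :: real assume t: "0 < t" "t \<le> y"
    show "(\<theta> has_real_derivative \<theta>' t) (at t)"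
      unfolding \<theta>_def \<theta>'_def
      using has_derivative_along[OF F1(2), of "(x + h, 0)" t "(0,1)"] has_derivative_along[OF F1(2), of "(x, 0)" t "(0,1)"] t
      unfolding V by (intro DERIV_diff) auto
    show "(\<theta>' has_real_derivative partial (0,1) (partial (0,1) F) (x + h, t) - partial (0,1) (partial (0,1) F) (x, t)) (at t)"
      unfolding \<theta>'_def
      using has_derivative_along[OF F2(2), of "(x + h, 0)" t "(0,1)" "(0,1)"] has_derivative_along[OF F2(2), of "(x, 0)" t "(0,1)" "(0,1)"] t
      unfolding V by (intro DERIV_diff) auto
    show "\<bar>partial (0,1) (partial (0,1) F) (x + h, t) - partial (0,1) (partial (0,1) F) (x, t)\<bar> \<le> 2 * \<kappa> / t"
      using hess_leD[OF h, of t "(0,1)" "(0,1)" "x+h"] hess_leD[OF h, of t "(0,1)" "(0,1)" x] e1 t y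
      by (auto simp: add_divide_distrib[symmetric])
  next
    show "\<bar>\<theta>' y\<bar> \<le> D * \<kappa>"
      unfolding \<theta>'_def using partial_F_horizontal_diff[OF h y e1, of x h] y by (simp add: D_def y_def[symmetric])
  qed
  have lim: "((\<lambda>t. \<bar>\<theta> y - \<theta> t\<bar>) \<longlongrightarrow> \<bar>\<theta> y - (f (x + h) - f x)\<bar>) (at_right 0)"
    unfolding \<theta>_def by (intro tendsto_intros poisson_boundary_limit)
  have "\<bar>\<theta> y - (f (x + h) - f x)\<bar> \<le> (D * \<kappa> + 4 * (2 * \<kappa>)) * y"
    by (rule tendsto_upperbound[OF lim])
       (use y B1 in \<open>auto simp: eventually_at_right[of 0 y] intro!: exI[of _ y]\<close>)
  moreover have "D * \<kappa> * y \<le> D\<^sup>2 * \<kappa> * y"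
    using D1 k y by (intro mult_right_mono) (auto simp: power2_eq_square)
  ultimately have "\<bar>f (x + h) - f x - grad (x, y) \<bullet> h\<bar> \<le> (2 * D\<^sup>2 + 8) * \<kappa> * y"
    using A unfolding \<theta>_def by (simp add: algebra_simps abs_le_iff)
  then show ?thesis by (simp add: D_def y_def)
qed

end

section \<open>Green's formula over cubes\<close>

lemma mem_cube: "x \<in> cube a l \<longleftrightarrow> (\<forall>i. a $ i \<le> x $ i \<and> x $ i \<le> a $ i + l)"
  by (simp add: cube_def mem_box_cart)

lemma content_cube: "l \<ge> 0 \<Longrightarrow> measure lborel (cube (a :: real^'n) l) = l ^ CARD('n)"
  unfolding cube_def by (subst content_cbox_cart) (auto simp: interval_eq_empty_cart not_less)

lemma mem_cbox_split_coordinate: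
  "x \<in> cbox u v \<longleftrightarrow> (u $ i \<le> x $ i \<and> x $ i \<le> v $ i) \<and> (\<forall>j. j \<noteq> i \<longrightarrow> u $ j \<le> x $ j \<and> x $ j \<le> v $ j)"
  for x :: "real^'n"
  by (metis mem_box_cart)

lemma content_slab:
  fixes a :: "real^'n"
  assumes "l \<ge> 0" "\<tau> \<ge> 0"
  shows "measure lborel (cbox a (\<chi> j. if j = i then a $ i + \<tau> else a $ j + l)) = \<tau> * l ^ (CARD('n) - 1)"
proof -
  have ne: "cbox a (\<chi> j. if j = i then a $ i + \<tau> else a $ j + l) \<noteq> {}"
    using assms by (auto simp: interval_eq_empty_cart not_less)
  have "measure lborel (cbox a (\<chi> j. if j = i then a $ i + \<tau> else a $ j + l))
     = (\<Prod>j\<in>UNIV. (\<chi> j. if j = i then a $ i + \<tau> else a $ j + l) $ j - a $ j)"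
    by (rule content_cbox_cart[OF ne])
  also have "\<dots> = (\<Prod>j\<in>UNIV. if j = i then \<tau> else l)" by (intro prod.cong) auto
  also have "\<dots> = \<tau> * (\<Prod>j\<in>UNIV - {i}. if j = i then \<tau> else l)" by (subst prod.remove[of _ i]) auto
  also have "(\<Prod>j\<in>UNIV - {i}. if j = i then \<tau> else l) = (\<Prod>j\<in>UNIV - {i}. l)" by (rule prod.cong) auto
  finally show ?thesis by (simp add: card_Diff_singleton)
qed

lemma slab_integral_bound:
  fixes G :: "real^'n \<Rightarrow> real"
  assumes cont: "continuous_on UNIV G" and "l \<ge> 0" "\<tau> \<ge> 0" "M \<ge> 0"
    and M: "\<And>x. x \<in> cbox a (\<chi> j. if j = i then a $ i + \<tau> else a $ j + l) \<Longrightarrow> \<bar>G x\<bar> \<le> M"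
  shows "\<bar>integral (cbox a (\<chi> j. if j = i then a $ i + \<tau> else a $ j + l)) G\<bar> \<le> M * (\<tau> * l ^ (CARD('n) - 1))"
proof -
  have "(G has_integral integral (cbox a (\<chi> j. if j = i then a $ i + \<tau> else a $ j + l)) G) (cbox a (\<chi> j. if j = i then a $ i + \<tau> else a $ j + l))"
    by (intro integrable_integral integrable_continuous continuous_on_subset[OF cont]) auto
  from has_integral_bound[OF assms(4) this] M show ?thesis
    unfolding content_slab[OF assms(2,3)] by auto
qed

text \<open>Divergence theorem in one coordinate. The integral of G over the cube shifted by t in
  direction i has derivative the integral of G' at t = 0; on the other hand the shifted and the
  original cube differ in two slabs of thickness t, each contributing at most M t l^(d-1). The range
  2l in the bound by M leaves room for the shifts.\<close>

lemma integral_axis_derivative_bound: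
  fixes G :: "real^'n \<Rightarrow> real"
  assumes d: "\<And>x. ((\<lambda>t. G (x + t *\<^sub>R axis i 1)) has_real_derivative G' x) (at 0)"
    and cG: "continuous_on UNIV G" and cont: "continuous_on UNIV G'" and l: "l > 0"
    and M: "M \<ge> 0" "\<And>x. (\<And>j. a $ j \<le> x $ j \<and> x $ j \<le> a $ j + 2 * l) \<Longrightarrow> \<bar>G x\<bar> \<le> M"
  shows "\<bar>integral (cube a l) G'\<bar> \<le> 2 * l ^ (CARD('n) - 1) * M"
proof -
  define e where "e = (axis i 1 :: real^'n)"
  have eB: "e \<in> Basis" by (auto simp: e_def Basis_vec_def)
  have inn: "x \<bullet> e = x $ i" for x by (simp add: e_def inner_axis)
  define b where "b = a + (\<chi> i. l)"
  have Q: "cube a l = cbox a b" by (simp add: cube_def b_def)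
  define H where "H = (\<lambda>t. integral (cbox a b) (\<lambda>x. G (x + t *\<^sub>R e)))"
  have sh: "((\<lambda>s. G (x + s *\<^sub>R e)) has_real_derivative G' (x + t *\<^sub>R e)) (at t)" for x t
  proof -
    have "((\<lambda>s. G (x + (t + s) *\<^sub>R e)) has_real_derivative G' (x + t *\<^sub>R e)) (at 0)"
      using d[of "x + t *\<^sub>R e"] by (simp add: e_def algebra_simps)
    then show ?thesis using DERIV_at_within_shift[of "\<lambda>s. G (x + s *\<^sub>R e)" _ t 0 UNIV] by simp
  qed
  have "(H has_field_derivative integral (cbox a b) (\<lambda>x. G' (x + 0 *\<^sub>R e))) (at 0 within UNIV)"
    unfolding H_def
  proof (rule leibniz_rule_field_derivative)
    show "(\<lambda>x. G (x + t *\<^sub>R e)) integrable_on cbox a b" for t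
      by (intro integrable_continuous continuous_on_compose2[OF cG] continuous_intros) auto
    show "continuous_on (UNIV \<times> cbox a b) (\<lambda>(t, x). G' (x + t *\<^sub>R e))"
      unfolding split_beta by (intro continuous_on_compose2[OF cont] continuous_intros) auto
  qed (use sh in auto)
  then have dH: "((\<lambda>t. (H t - H 0) / t) \<longlongrightarrow> integral (cube a l) G') (at 0)"
    unfolding DERIV_def Q by simp
  have bound: "\<bar>(H t - H 0) / t\<bar> \<le> 2 * l ^ (CARD('n) - 1) * M" if t: "0 < t" "t \<le> l" for t
  proof -
    have iG: "G integrable_on cbox u v" for u v
      by (intro integrable_continuous continuous_on_subset[OF cG]) auto
    have "((\<lambda>x. G (1 *\<^sub>R x + t *\<^sub>R e)) has_integral (1 / (\<bar>1\<bar> ^ DIM(real^'n))) *\<^sub>R integral (cbox (t *\<^sub>R e + a) (t *\<^sub>R e + b)) G)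
       ((\<lambda>x. (1 / 1) *\<^sub>R x + -((1 / 1) *\<^sub>R (t *\<^sub>R e))) ` cbox (t *\<^sub>R e + a) (t *\<^sub>R e + b))"
      by (rule has_integral_affinity) (use iG in \<open>auto intro: integrable_integral\<close>)
    moreover have "(\<lambda>x. (1 / 1) *\<^sub>R x + -((1 / 1) *\<^sub>R (t *\<^sub>R e))) ` cbox (t *\<^sub>R e + a) (t *\<^sub>R e + b) = cbox a b"
      unfolding cbox_translation by (simp add: image_image)
    ultimately have "((\<lambda>x. G (x + t *\<^sub>R e)) has_integral integral (cbox (t *\<^sub>R e + a) (t *\<^sub>R e + b)) G) (cbox a b)"
      by simp
    then have Ht: "H t = integral (cbox (t *\<^sub>R e + a) (t *\<^sub>R e + b)) G" unfolding H_def by (rule integral_unique)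
    have H0: "H 0 = integral (cbox a b) G" by (simp add: H_def)
    \<comment> \<open>\<open>L1\<close> is the slab lost at the near face, \<open>L2\<close> the
      slab gained at the far face; \<open>s3\<close> says that the remaining parts coincide.\<close>
    define L1 where "L1 = cbox a (\<chi> j. if j = i then a $ i + t else a $ j + l)"
    define a2 where "a2 = (\<chi> j. if j = i then a $ i + l else a $ j)"
    define L2 where "L2 = cbox a2 (\<chi> j. if j = i then a2 $ i + t else a2 $ j + l)"
    have ax: "axis i (1::real) $ i = 1" "j \<noteq> i \<Longrightarrow> axis i (1::real) $ j = 0" for j
      by (simp_all add: axis_def)
    have s1: "cbox a b \<inter> {x. x \<bullet> e \<le> a $ i + t} = L1"
      unfolding L1_def b_def inn using t by (auto simp: mem_cbox_split_coordinate[where i=i])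
    have s2: "cbox (t *\<^sub>R e + a) (t *\<^sub>R e + b) \<inter> {x. x \<bullet> e \<ge> a $ i + l} = L2"
      unfolding L2_def a2_def b_def inn unfolding e_def using t
      by (auto simp: mem_cbox_split_coordinate[where i=i] ax)
    have s3: "cbox (t *\<^sub>R e + a) (t *\<^sub>R e + b) \<inter> {x. x \<bullet> e \<le> a $ i + l} = cbox a b \<inter> {x. x \<bullet> e \<ge> a $ i + t}"
      unfolding b_def inn unfolding e_def using t
      by (auto simp: mem_cbox_split_coordinate[where i=i] ax)
    have "H t - H 0 = integral L2 G - integral L1 G"
      unfolding Ht H0 using integral_split[OF iG eB, of a b "a $ i + t"]
        integral_split[OF iG eB, of "t *\<^sub>R e + a" "t *\<^sub>R e + b" "a $ i + l"] unfolding s1 s2 s3 by simp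
    moreover have "\<bar>integral L1 G\<bar> \<le> M * (t * l ^ (CARD('n) - 1))"
      unfolding L1_def
    proof (rule slab_integral_bound[OF cG])
      fix x assume x: "x \<in> cbox a (\<chi> j. if j = i then a $ i + t else a $ j + l)"
      show "\<bar>G x\<bar> \<le> M"
      proof (rule M(2))
        fix j show "a $ j \<le> x $ j \<and> x $ j \<le> a $ j + 2 * l"
          using x t l unfolding mem_box_cart by (auto dest!: spec[of _ j] split: if_splits)
      qed
    qed (use t l M in auto)
    moreover have "\<bar>integral L2 G\<bar> \<le> M * (t * l ^ (CARD('n) - 1))"
      unfolding L2_def
    proof (rule slab_integral_bound[OF cG])
      fix x assume x: "x \<in> cbox a2 (\<chi> j. if j = i then a2 $ i + t else a2 $ j + l)"
      show "\<bar>G x\<bar> \<le> M"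
      proof (rule M(2))
        fix j show "a $ j \<le> x $ j \<and> x $ j \<le> a $ j + 2 * l"
          using x t l unfolding mem_box_cart a2_def by (auto dest!: spec[of _ j] split: if_splits)
      qed
    qed (use t l M in auto)
    ultimately have "\<bar>H t - H 0\<bar> \<le> t * (2 * l ^ (CARD('n) - 1) * M)" by (simp add: algebra_simps)
    then show ?thesis using t by (simp add: field_simps)
  qed
  have "((\<lambda>t. (H t - H 0) / t) \<longlongrightarrow> integral (cube a l) G') (at_right 0)"
    using dH by (rule filterlim_mono) (auto simp: at_within_le_at intro: at_le)
  then have "((\<lambda>t. \<bar>(H t - H 0) / t\<bar>) \<longlongrightarrow> \<bar>integral (cube a l) G'\<bar>) (at_right 0)"
    by (rule tendsto_rabs)
  then show ?thesis
    by (rule tendsto_upperbound) (use l bound in \<open>auto simp: eventually_at_right[of 0 l] intro!: exI[of _ l]\<close>)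
qed

text \<open>An elementary form of harmonicity, with pure second derivatives in basis directions
  only: just what Green's formula over boxes uses.\<close>

definition harmonic_half :: "((real^'n) \<times> real \<Rightarrow> real) \<Rightarrow> bool" where
  "harmonic_half w \<longleftrightarrow>
    (\<forall>p b. snd p > 0 \<longrightarrow> b \<in> Basis \<longrightarrow>
       ((\<lambda>t. w (p + t *\<^sub>R b)) has_real_derivative partial b w p) (at 0) \<and>
       ((\<lambda>t. partial b w (p + t *\<^sub>R b)) has_real_derivative partial b (partial b w) p) (at 0)) \<and>
    continuous_on {p. snd p > 0} w \<and>
    (\<forall>b\<in>Basis. continuous_on {p. snd p > 0} (partial b w) \<and> continuous_on {p. snd p > 0} (partial b (partial b w))) \<and>
    (\<forall>p. snd p > 0 \<longrightarrow> (\<Sum>b\<in>Basis. partial b (partial b w) p) = 0)"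

lemma continuous_slice:
  assumes "continuous_on {p::(real^'n) \<times> real. snd p > 0} g" "t > 0"
  shows "continuous_on S (\<lambda>x. g (x, t))"
  by (rule continuous_on_compose2[OF assms(1)]) (use assms(2) in \<open>auto intro!: continuous_intros\<close>)

lemma slice_integral_derivative:
  fixes g :: "(real^'n) \<times> real \<Rightarrow> real"
  assumes d: "\<And>p. snd p > 0 \<Longrightarrow> ((\<lambda>t. g (p + t *\<^sub>R (0, 1))) has_real_derivative g' p) (at 0)"
    and c: "continuous_on {p. snd p > 0} g" "continuous_on {p. snd p > 0} g'" and t: "t > 0"
  shows "((\<lambda>t. integral (cube a l) (\<lambda>x. g (x, t))) has_real_derivative integral (cube a l) (\<lambda>x. g' (x, t))) (at t)"
proof -
  have V: "(x, 0) + s *\<^sub>R (0, 1) = (x, s)" for x :: "real^'n" and s :: real by simp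
  have "((\<lambda>t. integral (cube a l) (\<lambda>x. g (x, t))) has_real_derivative integral (cube a l) (\<lambda>x. g' (x, t))) (at t within {0<..})"
    unfolding cube_def
  proof (rule leibniz_rule_field_derivative)
    fix s x assume s: "s \<in> {0::real<..}"
    have "((\<lambda>t. g ((x, 0) + t *\<^sub>R (0, 1))) has_real_derivative g' ((x, 0) + s *\<^sub>R (0, 1))) (at s)"
      by (rule has_derivative_along[OF d]) (use s in auto)
    then show "((\<lambda>t. g (x, t)) has_field_derivative g' (x, s)) (at s within {0<..})"
      unfolding V by (rule has_field_derivative_at_within)
  next
    fix s assume "s \<in> {0::real<..}"
    then show "(\<lambda>x. g (x, s)) integrable_on cbox a (a + (\<chi> i. l))"
      by (intro integrable_continuous continuous_slice[OF c(1)]) auto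
  next
    show "continuous_on ({0<..} \<times> cbox a (a + (\<chi> i. l))) (\<lambda>(t, x). g' (x, t))"
      unfolding split_beta by (rule continuous_on_compose2[OF c(2)]) (auto intro!: continuous_intros)
  qed (use t in auto)
  then show ?thesis using t by (simp add: at_within_open[of t "{0<..}"])
qed

text \<open>The comparison function a t + 2 c sqrt(l) sqrt(t) has derivative a + c sqrt(l / t); the
  sign s treats both directions at once.\<close>

lemma sqrt_growth_bound:
  fixes \<theta> :: "real \<Rightarrow> real"
  assumes d: "\<And>t. h \<le> t \<Longrightarrow> t \<le> l \<Longrightarrow> (\<theta> has_real_derivative \<theta>' t) (at t)"
    and b: "\<And>t. h \<le> t \<Longrightarrow> t \<le> l \<Longrightarrow> \<bar>\<theta>' t\<bar> \<le> a + c * sqrt (l / t)"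
    and h: "0 < h" "h \<le> l" and ac: "a \<ge> 0" "c \<ge> 0"
  shows "\<bar>\<theta> l - \<theta> h\<bar> \<le> (a + 2 * c) * l"
proof -
  have l: "l > 0" using h by linarith
  have 2: "s * \<theta> l - (a * l + 2 * c * sqrt l * sqrt l) \<le> s * \<theta> h - (a * h + 2 * c * sqrt l * sqrt h)" if s: "\<bar>s\<bar> = 1" for s
  proof (rule DERIV_nonpos_imp_nonincreasing[OF h(2)])
    fix u assume u: "h \<le> u" "u \<le> l"
    have "((\<lambda>u. s * \<theta> u - (a * u + 2 * c * sqrt l * sqrt u)) has_real_derivative s * \<theta>' u - (a + 2 * c * sqrt l * (inverse (sqrt u) / 2))) (at u)"
      using u h by (auto intro!: derivative_eq_intros d)
    moreover have "2 * c * sqrt l * (inverse (sqrt u) / 2) = c * sqrt (l / u)"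
      by (simp add: real_sqrt_divide field_simps)
    moreover have "s * \<theta>' u \<le> \<bar>\<theta>' u\<bar>" using s by (metis abs_ge_self abs_mult mult_1)
    ultimately show "\<exists>z. ((\<lambda>u. s * \<theta> u - (a * u + 2 * c * sqrt l * sqrt u)) has_real_derivative z) (at u) \<and> z \<le> 0"
      using b[of u] u by (intro exI conjI) (assumption, linarith)
  qed
  have nn: "a * h + 2 * c * sqrt l * sqrt h \<ge> 0" using ac h l by simp
  have "\<bar>\<theta> l - \<theta> h\<bar> \<le> a * l + 2 * c * sqrt l * sqrt l" using 2[of 1] 2[of "-1"] nn by (simp add: abs_le_iff)
  also have "2 * c * sqrt l * sqrt l = 2 * c * l" using l by (simp add: mult.assoc)
  finally show ?thesis by (simp add: algebra_simps)
qed

text \<open>2 |grad w|^2 is the Laplacian of w^2 and \<open>snd p\<close> is the weight y of Green's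
  formula: this is the volume term for w^2 over the cube, between the heights h and t.\<close>

definition energy :: "((real^'n) \<times> real \<Rightarrow> real) \<Rightarrow> real^'n \<Rightarrow> real \<Rightarrow> real \<Rightarrow> real \<Rightarrow> real" where
  "energy w a l h t = integral (cbox (a, h) (a + (\<chi> i. l), t)) (\<lambda>p. 2 * snd p * (\<Sum>b\<in>Basis. (partial b w p)\<^sup>2))"

text \<open>W bounds w up to logarithmic growth towards the boundary, written as
  \<open>sqrt (l / t)\<close>; it refers to the doubled cube because lateral fluxes are estimated on
  shifted cubes. \<mu> is the deviation on the top face from the corner value, which lets that value
  stand for the average.\<close>

locale half_space_cube =
  fixes w :: "(real^'n) \<times> real \<Rightarrow> real" and a :: "real^'n" and l h \<kappa> W \<mu> :: real
  assumes harm: "harmonic_half w" and h: "0 < h" "h \<le> l"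
    and kap: "\<kappa> \<ge> 0" "\<And>x t b. 0 < t \<Longrightarrow> t \<le> l \<Longrightarrow> b \<in> Basis \<Longrightarrow> \<bar>partial b w (x, t)\<bar> \<le> \<kappa> / t"
    and W: "W \<ge> 0" "\<And>x t. (\<And>j. a $ j \<le> x $ j \<and> x $ j \<le> a $ j + 2 * l) \<Longrightarrow> 0 < t \<Longrightarrow> t \<le> l \<Longrightarrow> \<bar>w (x, t)\<bar> \<le> W + 2 * \<kappa> * sqrt (l / t)"
    and mu: "\<And>x. x \<in> cube a l \<Longrightarrow> \<bar>w (x, l) - w (a, l)\<bar> \<le> \<mu>"
begin

lemma l_pos: "l > 0" using h by linarith

lemma w_deriv:
  assumes "snd p > 0" "b \<in> Basis"
  shows "((\<lambda>t. w (p + t *\<^sub>R b)) has_real_derivative partial b w p) (at 0)"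
    "((\<lambda>t. partial b w (p + t *\<^sub>R b)) has_real_derivative partial b (partial b w) p) (at 0)"
  using harm assms unfolding harmonic_half_def by blast+

lemma w_cont: "continuous_on {p. snd p > 0} w"
  "b \<in> Basis \<Longrightarrow> continuous_on {p. snd p > 0} (partial b w)"
  "b \<in> Basis \<Longrightarrow> continuous_on {p. snd p > 0} (partial b (partial b w))"
  using harm unfolding harmonic_half_def by blast+

lemma eyB: "(0, 1) \<in> (Basis :: ((real^'n) \<times> real) set)" by (simp add: Basis_prod_def)

lemma axB: "(axis i 1, 0) \<in> (Basis :: ((real^'n) \<times> real) set)"
  by (auto simp: Basis_prod_def Basis_vec_def)

lemma laplace: "snd p > 0 \<Longrightarrow> partial (0,1) (partial (0,1) w) p = - (\<Sum>i\<in>UNIV. partial (axis i 1, 0) (partial (axis i 1, 0) w) p)"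
proof -
  assume "snd p > 0"
  then have "(\<Sum>b\<in>Basis. partial b (partial b w) p) = 0" using harm unfolding harmonic_half_def by blast
  then show ?thesis unfolding sum_Basis_half_space by linarith
qed

lemma horizontal_shift: "(x + s *\<^sub>R axis i 1, t) = (x, t) + s *\<^sub>R (axis i 1, 0)" for x :: "real^'n" and t :: real
  by simp

text \<open>The flux density is 2 t w times a horizontal derivative of size \<kappa> / t, so the
  factor t cancels.\<close>

lemma lateral_flux_quadratic:
  assumes t: "h \<le> t" "t \<le> l"
  shows "\<bar>integral (cube a l) (\<lambda>x. 2 * t * ((partial (axis i 1, 0) w (x, t))\<^sup>2 + w (x, t) * partial (axis i 1, 0) (partial (axis i 1, 0) w) (x, t)))\<bar>
     \<le> 2 * l ^ (CARD('n) - 1) * (2 * \<kappa> * (W + 2 * \<kappa> * sqrt (l / t)))"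
proof (rule integral_axis_derivative_bound[where G="\<lambda>x. 2 * t * (w (x, t) * partial (axis i 1, 0) w (x, t))" and i=i])
  have t0: "t > 0" using t h by linarith
  show "((\<lambda>s. 2 * t * (w (x + s *\<^sub>R axis i 1, t) * partial (axis i 1, 0) w (x + s *\<^sub>R axis i 1, t))) has_real_derivative
      2 * t * ((partial (axis i 1, 0) w (x, t))\<^sup>2 + w (x, t) * partial (axis i 1, 0) (partial (axis i 1, 0) w) (x, t))) (at 0)" for x
    unfolding horizontal_shift
    using DERIV_cmult[OF DERIV_mult[OF w_deriv(1)[OF _ axB, where p="(x,t)" and i1=i] w_deriv(2)[OF _ axB, where p="(x,t)" and i1=i]], where c="2*t"] t0
    by (simp add: power2_eq_square mult.commute add.commute)
  show "continuous_on UNIV (\<lambda>x. 2 * t * (w (x, t) * partial (axis i 1, 0) w (x, t)))"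
    by (intro continuous_intros continuous_slice[OF _ t0] w_cont axB)
  show "continuous_on UNIV (\<lambda>x. 2 * t * ((partial (axis i 1, 0) w (x, t))\<^sup>2 + w (x, t) * partial (axis i 1, 0) (partial (axis i 1, 0) w) (x, t)))"
    by (intro continuous_intros continuous_slice[OF _ t0] w_cont axB)
  show "0 \<le> 2 * \<kappa> * (W + 2 * \<kappa> * sqrt (l / t))" using kap W t0 l_pos by simp
  fix x assume x: "\<And>j. a $ j \<le> x $ j \<and> x $ j \<le> a $ j + 2 * l"
  have "\<bar>2 * t * (w (x, t) * partial (axis i 1, 0) w (x, t))\<bar> = (2 * t) * (\<bar>w (x, t)\<bar> * \<bar>partial (axis i 1, 0) w (x, t)\<bar>)"
    using t0 by (simp add: abs_mult)
  also have "\<dots> \<le> (2 * t) * ((W + 2 * \<kappa> * sqrt (l / t)) * (\<kappa> / t))"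
    using t0 t kap W x axB l_pos by (intro mult_left_mono mult_mono) auto
  also have "\<dots> = 2 * \<kappa> * (W + 2 * \<kappa> * sqrt (l / t))" using t0 by simp
  finally show "\<bar>2 * t * (w (x, t) * partial (axis i 1, 0) w (x, t))\<bar> \<le> 2 * \<kappa> * (W + 2 * \<kappa> * sqrt (l / t))" .
qed (rule l_pos)

lemma lateral_flux_linear:
  assumes t: "h \<le> t" "t \<le> l"
  shows "\<bar>integral (cube a l) (\<lambda>x. t * partial (axis i 1, 0) (partial (axis i 1, 0) w) (x, t))\<bar> \<le> 2 * l ^ (CARD('n) - 1) * \<kappa>"
proof (rule integral_axis_derivative_bound[where G="\<lambda>x. t * partial (axis i 1, 0) w (x, t)" and i=i])
  have t0: "t > 0" using t h by linarith
  show "((\<lambda>s. t * partial (axis i 1, 0) w (x + s *\<^sub>R axis i 1, t)) has_real_derivative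
      t * partial (axis i 1, 0) (partial (axis i 1, 0) w) (x, t)) (at 0)" for x
    unfolding horizontal_shift by (intro DERIV_cmult w_deriv(2) axB) (use t0 in simp)
  show "continuous_on UNIV (\<lambda>x. t * partial (axis i 1, 0) w (x, t))"
    by (intro continuous_intros continuous_slice[OF _ t0] w_cont axB)
  show "continuous_on UNIV (\<lambda>x. t * partial (axis i 1, 0) (partial (axis i 1, 0) w) (x, t))"
    by (intro continuous_intros continuous_slice[OF _ t0] w_cont axB)
  show "\<bar>t * partial (axis i 1, 0) w (x, t)\<bar> \<le> \<kappa>" for x
    using kap(2)[OF t0 t(2) axB[of i], of x] t0 by (simp add: abs_mult field_simps)
qed (use l_pos kap in auto)

text \<open>With u = w^2 this is the integral of u - t u_t, whose t-derivative is the integral of -t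
  u_tt. By harmonicity of w this is the lateral flux (t times the horizontal Laplacian of u) minus
  the energy density. \<open>\<Psi>\<close> is the same with u = w, where the energy term is
  absent.\<close>

definition \<Phi> :: "real \<Rightarrow> real" where
  "\<Phi> t = integral (cube a l) (\<lambda>x. (w (x, t))\<^sup>2 - 2 * t * (w (x, t) * partial (0,1) w (x, t)))"

definition \<Psi> :: "real \<Rightarrow> real" where
  "\<Psi> t = integral (cube a l) (\<lambda>x. w (x, t) - t * partial (0,1) w (x, t))"

lemma slice_integrable:
  fixes g :: "(real^'n) \<times> real \<Rightarrow> real"
  shows "t > 0 \<Longrightarrow> continuous_on {p. snd p > 0} g \<Longrightarrow> (\<lambda>x. g (x, t)) integrable_on cube a l"
  unfolding cube_def by (intro integrable_continuous continuous_slice)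

text \<open>Approximate mean value property: between h and l \<open>\<Psi>\<close> varies only by
  the lateral flux, and at height l it is the corner value times the volume, up to \<mu> + \<kappa>
  per unit volume.\<close>

lemma linear_balance: "\<bar>l ^ CARD('n) * w (a, l) - \<Psi> h\<bar> \<le> (2 * real CARD('n) * \<kappa> + \<mu> + \<kappa>) * l ^ CARD('n)"
proof -
  have dPsi: "(\<Psi> has_real_derivative integral (cube a l) (\<lambda>x. - (t * partial (0,1) (partial (0,1) w) (x, t)))) (at t)" if "t > 0" for t
    unfolding \<Psi>_def
  proof (rule slice_integral_derivative[where g="\<lambda>p. w p - snd p * partial (0,1) w p" and g'="\<lambda>p. - (snd p * partial (0,1) (partial (0,1) w) p)", simplified fst_conv snd_conv, OF _ _ _ that])
    fix p :: "(real^'n) \<times> real" assume p: "snd p > 0"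
    show "((\<lambda>t. w (p + t *\<^sub>R (0, 1)) - snd (p + t *\<^sub>R (0, 1)) * partial (0, 1) w (p + t *\<^sub>R (0, 1))) has_real_derivative - (snd p * partial (0, 1) (partial (0, 1) w) p)) (at 0)"
    proof -
      have sn: "snd (p + t *\<^sub>R (0, 1)) = snd p + t" for t by simp
      have 2: "((\<lambda>t. snd p + t) has_real_derivative 1) (at 0)" by (auto intro!: derivative_eq_intros)
      show ?thesis unfolding sn using DERIV_diff[OF w_deriv(1)[OF p eyB] DERIV_mult[OF 2 w_deriv(2)[OF p eyB]]]
        by (simp del: scaleR_Pair add: algebra_simps)
    qed
  qed (intro continuous_intros w_cont eyB)+
  have eq: "integral (cube a l) (\<lambda>x. - (t * partial (0,1) (partial (0,1) w) (x, t)))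
      = (\<Sum>i\<in>UNIV. integral (cube a l) (\<lambda>x. t * partial (axis i 1, 0) (partial (axis i 1, 0) w) (x, t)))" if t: "t > 0" for t
  proof -
    have "integral (cube a l) (\<lambda>x. - (t * partial (0,1) (partial (0,1) w) (x, t)))
      = integral (cube a l) (\<lambda>x. \<Sum>i\<in>UNIV. t * partial (axis i 1, 0) (partial (axis i 1, 0) w) (x, t))"
      using laplace t by (simp add: sum_distrib_left)
    also have "\<dots> = (\<Sum>i\<in>UNIV. integral (cube a l) (\<lambda>x. t * partial (axis i 1, 0) (partial (axis i 1, 0) w) (x, t)))"
      by (rule integral_sum) (auto intro!: continuous_intros slice_integrable[OF t] w_cont axB)
    finally show ?thesis .
  qed
  define d where "d = real CARD('n)"
  have pw: "l ^ (CARD('n) - 1) * l = l ^ CARD('n)" using power_minus_mult[of "CARD('n)" l] by (simp add: mult.commute)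
  have "\<bar>\<Psi> l - \<Psi> h\<bar> \<le> (d * (2 * l ^ (CARD('n) - 1) * \<kappa>) + 2 * 0) * l"
  proof (rule sqrt_growth_bound[OF dPsi _ h])
    fix t assume t: "h \<le> t" "t \<le> l"
    have t0: "t > 0" using t h by linarith
    show "\<bar>integral (cube a l) (\<lambda>x. - (t * partial (0,1) (partial (0,1) w) (x, t)))\<bar> \<le> d * (2 * l ^ (CARD('n) - 1) * \<kappa>) + 0 * sqrt (l / t)"
      unfolding eq[OF t0]
      using order_trans[OF sum_abs sum_mono[of UNIV _ "\<lambda>_. 2 * l ^ (CARD('n) - 1) * \<kappa>", OF lateral_flux_linear[OF t]]]
      by (simp add: d_def)
  qed (use h kap l_pos in \<open>auto simp: d_def\<close>)
  then have 1: "\<bar>\<Psi> l - \<Psi> h\<bar> \<le> 2 * d * \<kappa> * l ^ CARD('n)"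
    by (simp add: pw[symmetric] mult_ac)
  have i: "((\<lambda>x. w (x, l) - l * partial (0,1) w (x, l) - w (a, l)) has_integral \<Psi> l - l ^ CARD('n) * w (a, l)) (cube a l)"
  proof (rule has_integral_diff)
    show "((\<lambda>x. w (x, l) - l * partial (0,1) w (x, l)) has_integral \<Psi> l) (cube a l)"
      unfolding \<Psi>_def
      by (intro integrable_integral integrable_diff slice_integrable[OF l_pos] continuous_intros w_cont eyB)
    show "((\<lambda>x. w (a, l)) has_integral l ^ CARD('n) * w (a, l)) (cube a l)"
      using has_integral_const[of "w (a,l)" a "a + (\<chi> i. l)"] content_cube[of l a] l_pos by (simp add: cube_def)
  qed
  have mu0: "\<mu> \<ge> 0" using mu[of a] l_pos by (auto simp: mem_cube)
  have "norm (\<Psi> l - l ^ CARD('n) * w (a, l)) \<le> (\<mu> + \<kappa>) * measure lborel (cbox a (a + (\<chi> i. l)))"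
  proof (rule has_integral_bound[OF _ i[unfolded cube_def]])
    fix x assume "x \<in> cbox a (a + (\<chi> i. l))"
    then have x: "x \<in> cube a l" by (simp add: cube_def)
    have "\<bar>l * partial (0,1) w (x, l)\<bar> \<le> \<kappa>" using kap(2)[OF l_pos _ eyB, of x] l_pos by (simp add: abs_mult field_simps)
    then show "norm (w (x, l) - l * partial (0,1) w (x, l) - w (a, l)) \<le> \<mu> + \<kappa>" using mu[OF x] by simp
  qed (use mu0 kap in auto)
  then have 2: "\<bar>\<Psi> l - l ^ CARD('n) * w (a, l)\<bar> \<le> (\<mu> + \<kappa>) * l ^ CARD('n)"
    using content_cube[of l a] l_pos by (simp add: cube_def)
  from 1 2 show ?thesis unfolding d_def[symmetric] by (simp add: algebra_simps abs_le_iff)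
qed

text \<open>Green's formula: \<Phi> plus the energy accumulated up to height t changes only by the
  lateral flux, and at height l \<Phi> is the squared corner value times the volume, up to the
  variation on the top face. The second moment at height h thus exceeds the square at the top by the
  energy.\<close>

lemma quadratic_balance:
  "\<bar>l ^ CARD('n) * (w (a, l))\<^sup>2 - (\<Phi> h - energy w a l h l)\<bar>
     \<le> (4 * real CARD('n) * \<kappa> * (W + 4 * \<kappa>) + 2 * (\<mu> + \<kappa>) * (W + 2 * \<kappa>)) * l ^ CARD('n)"
proof -
  define d where "d = real CARD('n)"
  define g where "g = (\<lambda>p. 2 * snd p * (\<Sum>b\<in>Basis. (partial b w p)\<^sup>2))"
  define eh where "eh = (\<lambda>t. integral (cube a l) (\<lambda>x. g (x, t)))"
  define q where "q = (\<lambda>i p. 2 * snd p * ((partial (axis i 1, 0) w p)\<^sup>2 + w p * partial (axis i 1, 0) (partial (axis i 1, 0) w) p))"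
  have cg: "continuous_on {p. snd p > 0} g" unfolding g_def by (intro continuous_intros w_cont)
  have cq: "continuous_on {p. snd p > 0} (q i)" for i unfolding q_def by (intro continuous_intros w_cont axB)
  have dPhi: "(\<Phi> has_real_derivative integral (cube a l) (\<lambda>x. - (2 * t * ((partial (0,1) w (x, t))\<^sup>2 + w (x, t) * partial (0,1) (partial (0,1) w) (x, t))))) (at t)" if "t > 0" for t
    unfolding \<Phi>_def
  proof (rule slice_integral_derivative[where g="\<lambda>p. (w p)\<^sup>2 - 2 * snd p * (w p * partial (0,1) w p)"
      and g'="\<lambda>p. - (2 * snd p * ((partial (0,1) w p)\<^sup>2 + w p * partial (0,1) (partial (0,1) w) p))", simplified fst_conv snd_conv, OF _ _ _ that])
    fix p :: "(real^'n) \<times> real" assume p: "snd p > 0"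
    have 1: "((\<lambda>t. (w (p + t *\<^sub>R (0, 1)))\<^sup>2) has_real_derivative 2 * w p * partial (0,1) w p) (at 0)"
      using DERIV_power[OF w_deriv(1)[OF p eyB], of 2] by (simp del: scaleR_Pair add: mult_ac)
    have 2: "((\<lambda>t. 2 * (snd p + t)) has_real_derivative 2) (at 0)" by (auto intro!: derivative_eq_intros)
    have 3: "((\<lambda>t. w (p + t *\<^sub>R (0, 1)) * partial (0,1) w (p + t *\<^sub>R (0, 1))) has_real_derivative (partial (0,1) w p)\<^sup>2 + w p * partial (0,1) (partial (0,1) w) p) (at 0)"
      using DERIV_mult[OF w_deriv(1)[OF p eyB] w_deriv(2)[OF p eyB]]
      by (simp del: scaleR_Pair add: power2_eq_square mult.commute)
    show "((\<lambda>t. (w (p + t *\<^sub>R (0, 1)))\<^sup>2 - 2 * snd (p + t *\<^sub>R (0, 1)) * (w (p + t *\<^sub>R (0, 1)) * partial (0, 1) w (p + t *\<^sub>R (0, 1)))) has_real_derivative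
        - (2 * snd p * ((partial (0,1) w p)\<^sup>2 + w p * partial (0,1) (partial (0,1) w) p))) (at 0)"
    proof -
      have sn: "snd (p + t *\<^sub>R (0, 1)) = snd p + t" for t by simp
      show ?thesis unfolding sn using DERIV_diff[OF 1 DERIV_mult[OF 2 3]]
        by (simp del: scaleR_Pair add: algebra_simps)
    qed
  qed (intro continuous_intros w_cont eyB)+
  have eq: "integral (cube a l) (\<lambda>x. - (2 * t * ((partial (0,1) w (x, t))\<^sup>2 + w (x, t) * partial (0,1) (partial (0,1) w) (x, t))))
      = (\<Sum>i\<in>UNIV. integral (cube a l) (\<lambda>x. q i (x, t))) - eh t" if t: "t > 0" for t
  proof -
    have "- (2 * t * ((partial (0,1) w (x, t))\<^sup>2 + w (x, t) * partial (0,1) (partial (0,1) w) (x, t))) = (\<Sum>i\<in>UNIV. q i (x, t)) - g (x, t)" for x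
      unfolding q_def g_def sum_Basis_half_space using laplace[of "(x,t)"] t
      by (simp add: sum.distrib sum_distrib_left algebra_simps)
    then have "integral (cube a l) (\<lambda>x. - (2 * t * ((partial (0,1) w (x, t))\<^sup>2 + w (x, t) * partial (0,1) (partial (0,1) w) (x, t))))
      = integral (cube a l) (\<lambda>x. (\<Sum>i\<in>UNIV. q i (x, t)) - g (x, t))" by simp
    also have "\<dots> = (\<Sum>i\<in>UNIV. integral (cube a l) (\<lambda>x. q i (x, t))) - eh t"
      unfolding eh_def using slice_integrable[OF t cq] slice_integrable[OF t cg]
      by (subst integral_diff) (auto intro!: integrable_sum simp: integral_sum)
    finally show ?thesis .
  qed
  \<comment> \<open>The range exceeds [h,l] on both sides so that the primitive \<open>E\<close> has
    two-sided derivatives on all of [h,l]; the starting point h/2 cancels in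
    \<open>E l - E h\<close>.\<close>
  have ceh: "continuous_on {h/2..2*l} eh"
  proof -
    have "continuous_on (cbox (h/2) (2*l)) (\<lambda>t. integral (cbox a (a + (\<chi> i. l))) (\<lambda>x. g (x, t)))"
      by (rule integral_continuous_on_param[where f="\<lambda>t x. g (x, t)"])
         (use h in \<open>auto simp: split_beta intro!: continuous_on_compose2[OF cg] continuous_intros\<close>)
    then show ?thesis by (simp add: eh_def cube_def)
  qed
  have E: "energy w a l h l = integral {h..l} eh"
  proof -
    have cgb: "continuous_on (cbox (a, h) (a + (\<chi> i. l), l)) g"
      by (rule continuous_on_subset[OF cg]) (use h in \<open>auto simp: cbox_Pair_eq\<close>)
    have "energy w a l h l = integral (cbox a (a + (\<chi> i. l))) (\<lambda>x. integral (cbox h l) (\<lambda>t. g (x, t)))"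
      unfolding energy_def g_def[symmetric] by (rule integral_prod_continuous[OF cgb])
    also have "\<dots> = integral (cbox h l) (\<lambda>t. integral (cbox a (a + (\<chi> i. l))) (\<lambda>x. g (x, t)))"
      by (rule integral_swap_continuous) (use cgb in \<open>simp add: split_beta\<close>)
    finally show ?thesis by (simp add: eh_def cube_def)
  qed
  define E where "E = (\<lambda>t. integral {h/2..t} eh)"
  have dE: "(E has_real_derivative eh t) (at t)" if t: "h \<le> t" "t \<le> l" for t
  proof -
    have "(E has_real_derivative eh t) (at t within {h/2..2*l})"
      unfolding E_def by (rule integral_has_real_derivative[OF ceh]) (use t h in auto)
    moreover have "at t within {h/2..2*l} = at t"
      by (rule at_within_interior) (use t h in auto)
    ultimately show ?thesis by simp
  qed
  have EE: "E l - E h = energy w a l h l"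
  proof -
    have "eh integrable_on {h/2..l}"
      by (rule integrable_continuous_real, rule continuous_on_subset[OF ceh]) (use h in auto)
    then show ?thesis unfolding E_def E
      using Henstock_Kurzweil_Integration.integral_combine[of "h/2" h l eh] h by simp
  qed
  have pw: "l ^ (CARD('n) - 1) * l = l ^ CARD('n)" using power_minus_mult[of "CARD('n)" l] by (simp add: mult.commute)
  define P where "P = l ^ (CARD('n) - 1)"
  have P: "P \<ge> 0" using l_pos by (simp add: P_def)
  have "\<bar>(\<Phi> l + E l) - (\<Phi> h + E h)\<bar> \<le> (d * (2 * P * (2 * \<kappa> * W)) + 2 * (d * (2 * P * (2 * \<kappa> * (2 * \<kappa>))))) * l"
  proof (rule sqrt_growth_bound[OF _ _ h])
    fix t assume t: "h \<le> t" "t \<le> l"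
    have t0: "t > 0" using t h by linarith
    show "((\<lambda>t. \<Phi> t + E t) has_real_derivative (\<Sum>i\<in>UNIV. integral (cube a l) (\<lambda>x. q i (x, t)))) (at t)"
      using DERIV_add[OF dPhi[OF t0] dE[OF t]] unfolding eq[OF t0] by simp
    have "\<bar>\<Sum>i\<in>UNIV. integral (cube a l) (\<lambda>x. q i (x, t))\<bar> \<le> (\<Sum>i\<in>(UNIV :: 'n set). 2 * P * (2 * \<kappa> * (W + 2 * \<kappa> * sqrt (l / t))))"
      using lateral_flux_quadratic[OF t] by (intro order_trans[OF sum_abs sum_mono]) (simp add: q_def P_def)
    also have "\<dots> = d * (2 * P * (2 * \<kappa> * W)) + d * (2 * P * (2 * \<kappa> * (2 * \<kappa>))) * sqrt (l / t)"
      by (simp add: d_def algebra_simps)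
    finally show "\<bar>\<Sum>i\<in>UNIV. integral (cube a l) (\<lambda>x. q i (x, t))\<bar> \<le> d * (2 * P * (2 * \<kappa> * W)) + d * (2 * P * (2 * \<kappa> * (2 * \<kappa>))) * sqrt (l / t)" .
  qed (use P kap W in \<open>auto simp: d_def\<close>)
  also have "\<dots> = 4 * d * \<kappa> * (W + 4 * \<kappa>) * (P * l)" by (simp add: algebra_simps)
  also have "P * l = l ^ CARD('n)" using pw by (simp add: P_def)
  finally have 1: "\<bar>(\<Phi> l + E l) - (\<Phi> h + E h)\<bar> \<le> 4 * d * \<kappa> * (W + 4 * \<kappa>) * l ^ CARD('n)" .
  have i: "((\<lambda>x. (w (x, l))\<^sup>2 - 2 * l * (w (x, l) * partial (0,1) w (x, l)) - (w (a, l))\<^sup>2) has_integral \<Phi> l - l ^ CARD('n) * (w (a, l))\<^sup>2) (cube a l)"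
  proof (rule has_integral_diff)
    have "(\<lambda>x. (w (x, l))\<^sup>2 - 2 * l * (w (x, l) * partial (0,1) w (x, l))) integrable_on cube a l"
      unfolding cube_def
      by (intro integrable_continuous continuous_intros continuous_slice[OF _ l_pos] w_cont eyB)
    then show "((\<lambda>x. (w (x, l))\<^sup>2 - 2 * l * (w (x, l) * partial (0,1) w (x, l))) has_integral \<Phi> l) (cube a l)"
      unfolding \<Phi>_def by (rule integrable_integral)
    show "((\<lambda>x. (w (a, l))\<^sup>2) has_integral l ^ CARD('n) * (w (a, l))\<^sup>2) (cube a l)"
      using has_integral_const[of "(w (a,l))\<^sup>2" a "a + (\<chi> i. l)"] content_cube[of l a] l_pos by (simp add: cube_def)
  qed
  have mu0: "\<mu> \<ge> 0" using mu[of a] l_pos by (auto simp: mem_cube)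
  have "norm (\<Phi> l - l ^ CARD('n) * (w (a, l))\<^sup>2) \<le> (2 * (\<mu> + \<kappa>) * (W + 2 * \<kappa>)) * measure lborel (cbox a (a + (\<chi> i. l)))"
  proof (rule has_integral_bound[OF _ i[unfolded cube_def]])
    fix x assume "x \<in> cbox a (a + (\<chi> i. l))"
    then have x: "x \<in> cube a l" by (simp add: cube_def)
    have xb: "a $ j \<le> x $ j \<and> x $ j \<le> a $ j + 2 * l" for j
      using x[unfolded mem_cube, rule_format, of j] l_pos by auto
    have w1: "\<bar>w (x, l)\<bar> \<le> W + 2 * \<kappa>" using W(2)[OF xb l_pos] l_pos by simp
    have w2: "\<bar>w (a, l)\<bar> \<le> W + 2 * \<kappa>" using W(2)[of a l] l_pos by simp
    have p: "\<bar>l * partial (0,1) w (x, l)\<bar> \<le> \<kappa>" using kap(2)[OF l_pos _ eyB, of x] l_pos by (simp add: abs_mult field_simps)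
    have "\<bar>(w (x, l))\<^sup>2 - (w (a, l))\<^sup>2\<bar> = \<bar>w (x, l) - w (a, l)\<bar> * \<bar>w (x, l) + w (a, l)\<bar>"
      by (simp add: abs_mult[symmetric] power2_eq_square algebra_simps)
    also have "\<dots> \<le> \<mu> * (2 * (W + 2 * \<kappa>))"
      using mu[OF x] w1 w2 mu0 by (intro mult_mono) auto
    finally have A: "\<bar>(w (x, l))\<^sup>2 - (w (a, l))\<^sup>2\<bar> \<le> \<mu> * (2 * (W + 2 * \<kappa>))" .
    have "\<bar>2 * l * (w (x, l) * partial (0,1) w (x, l))\<bar> = 2 * (\<bar>w (x, l)\<bar> * \<bar>l * partial (0,1) w (x, l)\<bar>)"
      by (simp add: abs_mult)
    also have "\<dots> \<le> 2 * ((W + 2 * \<kappa>) * \<kappa>)" using w1 p kap W by (intro mult_left_mono mult_mono) auto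
    finally have B: "\<bar>2 * l * (w (x, l) * partial (0,1) w (x, l))\<bar> \<le> 2 * ((W + 2 * \<kappa>) * \<kappa>)" .
    have "\<mu> * (2 * (W + 2 * \<kappa>)) + 2 * ((W + 2 * \<kappa>) * \<kappa>) = 2 * (\<mu> + \<kappa>) * (W + 2 * \<kappa>)" by (simp add: algebra_simps)
    then show "norm ((w (x, l))\<^sup>2 - 2 * l * (w (x, l) * partial (0,1) w (x, l)) - (w (a, l))\<^sup>2) \<le> 2 * (\<mu> + \<kappa>) * (W + 2 * \<kappa>)"
      unfolding real_norm_def using A B by linarith
  qed (use mu0 kap W in auto)
  then have 2: "\<bar>\<Phi> l - l ^ CARD('n) * (w (a, l))\<^sup>2\<bar> \<le> (2 * (\<mu> + \<kappa>) * (W + 2 * \<kappa>)) * l ^ CARD('n)"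
    using content_cube[of l a] l_pos by (simp add: cube_def)
  have "(4 * d * \<kappa> * (W + 4 * \<kappa>) + 2 * (\<mu> + \<kappa>) * (W + 2 * \<kappa>)) * l ^ CARD('n)
    = 4 * d * \<kappa> * (W + 4 * \<kappa>) * l ^ CARD('n) + (2 * (\<mu> + \<kappa>) * (W + 2 * \<kappa>)) * l ^ CARD('n)" by (rule distrib_right)
  with 1 2 EE show ?thesis unfolding d_def[symmetric] by linarith
qed

end

section \<open>Cantor sets of cubes and Hausdorff dimension\<close>

text \<open>Descendants of w at a stopping time truncated after n levels: the first ones that
  satisfy P, and at the last level whatever remains, whether or not P holds there.\<close>

primrec stops :: "'v set \<Rightarrow> ('v list \<Rightarrow> bool) \<Rightarrow> nat \<Rightarrow> 'v list \<Rightarrow> 'v list set" where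
  "stops D P 0 w = {w}"
| "stops D P (Suc n) w = (if P w then {w} else (\<Union>v\<in>D. stops D P n (w @ [v])))"

lemma stops_structure:
  assumes "\<sigma> \<in> stops D P n w"
  shows "\<exists>u. \<sigma> = w @ u \<and> set u \<subseteq> D \<and> length u \<le> n \<and> (P \<sigma> \<or> length u = n) \<and> (\<forall>j<length u. \<not> P (w @ take j u))"
  using assms
proof (induction n arbitrary: w)
  case 0 then show ?case by simp
next
  case (Suc n)
  show ?case
  proof (cases "P w")
    case True with Suc show ?thesis by simp
  next
    case False
    then obtain v where v: "v \<in> D" "\<sigma> \<in> stops D P n (w @ [v])" using Suc.prems by auto
    from Suc.IH[OF v(2)] obtain u where u: "\<sigma> = (w @ [v]) @ u" "set u \<subseteq> D" "length u \<le> n" "P \<sigma> \<or> length u = n"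
      "\<forall>j<length u. \<not> P ((w @ [v]) @ take j u)" by blast
    have "\<not> P (w @ take j (v # u))" if "j < length (v # u)" for j
      using that u(5) False by (cases j) auto
    with u v show ?thesis by (intro exI[of _ "v # u"]) auto
  qed
qed

lemma finite_stops: "finite D \<Longrightarrow> finite (stops D P n w)"
  by (induction n arbitrary: w) auto

lemma stops_disjoint:
  assumes "v \<noteq> v'" shows "stops D P n (w @ [v]) \<inter> stops D P m (w @ [v']) = {}"
  using assms by (auto dest!: stops_structure)

lemma stops_antichain:
  assumes "\<sigma> \<in> stops D P n w" "\<tau> \<in> stops D P n w" "prefix \<sigma> \<tau>"
  shows "\<sigma> = \<tau>"
proof -
  obtain u where u: "\<sigma> = w @ u" "length u \<le> n" "P \<sigma> \<or> length u = n" using stops_structure[OF assms(1)] by blast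
  obtain u' where u': "\<tau> = w @ u'" "length u' \<le> n" "\<forall>j<length u'. \<not> P (w @ take j u')" using stops_structure[OF assms(2)] by blast
  have pre: "prefix u u'" using assms(3) u(1) u'(1) by simp
  then have le: "length u \<le> length u'" by (rule prefix_length_le)
  have tk: "u = take (length u) u'" using pre by (auto elim!: prefixE)
  show ?thesis
  proof (cases "length u < length u'")
    case True
    then have "\<not> P \<sigma>" using u'(3) u(1) tk by metis
    then show ?thesis using u(3) True u'(2) by simp
  next
    case False
    then show ?thesis using le tk u u' by simp
  qed
qed

text \<open>Optional stopping for a supermartingale: splitting a node never increases the sum. It is
  applied to masses, to integrals over cells and to weighted energies.\<close>

lemma sum_stops_le:
  fixes k :: "'v list \<Rightarrow> real"
  assumes "finite D" "\<And>u. set u \<subseteq> D \<Longrightarrow> length u < n \<Longrightarrow> (\<Sum>v\<in>D. k ((w @ u) @ [v])) \<le> k (w @ u)"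
  shows "(\<Sum>\<sigma>\<in>stops D P n w. k \<sigma>) \<le> k w"
  using assms(2)
proof (induction n arbitrary: w)
  case 0 then show ?case by simp
next
  case (Suc n)
  show ?case
  proof (cases "P w")
    case True then show ?thesis by simp
  next
    case False
    have "(\<Sum>\<sigma>\<in>stops D P (Suc n) w. k \<sigma>) = (\<Sum>v\<in>D. \<Sum>\<sigma>\<in>stops D P n (w @ [v]). k \<sigma>)"
      using False by (simp, subst sum.UNION_disjoint) (auto simp: assms(1) finite_stops dest: stops_disjoint)
    also have "\<dots> \<le> (\<Sum>v\<in>D. k (w @ [v]))"
    proof (rule sum_mono, rule Suc.IH)
      fix v u assume "v \<in> D" "set u \<subseteq> D" "length u < n"
      then show "(\<Sum>v'\<in>D. k (((w @ [v]) @ u) @ [v'])) \<le> k ((w @ [v]) @ u)"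
        using Suc.prems[of "v # u"] by simp
    qed
    also have "\<dots> \<le> k w" using Suc.prems[of "[]"] by simp
    finally show ?thesis .
  qed
qed

lemma sum_stops_eq:
  fixes k :: "'v list \<Rightarrow> real"
  assumes "finite D" "\<And>u. set u \<subseteq> D \<Longrightarrow> length u < n \<Longrightarrow> (\<Sum>v\<in>D. k ((w @ u) @ [v])) = k (w @ u)"
  shows "(\<Sum>\<sigma>\<in>stops D P n w. k \<sigma>) = k w"
proof (rule antisym)
  show "(\<Sum>\<sigma>\<in>stops D P n w. k \<sigma>) \<le> k w" by (rule sum_stops_le[OF assms(1)]) (simp only: assms(2))
  have "(\<Sum>\<sigma>\<in>stops D P n w. - k \<sigma>) \<le> - k w"
    by (rule sum_stops_le[OF assms(1)]) (simp only: assms(2) sum_negf)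
  then show "k w \<le> (\<Sum>\<sigma>\<in>stops D P n w. k \<sigma>)" by (simp add: sum_negf)
qed

text \<open>L is the absolute level, so the set is empty when L is below the length of w.\<close>

definition ext :: "'v set \<Rightarrow> nat \<Rightarrow> 'v list \<Rightarrow> 'v list set" where
  "ext D L w = {w @ u | u. set u \<subseteq> D \<and> length w + length u = L}"

lemma card_ext:
  assumes "finite D" "length w \<le> L"
  shows "finite (ext D L w)" "card (ext D L w) = card D ^ (L - length w)"
proof -
  have eq: "ext D L w = (\<lambda>u. w @ u) ` {u. set u \<subseteq> D \<and> length u = L - length w}"
    unfolding ext_def using assms(2) by auto
  show "finite (ext D L w)" unfolding eq by (intro finite_imageI finite_lists_length_eq assms)
  have "inj_on (\<lambda>u. w @ u) {u. set u \<subseteq> D \<and> length u = L - length w}" by (auto simp: inj_on_def)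
  then show "card (ext D L w) = card D ^ (L - length w)"
    unfolding eq by (simp add: card_image card_lists_length_eq[OF assms(1)])
qed

lemma ext_prefix: "z \<in> ext D L w \<Longrightarrow> prefix w z" by (auto simp: ext_def)

lemma power_diff_inverse: "(b::real) > 0 \<Longrightarrow> m \<le> L \<Longrightarrow> b ^ (L - m) = b ^ L * (1/b) ^ m"
  by (simp add: power_diff power_one_over field_simps)

text \<open>Kraft's inequality: at a common level L, distinct members of an antichain have disjoint
  sets of descendants, all of them descendants of W.\<close>

lemma kraft_antichain:
  assumes D: "finite D" "D \<noteq> {}" and A: "finite A" "\<And>x y. x \<in> A \<Longrightarrow> y \<in> A \<Longrightarrow> prefix x y \<Longrightarrow> x = y"
    and W: "\<And>x. x \<in> A \<Longrightarrow> \<exists>u. x = W @ u \<and> set u \<subseteq> D"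
  shows "(\<Sum>x\<in>A. (1 / real (card D)) ^ length x) \<le> (1 / real (card D)) ^ length W"
proof -
  define b where "b = real (card D)"
  have b: "b > 0" using D by (simp add: b_def card_gt_0_iff)
  obtain L where L: "\<And>x. x \<in> insert W A \<Longrightarrow> length x \<le> L"
    using finite_nat_set_iff_bounded_le[of "length ` insert W A"] A(1) by auto
  have "(\<Sum>x\<in>A. b ^ (L - length x)) = (\<Sum>x\<in>A. real (card (ext D L x)))"
    using L D by (intro sum.cong) (auto simp: card_ext b_def)
  also have "\<dots> = real (card (\<Union>x\<in>A. ext D L x))"
  proof -
    have "card (\<Union>x\<in>A. ext D L x) = (\<Sum>x\<in>A. card (ext D L x))"
    proof (rule card_UN_disjoint[OF A(1)])
      show "\<forall>i\<in>A. finite (ext D L i)" using L D card_ext by auto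
      show "\<forall>i\<in>A. \<forall>j\<in>A. i \<noteq> j \<longrightarrow> ext D L i \<inter> ext D L j = {}"
        using A(2) by (auto dest!: ext_prefix) (metis prefix_same_cases)
    qed
    then show ?thesis by simp
  qed
  also have "\<dots> \<le> real (card (ext D L W))"
  proof (intro of_nat_mono card_mono)
    show "finite (ext D L W)" using L D card_ext by auto
    show "(\<Union>x\<in>A. ext D L x) \<subseteq> ext D L W" using W unfolding ext_def by fastforce
  qed
  also have "\<dots> = b ^ (L - length W)" using L D by (simp add: card_ext b_def)
  finally have "(\<Sum>x\<in>A. b ^ (L - length x)) \<le> b ^ (L - length W)" .
  then have "b ^ L * (\<Sum>x\<in>A. (1/b) ^ length x) \<le> b ^ L * (1/b) ^ length W"
    using L by (simp add: power_diff_inverse[OF b] sum_distrib_left)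
  then show ?thesis using b by (simp add: b_def)
qed

text \<open>The converse count: each covering word has |D|^(L - length) descendants at level L,
  while words longer than L have none and only increase the right side.\<close>

lemma kraft_cover:
  assumes D: "finite D" "D \<noteq> {}" and W: "finite \<W>" and X: "\<X> \<subseteq> (\<Union>w\<in>\<W>. ext D L w)"
  shows "real (card \<X>) \<le> real (card D) ^ L * (\<Sum>w\<in>\<W>. (1 / real (card D)) ^ length w)"
proof -
  define b where "b = real (card D)"
  have b: "b > 0" using D by (simp add: b_def card_gt_0_iff)
  let ?V = "{w\<in>\<W>. length w \<le> L}"
  have X': "\<X> \<subseteq> (\<Union>w\<in>?V. ext D L w)" using X by (fastforce simp: ext_def)
  have fin: "finite (\<Union>w\<in>?V. ext D L w)" using W D card_ext by auto
  have "card \<X> \<le> card (\<Union>w\<in>?V. ext D L w)" by (rule card_mono[OF fin X'])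
  also have "\<dots> \<le> (\<Sum>w\<in>?V. card (ext D L w))" by (rule card_UN_le) (use W in auto)
  finally have "real (card \<X>) \<le> (\<Sum>w\<in>?V. real (card (ext D L w)))" by (metis of_nat_mono of_nat_sum)
  also have "\<dots> = (\<Sum>w\<in>?V. b ^ L * (1/b) ^ length w)"
    using D by (intro sum.cong) (auto simp: card_ext b_def[symmetric] power_diff_inverse[OF b])
  also have "\<dots> \<le> (\<Sum>w\<in>\<W>. b ^ L * (1/b) ^ length w)"
    by (rule sum_mono2) (use W b in auto)
  finally show ?thesis by (simp add: b_def sum_distrib_left)
qed

text \<open>Nodes are abstract and carry a word \<open>wd\<close>, because for the small class a
  node also remembers a phase and a centre. A selection keeps at least the fraction c of the mass
  and descends at least m levels. The weight q^length decays no faster than the mass, and the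
  condition on c, q and m says that over m levels this advantage makes up for the factor c.\<close>

locale cantor_tree =
  fixes D :: "'v set" and wd :: "'x \<Rightarrow> 'v list" and ch :: "'x \<Rightarrow> 'x set" and G :: "'x set"
    and c q :: real and m :: nat
  assumes D: "finite D" "D \<noteq> {}"
    and q: "q > 0" "q * real (card D) \<ge> 1" and c: "0 < c" "c \<le> 1" "c * (q * real (card D)) ^ m \<ge> 1"
    and ch: "\<And>x. x \<in> G \<Longrightarrow> ch x \<subseteq> G" "\<And>x. x \<in> G \<Longrightarrow> finite (ch x)"
    and ch_ext: "\<And>x y. x \<in> G \<Longrightarrow> y \<in> ch x \<Longrightarrow> \<exists>u. wd y = wd x @ u \<and> set u \<subseteq> D \<and> m \<le> length u"
    and ch_antichain: "\<And>x y z. x \<in> G \<Longrightarrow> y \<in> ch x \<Longrightarrow> z \<in> ch x \<Longrightarrow> prefix (wd y) (wd z) \<Longrightarrow> y = z"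
    and ch_mass: "\<And>x. x \<in> G \<Longrightarrow> c * (1 / real (card D)) ^ length (wd x) \<le> (\<Sum>y\<in>ch x. (1 / real (card D)) ^ length (wd y))"
begin

primrec gen :: "nat \<Rightarrow> 'x \<Rightarrow> 'x set" where
  "gen 0 x = {x}"
| "gen (Suc j) x = (\<Union>y\<in>ch x. gen j y)"

lemma gen_G: "x \<in> G \<Longrightarrow> gen j x \<subseteq> G"
proof (induction j arbitrary: x)
  case (Suc j)
  show ?case
  proof
    fix z assume "z \<in> gen (Suc j) x"
    then obtain y where "y \<in> ch x" "z \<in> gen j y" by auto
    then show "z \<in> G" using ch(1)[OF Suc.prems] Suc.IH[of y] by blast
  qed
qed simp

lemma finite_gen: "x \<in> G \<Longrightarrow> finite (gen j x)"
proof (induction j arbitrary: x)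
  case (Suc j)
  then show ?case using ch[OF Suc.prems] by (auto simp: subset_iff)
qed simp

text \<open>Takes the place of a mass distribution on the limit set; induction on j. Children inside
  a covering word are counted by mass with Kraft's inequality. The induction hypothesis serves the
  others, and its factor c is cancelled by the m extra levels. The last hypothesis excludes covering
  words strictly above x, which the sum on the right would not count.\<close>

lemma cover_mass:
  assumes "x \<in> G" "finite \<W>"
    and "\<And>y z. y \<in> gen j x \<Longrightarrow> z \<in> ext D L (wd y) \<Longrightarrow> \<exists>W\<in>\<W>. prefix W z"
    and "\<And>y. y \<in> gen j x \<Longrightarrow> length (wd y) \<le> L"
    and "\<And>W. W \<in> \<W> \<Longrightarrow> prefix W (wd x) \<Longrightarrow> W = wd x"
  shows "c * q ^ length (wd x) \<le> (\<Sum>W | W \<in> \<W> \<and> prefix (wd x) W. q ^ length W)"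
  using assms
proof (induction j arbitrary: x)
  define b where "b = real (card D)"
  have b: "b > 0" using D by (simp add: b_def card_gt_0_iff)
  have qb: "q * b \<ge> 1" using q by (simp add: b_def)
  \<comment> \<open>The weight q^k is (q b)^k times the mass b^(-k); since q b is at least 1, the
    exponent of the first factor may be lowered.\<close>
  have split: "q ^ k = (q * b) ^ k * (1/b) ^ k" for k :: nat using b by (simp add: power_mult_distrib[symmetric])
  have ge: "q ^ k \<ge> (q * b) ^ i * (1/b) ^ k" if "i \<le> k" for i k :: nat
    unfolding split[of k] using that qb b by (intro mult_right_mono power_increasing) auto
  have triv: "c * q ^ length (wd x) \<le> (\<Sum>W | W \<in> \<W> \<and> prefix (wd x) W. q ^ length W)" if "wd x \<in> \<W>" "finite \<W>" for x
  proof -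
    have "c * q ^ length (wd x) \<le> q ^ length (wd x)" using c q by (simp add: mult_left_le_one_le)
    also have "\<dots> = (\<Sum>W\<in>{wd x}. q ^ length W)" by simp
    also have "\<dots> \<le> (\<Sum>W | W \<in> \<W> \<and> prefix (wd x) W. q ^ length W)"
      by (rule sum_mono2) (use that q in auto)
    finally show ?thesis .
  qed
  {
    case 0
    show ?case
    proof (cases "wd x \<in> \<W>")
      case True then show ?thesis using triv 0 by blast
    next
      case False
      let ?V = "{W \<in> \<W>. prefix (wd x) W}"
      have "ext D L (wd x) \<subseteq> (\<Union>w\<in>?V. ext D L w)"
      proof
        fix z assume z: "z \<in> ext D L (wd x)"
        then obtain W where W: "W \<in> \<W>" "prefix W z" using 0(3) by auto
        have "\<not> prefix W (wd x)" using 0(5) W False by blast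
        then have p: "prefix (wd x) W" using W(2) ext_prefix[OF z] prefix_same_cases by blast
        then have "z \<in> ext D L W" using z W(2) by (auto simp: ext_def prefix_def)
        then show "z \<in> (\<Union>w\<in>?V. ext D L w)" using p W by blast
      qed
      from kraft_cover[OF D _ this] 0 have "b ^ (L - length (wd x)) \<le> b ^ L * (\<Sum>W\<in>?V. (1/b) ^ length W)"
        by (simp add: card_ext D b_def)
      then have "(1/b) ^ length (wd x) \<le> (\<Sum>W\<in>?V. (1/b) ^ length W)"
        using power_diff_inverse[OF b, of "length (wd x)" L] 0(4)[of x] b by simp
      then have "(q * b) ^ length (wd x) * (1/b) ^ length (wd x) \<le> (q * b) ^ length (wd x) * (\<Sum>W\<in>?V. (1/b) ^ length W)"
        using qb by (intro mult_left_mono) auto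
      also have "\<dots> \<le> (\<Sum>W\<in>?V. q ^ length W)"
        unfolding sum_distrib_left by (rule sum_mono, rule ge) (auto dest: prefix_length_le)
      finally have "q ^ length (wd x) \<le> (\<Sum>W\<in>?V. q ^ length W)" using split by simp
      moreover have "c * q ^ length (wd x) \<le> q ^ length (wd x)" using c q by (simp add: mult_left_le_one_le)
      ultimately show ?thesis by simp
    qed
  next
    case (Suc j)
    show ?case
    proof (cases "wd x \<in> \<W>")
      case True then show ?thesis using triv Suc by blast
    next
      case False
      note xG = Suc.prems(1)
      \<comment> \<open>\<open>C1\<close>: children inside a single covering word.
        \<open>C2\<close>: children covered only piecewise, by words strictly below them.\<close>
      define C1 where "C1 = {y \<in> ch x. \<exists>W\<in>\<W>. prefix W (wd y)}"
      define C2 where "C2 = {y \<in> ch x. \<not> (\<exists>W\<in>\<W>. prefix W (wd y))}"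
      define W1 where "W1 = {W \<in> \<W>. \<exists>y\<in>C1. prefix W (wd y)}"
      have fc: "finite C1" "finite C2" using ch(2)[OF xG] by (auto simp: C1_def C2_def)
      have fW: "finite W1" using Suc.prems(2) by (simp add: W1_def)
      have W1x: "prefix (wd x) W" if WW: "W \<in> W1" for W
      proof -
        obtain y where y: "y \<in> C1" "prefix W (wd y)" "W \<in> \<W>" using WW by (auto simp: W1_def)
        have "prefix (wd x) (wd y)" using ch_ext[OF xG, of y] y by (auto simp: C1_def)
        moreover have "\<not> prefix W (wd x)" using Suc.prems(5) y(3) False by blast
        ultimately show ?thesis using y(2) prefix_same_cases by blast
      qed
      \<comment> \<open>The children in \<open>C1\<close> are grouped by a covering word above them;
        each group is an antichain below that word.\<close>
      have mass1: "(\<Sum>y\<in>C1. (1/b) ^ length (wd y)) \<le> (\<Sum>W\<in>W1. (1/b) ^ length W)"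
      proof -
        have "\<forall>y\<in>C1. \<exists>W\<in>W1. prefix W (wd y)" by (auto simp: W1_def C1_def)
        then obtain wf where wf: "\<And>y. y \<in> C1 \<Longrightarrow> wf y \<in> W1 \<and> prefix (wf y) (wd y)" by metis
        have "(\<Sum>y\<in>C1. (1/b) ^ length (wd y)) = (\<Sum>W\<in>W1. \<Sum>y\<in>{y \<in> C1. wf y = W}. (1/b) ^ length (wd y))"
          by (rule sum.group[symmetric]) (use fc fW wf in auto)
        also have "\<dots> \<le> (\<Sum>W\<in>W1. (1/b) ^ length W)"
        proof (rule sum_mono)
          fix W assume W: "W \<in> W1"
          let ?A = "{y \<in> C1. wf y = W}"
          have inj: "inj_on wd ?A"
            using ch_antichain[OF xG] by (auto simp: inj_on_def C1_def)
          have "(\<Sum>y\<in>?A. (1/b) ^ length (wd y)) = (\<Sum>w\<in>wd ` ?A. (1/b) ^ length w)"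
            by (simp add: sum.reindex[OF inj])
          also have "\<dots> \<le> (1/b) ^ length W"
            unfolding b_def
          proof (rule kraft_antichain[OF D])
            show "finite (wd ` ?A)" using fc by auto
            show "\<And>x y. x \<in> wd ` ?A \<Longrightarrow> y \<in> wd ` ?A \<Longrightarrow> prefix x y \<Longrightarrow> x = y"
              using ch_antichain[OF xG] by (auto simp: C1_def)
            fix z assume "z \<in> wd ` ?A"
            then obtain y where y: "y \<in> ch x" "prefix W (wd y)" "z = wd y" using wf by (auto simp: C1_def)
            obtain u where u: "wd y = wd x @ u" "set u \<subseteq> D" using ch_ext[OF xG y(1)] by blast
            obtain r where r: "W = wd x @ r" using W1x[OF W] by (auto simp: prefix_def)
            obtain t where t: "wd y = W @ t" using y(2) by (auto simp: prefix_def)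
            have "set t \<subseteq> set u" using u(1) r t by auto
            then show "\<exists>u. z = W @ u \<and> set u \<subseteq> D" using y t u by auto
          qed
          finally show "(\<Sum>y\<in>?A. (1/b) ^ length (wd y)) \<le> (1/b) ^ length W" .
        qed
        finally show ?thesis .
      qed
      let ?V = "\<lambda>y. {W \<in> \<W>. prefix (wd y) W}"
      have mass2: "(q * b) ^ length (wd x) * (1/b) ^ length (wd y) \<le> (\<Sum>W\<in>?V y. q ^ length W)" if y: "y \<in> C2" for y
      proof -
        have yc: "y \<in> ch x" using y by (simp add: C2_def)
        obtain u where u: "wd y = wd x @ u" "m \<le> length u" using ch_ext[OF xG yc] by blast
        \<comment> \<open>Here the assumption on \<open>c * (q * b) ^ m\<close> is spent: it buys
          back the factor c of the induction hypothesis.\<close>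
        have "1 * ((q * b) ^ length (wd x) * (1/b) ^ length (wd y)) \<le> (c * (q * b) ^ m) * ((q * b) ^ length (wd x) * (1/b) ^ length (wd y))"
          using c(3) qb b by (intro mult_right_mono) (auto simp: b_def)
        also have "\<dots> = c * ((q * b) ^ (m + length (wd x)) * (1/b) ^ length (wd y))" by (simp add: power_add mult_ac)
        also have "\<dots> \<le> c * q ^ length (wd y)" using c u by (intro mult_left_mono ge) auto
        also have "\<dots> \<le> (\<Sum>W\<in>?V y. q ^ length W)"
        proof (rule Suc.IH)
          show "y \<in> G" using ch(1)[OF xG] yc by blast
          show "\<And>y' z. y' \<in> gen j y \<Longrightarrow> z \<in> ext D L (wd y') \<Longrightarrow> \<exists>W\<in>\<W>. prefix W z"
            using Suc.prems(3) yc by auto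
          show "\<And>y'. y' \<in> gen j y \<Longrightarrow> length (wd y') \<le> L" using Suc.prems(4) yc by auto
          show "\<And>W. W \<in> \<W> \<Longrightarrow> prefix W (wd y) \<Longrightarrow> W = wd y" using y by (auto simp: C2_def)
        qed (rule Suc.prems(2))
        finally show ?thesis by simp
      qed
      \<comment> \<open>No covering word is counted twice: a word above a child in \<open>C1\<close>
        and below one in \<open>C2\<close> would make two distinct children comparable.\<close>
      have disj1: "W1 \<inter> (\<Union>y\<in>C2. ?V y) = {}"
      proof -
        have False if "W \<in> W1" "y \<in> C2" "W \<in> ?V y" for W y
        proof -
          obtain y1 where y1: "y1 \<in> C1" "prefix W (wd y1)" using \<open>W \<in> W1\<close> by (auto simp: W1_def)
          have "prefix (wd y) (wd y1)" using that(3) y1(2) prefix_order.trans by blast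
          then have "y = y1" using ch_antichain[OF xG] that(2) y1(1) by (auto simp: C1_def C2_def)
          then show False using that(2) y1(1) by (auto simp: C1_def C2_def)
        qed
        then show ?thesis by blast
      qed
      have disj2: "?V y \<inter> ?V y' = {}" if "y \<in> C2" "y' \<in> C2" "y \<noteq> y'" for y y'
      proof -
        have False if "W \<in> ?V y" "W \<in> ?V y'" for W
        proof -
          have "prefix (wd y) (wd y') \<or> prefix (wd y') (wd y)" using that prefix_same_cases by blast
          then show False using ch_antichain[OF xG] \<open>y \<in> C2\<close> \<open>y' \<in> C2\<close> \<open>y \<noteq> y'\<close> by (auto simp: C2_def)
        qed
        then show ?thesis by blast
      qed
      have chC: "ch x = C1 \<union> C2" "C1 \<inter> C2 = {}" by (auto simp: C1_def C2_def)
      have "c * q ^ length (wd x) = (q * b) ^ length (wd x) * (c * (1/b) ^ length (wd x))" unfolding split[of "length (wd x)"] by simp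
      also have "\<dots> \<le> (q * b) ^ length (wd x) * (\<Sum>y\<in>ch x. (1/b) ^ length (wd y))"
        using ch_mass[OF xG] qb by (intro mult_left_mono) (auto simp: b_def)
      also have "\<dots> = (q * b) ^ length (wd x) * (\<Sum>y\<in>C1. (1/b) ^ length (wd y)) + (\<Sum>y\<in>C2. (q * b) ^ length (wd x) * (1/b) ^ length (wd y))"
        unfolding chC(1) by (subst sum.union_disjoint[OF fc chC(2)]) (simp add: distrib_left sum_distrib_left)
      also have "\<dots> \<le> (q * b) ^ length (wd x) * (\<Sum>W\<in>W1. (1/b) ^ length W) + (\<Sum>y\<in>C2. \<Sum>W\<in>?V y. q ^ length W)"
        using mass1 mass2 qb by (intro add_mono mult_left_mono sum_mono) auto
      also have "\<dots> \<le> (\<Sum>W\<in>W1. q ^ length W) + (\<Sum>y\<in>C2. \<Sum>W\<in>?V y. q ^ length W)"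
        unfolding sum_distrib_left using W1x prefix_length_le by (intro add_right_mono sum_mono ge) blast
      also have "(\<Sum>y\<in>C2. \<Sum>W\<in>?V y. q ^ length W) = (\<Sum>W\<in>(\<Union>y\<in>C2. ?V y). q ^ length W)"
        using fc(2) Suc.prems(2) disj2 by (subst sum.UNION_disjoint) auto
      also have "(\<Sum>W\<in>W1. q ^ length W) + (\<Sum>W\<in>(\<Union>y\<in>C2. ?V y). q ^ length W) = (\<Sum>W\<in>W1 \<union> (\<Union>y\<in>C2. ?V y). q ^ length W)"
        using fc(2) Suc.prems(2) fW disj1 by (subst sum.union_disjoint) auto
      also have "\<dots> \<le> (\<Sum>W\<in>?V x. q ^ length W)"
      proof (rule sum_mono2)
        show "W1 \<union> (\<Union>y\<in>C2. ?V y) \<subseteq> ?V x"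
        proof -
          have "prefix (wd x) W" if "y \<in> C2" "prefix (wd y) W" for y W
          proof -
            have "y \<in> ch x" using that by (simp add: C2_def)
            then obtain u where "wd y = wd x @ u" using ch_ext[OF xG] by blast
            then show ?thesis using that(2) by (auto simp: prefix_def)
          qed
          then show ?thesis using W1x by (auto simp: W1_def)
        qed
      qed (use Suc.prems(2) q in auto)
      finally show ?thesis .
    qed
  }
qed

end


section \<open>N-adic cells addressed by words of digits\<close>

text \<open>Digits are real vectors with integer entries, so that they serve directly as offsets in
  \<open>corner\<close>.\<close>

definition digits :: "nat \<Rightarrow> (real^'n) set" where
  "digits N = {v. \<forall>i. \<exists>k<N. v $ i = real k}"

lemma digits_image: "(digits N :: (real^'n) set) = (\<lambda>g. \<chi> i. real (g i)) ` (UNIV \<rightarrow>\<^sub>E {..<N})"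
proof
  show "(digits N :: (real^'n) set) \<subseteq> (\<lambda>g. \<chi> i. real (g i)) ` (UNIV \<rightarrow>\<^sub>E {..<N})"
  proof
    fix v :: "real^'n" assume "v \<in> digits N"
    then obtain g where g: "\<And>i. g i < N \<and> v $ i = real (g i)" unfolding digits_def by (auto; metis)
    then show "v \<in> (\<lambda>g. \<chi> i. real (g i)) ` (UNIV \<rightarrow>\<^sub>E {..<N})"
      by (intro image_eqI[of _ _ g]) (auto simp: vec_eq_iff)
  qed
qed (auto simp: digits_def PiE_def)

lemma finite_digits: "finite (digits N :: (real^'n) set)"
  unfolding digits_image by (intro finite_imageI finite_PiE) auto

lemma card_digits: "card (digits N :: (real^'n) set) = N ^ CARD('n)"
proof -
  have "inj_on (\<lambda>g. (\<chi> i. real (g i)) :: real^'n) (UNIV \<rightarrow>\<^sub>E {..<N})"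
    by (auto simp: inj_on_def vec_eq_iff)
  then show ?thesis unfolding digits_image by (simp add: card_image card_PiE)
qed

lemma zero_digits: "N > 0 \<Longrightarrow> 0 \<in> digits N"
  by (auto simp: digits_def)

text \<open>The first letter is the coarsest digit, so extending a word on the right subdivides its
  cell, and prefixes are ancestors.\<close>

primrec corner :: "nat \<Rightarrow> (real^'n) list \<Rightarrow> real^'n \<Rightarrow> real \<Rightarrow> real^'n" where
  "corner N [] a l = a"
| "corner N (v # w) a l = corner N w (a + (l / real N) *\<^sub>R v) (l / real N)"

definition cell :: "nat \<Rightarrow> (real^'n) list \<Rightarrow> real^'n \<Rightarrow> real \<Rightarrow> (real^'n) set" where
  "cell N w a l = cube (corner N w a l) (l / real N ^ length w)"

lemma corner_append: "corner N (u @ w) a l = corner N w (corner N u a l) (l / real N ^ length u)"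
  by (induction u arbitrary: a l) auto

lemma cell_append: "cell N (u @ w) a l = cell N w (corner N u a l) (l / real N ^ length u)"
  by (simp add: cell_def corner_append power_add)

lemma cell_Nil: "cell N [] a l = cube a l" by (simp add: cell_def)

lemma cell_Cons: "cell N (v # w) a l = cell N w (a + (l / real N) *\<^sub>R v) (l / real N)"
  by (simp add: cell_def)

lemma grid_index:
  fixes t :: real assumes "0 \<le> t" "t \<le> real N" "N > 0"
  shows "\<exists>k<N. real k \<le> t \<and> t \<le> real k + 1"
proof (cases "t < real N")
  case True
  then have "nat \<lfloor>t\<rfloor> < N" using assms(1) by linarith
  moreover have "real (nat \<lfloor>t\<rfloor>) \<le> t" "t \<le> real (nat \<lfloor>t\<rfloor>) + 1" using assms(1) by linarith+
  ultimately show ?thesis by blast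
next
  case False
  then show ?thesis using assms by (intro exI[of _ "N - 1"]) auto
qed

lemma cube_children:
  fixes a :: "real^'n"
  assumes N: "N > 0" and l: "l > 0"
  shows "cube a l = (\<Union>v\<in>digits N. cube (a + (l / real N) *\<^sub>R v) (l / real N))"
proof
  show "cube a l \<subseteq> (\<Union>v\<in>digits N. cube (a + (l / real N) *\<^sub>R v) (l / real N))"
  proof
    fix x assume x: "x \<in> cube a l"
    have "\<exists>k<N. real k \<le> (x $ i - a $ i) * real N / l \<and> (x $ i - a $ i) * real N / l \<le> real k + 1" for i
    proof (rule grid_index[OF _ _ N])
      have xi: "a $ i \<le> x $ i" "x $ i \<le> a $ i + l" using x by (auto simp: mem_cube)
      show "0 \<le> (x $ i - a $ i) * real N / l" using xi l by simp
      have "(x $ i - a $ i) * real N \<le> l * real N" using xi by (intro mult_right_mono) auto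
      then show "(x $ i - a $ i) * real N / l \<le> real N" using l by (simp add: field_simps)
    qed
    then obtain g where g: "\<And>i. g i < N \<and> real (g i) \<le> (x $ i - a $ i) * real N / l \<and> (x $ i - a $ i) * real N / l \<le> real (g i) + 1"
      by metis
    have "x \<in> cube (a + (l / real N) *\<^sub>R (\<chi> i. real (g i))) (l / real N)"
      unfolding mem_cube
    proof
      fix i
      have "real (g i) * l \<le> (x $ i - a $ i) * real N" "(x $ i - a $ i) * real N \<le> (real (g i) + 1) * l"
        using g[of i] l by (auto simp: field_simps)
      then have "l / real N * real (g i) \<le> x $ i - a $ i" "x $ i - a $ i \<le> l / real N * real (g i) + l / real N"
        using N by (auto simp: field_simps)
      then show "(a + (l / real N) *\<^sub>R (\<chi> i. real (g i))) $ i \<le> x $ i \<and> x $ i \<le> (a + (l / real N) *\<^sub>R (\<chi> i. real (g i))) $ i + l / real N"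
        by simp
    qed
    moreover have "(\<chi> i. real (g i)) \<in> digits N" using g by (auto simp: digits_def)
    ultimately show "x \<in> (\<Union>v\<in>digits N. cube (a + (l / real N) *\<^sub>R v) (l / real N))" by blast
  qed
next
  show "(\<Union>v\<in>digits N. cube (a + (l / real N) *\<^sub>R v) (l / real N)) \<subseteq> cube a l"
  proof clarify
    fix v x assume v: "v \<in> (digits N :: (real^'n) set)" and x: "x \<in> cube (a + (l / real N) *\<^sub>R v) (l / real N)"
    show "x \<in> cube a l" unfolding mem_cube
    proof
      fix i
      obtain k where k: "k < N" "v $ i = real k" using v by (auto simp: digits_def)
      have "l / real N * real k + l / real N = l * (real k + 1) / real N" by (simp add: distrib_left add_divide_distrib)
      also have "\<dots> \<le> l * real N / real N" using k l N by (intro divide_right_mono mult_left_mono) auto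
      finally have "l / real N * real k + l / real N \<le> l" using N by simp
      moreover have "0 \<le> l / real N * real k" using l by simp
      moreover have "(a + (l / real N) *\<^sub>R v) $ i \<le> x $ i \<and> x $ i \<le> (a + (l / real N) *\<^sub>R v) $ i + l / real N"
        using x unfolding mem_cube by blast
      then have "a $ i + l / real N * real k \<le> x $ i \<and> x $ i \<le> a $ i + l / real N * real k + l / real N"
        using k by simp
      ultimately show "a $ i \<le> x $ i \<and> x $ i \<le> a $ i + l" by linarith
    qed
  qed
qed

text \<open>Cells are closed, so neighbours overlap; different digits differ in some coordinate, and
  the overlap lies in a hyperplane orthogonal to that axis.\<close>

lemma cube_children_negligible:
  fixes a :: "real^'n"
  assumes N: "N > 0" and l: "l > 0" and v: "v \<in> digits N" "v' \<in> digits N" "v \<noteq> v'"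
  shows "negligible (cube (a + (l / real N) *\<^sub>R v) (l / real N) \<inter> cube (a + (l / real N) *\<^sub>R v') (l / real N))"
proof -
  obtain i where i: "v $ i \<noteq> v' $ i" using v(3) by (auto simp: vec_eq_iff)
  obtain k k' where k: "v $ i = real k" "v' $ i = real k'" using v by (auto simp: digits_def) metis
  define c where "c = a $ i + (l / real N) * max (real k) (real k')"
  have "cube (a + (l / real N) *\<^sub>R v) (l / real N) \<inter> cube (a + (l / real N) *\<^sub>R v') (l / real N) \<subseteq> {x. x $ i = c}"
  proof
    fix x assume "x \<in> cube (a + (l / real N) *\<^sub>R v) (l / real N) \<inter> cube (a + (l / real N) *\<^sub>R v') (l / real N)"
    then have "(a + (l / real N) *\<^sub>R v) $ i \<le> x $ i \<and> x $ i \<le> (a + (l / real N) *\<^sub>R v) $ i + l / real N"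
      "(a + (l / real N) *\<^sub>R v') $ i \<le> x $ i \<and> x $ i \<le> (a + (l / real N) *\<^sub>R v') $ i + l / real N"
      unfolding mem_cube Int_iff by blast+
    then have x: "a $ i + l / real N * real k \<le> x $ i" "x $ i \<le> a $ i + l / real N * real k + l / real N"
      "a $ i + l / real N * real k' \<le> x $ i" "x $ i \<le> a $ i + l / real N * real k' + l / real N"
      using k by auto
    have ineq: "l / real N * real p + l / real N \<le> l / real N * real q" if "p < q" for p q :: nat
    proof -
      have "l / real N * (real p + 1) \<le> l / real N * real q" using that l N by (intro mult_left_mono) auto
      then show ?thesis by (simp add: distrib_left)
    qed
    have "k < k' \<or> k' < k" using i k by auto
    then have "x $ i = c"
    proof
      assume kk: "k < k'"
      then have "c = a $ i + l / real N * real k'" by (simp add: c_def)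
      then show ?thesis using ineq[OF kk] x by linarith
    next
      assume kk: "k' < k"
      then have "c = a $ i + l / real N * real k" by (simp add: c_def)
      then show ?thesis using ineq[OF kk] x by linarith
    qed
    then show "x \<in> {x. x $ i = c}" by simp
  qed
  moreover have "negligible {x :: real^'n. x $ i = c}"
    using negligible_standard_hyperplane[of "axis i 1 :: real^'n" c]
    by (auto simp: inner_axis Basis_vec_def)
  ultimately show ?thesis using negligible_subset by blast
qed

lemma integral_cube_children:
  fixes f :: "real^'n \<Rightarrow> real"
  assumes N: "N > 0" and l: "l > 0" and f: "\<And>b r. f integrable_on cube b r"
  shows "integral (cube a l) f = (\<Sum>v\<in>digits N. integral (cube (a + (l / real N) *\<^sub>R v) (l / real N)) f)"
proof -
  have "(f has_integral (\<Sum>v\<in>digits N. integral (cube (a + (l / real N) *\<^sub>R v) (l / real N)) f))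
    (\<Union>v\<in>digits N. cube (a + (l / real N) *\<^sub>R v) (l / real N))"
    by (intro has_integral_UN finite_digits integrable_integral f)
       (auto simp: pairwise_def intro: cube_children_negligible[OF N l])
  then show ?thesis unfolding cube_children[OF N l, symmetric] by (rule integral_unique)
qed

lemma corner_snoc: "corner N (w @ [v]) a l = corner N w a l + (l / real N ^ length w / real N) *\<^sub>R v"
  by (simp add: corner_append)

lemma integral_cell_children:
  fixes f :: "real^'n \<Rightarrow> real"
  assumes N: "N > 0" and l: "l > 0" and f: "\<And>b r. f integrable_on cube b r"
  shows "(\<Sum>v\<in>digits N. integral (cell N (w @ [v]) a l) f) = integral (cell N w a l) f"
  unfolding cell_def corner_snoc
  using integral_cube_children[OF N _ f, of "l / real N ^ length w" "corner N w a l"] l N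
  by (simp add: mult.commute)

lemma cell_subset_cube:
  assumes N: "N > 0" and "l > 0" "set w \<subseteq> digits N"
  shows "cell N w a l \<subseteq> cube a l"
  using assms(2,3)
proof (induction w arbitrary: a l)
  case Nil then show ?case by (simp add: cell_Nil)
next
  case (Cons v w)
  have "cell N (v # w) a l \<subseteq> cube (a + (l / real N) *\<^sub>R v) (l / real N)"
    unfolding cell_Cons using Cons N by auto
  also have "\<dots> \<subseteq> cube a l" unfolding cube_children[OF N \<open>l > 0\<close>, of a] using Cons.prems by auto
  finally show ?case .
qed

lemma cell_append_subset:
  assumes N: "N > 0" and "l > 0" "set w \<subseteq> digits N"
  shows "cell N (u @ w) a l \<subseteq> cell N u a l"
  unfolding cell_append using cell_subset_cube[OF N _ assms(3), of "l / real N ^ length u" "corner N u a l"] assms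
  by (simp add: cell_def)

lemma corner_in_cell: "l > 0 \<Longrightarrow> corner N w a l \<in> cell N w a l"
  by (simp add: cell_def mem_cube)

lemma cell_cover:
  assumes N: "N > 0" and "l > 0" "x \<in> cube a l"
  shows "\<exists>w. set w \<subseteq> digits N \<and> length w = k \<and> x \<in> cell N w a l"
  using assms(2,3)
proof (induction k arbitrary: a l)
  case 0 then show ?case by (auto simp: cell_Nil)
next
  case (Suc k)
  obtain v where v: "v \<in> digits N" "x \<in> cube (a + (l / real N) *\<^sub>R v) (l / real N)"
    using Suc.prems cube_children[OF N, of l a] by auto
  have "l / real N > 0" using Suc.prems N by simp
  from Suc.IH[OF this v(2)] obtain w where "set w \<subseteq> digits N" "length w = k" "x \<in> cell N w (a + (l / real N) *\<^sub>R v) (l / real N)"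
    by blast
  then show ?case using v by (intro exI[of _ "v # w"]) (auto simp: cell_Cons)
qed

lemma stops_False: "stops D (\<lambda>_. False) n w = ext D (length w + n) w"
proof (induction n arbitrary: w)
  case 0 then show ?case by (auto simp: ext_def)
next
  case (Suc n)
  have "x \<in> (\<Union>v\<in>D. ext D (length (w @ [v]) + n) (w @ [v])) \<longleftrightarrow> x \<in> ext D (length w + Suc n) w" for x
  proof
    assume "x \<in> (\<Union>v\<in>D. ext D (length (w @ [v]) + n) (w @ [v]))"
    then obtain v u where "v \<in> D" "x = w @ v # u" "set u \<subseteq> D" "length u = n" by (auto simp: ext_def)
    then show "x \<in> ext D (length w + Suc n) w" unfolding ext_def by (intro CollectI exI[of _ "v # u"]) auto
  next
    assume "x \<in> ext D (length w + Suc n) w"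
    then obtain u where u: "x = w @ u" "set u \<subseteq> D" "length u = Suc n" by (auto simp: ext_def)
    then obtain v u' where "u = v # u'" by (cases u) auto
    with u show "x \<in> (\<Union>v\<in>D. ext D (length (w @ [v]) + n) (w @ [v]))" by (auto simp: ext_def intro!: bexI[of _ v])
  qed
  then show ?case using Suc by auto
qed

text \<open>Volume count: a cell of side \<sigma> that meets V lies within 2\<sigma> + \<sigma> of p
  in every coordinate, hence in a cube of side 6\<sigma>, and cells of one level do not overlap.
  Non-overlap enters through \<open>sum_stops_eq\<close> for the integral of the indicator of that
  cube.\<close>

lemma card_cells_meeting:
  fixes a p :: "real^'n"
  assumes N: "N > 0" and l: "l > 0" and r: "r \<le> 2 * (l / real N ^ k)"
    and V: "\<And>y i. y \<in> V \<Longrightarrow> \<bar>y $ i - p $ i\<bar> \<le> r"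
  shows "card {W. set W \<subseteq> digits N \<and> length W = k \<and> cell N W a l \<inter> V \<noteq> {}} \<le> 6 ^ CARD('n)"
proof -
  define \<sigma> where "\<sigma> = l / real N ^ k"
  have \<sigma>: "\<sigma> > 0" using l N by (simp add: \<sigma>_def)
  let ?M = "{W. set W \<subseteq> digits N \<and> length W = k \<and> cell N W a l \<inter> V \<noteq> {}}"
  define Bx where "Bx = cube (p - (\<chi> i. 3 * \<sigma>)) (6 * \<sigma>)"
  define f where "f = (indicator Bx :: real^'n \<Rightarrow> real)"
  have f_int: "f integrable_on S" if "S = cbox u v" for S u v
  proof -
    have "(\<lambda>x. 1::real) integrable_on (Bx \<inter> S)" unfolding that Bx_def cube_def Int_interval by (rule integrable_const)
    then have "(\<lambda>x. if x \<in> Bx then 1 else 0 :: real) integrable_on S" by (simp add: integrable_restrict_Int)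
    moreover have "f = (\<lambda>x. if x \<in> Bx then 1 else 0)" by (auto simp: f_def indicator_def)
    ultimately show ?thesis by simp
  qed
  then have fi: "f integrable_on cube b t" for b t by (simp add: cube_def)
  have sub: "cell N W a l \<subseteq> Bx" if WM: "W \<in> ?M" for W
  proof -
    obtain y where y: "y \<in> cell N W a l" "y \<in> V" using WM by auto
    show ?thesis
    proof
      fix x assume x: "x \<in> cell N W a l"
      show "x \<in> Bx" unfolding Bx_def mem_cube
      proof
        fix i
        have "\<bar>x $ i - y $ i\<bar> \<le> \<sigma>"
        proof -
          have "corner N W a l $ i \<le> x $ i \<and> x $ i \<le> corner N W a l $ i + \<sigma>"
            "corner N W a l $ i \<le> y $ i \<and> y $ i \<le> corner N W a l $ i + \<sigma>"
            using x y WM by (auto simp: cell_def mem_cube \<sigma>_def)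
          then show ?thesis by linarith
        qed
        moreover have "\<bar>y $ i - p $ i\<bar> \<le> 2 * \<sigma>" using V[OF y(2), of i] r by (simp add: \<sigma>_def)
        ultimately show "(p - (\<chi> i. 3 * \<sigma>)) $ i \<le> x $ i \<and> x $ i \<le> (p - (\<chi> i. 3 * \<sigma>)) $ i + 6 * \<sigma>" by simp linarith
      qed
    qed
  qed
  have S: "stops (digits N) (\<lambda>_. False) k [] = {W. set W \<subseteq> digits N \<and> length W = k}"
    unfolding stops_False by (auto simp: ext_def)
  have fS: "finite {W. set W \<subseteq> (digits N :: (real^'n) set) \<and> length W = k}"
    by (rule finite_lists_length_eq[OF finite_digits])
  have "real (card ?M) * \<sigma> ^ CARD('n) = (\<Sum>W\<in>?M. \<sigma> ^ CARD('n))" by simp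
  also have "\<dots> = (\<Sum>W\<in>?M. integral (cell N W a l) f)"
  proof (rule sum.cong[OF refl])
    fix W assume W: "W \<in> ?M"
    have "integral (cell N W a l) f = integral (cell N W a l) (\<lambda>_. 1)"
      by (rule integral_cong) (use sub[OF W] in \<open>auto simp: f_def indicator_def\<close>)
    also have "\<dots> = measure lborel (cell N W a l)" by (simp add: cell_def cube_def)
    finally show "\<sigma> ^ CARD('n) = integral (cell N W a l) f" using W \<sigma> by (simp add: cell_def content_cube \<sigma>_def)
  qed
  also have "\<dots> \<le> (\<Sum>W\<in>{W. set W \<subseteq> digits N \<and> length W = k}. integral (cell N W a l) f)"
    by (rule sum_mono2[OF fS]) (auto intro!: integral_nonneg fi simp: cell_def, auto simp: f_def)
  also have "\<dots> = integral (cell N [] a l) f"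
    unfolding S[symmetric] by (rule sum_stops_eq[OF finite_digits integral_cell_children[OF N l fi]])
  also have "\<dots> \<le> integral Bx (\<lambda>_. 1)"
  proof -
    have "integral (cube a l) f = integral (Bx \<inter> cube a l) (\<lambda>_. 1)"
      unfolding f_def by (subst integral_restrict_Int[symmetric]) (auto intro!: integral_cong simp: indicator_def)
    also have "\<dots> \<le> integral Bx (\<lambda>_. 1)"
    proof (rule integral_subset_le)
      show "(\<lambda>_. 1::real) integrable_on Bx \<inter> cube a l" unfolding Bx_def cube_def Int_interval by (rule integrable_const)
      show "(\<lambda>_. 1::real) integrable_on Bx" unfolding Bx_def cube_def by (rule integrable_const)
    qed auto
    finally show ?thesis by (simp add: cell_Nil)
  qed
  also have "\<dots> = (6 * \<sigma>) ^ CARD('n)"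
    using content_cube[of "6 * \<sigma>" "p - (\<chi> i. 3 * \<sigma>)"] \<sigma> by (simp add: Bx_def cube_def)
  finally have "real (card ?M) * \<sigma> ^ CARD('n) \<le> 6 ^ CARD('n) * \<sigma> ^ CARD('n)" by (simp add: power_mult_distrib)
  then have "real (card ?M) \<le> real (6 ^ CARD('n))" using \<sigma> by (simp add: mult_le_cancel_right)
  then show ?thesis by (simp only: of_nat_le_iff)
qed


section \<open>Upper and lower bounds for Hausdorff measure\<close>

lemma hausdorff_premeasure_le: "U \<in> delta_covers \<delta> A \<Longrightarrow> hausdorff_premeasure \<delta> s A \<le> (\<Sum>i. hausdorff_gauge s (U i))"
  unfolding hausdorff_premeasure_def by (rule INF_lower)

lemma hausdorff_premeasure_zero:
  assumes "hausdorff_measure s A = 0" "\<delta> > 0" "\<epsilon> > 0"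
  shows "\<exists>U \<in> delta_covers \<delta> A. (\<Sum>i. hausdorff_gauge s (U i)) < ennreal \<epsilon>"
proof -
  have "hausdorff_premeasure \<delta> s A \<le> hausdorff_measure s A"
    unfolding hausdorff_measure_def by (rule SUP_upper) (use assms in simp)
  then have "hausdorff_premeasure \<delta> s A < ennreal \<epsilon>" using assms by simp
  then show ?thesis unfolding hausdorff_premeasure_def INF_less_iff .
qed

lemma cube_bounded_diameter:
  fixes a :: "real^'n"
  assumes "l \<ge> 0"
  shows "bounded (cube a l)" "diameter (cube a l) \<le> real CARD('n) * l"
proof -
  show "bounded (cube a l)" by (simp add: cube_def bounded_cbox)
  show "diameter (cube a l) \<le> real CARD('n) * l"
  proof (rule diameter_le)
    show "cube a l \<noteq> {} \<or> 0 \<le> real CARD('n) * l" using assms by simp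
    fix x y assume xy: "x \<in> cube a l" "y \<in> cube a l"
    have "norm (x - y) \<le> (\<Sum>i\<in>UNIV. \<bar>(x - y) $ i\<bar>)" by (rule norm_le_l1_cart)
    also have "\<dots> \<le> (\<Sum>i\<in>(UNIV :: 'n set). l)"
    proof (rule sum_mono)
      fix i
      have "a $ i \<le> x $ i \<and> x $ i \<le> a $ i + l" "a $ i \<le> y $ i \<and> y $ i \<le> a $ i + l"
        using xy unfolding mem_cube by blast+
      then show "\<bar>(x - y) $ i\<bar> \<le> l" by simp linarith
    qed
    finally show "norm (x - y) \<le> real CARD('n) * l" by simp
  qed
qed

text \<open>Dyadic cover: 2^(d k) cells of diameter at most d l 2^(-k) have total gauge at most (d
  l)^s 2^((d-s) k), which tends to 0.\<close>

lemma hausdorff_measure_above_dim: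
  fixes A :: "(real^'n) set"
  assumes A: "A \<subseteq> cube a l" and l: "l > 0" and s: "s > real CARD('n)"
  shows "hausdorff_measure s A = 0"
proof -
  define d where "d = real CARD('n)"
  have d: "d \<ge> 1" by (simp add: d_def Suc_leI)
  have sd: "s > d" using s by (simp add: d_def)
  let ?W = "\<lambda>k. {w. set w \<subseteq> (digits 2 :: (real^'n) set) \<and> length w = k}"
  have fW: "finite (?W k)" for k by (rule finite_lists_length_eq[OF finite_digits])
  have bound: "hausdorff_premeasure \<delta> s A \<le> ennreal ((d * l) powr s * (2 powr (d - s)) ^ k)"
    if \<delta>: "d * (l / 2 ^ k) \<le> \<delta>" for \<delta> k
  proof -
    obtain ws where ws: "set ws = ?W k" "distinct ws" using finite_distinct_list[OF fW] by blast
    define U where "U = (\<lambda>i. if i < length ws then cell 2 (ws ! i) a l else {})"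
    have cb: "bounded (cell 2 w a l) \<and> diameter (cell 2 w a l) \<le> d * (l / 2 ^ k)" if "w \<in> ?W k" for w
      using cube_bounded_diameter[of "l / 2 ^ k" "corner 2 w a l"] that l by (simp add: cell_def d_def)
    have inW: "ws ! i \<in> ?W k" if "i < length ws" for i using ws(1) that nth_mem by blast
    have dpos: "0 \<le> d * (l / 2 ^ k)" using d l by simp
    have "U \<in> delta_covers \<delta> A"
      unfolding delta_covers_def
    proof (intro CollectI conjI allI)
      show "A \<subseteq> (\<Union>i. U i)"
      proof
        fix x assume "x \<in> A"
        then obtain w where w: "w \<in> ?W k" "x \<in> cell 2 w a l" using cell_cover[of 2 l x a k] A l by auto
        then obtain i where "i < length ws" "ws ! i = w" using ws(1) by (metis in_set_conv_nth)
        then show "x \<in> (\<Union>i. U i)" using w by (auto simp: U_def)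
      qed
      fix i
      show "bounded (U i)" using cb[OF inW] by (auto simp: U_def)
      show "diameter (U i) \<le> \<delta>" using cb[OF inW, of i] \<delta> dpos by (auto simp: U_def intro: order_trans)
    qed
    then have "hausdorff_premeasure \<delta> s A \<le> (\<Sum>i. hausdorff_gauge s (U i))" by (rule hausdorff_premeasure_le)
    also have "\<dots> = (\<Sum>i<length ws. hausdorff_gauge s (U i))"
      by (rule suminf_finite) (auto simp: U_def hausdorff_gauge_def)
    also have "\<dots> \<le> (\<Sum>i<length ws. ennreal ((d * (l / 2 ^ k)) powr s))"
    proof (rule sum_mono)
      fix i assume i: "i \<in> {..<length ws}"
      have "diameter (U i) powr s \<le> (d * (l / 2 ^ k)) powr s"
        using cb[OF inW, of i] i sd d
        by (intro powr_mono2) (auto simp: U_def intro!: diameter_ge_0)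
      then show "hausdorff_gauge s (U i) \<le> ennreal ((d * (l / 2 ^ k)) powr s)"
        using sd d by (auto simp: hausdorff_gauge_def ennreal_leI)
    qed
    also have "\<dots> = ennreal (real (length ws) * (d * (l / 2 ^ k)) powr s)"
      by (simp add: ennreal_mult'' ennreal_of_nat_eq_real_of_nat)
    also have "real (length ws) = (2 powr d) ^ k"
    proof -
      have "length ws = card (set ws)" using ws(2) by (simp add: distinct_card)
      also have "\<dots> = (2 ^ CARD('n)) ^ k" unfolding ws(1) by (simp add: card_lists_length_eq[OF finite_digits] card_digits)
      finally show ?thesis by (simp add: d_def powr_realpow)
    qed
    also have "(2 powr d) ^ k * (d * (l / 2 ^ k)) powr s = (d * l) powr s * (2 powr (d - s)) ^ k"
    proof -
      have "(d * (l / 2 ^ k)) powr s = (d * l) powr s * (2 powr (- s)) ^ k"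
      proof -
        have "(d * (l / 2 ^ k)) powr s = (d * l * (2 powr - real k)) powr s" by (simp add: powr_minus_divide powr_realpow)
        also have "\<dots> = (d * l) powr s * (2 powr (- real k)) powr s" by (rule powr_mult)
        also have "(2 powr (- real k)) powr s = (2 powr (- s)) ^ k"
          by (simp add: powr_powr powr_realpow[symmetric] mult.commute)
        finally show ?thesis .
      qed
      then show ?thesis by (simp add: power_mult_distrib[symmetric] powr_add[symmetric] diff_conv_add_uminus del: add_uminus_conv_diff)
    qed
    finally show ?thesis .
  qed
  have "hausdorff_premeasure \<delta> s A \<le> 0" if \<delta>: "\<delta> > 0" for \<delta>
  proof (rule ennreal_le_epsilon)
    fix e :: real assume e: "e > 0"
    have q: "2 powr (d - s) < 1" using sd by (simp add: powr_less_one)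
    have "(\<lambda>k. (d * l) powr s * (2 powr (d - s)) ^ k) \<longlonglongrightarrow> (d * l) powr s * 0"
      by (intro tendsto_mult_left LIMSEQ_power_zero) (use q in auto)
    then have e1: "\<forall>\<^sub>F k in sequentially. (d * l) powr s * (2 powr (d - s)) ^ k < e" using e by (intro order_tendstoD) auto
    have "(\<lambda>k. (d * l) * (1 / 2) ^ k) \<longlonglongrightarrow> (d * l) * 0"
      by (intro tendsto_mult_left LIMSEQ_power_zero) auto
    then have e2: "\<forall>\<^sub>F k in sequentially. (d * l) * (1 / 2) ^ k < \<delta>" using \<delta> by (intro order_tendstoD) auto
    obtain k where k: "(d * l) powr s * (2 powr (d - s)) ^ k < e" "(d * l) * (1 / 2) ^ k < \<delta>"
      using eventually_happens[OF eventually_conj[OF e1 e2]] by auto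
    then have "d * (l / 2 ^ k) \<le> \<delta>" by (simp add: power_one_over)
    from bound[OF this] k(1) show "hausdorff_premeasure \<delta> s A \<le> 0 + ennreal e"
      by (simp add: order_trans[OF _ ennreal_leI[OF less_imp_le]])
  qed
  then show ?thesis unfolding hausdorff_measure_def by (auto simp: SUP_le_iff le_zero_eq intro!: antisym)
qed

text \<open>Exponent 0 is treated apart because the hypothesis covers only s > 0: a cover with
  counting gauge below 1 consists of empty sets, so A would be empty, and then the measure for d/2
  would vanish as well.\<close>

lemma hausdorff_dim_eqI:
  fixes A :: "(real^'n) set"
  assumes A: "A \<subseteq> cube a l" and l: "l > 0"
    and pos: "\<And>s. 0 < s \<Longrightarrow> s < real CARD('n) \<Longrightarrow> hausdorff_measure s A \<noteq> 0"
  shows "hausdorff_dim A = of_nat CARD('n)"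
proof (rule antisym)
  define d where "d = real CARD('n)"
  have d: "d > 0" by (simp add: d_def)
  have dn: "of_nat CARD('n) = ennreal d" by (simp add: d_def ennreal_of_nat_eq_real_of_nat)
  show "hausdorff_dim A \<le> of_nat CARD('n)"
  proof (rule ennreal_le_epsilon)
    fix e :: real assume e: "e > 0"
    have "hausdorff_dim A \<le> ennreal (d + e)"
      unfolding hausdorff_dim_def
    proof (rule Inf_lower)
      show "ennreal (d + e) \<in> {ennreal s | s. 0 \<le> s \<and> hausdorff_measure s A = 0}"
        using hausdorff_measure_above_dim[OF A l, of "d + e"] e d
        by (intro CollectI exI[of _ "d + e"]) (simp add: d_def)
    qed
    also have "\<dots> = of_nat CARD('n) + ennreal e" using d e by (simp add: dn)
    finally show "hausdorff_dim A \<le> of_nat CARD('n) + ennreal e" .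
  qed
  have zero: "hausdorff_measure 0 A \<noteq> 0"
  proof
    assume "hausdorff_measure 0 A = 0"
    then obtain U where U: "U \<in> delta_covers 1 A" "(\<Sum>i. hausdorff_gauge 0 (U i)) < ennreal 1"
      using hausdorff_premeasure_zero[of 0 A 1 1] by auto
    have "U i = {}" for i
    proof (rule ccontr)
      assume "U i \<noteq> {}"
      then have "1 = (\<Sum>i\<in>{i}. hausdorff_gauge 0 (U i))" by (simp add: hausdorff_gauge_def)
      also have "\<dots> \<le> (\<Sum>i. hausdorff_gauge 0 (U i))" by (rule sum_le_suminf) auto
      finally show False using U(2) by simp
    qed
    then have "A = {}" using U(1) by (auto simp: delta_covers_def)
    have "hausdorff_premeasure \<delta> (d/2) A \<le> 0" if "\<delta> > 0" for \<delta>
    proof -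
      have "(\<lambda>i::nat. {}) \<in> delta_covers \<delta> A" using \<open>A = {}\<close> that by (auto simp: delta_covers_def)
      from hausdorff_premeasure_le[OF this, of "d/2"] show ?thesis by (simp add: hausdorff_gauge_def)
    qed
    then have "hausdorff_measure (d/2) A = 0"
      unfolding hausdorff_measure_def by (auto simp: SUP_le_iff le_zero_eq intro!: antisym)
    then show False using pos[of "d/2"] d by (simp add: d_def)
  qed
  show "of_nat CARD('n) \<le> hausdorff_dim A"
    unfolding hausdorff_dim_def dn
  proof (rule Inf_greatest)
    fix x assume "x \<in> {ennreal s | s. 0 \<le> s \<and> hausdorff_measure s A = 0}"
    then obtain s where s: "x = ennreal s" "0 \<le> s" "hausdorff_measure s A = 0" by auto
    then have "s \<ge> d" using zero pos[of s] by (cases "s = 0") (auto simp: d_def not_less[symmetric])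
    then show "ennreal d \<le> x" using s by (simp add: ennreal_leI)
  qed
qed

text \<open>Replaces a diameter, possibly 0, by a strictly larger radius at an arbitrarily small
  cost in the gauge, so that covering sets can be made open.\<close>

lemma radius_above:
  fixes t :: real
  assumes "t \<ge> 0" "t < b" "\<epsilon> > 0" "s > 0"
  shows "\<exists>r. t < r \<and> r \<le> b \<and> r powr s \<le> t powr s + \<epsilon>"
proof -
  define r where "r = min b ((t powr s + \<epsilon>) powr (1/s))"
  have pos: "t powr s + \<epsilon> > 0" using assms(3) by (simp add: add_nonneg_pos)
  have "t = (t powr s) powr (1/s)" using assms by (simp add: powr_powr)
  also have "\<dots> < (t powr s + \<epsilon>) powr (1/s)" using assms by (intro powr_less_mono2) auto
  finally have 1: "t < r" using assms by (simp add: r_def)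
  have "r powr s \<le> ((t powr s + \<epsilon>) powr (1/s)) powr s"
    using 1 assms by (intro powr_mono2) (auto simp: r_def)
  also have "\<dots> = t powr s + \<epsilon>" using pos assms by (simp add: powr_powr)
  finally show ?thesis using 1 by (intro exI[of _ r]) (auto simp: r_def)
qed

lemma grid_level:
  fixes r :: real
  assumes "0 < r" "r \<le> l" "N \<ge> 2"
  shows "\<exists>k. l / real N ^ Suc k < r \<and> r \<le> l / real N ^ k"
proof -
  have "(\<lambda>k. l * (1 / real N) ^ k) \<longlonglongrightarrow> l * 0" using assms by (intro tendsto_mult_left LIMSEQ_power_zero) auto
  then have "\<forall>\<^sub>F k in sequentially. l * (1 / real N) ^ k < r" using assms by (intro order_tendstoD) auto
  then obtain k where "l * (1 / real N) ^ k < r" by (auto simp: eventually_sequentially)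
  then have ex: "\<exists>k. l / real N ^ k < r" by (intro exI[of _ k]) (simp add: power_one_over)
  define k where "k = (LEAST k. l / real N ^ k < r)"
  have k: "l / real N ^ k < r" unfolding k_def using ex by (rule LeastI_ex)
  have "k \<noteq> 0" using k assms by (cases k) auto
  then obtain j where j: "k = Suc j" by (cases k) auto
  have "\<not> l / real N ^ j < r" using not_less_Least[of j "\<lambda>k. l / real N ^ k < r"] j by (simp add: k_def[symmetric])
  then show ?thesis using k j by (intro exI[of _ j]) auto
qed

text \<open>A cover of small gauge is made open; by compactness it already covers some stage j, and
  finitely many members suffice. Each member is replaced by the at most 6^d cells of comparable size
  that meet it, and the words of these cells contradict hypothesis \<open>cover\<close>.\<close>

lemma hausdorff_measure_pos:
  fixes a :: "real^'n" and \<G> :: "nat \<Rightarrow> (real^'n) list set"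
  assumes N: "N \<ge> 2" and l: "l > 0" and s: "s > 0" and \<eta>: "\<eta> > 0"
    and fin: "\<And>j. finite (\<G> j)" "\<And>j w. w \<in> \<G> j \<Longrightarrow> set w \<subseteq> digits N"
    and dec: "\<And>j. (\<Union>w\<in>\<G> (Suc j). cell N w a l) \<subseteq> (\<Union>w\<in>\<G> j. cell N w a l)"
    and cover: "\<And>j \<W> L0. finite \<W> \<Longrightarrow>
       (\<And>L w z. L \<ge> L0 \<Longrightarrow> w \<in> \<G> j \<Longrightarrow> z \<in> ext (digits N) L w \<Longrightarrow> \<exists>W\<in>\<W>. prefix W z) \<Longrightarrow>
       \<eta> \<le> (\<Sum>W\<in>\<W>. (real N powr (-s)) ^ length W)"
    and A: "(\<Inter>j. \<Union>w\<in>\<G> j. cell N w a l) \<subseteq> A"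
  shows "hausdorff_measure s A \<noteq> 0"
proof
  assume zero: "hausdorff_measure s A = 0"
  have N0: "N > 0" using N by simp
  define K where "K = (\<lambda>j. \<Union>w\<in>\<G> j. cell N w a l)"
  \<comment> \<open>A covering set of radius r treated at level k meets at most 6^d cells, each of
    weight N^(-s k), which is at most (N r / l)^s by the choice of k.\<close>
  define M where "M = 6 ^ CARD('n) * (real N / l) powr s"
  have M: "M > 0" using N l by (simp add: M_def)
  \<comment> \<open>The gauges and the enlargements of the radii contribute M c each, so the words
    have total weight at most \<eta> / 2.\<close>
  define c where "c = \<eta> / (4 * M)"
  have c: "c > 0" using \<eta> M by (simp add: c_def)
  \<comment> \<open>Diameters up to l / 2 leave room for strictly larger radii not exceeding l, so
    that a grid level exists for each.\<close>
  obtain U where U: "U \<in> delta_covers (l/2) A" "(\<Sum>i. hausdorff_gauge s (U i)) < ennreal c"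
    using hausdorff_premeasure_zero[OF zero, of "l/2" c] l c by auto
  have Ub: "bounded (U i)" "diameter (U i) \<le> l/2" "A \<subseteq> (\<Union>i. U i)" for i using U(1) by (auto simp: delta_covers_def)
  have "\<exists>r. diameter (U i) < r \<and> r \<le> l \<and> r powr s \<le> diameter (U i) powr s + c * (1/2) ^ Suc i" for i
    by (rule radius_above) (use Ub(2)[of i] l c s diameter_ge_0[OF Ub(1)] in auto)
  then obtain r where r: "\<And>i. diameter (U i) < r i \<and> r i \<le> l \<and> r i powr s \<le> diameter (U i) powr s + c * (1/2) ^ Suc i" by metis
  have rpos: "r i > 0" for i using r[of i] diameter_ge_0[OF Ub(1), of i] by linarith
  have "\<exists>k. l / real N ^ Suc k < r i \<and> r i \<le> l / real N ^ k" for i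
    using grid_level[OF rpos _ N] r by blast
  then obtain k where k: "\<And>i. l / real N ^ Suc (k i) < r i \<and> r i \<le> l / real N ^ k i" by metis
  define V where "V = (\<lambda>i. \<Union>x\<in>U i. ball x (r i))"
  define WW where "WW = (\<lambda>i. {W. set W \<subseteq> digits N \<and> length W = k i \<and> cell N W a l \<inter> V i \<noteq> {}})"
  have openV: "open (V i)" for i unfolding V_def by auto
  have UV: "U i \<subseteq> V i" for i unfolding V_def using rpos by auto
  have cardW: "card (WW i) \<le> (if U i = {} then 0 else 6 ^ CARD('n))" for i
  proof (cases "U i = {}")
    case True then show ?thesis by (simp add: WW_def V_def)
  next
    case False
    then obtain p where p: "p \<in> U i" by blast
    have "card (WW i) \<le> 6 ^ CARD('n)"
      unfolding WW_def
    proof (rule card_cells_meeting[OF N0 l])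
      show "2 * r i \<le> 2 * (l / real N ^ k i)" using k[of i] by simp
      fix y j assume "y \<in> V i"
      then obtain x where x: "x \<in> U i" "dist x y < r i" by (auto simp: V_def)
      have "dist x p \<le> diameter (U i)" by (rule diameter_bounded_bound[OF Ub(1) x(1) p])
      then have "dist y p \<le> 2 * r i" using x(2) r[of i] dist_triangle[of y p x] by (simp add: dist_commute)
      moreover have "\<bar>(y - p) $ j\<bar> \<le> norm (y - p)" by (rule component_le_norm_cart)
      ultimately show "\<bar>y $ j - p $ j\<bar> \<le> 2 * r i" by (simp add: dist_norm)
    qed
    then show ?thesis using False by simp
  qed
  have finW: "finite (WW i)" for i
    by (rule finite_subset[OF _ finite_lists_length_eq[OF finite_digits, of N "k i"]]) (auto simp: WW_def)
  have wsum: "(\<Sum>W\<in>WW i. (real N powr (-s)) ^ length W) \<le> M * (if U i = {} then 0 else diameter (U i) powr s) + M * c * (1/2) ^ Suc i" for i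
  proof -
    have pk: "(real N powr (-s)) ^ k i = real N powr (- s * real (k i))"
      using N0 by (simp add: powr_realpow[symmetric] powr_powr)
    have pk2: "(1 / real N ^ k i) powr s = real N powr (- s * real (k i))"
    proof -
      have "1 / real N ^ k i = real N powr (- real (k i))" using N0 by (simp add: powr_minus_divide powr_realpow)
      then show ?thesis by (simp add: powr_powr mult.commute)
    qed
    have "(real N powr (-s)) ^ k i = (1 / real N ^ k i) powr s" unfolding pk pk2 ..
    also have "\<dots> \<le> (real N / l * r i) powr s"
    proof (rule powr_mono2)
      have "l < r i * (real N * real N ^ k i)" using k[of i] N0 by (simp add: field_simps)
      then show "1 / real N ^ k i \<le> real N / l * r i" using N0 l by (simp add: field_simps)
    qed (use s in auto)
    also have "\<dots> = (real N / l) powr s * r i powr s" by (rule powr_mult)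
    finally have w1: "(real N powr (-s)) ^ k i \<le> (real N / l) powr s * r i powr s" .
    have "(\<Sum>W\<in>WW i. (real N powr (-s)) ^ length W) = real (card (WW i)) * (real N powr (-s)) ^ k i"
      by (simp add: WW_def)
    also have "\<dots> \<le> (if U i = {} then 0 else 6 ^ CARD('n)) * ((real N / l) powr s * r i powr s)"
    proof (intro mult_mono w1)
      have "real (card (WW i)) \<le> real (if U i = {} then 0 else 6 ^ CARD('n))" using cardW[of i] unfolding of_nat_le_iff .
      then show "real (card (WW i)) \<le> (if U i = {} then 0 else 6 ^ CARD('n))" by (auto split: if_splits)
    qed auto
    also have "\<dots> = (if U i = {} then 0 else M * r i powr s)" by (simp add: M_def)
    also have "\<dots> \<le> (if U i = {} then 0 else M * (diameter (U i) powr s + c * (1/2) ^ Suc i))"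
      using r[of i] M by (auto intro!: mult_left_mono simp del: power_Suc)
    also have "\<dots> \<le> M * (if U i = {} then 0 else diameter (U i) powr s) + M * c * (1/2) ^ Suc i"
      using M c by (auto simp: algebra_simps)
    finally show ?thesis .
  qed
  have compK: "compact (K j)" for j unfolding K_def cell_def cube_def by (intro compact_UN fin compact_cbox)
  have decK: "K (Suc j) \<subseteq> K j" for j using dec by (simp add: K_def)
  have anti: "K j' \<subseteq> K j" if "j \<le> j'" for j j' using lift_Suc_antimono_le[of K, OF decK that] .
  \<comment> \<open>Otherwise the sets K j without the open union are compact, nested and nonempty,
    and a common point lies in A but in no U i.\<close>
  have "\<exists>j. K j \<subseteq> (\<Union>i. V i)"
  proof (rule ccontr)
    assume none: "\<not> ?thesis"
    have "(\<Inter>j. K j - (\<Union>i. V i)) \<noteq> {}"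
    proof (rule compact_nest)
      show "\<And>j. compact (K j - (\<Union>i. V i))" by (intro compact_diff compK open_UN ballI openV)
      show "\<And>j. K j - (\<Union>i. V i) \<noteq> {}" using none by blast
      show "\<And>j j'. j \<le> j' \<Longrightarrow> K j' - (\<Union>i. V i) \<subseteq> K j - (\<Union>i. V i)" using anti by blast
    qed
    then obtain x where x: "x \<in> (\<Inter>j. K j)" "x \<notin> (\<Union>i. V i)" by blast
    then have "x \<in> A" using A by (auto simp: K_def)
    then obtain i where "x \<in> U i" using Ub(3) by blast
    then show False using x(2) UV[of i] by blast
  qed
  then obtain j where j: "K j \<subseteq> (\<Union>i. V i)" by blast
  obtain I where "I \<subseteq> UNIV" and I: "finite I" "K j \<subseteq> (\<Union>i\<in>I. V i)"
    by (rule compactE_image[OF compK openV j])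
  define \<W> where "\<W> = (\<Union>i\<in>I. WW i)"
  obtain L0 where L0: "\<And>i. i \<in> I \<Longrightarrow> k i \<le> L0"
    using finite_nat_set_iff_bounded_le[of "k ` I"] I(1) by auto
  have "\<eta> \<le> (\<Sum>W\<in>\<W>. (real N powr (-s)) ^ length W)"
  proof (rule cover[of \<W> L0 j])
    show "finite \<W>" using I(1) finW by (simp add: \<W>_def)
    fix L w z assume L: "L \<ge> L0" "w \<in> \<G> j" "z \<in> ext (digits N) L w"
    obtain u where u: "z = w @ u" "set u \<subseteq> digits N" "length w + length u = L" using L(3) by (auto simp: ext_def)
    \<comment> \<open>The lower corner represents the fine cell z: it lies in K j, hence in some V
      i, and the ancestor of z at level k i is a cell meeting V i. L0 makes z long enough to have
      that ancestor.\<close>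
    define x where "x = corner N z a l"
    have zd: "set z \<subseteq> digits N" using u fin(2)[OF L(2)] by simp
    have xz: "x \<in> cell N z a l" unfolding x_def by (rule corner_in_cell[OF l])
    have "x \<in> cell N w a l" using cell_append_subset[OF N0 l u(2), of w a] xz u(1) by blast
    then have "x \<in> K j" using L(2) by (auto simp: K_def)
    then obtain i where i: "i \<in> I" "x \<in> V i" using I(2) by blast
    define W where "W = take (k i) z"
    have zW: "z = W @ drop (k i) z" by (simp add: W_def)
    have "x \<in> cell N W a l"
      using cell_append_subset[OF N0 l, of "drop (k i) z" W a] xz zW zd set_drop_subset[of "k i" z] by auto
    moreover have "length W = k i" using L0[OF i(1)] L(1) u by (simp add: W_def)
    moreover have "set W \<subseteq> digits N" using zd set_take_subset[of "k i" z] by (auto simp: W_def)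
    ultimately have "W \<in> WW i" using i(2) by (auto simp: WW_def)
    moreover have "prefix W z" by (simp add: W_def take_is_prefix)
    ultimately show "\<exists>W\<in>\<W>. prefix W z" using i(1) by (auto simp: \<W>_def)
  qed
  also have "\<dots> \<le> (\<Sum>i\<in>I. \<Sum>W\<in>WW i. (real N powr (-s)) ^ length W)"
    unfolding \<W>_def
    using I(1)
  proof (induction I rule: finite_induct)
    case (insert i I)
    have "(\<Sum>W\<in>(\<Union>i\<in>insert i I. WW i). (real N powr (-s)) ^ length W) = (\<Sum>W\<in>WW i \<union> (\<Union>i\<in>I. WW i). (real N powr (-s)) ^ length W)" by simp
    also have "\<dots> \<le> (\<Sum>W\<in>WW i. (real N powr (-s)) ^ length W) + (\<Sum>W\<in>(\<Union>i\<in>I. WW i). (real N powr (-s)) ^ length W)"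
      by (subst sum_Un) (use insert finW in \<open>auto intro!: sum_nonneg\<close>)
    finally show ?case using insert by simp
  qed simp
  also have "\<dots> \<le> (\<Sum>i\<in>I. M * (if U i = {} then 0 else diameter (U i) powr s) + M * c * (1/2) ^ Suc i)"
    by (rule sum_mono[OF wsum])
  also have "\<dots> = M * (\<Sum>i\<in>I. if U i = {} then 0 else diameter (U i) powr s) + M * c * (\<Sum>i\<in>I. (1/2) ^ Suc i)"
    by (simp add: sum.distrib sum_distrib_left)
  also have "\<dots> \<le> M * c + M * c * 1"
  proof (intro add_mono mult_left_mono)
    have "ennreal (\<Sum>i\<in>I. if U i = {} then 0 else diameter (U i) powr s) = (\<Sum>i\<in>I. hausdorff_gauge s (U i))"
    proof -
      have "hausdorff_gauge s (U i) = ennreal (if U i = {} then 0 else diameter (U i) powr s)" for i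
        using s by (simp add: hausdorff_gauge_def)
      then show ?thesis by (simp add: sum_ennreal del: if_split)
    qed
    also have "\<dots> \<le> (\<Sum>i. hausdorff_gauge s (U i))" by (rule sum_le_suminf) (use I in auto)
    also have "\<dots> \<le> ennreal c" using U(2) by simp
    finally show "(\<Sum>i\<in>I. if U i = {} then 0 else diameter (U i) powr s) \<le> c" using c by simp
    have "(\<Sum>i\<in>I. (1/2::real) ^ Suc i) \<le> (\<Sum>i. (1/2) ^ Suc i)"
      by (rule sum_le_suminf) (use I summable_geometric[of "1/2::real"] in \<open>auto simp: summable_Suc_iff\<close>)
    then show "(\<Sum>i\<in>I. (1/2::real) ^ Suc i) \<le> 1" using sums_unique[OF power_half_series] by simp
  qed (use M c in auto)
  also have "\<dots> = \<eta> / 2" using M by (simp add: c_def)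
  finally show False using \<eta> by simp
qed

section \<open>Directional derivatives and weak quasiregularity\<close>

text \<open>Since |X| is at most 2R, the second moment forces the mean of |X| to be at least c R /
  2, and with the small mean of X the mean of |X| - X is at least 3 c R / 8. Indices with X > - c R
  / 16 contribute at most c R / 8 to it, the others at most 4R per unit of mass, which leaves them
  mass c / 16.\<close>

lemma negative_part_mass:
  fixes p X :: "'i \<Rightarrow> real"
  assumes S: "finite S" and p: "\<And>i. i \<in> S \<Longrightarrow> p i \<ge> 0" "(\<Sum>i\<in>S. p i) = 1"
    and X: "\<And>i. i \<in> S \<Longrightarrow> \<bar>X i\<bar> \<le> 2 * R" and R: "R > 0" and c: "c > 0"
    and sq: "(\<Sum>i\<in>S. p i * (X i)\<^sup>2) \<ge> c * R\<^sup>2" and mean: "\<bar>\<Sum>i\<in>S. p i * X i\<bar> \<le> c / 8 * R"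
  shows "(\<Sum>i | i \<in> S \<and> X i \<le> - (c / 16 * R). p i) \<ge> c / 16"
proof -
  let ?T = "{i \<in> S. X i \<le> - (c / 16 * R)}"
  have 1: "(X i)\<^sup>2 \<le> 2 * R * \<bar>X i\<bar>" if "i \<in> S" for i
    using mult_right_mono[OF X[OF that], of "\<bar>X i\<bar>"] by (simp add: power2_eq_square)
  have "c * R\<^sup>2 \<le> (\<Sum>i\<in>S. p i * (2 * R * \<bar>X i\<bar>))"
    by (rule order_trans[OF sq]) (intro sum_mono mult_left_mono 1 p)
  also have "\<dots> = (2 * R) * (\<Sum>i\<in>S. p i * \<bar>X i\<bar>)" by (simp add: sum_distrib_left mult_ac)
  finally have "R * (c * R) \<le> R * (2 * (\<Sum>i\<in>S. p i * \<bar>X i\<bar>))" by (simp add: power2_eq_square mult_ac)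
  then have a: "c * R \<le> 2 * (\<Sum>i\<in>S. p i * \<bar>X i\<bar>)" using R by simp
  have "(\<Sum>i\<in>S. p i * (\<bar>X i\<bar> - X i)) \<le> (\<Sum>i\<in>S. p i * (c / 8 * R) + (if i \<in> ?T then 4 * R * p i else 0))"
  proof (rule sum_mono)
    fix i assume i: "i \<in> S"
    show "p i * (\<bar>X i\<bar> - X i) \<le> p i * (c / 8 * R) + (if i \<in> ?T then 4 * R * p i else 0)"
    proof (cases "i \<in> ?T")
      case True
      have "\<bar>X i\<bar> - X i \<le> 4 * R" using X[OF i] by linarith
      then have "p i * (\<bar>X i\<bar> - X i) \<le> p i * (4 * R)" using p(1)[OF i] by (rule mult_left_mono)
      moreover have "0 \<le> p i * (c / 8 * R)" using p(1)[OF i] c R by simp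
      ultimately show ?thesis using True by (simp add: mult_ac)
    next
      case False
      then have "\<bar>X i\<bar> - X i \<le> c / 8 * R" using i c R by (cases "X i \<ge> 0") auto
      then have "p i * (\<bar>X i\<bar> - X i) \<le> p i * (c / 8 * R)" using p(1)[OF i] by (rule mult_left_mono)
      then show ?thesis unfolding if_not_P[OF False] by (simp only: add_0_right)
    qed
  qed
  also have "\<dots> = c / 8 * R * (\<Sum>i\<in>S. p i) + 4 * R * (\<Sum>i\<in>?T. p i)"
  proof -
    have "(\<Sum>i\<in>S. if i \<in> ?T then 4 * R * p i else 0) = (\<Sum>i\<in>?T. 4 * R * p i)"
      using S by (subst sum.inter_restrict[symmetric]) (auto intro!: sum.cong)
    then show ?thesis by (simp add: sum.distrib sum_distrib_left sum_distrib_right mult_ac)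
  qed
  finally have "(\<Sum>i\<in>S. p i * \<bar>X i\<bar>) - (\<Sum>i\<in>S. p i * X i) \<le> c / 8 * R + 4 * R * (\<Sum>i\<in>?T. p i)"
    using p(2) by (simp add: right_diff_distrib sum_subtractf)
  with a mean have "R * (c / 4) \<le> R * (4 * (\<Sum>i\<in>?T. p i))" by (simp add: algebra_simps abs_le_iff)
  then show ?thesis using R by simp
qed

context bounded_continuous begin

text \<open>The shift c is chosen later so that the function vanishes at the root of a stopping
  tree.\<close>

definition dir :: "real^'n \<Rightarrow> real \<Rightarrow> (real^'n) \<times> real \<Rightarrow> real" where
  "dir e c p = e \<bullet> grad p - c"

lemma dir_alt: "dir e c = (\<lambda>p. (\<Sum>i\<in>UNIV. e $ i * partial (axis i 1, 0) F p) - c)"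
  by (auto simp: dir_def grad_def inner_vec_def)

lemma open_half: "open {p::(real^'n) \<times> real. snd p > 0}"
  by (intro open_Collect_less continuous_intros)

lemma dir_deriv:
  assumes "snd p > 0"
  shows "((\<lambda>t. dir e c (p + t *\<^sub>R b)) has_real_derivative (\<Sum>i\<in>UNIV. e $ i * partial b (partial (axis i 1, 0) F) p)) (at 0)"
    "partial b (dir e c) p = (\<Sum>i\<in>UNIV. e $ i * partial b (partial (axis i 1, 0) F) p)"
proof -
  show 1: "((\<lambda>t. dir e c (p + t *\<^sub>R b)) has_real_derivative (\<Sum>i\<in>UNIV. e $ i * partial b (partial (axis i 1, 0) F) p)) (at 0)"
    unfolding dir_alt
    using DERIV_diff[OF DERIV_sum[of UNIV "\<lambda>t i. e $ i * partial (axis i 1, 0) F (p + t *\<^sub>R b)", OF DERIV_cmult[OF F2(2)[OF assms]]] DERIV_const]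
    by simp
  show "partial b (dir e c) p = (\<Sum>i\<in>UNIV. e $ i * partial b (partial (axis i 1, 0) F) p)"
    by (rule partial_eqI[OF 1])
qed

lemma dir_deriv2:
  assumes "snd p > 0"
  shows "((\<lambda>t. partial b (dir e c) (p + t *\<^sub>R b)) has_real_derivative (\<Sum>i\<in>UNIV. e $ i * partial b (partial b (partial (axis i 1, 0) F)) p)) (at 0)"
    "partial b (partial b (dir e c)) p = (\<Sum>i\<in>UNIV. e $ i * partial b (partial b (partial (axis i 1, 0) F)) p)"
proof -
  have op: "open {t::real. snd (p + t *\<^sub>R b) > 0}"
    by (intro open_Collect_less continuous_intros)
  have "((\<lambda>t. \<Sum>i\<in>UNIV. e $ i * partial b (partial (axis i 1, 0) F) (p + t *\<^sub>R b)) has_real_derivative (\<Sum>i\<in>UNIV. e $ i * partial b (partial b (partial (axis i 1, 0) F)) p)) (at 0)"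
    by (rule DERIV_sum, rule DERIV_cmult, rule F3(2)[OF assms])
  then show 1: "((\<lambda>t. partial b (dir e c) (p + t *\<^sub>R b)) has_real_derivative (\<Sum>i\<in>UNIV. e $ i * partial b (partial b (partial (axis i 1, 0) F)) p)) (at 0)"
    by (rule has_field_derivative_transform_within_open[OF _ op]) (use assms dir_deriv(2) in auto)
  show "partial b (partial b (dir e c)) p = (\<Sum>i\<in>UNIV. e $ i * partial b (partial b (partial (axis i 1, 0) F)) p)"
    by (rule partial_eqI[OF 1])
qed

lemma dir_harmonic: "harmonic_half (dir e c)"
  unfolding harmonic_half_def
proof (intro conjI allI impI ballI)
  fix p b assume p: "0 < snd (p :: (real^'n) \<times> real)"
  show "((\<lambda>t. dir e c (p + t *\<^sub>R b)) has_real_derivative partial b (dir e c) p) (at 0)"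
    using dir_deriv[OF p] by simp
  show "((\<lambda>t. partial b (dir e c) (p + t *\<^sub>R b)) has_real_derivative partial b (partial b (dir e c)) p) (at 0)"
    using dir_deriv2[OF p] by simp
next
  show "continuous_on {p. 0 < snd p} (dir e c)"
    unfolding dir_alt by (intro continuous_intros F_continuous)
  fix b :: "(real^'n) \<times> real"
  have "continuous_on {p. 0 < snd p} (\<lambda>p. \<Sum>i\<in>UNIV. e $ i * partial b (partial (axis i 1, 0) F) p)"
    by (intro continuous_intros F_continuous)
  then show "continuous_on {p. 0 < snd p} (partial b (dir e c))"
    by (rule continuous_on_eq) (simp add: dir_deriv(2))
  have "continuous_on {p. 0 < snd p} (\<lambda>p. \<Sum>i\<in>UNIV. e $ i * partial b (partial b (partial (axis i 1, 0) F)) p)"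
    by (intro continuous_intros F_continuous)
  then show "continuous_on {p. 0 < snd p} (partial b (partial b (dir e c)))"
    by (rule continuous_on_eq) (simp add: dir_deriv2(2))
next
  fix p assume p: "0 < snd (p :: (real^'n) \<times> real)"
  have "(\<Sum>b\<in>Basis. partial b (partial b (dir e c)) p) = (\<Sum>i\<in>UNIV. e $ i * (\<Sum>b\<in>Basis. partial b (partial b (partial (axis i 1, 0) F)) p))"
    unfolding dir_deriv2(2)[OF p] by (subst sum.swap) (simp add: sum_distrib_left)
  then show "(\<Sum>b\<in>Basis. partial b (partial b (dir e c)) p) = 0" by (simp add: partial_F_harmonic[OF p])
qed

lemma hessian_apply_component:
  assumes "b \<in> Basis"
  shows "hessian_apply F p e \<bullet> b = (\<Sum>c\<in>Basis. partial b (partial c F) p * (e \<bullet> c))"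
  unfolding hessian_apply_def using assms by simp

lemma norm_hessian_apply:
  "(norm (hessian_apply F p e))\<^sup>2 = (\<Sum>b\<in>Basis. (\<Sum>c\<in>Basis. partial b (partial c F) p * (e \<bullet> c))\<^sup>2)"
proof -
  have "(norm (hessian_apply F p e))\<^sup>2 = hessian_apply F p e \<bullet> hessian_apply F p e" by (simp add: dot_square_norm)
  also have "\<dots> = (\<Sum>b\<in>Basis. (hessian_apply F p e \<bullet> b)\<^sup>2)" by (subst euclidean_inner) (simp add: power2_eq_square)
  finally show ?thesis by (simp add: hessian_apply_component)
qed

text \<open>The Hessian applied to a horizontal vector is the full gradient of the corresponding
  component of \<open>grad\<close>; this links weak quasiregularity to energies.\<close>

lemma norm_hessian_apply_dir:
  assumes "snd p > 0"
  shows "(norm (hessian_apply F p (e, 0)))\<^sup>2 = (\<Sum>b\<in>Basis. (partial b (dir e c) p)\<^sup>2)"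
  unfolding norm_hessian_apply dir_deriv(2)[OF assms] sum_Basis_half_space[where g="\<lambda>c. partial _ (partial c F) p * ((e, 0) \<bullet> c)"]
  by (simp add: inner_axis mult.commute)

lemma hessian_apply_continuous: "continuous_on {p. snd p > 0} (\<lambda>p. (norm (hessian_apply F p e))\<^sup>2)"
  unfolding norm_hessian_apply by (intro continuous_intros F_continuous)

lemma box_subset_half: "N > 0 \<Longrightarrow> l > 0 \<Longrightarrow> upper_box N a l \<subseteq> {p. snd p > 0}"
  unfolding upper_box_def by (auto intro: less_le_trans[of 0 "l / real N"])

lemma upper_box_cbox: "upper_box N a l = cbox (a, l / real N) (a + (\<chi> i. l), l)"
  by (simp add: upper_box_def cube_def cbox_Pair_eq)

lemma set_integrable_box:
  fixes g :: "(real^'n) \<times> real \<Rightarrow> real"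
  assumes "continuous_on {p. snd p > 0} g" "N > 0" "l > 0"
  shows "set_integrable lborel (upper_box N a l) g"
  unfolding set_integrable_def
  by (rule borel_integrable_compact)
     (use continuous_on_subset[OF assms(1) box_subset_half[OF assms(2,3)]] in \<open>auto simp: upper_box_cbox\<close>)

text \<open>The integral of a non-integrable function is 0 by default, so monotonicity requires
  integrability of the supremum. It is measurable because superlevel sets of a supremum of
  continuous functions are open, and it is dominated by a function continuous on the compact
  box.\<close>

lemma hessian_sup_integral:
  fixes e :: "(real^'n) \<times> real"
  assumes N: "N > 0" and l: "l > 0" and e: "norm e = 1"
  shows "(LINT p : upper_box N a l | lborel. (norm (hessian_apply F p e))\<^sup>2)
     \<le> (LINT p : upper_box N a l | lborel. (SUP e \<in> sphere 0 1. (norm (hessian_apply F p e))\<^sup>2))"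
proof -
  define h where "h = (\<lambda>e p. (norm (hessian_apply F p e))\<^sup>2)"
  define bd where "bd = (\<lambda>p. \<Sum>b\<in>(Basis :: ((real^'n) \<times> real) set). (\<Sum>c\<in>Basis. \<bar>partial b (partial c F) p\<bar>)\<^sup>2)"
  define S where "S = (\<lambda>p. SUP e \<in> sphere 0 1. h e p)"
  have cb: "continuous_on {p. snd p > 0} bd" unfolding bd_def by (intro continuous_intros F_continuous)
  have hb: "h e p \<le> bd p" if "e \<in> sphere 0 1" for e p
    unfolding h_def bd_def norm_hessian_apply
  proof (rule sum_mono)
    fix b :: "(real^'n) \<times> real"
    have "\<bar>\<Sum>c\<in>Basis. partial b (partial c F) p * (e \<bullet> c)\<bar> \<le> (\<Sum>c\<in>Basis. \<bar>partial b (partial c F) p\<bar>)"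
    proof (rule order_trans[OF sum_abs sum_mono])
      fix c :: "(real^'n) \<times> real" assume "c \<in> Basis"
      then have "\<bar>e \<bullet> c\<bar> \<le> 1" using Basis_le_norm[of c e] that by simp
      then show "\<bar>partial b (partial c F) p * (e \<bullet> c)\<bar> \<le> \<bar>partial b (partial c F) p\<bar>"
        by (simp add: abs_mult mult_left_le)
    qed
    then show "(\<Sum>c\<in>Basis. partial b (partial c F) p * (e \<bullet> c))\<^sup>2 \<le> (\<Sum>c\<in>Basis. \<bar>partial b (partial c F) p\<bar>)\<^sup>2"
      by (subst power2_abs[symmetric], intro power_mono abs_ge_zero)
  qed
  have bdd: "bdd_above ((\<lambda>e. h e p) ` sphere 0 1)" for p using hb by (intro bdd_aboveI2[of _ _ "bd p"])
  have ne: "sphere (0::(real^'n) \<times> real) 1 \<noteq> {}" using e by auto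
  have hS: "h e p \<le> S p" for p unfolding S_def by (rule cSUP_upper[OF _ bdd]) (use e in simp)
  have h0: "0 \<le> h e p" for e p by (simp add: h_def)
  have Sb: "\<bar>S p\<bar> \<le> bd p" for p
  proof -
    have "S p \<le> bd p" unfolding S_def using hb by (intro cSUP_least[OF ne])
    then show ?thesis using hS[of p] h0[of e p] by linarith
  qed
  \<comment> \<open>Superlevel sets are known to be open only over the half-space; g cuts S off
    outside it, and the box does not see the difference.\<close>
  define g where "g = (\<lambda>p. if snd p > 0 then S p else 0)"
  have meas: "g \<in> borel_measurable borel"
  proof (rule borel_measurableI_greater)
    fix y :: real
    have op: "open {p. snd p > 0 \<and> y < S p}"
    proof -
      have "{p. snd p > 0 \<and> y < S p} = (\<Union>e\<in>sphere 0 1. {p \<in> {p. snd p > 0}. y < h e p})"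
        unfolding S_def using less_cSUP_iff[OF ne bdd] by auto
      moreover have "open {p \<in> {p. snd p > 0}. y < h e p}" for e
      proof -
        have "open ((\<lambda>p. (norm (hessian_apply F p e))\<^sup>2) -` {y<..} \<inter> {p. snd p > 0})"
          using continuous_on_open_vimage[OF open_half] hessian_apply_continuous[of e] open_greaterThan by blast
        moreover have "(\<lambda>p. (norm (hessian_apply F p e))\<^sup>2) -` {y<..} \<inter> {p. snd p > 0} = {p \<in> {p. snd p > 0}. y < h e p}"
          by (auto simp: h_def)
        ultimately show ?thesis by simp
      qed
      ultimately show ?thesis by auto
    qed
    have "{p \<in> space borel. y < g p} = {p. snd p > 0 \<and> y < S p} \<union> (if y < 0 then {p. \<not> snd p > 0} else {})"
      by (auto simp: g_def)
    moreover have "{p :: (real^'n) \<times> real. \<not> snd p > 0} \<in> sets borel"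
      using open_half by (simp add: Collect_neg_eq borel_open)
    ultimately show "{p \<in> space borel. y < g p} \<in> sets borel" using borel_open[OF op] by auto
  qed
  have gS: "indicator (upper_box N a l) p *\<^sub>R S p = indicator (upper_box N a l) p *\<^sub>R g p" for p
    using box_subset_half[OF N l, of a] by (auto simp: g_def indicator_def)
  have bm: "upper_box N a l \<in> sets borel" unfolding upper_box_cbox by simp
  have iS: "set_integrable lborel (upper_box N a l) S"
    unfolding set_integrable_def gS
  proof (rule Bochner_Integration.integrable_bound)
    show "integrable lborel (\<lambda>p. indicator (upper_box N a l) p *\<^sub>R bd p)"
      using set_integrable_box[OF cb N l] by (simp add: set_integrable_def)
    show "(\<lambda>p. indicator (upper_box N a l) p *\<^sub>R g p) \<in> borel_measurable lborel"
      using meas bm by measurable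
    show "AE p in lborel. norm (indicator (upper_box N a l) p *\<^sub>R g p) \<le> norm (indicator (upper_box N a l) p *\<^sub>R bd p)"
      using Sb order_trans[OF abs_ge_zero Sb] by (auto simp: g_def indicator_def)
  qed
  have "(LINT p : upper_box N a l | lborel. h e p) \<le> (LINT p : upper_box N a l | lborel. S p)"
    by (rule set_integral_mono[OF set_integrable_box[OF _ N l] iS])
       (use hessian_apply_continuous hS in \<open>auto simp: h_def\<close>)
  then show ?thesis by (simp add: h_def S_def)
qed

text \<open>Both vectors are taken horizontal: the integral for e' is at most that of the maximum,
  and the minimum is at most the integral for e.\<close>

lemma isotropy:
  assumes Q: "\<And>a l. l > 0 \<Longrightarrow>
        (LINT p : upper_box N a l | lborel. (SUP e \<in> sphere 0 1. (norm (hessian_apply F p e))\<^sup>2))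
        \<le> \<gamma>\<^sup>2 * (INF e \<in> sphere 0 1. (LINT p : upper_box N a l | lborel. (norm (hessian_apply F p e))\<^sup>2))"
    and N: "N > 0" and l: "l > 0" and e: "norm e = 1" "norm e' = 1"
  shows "integral (upper_box N a l) (\<lambda>p. \<Sum>b\<in>Basis. (partial b (dir e' c') p)\<^sup>2)
    \<le> \<gamma>\<^sup>2 * integral (upper_box N a l) (\<lambda>p. \<Sum>b\<in>Basis. (partial b (dir e c) p)\<^sup>2)"
proof -
  have int: "(LINT p : upper_box N a l | lborel. (norm (hessian_apply F p (e, 0)))\<^sup>2)
     = integral (upper_box N a l) (\<lambda>p. \<Sum>b\<in>Basis. (partial b (dir e c) p)\<^sup>2)" for e c
  proof -
    have "(LINT p : upper_box N a l | lborel. (norm (hessian_apply F p (e, 0)))\<^sup>2) = integral (upper_box N a l) (\<lambda>p. (norm (hessian_apply F p (e, 0)))\<^sup>2)"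
      by (rule set_borel_integral_eq_integral(2)[OF set_integrable_box[OF hessian_apply_continuous N l]])
    also have "\<dots> = integral (upper_box N a l) (\<lambda>p. \<Sum>b\<in>Basis. (partial b (dir e c) p)\<^sup>2)"
      by (rule integral_cong, rule norm_hessian_apply_dir) (use box_subset_half[OF N l, of a] in auto)
    finally show ?thesis .
  qed
  have ne: "norm (u, 0::real) = norm u" for u :: "real^'n" by (simp add: norm_Pair)
  have "(LINT p : upper_box N a l | lborel. (norm (hessian_apply F p (e', 0)))\<^sup>2)
     \<le> (LINT p : upper_box N a l | lborel. (SUP e \<in> sphere 0 1. (norm (hessian_apply F p e))\<^sup>2))"
    by (rule hessian_sup_integral[OF N l]) (simp add: ne e)
  also have "\<dots> \<le> \<gamma>\<^sup>2 * (INF e \<in> sphere 0 1. (LINT p : upper_box N a l | lborel. (norm (hessian_apply F p e))\<^sup>2))"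
    by (rule Q[OF l])
  also have "\<dots> \<le> \<gamma>\<^sup>2 * (LINT p : upper_box N a l | lborel. (norm (hessian_apply F p (e, 0)))\<^sup>2)"
  proof (intro mult_left_mono cINF_lower)
    show "bdd_below ((\<lambda>e. LINT p : upper_box N a l | lborel. (norm (hessian_apply F p e))\<^sup>2) ` sphere 0 1)"
      by (rule bdd_belowI2[of _ 0]) (auto simp: set_lebesgue_integral_def intro!: integral_nonneg_AE)
  qed (use e ne in auto)
  finally show ?thesis unfolding int[of e' c'] int[of e c] .
qed

end

section \<open>Masses and energies on the tree of cells\<close>

lemma sum_pow_cells:
  assumes "finite D" "D \<noteq> {}"
  shows "(\<Sum>\<sigma>\<in>stops D P n w. (1 / real (card D)) ^ length \<sigma>) = (1 / real (card D)) ^ length w"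
  by (rule sum_stops_eq[OF assms(1)]) (use assms in \<open>simp add: card_gt_0_iff\<close>)

context
  fixes w :: "(real^'n) \<times> real \<Rightarrow> real"
  assumes w: "harmonic_half w"
begin

text \<open>Energy over a vertical segment. As an integral of columns the energy can be split both
  in height and, by \<open>integral_cube_children\<close>, horizontally.\<close>

definition column :: "real \<Rightarrow> real \<Rightarrow> real^'n \<Rightarrow> real" where
  "column h t x = integral {h..t} (\<lambda>y. 2 * y * (\<Sum>b\<in>Basis. (partial b w (x, y))\<^sup>2))"

lemma energy_density_continuous: "continuous_on {p. snd p > 0} (\<lambda>p. 2 * snd p * (\<Sum>b\<in>Basis. (partial b w p)\<^sup>2))"
  using w unfolding harmonic_half_def by (intro continuous_intros) blast

lemma energy_density_box:
  assumes "h > 0"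
  shows "continuous_on (cbox (a, h) (b, t)) (\<lambda>p. 2 * snd p * (\<Sum>b\<in>Basis. (partial b w p)\<^sup>2))"
  by (rule continuous_on_subset[OF energy_density_continuous]) (use assms in \<open>auto simp: cbox_Pair_eq\<close>)

lemma column_integrable:
  assumes "h > 0" shows "column h t integrable_on cube b r"
  using integral_integrable_2dim[OF energy_density_box[OF assms, of b "b + (\<chi> i. r)" t]]
  by (simp add: column_def[abs_def] cube_def)

lemma energy_column:
  assumes "h > 0" shows "energy w a l h t = integral (cube a l) (column h t)"
  using integral_prod_continuous[OF energy_density_box[OF assms, of a "a + (\<chi> i. l)" t]]
  by (simp add: energy_def column_def[abs_def] cube_def)

lemma column_split:
  assumes "0 < h" "h \<le> m" "m \<le> t"
  shows "column h t x = column h m x + column m t x"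
proof -
  have "continuous_on {h..t} (\<lambda>y. 2 * y * (\<Sum>b\<in>Basis. (partial b w (x, y))\<^sup>2))"
    using assms by (intro continuous_on_compose2[OF energy_density_continuous, where f="\<lambda>y. (x, y)", simplified] continuous_intros) auto
  then show ?thesis unfolding column_def
    by (intro Henstock_Kurzweil_Integration.integral_combine[OF assms(2,3), symmetric] integrable_continuous_real)
qed

lemma energy_children:
  assumes N: "N > 0" and l: "l > 0" and h: "0 < h" "h \<le> l / real N"
  shows "energy w a l h l = energy w a l (l / real N) l
    + (\<Sum>v\<in>digits N. energy w (a + (l / real N) *\<^sub>R v) (l / real N) h (l / real N))"
proof -
  have lN: "0 < l / real N" "l / real N \<le> l" using N l by (auto simp: divide_le_eq mult_le_cancel_left1)
  have "energy w a l h l = integral (cube a l) (\<lambda>x. column h (l / real N) x + column (l / real N) l x)"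
    unfolding energy_column[OF h(1)] by (rule integral_cong) (rule column_split[OF h lN(2)])
  also have "\<dots> = integral (cube a l) (column h (l / real N)) + integral (cube a l) (column (l / real N) l)"
    by (rule integral_add[OF column_integrable[OF h(1)] column_integrable[OF lN(1)]])
  also have "integral (cube a l) (column h (l / real N)) = (\<Sum>v\<in>digits N. integral (cube (a + (l / real N) *\<^sub>R v) (l / real N)) (column h (l / real N)))"
    by (rule integral_cube_children[OF N l column_integrable[OF h(1)]])
  finally show ?thesis by (simp add: energy_column h lN)
qed

end

text \<open>On the top box the weight 2y lies between 2 l / N and 2 l; the ratio N is the price for
  passing from the unweighted integrals of the quasiregularity condition to energies.\<close>

lemma energy_box_bounds:
  fixes w :: "(real^'n) \<times> real \<Rightarrow> real" and a :: "real^'n"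
  assumes w: "harmonic_half w" and N: "N > 0" and l: "l > 0"
  defines "S \<equiv> integral (upper_box N a l) (\<lambda>p. \<Sum>b\<in>Basis. (partial b w p)\<^sup>2)"
  shows "energy w a l (l / real N) l \<le> 2 * l * S" "2 * (l / real N) * S \<le> energy w a l (l / real N) l"
proof -
  have lN: "0 < l / real N" using N l by simp
  have c: "continuous_on (cbox (a, l / real N) (a + (\<chi> i. l), l)) (\<lambda>p. \<Sum>b\<in>Basis. (partial b w p)\<^sup>2)"
  proof (rule continuous_on_subset)
    show "continuous_on {p. snd p > 0} (\<lambda>p. \<Sum>b\<in>Basis. (partial b w p)\<^sup>2)"
      using w unfolding harmonic_half_def by (intro continuous_intros) blast
  qed (use lN in \<open>auto simp: cbox_Pair_eq\<close>)
  have box: "upper_box N a l = cbox (a, l / real N) (a + (\<chi> i. l), l)"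
    by (simp add: upper_box_def cube_def cbox_Pair_eq)
  have i: "(\<lambda>p. r * (\<Sum>b\<in>Basis. (partial b w p)\<^sup>2)) integrable_on cbox (a, l / real N) (a + (\<chi> i. l), l)" for r
    by (intro integrable_continuous continuous_intros c)
  note ie = integrable_continuous[OF energy_density_box[OF w lN, of a "a + (\<chi> i. l)" l]]
  have e: "r * S = integral (cbox (a, l / real N) (a + (\<chi> i. l), l)) (\<lambda>p. r * (\<Sum>b\<in>Basis. (partial b w p)\<^sup>2))" for r
    unfolding S_def box by simp
  show "energy w a l (l / real N) l \<le> 2 * l * S"
    unfolding e energy_def
    by (rule integral_le[OF ie i]) (auto simp: cbox_Pair_eq intro!: mult_right_mono sum_nonneg)
  show "2 * (l / real N) * S \<le> energy w a l (l / real N) l"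
    unfolding e energy_def
  proof (rule integral_le[OF i ie])
    fix p assume "p \<in> cbox (a, l / real N) (a + (\<chi> i. l), l)"
    then have "l / real N \<le> snd p" by (auto simp: cbox_Pair_eq)
    then have "2 * (l / real N) \<le> 2 * snd p" by simp
    then show "2 * (l / real N) * (\<Sum>b\<in>Basis. (partial b w p)\<^sup>2) \<le> 2 * snd p * (\<Sum>b\<in>Basis. (partial b w p)\<^sup>2)"
      by (rule mult_right_mono) (simp add: sum_nonneg)
  qed
qed

context bounded_continuous begin

text \<open>Dominates the constants for components of \<open>grad\<close>: d for derivatives and
  vertical increments, and 2 d^2 (d + 1) for horizontal increments.\<close>

definition cc :: real where "cc = 2 * (real CARD('n) + 1) ^ 3"

lemma cc_ge: "cc \<ge> 1" "cc \<ge> real CARD('n)"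
proof -
  have "(real CARD('n) + 1) ^ 1 \<le> (real CARD('n) + 1) ^ 3" by (rule power_increasing) auto
  then show "cc \<ge> 1" "cc \<ge> real CARD('n)" by (auto simp: cc_def)
qed

lemma hess_le_mono: "hess_le \<kappa> l \<Longrightarrow> l' \<le> l \<Longrightarrow> hess_le \<kappa> l'"
  unfolding hess_le_def by force

lemma axis_Basis: "(axis i 1, 0) \<in> (Basis :: ((real^'n) \<times> real) set)"
  by (auto simp: Basis_prod_def Basis_vec_def)

lemma weighted_sum_bound:
  fixes e :: "real^'n"
  assumes "norm e \<le> 1" "\<And>i. \<bar>g i\<bar> \<le> M"
  shows "\<bar>\<Sum>i\<in>UNIV. e $ i * g i\<bar> \<le> real CARD('n) * M"
proof -
  have "\<bar>\<Sum>i\<in>UNIV. e $ i * g i\<bar> \<le> (\<Sum>i\<in>(UNIV :: 'n set). M)"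
  proof (rule order_trans[OF sum_abs sum_mono])
    fix i
    have "\<bar>e $ i\<bar> \<le> 1" using component_le_norm_cart[of e i] assms(1) by linarith
    then have "\<bar>e $ i\<bar> * \<bar>g i\<bar> \<le> 1 * \<bar>g i\<bar>" by (intro mult_right_mono) auto
    then show "\<bar>e $ i * g i\<bar> \<le> M" using assms(2)[of i] by (simp add: abs_mult)
  qed
  then show ?thesis by simp
qed

lemma dir_partial_bound:
  assumes h: "hess_le \<kappa> l" and e: "norm e \<le> 1" and t: "0 < t" "t \<le> l" and b: "b \<in> Basis"
  shows "\<bar>partial b (dir e c) (x, t)\<bar> \<le> cc * \<kappa> / t"
proof -
  have k: "\<kappa> \<ge> 0" using hess_le_nonneg[OF h] t by linarith
  have "\<bar>partial b (dir e c) (x, t)\<bar> \<le> real CARD('n) * (\<kappa> / t)"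
    using dir_deriv(2)[of "(x,t)" b e c] t
      weighted_sum_bound[OF e, of "\<lambda>i. partial b (partial (axis i 1, 0) F) (x, t)", OF hess_leD[OF h t b axis_Basis]]
    by simp
  also have "\<dots> \<le> cc * (\<kappa> / t)" using cc_ge k t by (intro mult_right_mono) auto
  finally show ?thesis by simp
qed

lemma dir_horizontal:
  assumes h: "hess_le \<kappa> l" and e: "norm e \<le> 1" and t: "0 < t" "t \<le> l" and x: "\<And>j. \<bar>x $ j - a $ j\<bar> \<le> 2 * t"
  shows "\<bar>dir e c (x, t) - dir e c (a, t)\<bar> \<le> cc * \<kappa>"
proof -
  define d where "d = real CARD('n)"
  have k: "\<kappa> \<ge> 0" using hess_le_nonneg[OF h] t by linarith
  have d: "d \<ge> 0" by (simp add: d_def)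
  have nx: "norm (x - a) \<le> d * (2 * t)"
  proof -
    have "norm (x - a) \<le> (\<Sum>i\<in>UNIV. \<bar>(x - a) $ i\<bar>)" by (rule norm_le_l1_cart)
    also have "\<dots> \<le> (\<Sum>i\<in>(UNIV :: 'n set). 2 * t)" by (rule sum_mono) (use x in simp)
    finally show ?thesis by (simp add: d_def)
  qed
  have F: "\<bar>partial (axis i 1, 0) F (x, t) - partial (axis i 1, 0) F (a, t)\<bar> \<le> (d + 1) * (d * 2) * \<kappa>" for i
  proof -
    have "\<bar>partial (axis i 1, 0) F (a + (x - a), t) - partial (axis i 1, 0) F (a, t)\<bar> \<le> (d + 1) * norm (x - a) * \<kappa> / t"
      unfolding d_def by (rule partial_F_horizontal_diff[OF h t axis_Basis])
    also have "\<dots> \<le> (d + 1) * (d * (2 * t)) * \<kappa> / t"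
      using nx d k t by (intro divide_right_mono mult_right_mono mult_left_mono) auto
    also have "\<dots> = (d + 1) * (d * 2) * \<kappa>" using t by simp
    finally show ?thesis by simp
  qed
  have "dir e c (x, t) - dir e c (a, t) = (\<Sum>i\<in>UNIV. e $ i * (partial (axis i 1, 0) F (x, t) - partial (axis i 1, 0) F (a, t)))"
    unfolding dir_alt by (simp add: right_diff_distrib sum_subtractf)
  then have "\<bar>dir e c (x, t) - dir e c (a, t)\<bar> \<le> d * ((d + 1) * (d * 2) * \<kappa>)"
    using weighted_sum_bound[OF e F] by (simp add: d_def)
  also have "\<dots> = (d * (d + 1) * d) * (2 * \<kappa>)" by (simp add: mult_ac)
  also have "\<dots> \<le> ((d + 1) * (d + 1) * (d + 1)) * (2 * \<kappa>)"
    using d k by (intro mult_right_mono mult_mono) auto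
  also have "\<dots> = cc * \<kappa>" by (simp add: cc_def d_def power3_eq_cube)
  finally show ?thesis .
qed

lemma dir_vertical:
  assumes h: "hess_le \<kappa> l" and e: "norm e \<le> 1" and t: "0 < t" "t \<le> s" "s \<le> l"
  shows "\<bar>dir e c (x, s) - dir e c (x, t)\<bar> \<le> 2 * (cc * \<kappa>) * sqrt (s / t)"
proof -
  have k: "\<kappa> \<ge> 0" using hess_le_nonneg[OF h] t by linarith
  have "dir e c (x, s) - dir e c (x, t) = (\<Sum>i\<in>UNIV. e $ i * (partial (axis i 1, 0) F (x, s) - partial (axis i 1, 0) F (x, t)))"
    unfolding dir_alt by (simp add: right_diff_distrib sum_subtractf)
  then have "\<bar>dir e c (x, s) - dir e c (x, t)\<bar> \<le> real CARD('n) * (2 * \<kappa> * sqrt (s / t))"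
    using weighted_sum_bound[OF e partial_F_vertical_diff[OF h t axis_Basis]] by simp
  also have "\<dots> \<le> cc * (2 * \<kappa> * sqrt (s / t))" using cc_ge k t by (intro mult_right_mono) auto
  finally show ?thesis by (simp add: mult_ac)
qed

text \<open>From the top corner any point of the doubled cube is reached by a horizontal move at
  height s, costing \<open>cc * \<kappa>\<close>, and a descent, costing the square root term; this
  explains the value of W.\<close>

lemma half_space_cube_dir:
  assumes H: "hess_le \<kappa> l" and e: "norm e \<le> 1" and h: "0 < h" "h \<le> s" "s \<le> l"
  shows "half_space_cube (dir e c) a s h (cc * \<kappa>) (\<bar>dir e c (a, s)\<bar> + cc * \<kappa>) (cc * \<kappa>)"
proof
  have s: "0 < s" using h by linarith
  have k: "\<kappa> \<ge> 0" using hess_le_nonneg[OF H] h by linarith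
  show "harmonic_half (dir e c)" by (rule dir_harmonic)
  show "0 \<le> cc * \<kappa>" "0 \<le> \<bar>dir e c (a, s)\<bar> + cc * \<kappa>" using cc_ge k by auto
  show "\<bar>partial b (dir e c) (x, t)\<bar> \<le> cc * \<kappa> / t" if "0 < t" "t \<le> s" "b \<in> Basis" for x t b
    by (rule dir_partial_bound[OF H e]) (use that h in auto)
  show "\<bar>dir e c (x, s) - dir e c (a, s)\<bar> \<le> cc * \<kappa>" if "x \<in> cube a s" for x
  proof (rule dir_horizontal[OF H e s h(3)])
    fix j show "\<bar>x $ j - a $ j\<bar> \<le> 2 * s" using that s unfolding mem_cube by (auto dest!: spec[of _ j])
  qed
  show "\<bar>dir e c (x, t)\<bar> \<le> \<bar>dir e c (a, s)\<bar> + cc * \<kappa> + 2 * (cc * \<kappa>) * sqrt (s / t)"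
    if x: "\<And>j. a $ j \<le> x $ j \<and> x $ j \<le> a $ j + 2 * s" and t: "0 < t" "t \<le> s" for x t
  proof -
    have "\<bar>dir e c (x, s) - dir e c (a, s)\<bar> \<le> cc * \<kappa>"
    proof (rule dir_horizontal[OF H e s h(3)])
      fix j show "\<bar>x $ j - a $ j\<bar> \<le> 2 * s" using x[of j] s by auto
    qed
    moreover have "\<bar>dir e c (x, s) - dir e c (x, t)\<bar> \<le> 2 * (cc * \<kappa>) * sqrt (s / t)"
      by (rule dir_vertical[OF H e t h(3)])
    ultimately show ?thesis by linarith
  qed
qed (use h in auto)

text \<open>Dominates the errors of \<open>linear_balance\<close> and
  \<open>quadratic_balance\<close> for the parameters of \<open>half_space_cube_dir\<close>; the
  largest coefficient that occurs is (20 d + 12) cc^2.\<close>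

definition c2 :: real where "c2 = 40 * (real CARD('n) + 1) * cc\<^sup>2"

lemma c2_ge: "c2 \<ge> cc" "c2 \<ge> 1"
proof -
  have "1 * (cc * 1) \<le> 40 * (real CARD('n) + 1) * (cc * cc)" using cc_ge(1) by (intro mult_mono) auto
  then show "c2 \<ge> cc" by (simp add: c2_def power2_eq_square)
  then show "c2 \<ge> 1" using cc_ge(1) by linarith
qed

text \<open>h may be any height up to s, so that cells of different sizes can be compared at one
  common bottom height.\<close>

lemma balance:
  fixes c :: real and a :: "real^'n"
  assumes H: "hess_le \<kappa> l" and e: "norm e \<le> 1" and h: "0 < h" "h \<le> s" "s \<le> l"
  defines "w \<equiv> dir e c"
  shows "\<bar>s ^ CARD('n) * w (a, s) - integral (cube a s) (\<lambda>x. w (x, h) - h * partial (0,1) w (x, h))\<bar> \<le> c2 * \<kappa> * s ^ CARD('n)"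
    and "\<bar>s ^ CARD('n) * (w (a, s))\<^sup>2 - (integral (cube a s) (\<lambda>x. (w (x, h))\<^sup>2 - 2 * h * (w (x, h) * partial (0,1) w (x, h))) - energy w a s h s)\<bar>
       \<le> c2 * \<kappa> * (\<bar>w (a, s)\<bar> + \<kappa>) * s ^ CARD('n)"
proof -
  define d where "d = real CARD('n)"
  have k: "\<kappa> \<ge> 0" using hess_le_nonneg[OF H] h by linarith
  interpret half_space_cube w a s h "cc * \<kappa>" "\<bar>w (a, s)\<bar> + cc * \<kappa>" "cc * \<kappa>"
    unfolding w_def by (rule half_space_cube_dir[OF H e h])
  have d: "d \<ge> 0" by (simp add: d_def)
  have c1: "cc \<ge> 1" by (rule cc_ge)
  have cc2: "cc \<le> cc\<^sup>2" using c1 by (simp add: power2_eq_square)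
  have sp: "0 \<le> s ^ CARD('n)" using h by simp
  have "(2 * d * (cc * \<kappa>) + cc * \<kappa> + cc * \<kappa>) = (2 * d + 2) * cc * \<kappa>" by (simp add: algebra_simps)
  also have "\<dots> \<le> (40 * (d + 1)) * cc\<^sup>2 * \<kappa>" using d cc2 k c1 by (intro mult_right_mono mult_mono) auto
  finally have l1: "2 * d * (cc * \<kappa>) + cc * \<kappa> + cc * \<kappa> \<le> c2 * \<kappa>" by (simp add: c2_def d_def)
  show "\<bar>s ^ CARD('n) * w (a, s) - integral (cube a s) (\<lambda>x. w (x, h) - h * partial (0,1) w (x, h))\<bar> \<le> c2 * \<kappa> * s ^ CARD('n)"
    using order_trans[OF linear_balance[unfolded \<Psi>_def] mult_right_mono[OF l1[unfolded d_def] sp]] .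
  define W0 where "W0 = \<bar>w (a, s)\<bar>"
  have W0: "W0 \<ge> 0" by (simp add: W0_def)
  have "4 * d * (cc * \<kappa>) * (W0 + cc * \<kappa> + 4 * (cc * \<kappa>)) + 2 * (cc * \<kappa> + cc * \<kappa>) * (W0 + cc * \<kappa> + 2 * (cc * \<kappa>))
    = (4 * d + 4) * cc * (\<kappa> * W0) + (20 * d + 12) * cc\<^sup>2 * (\<kappa> * \<kappa>)" by (simp add: algebra_simps power2_eq_square)
  also have "\<dots> \<le> (40 * (d + 1)) * cc\<^sup>2 * (\<kappa> * W0) + (40 * (d + 1)) * cc\<^sup>2 * (\<kappa> * \<kappa>)"
    using d cc2 k c1 W0 by (intro add_mono mult_right_mono mult_mono) auto
  also have "\<dots> = c2 * \<kappa> * (W0 + \<kappa>)" by (simp add: c2_def d_def algebra_simps)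
  finally have l2: "4 * d * (cc * \<kappa>) * (W0 + cc * \<kappa> + 4 * (cc * \<kappa>)) + 2 * (cc * \<kappa> + cc * \<kappa>) * (W0 + cc * \<kappa> + 2 * (cc * \<kappa>)) \<le> c2 * \<kappa> * (W0 + \<kappa>)" .
  show "\<bar>s ^ CARD('n) * (w (a, s))\<^sup>2 - (integral (cube a s) (\<lambda>x. (w (x, h))\<^sup>2 - 2 * h * (w (x, h) * partial (0,1) w (x, h))) - energy w a s h s)\<bar>
       \<le> c2 * \<kappa> * (\<bar>w (a, s)\<bar> + \<kappa>) * s ^ CARD('n)"
    using order_trans[OF quadratic_balance[unfolded \<Phi>_def] mult_right_mono[OF l2[unfolded d_def W0_def] sp]] .
qed

text \<open>The corner, at height equal to the side, stands for the whole cell: by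
  \<open>grad_cell\<close> the value over its other points differs by O(\<kappa>).\<close>

definition U :: "nat \<Rightarrow> real^'n \<Rightarrow> real \<Rightarrow> (real^'n) list \<Rightarrow> real^'n" where
  "U N a l \<sigma> = grad (corner N \<sigma> a l, l / real N ^ length \<sigma>)"

text \<open>Bound, in units of \<kappa>, for the change of U from a cell of side s to a child: per
  component d (d + 1) for the move to the child's corner, at distance at most d s, and 2 sqrt N for
  the descent to s / N; the outer d sums the components.\<close>

definition jump :: "nat \<Rightarrow> real" where
  "jump N = real CARD('n) * (real CARD('n) * (real CARD('n) + 1) + 2 * sqrt (real N))"

lemma digit_norm:
  assumes "v \<in> (digits N :: (real^'n) set)" shows "norm v \<le> real CARD('n) * real N"
proof -
  have "norm v \<le> (\<Sum>i\<in>UNIV. \<bar>v $ i\<bar>)" by (rule norm_le_l1_cart)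
  also have "\<dots> \<le> (\<Sum>i\<in>(UNIV :: 'n set). real N)"
  proof (rule sum_mono)
    fix i obtain k where "k < N" "v $ i = real k" using assms by (auto simp: digits_def)
    then show "\<bar>v $ i\<bar> \<le> real N" by simp
  qed
  finally show ?thesis by simp
qed

lemma U_jump:
  assumes H: "hess_le \<kappa> (l / real N ^ length u)" and N: "N > 0" and l: "l > 0" and v: "v \<in> digits N"
  shows "norm (U N a l (u @ [v]) - U N a l u) \<le> jump N * \<kappa>"
proof -
  define d where "d = real CARD('n)"
  define s where "s = l / real N ^ length u"
  have s: "s > 0" using N l by (simp add: s_def)
  have sN: "0 < s / real N" "s / real N \<le> s" using s N by (auto simp: divide_le_eq mult_le_cancel_left1)
  have k: "\<kappa> \<ge> 0" using hess_le_nonneg[OF H] s by (simp add: s_def)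
  define x where "x = corner N u a l"
  define \<delta> where "\<delta> = (s / real N) *\<^sub>R v"
  have nd: "norm \<delta> \<le> d * s"
  proof -
    have "norm \<delta> \<le> (s / real N) * (d * real N)" unfolding \<delta>_def norm_scaleR
      using digit_norm[OF v] sN by (intro mult_mono) (auto simp: d_def)
    then show ?thesis using N by (simp add: mult.commute)
  qed
  have Uv: "U N a l (u @ [v]) = grad (x + \<delta>, s / real N)" "U N a l u = grad (x, s)"
    by (simp_all add: U_def x_def \<delta>_def s_def corner_snoc mult.commute)
  have comp: "\<bar>(grad (x + \<delta>, s / real N) - grad (x, s)) $ i\<bar> \<le> d * (d + 1) * \<kappa> + 2 * \<kappa> * sqrt (real N)" for i
  proof -
    have "\<bar>partial (axis i 1, 0) F (x + \<delta>, s) - partial (axis i 1, 0) F (x, s)\<bar> \<le> (d + 1) * norm \<delta> * \<kappa> / s"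
      unfolding d_def by (rule partial_F_horizontal_diff[OF H[folded s_def] s order_refl axis_Basis])
    also have "\<dots> \<le> (d + 1) * (d * s) * \<kappa> / s"
      using nd k s by (intro divide_right_mono mult_right_mono mult_left_mono) (auto simp: d_def)
    also have "\<dots> = d * (d + 1) * \<kappa>" using s by simp
    finally have 1: "\<bar>partial (axis i 1, 0) F (x + \<delta>, s) - partial (axis i 1, 0) F (x, s)\<bar> \<le> d * (d + 1) * \<kappa>" .
    have 2: "\<bar>partial (axis i 1, 0) F (x + \<delta>, s) - partial (axis i 1, 0) F (x + \<delta>, s / real N)\<bar> \<le> 2 * \<kappa> * sqrt (s / (s / real N))"
      by (rule partial_F_vertical_diff[OF H[folded s_def] sN order_refl axis_Basis])
    have "s / (s / real N) = real N" using s by simp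
    with 1 2 show ?thesis by (simp add: grad_def) 
  qed
  have "norm (grad (x + \<delta>, s / real N) - grad (x, s)) \<le> (\<Sum>i\<in>UNIV. \<bar>(grad (x + \<delta>, s / real N) - grad (x, s)) $ i\<bar>)"
    by (rule norm_le_l1_cart)
  also have "\<dots> \<le> (\<Sum>i\<in>(UNIV :: 'n set). d * (d + 1) * \<kappa> + 2 * \<kappa> * sqrt (real N))" by (rule sum_mono[OF comp])
  also have "\<dots> = jump N * \<kappa>" by (simp add: jump_def d_def algebra_simps)
  finally show ?thesis unfolding Uv .
qed


text \<open>All proper prefixes of a stopping word are still within R, and the last step overshoots
  by at most one jump, hence by at most R.\<close>

lemma stops_drift:
  assumes H: "hess_le \<kappa> l" and N: "N > 0" and l: "l > 0"
    and R: "jump N * \<kappa> \<le> R" "R \<ge> 0"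
    and s: "\<sigma> \<in> stops (digits N) (\<lambda>\<sigma>. norm (U N a l \<sigma> - U N a l []) > R) n []"
  shows "norm (U N a l \<sigma> - U N a l []) \<le> 2 * R"
    and "prefix \<tau> \<sigma> \<Longrightarrow> norm (U N a l \<tau> - U N a l []) \<le> 2 * R"
proof -
  obtain u where u: "\<sigma> = u" "set u \<subseteq> digits N" "\<And>j. j < length u \<Longrightarrow> norm (U N a l (take j u) - U N a l []) \<le> R"
    using stops_structure[OF s] by (auto simp: not_less)
  show 1: "norm (U N a l \<sigma> - U N a l []) \<le> 2 * R"
  proof (cases u rule: rev_cases)
    case Nil then show ?thesis using u(1) R by simp
  next
    case (snoc u' v)
    have "norm (U N a l u' - U N a l []) \<le> R" using u(3)[of "length u'"] snoc by simp
    moreover have "norm (U N a l (u' @ [v]) - U N a l u') \<le> jump N * \<kappa>"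
    proof (rule U_jump[OF _ N l])
      show "hess_le \<kappa> (l / real N ^ length u')"
        using N l by (intro hess_le_mono[OF H]) (simp add: divide_le_eq mult_le_cancel_left1)
      show "v \<in> digits N" using u(2) snoc by simp
    qed
    moreover have "norm (U N a l \<sigma> - U N a l []) \<le> norm (U N a l (u' @ [v]) - U N a l u') + norm (U N a l u' - U N a l [])"
      using norm_triangle_ineq[of "U N a l (u' @ [v]) - U N a l u'" "U N a l u' - U N a l []"] u(1) snoc by simp
    ultimately show ?thesis using R by linarith
  qed
  show "norm (U N a l \<tau> - U N a l []) \<le> 2 * R" if "prefix \<tau> \<sigma>"
  proof (cases "length \<tau> < length u")
    case True
    then have "\<tau> = take (length \<tau>) u" using that u(1) by (auto simp: prefix_def)
    then show ?thesis using u(3)[OF True] R by simp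
  next
    case False
    then have "\<tau> = \<sigma>" using that u(1) by (auto simp: prefix_def)
    then show ?thesis using 1 by simp
  qed
qed

text \<open>Lower bound for the stopped second moment divided by R^2 in
  \<open>exit_direction\<close>: exits give R^2 / 2 over all d axes, isotropy costs the factor
  \<gamma>^2 N, and error terms halve the gain twice, hence 8.\<close>

definition th :: "real \<Rightarrow> nat \<Rightarrow> real" where "th \<gamma> N = 1 / (8 * real CARD('n) * \<gamma>\<^sup>2 * real N)"

text \<open>The first summand absorbs the errors of Green's formula; 128 is what the mean requires,
  namely that 2 c2 \<kappa> is at most th R / 8. \<open>jump N\<close> limits the overshoot at exit,
  and 1 gives \<kappa> \<le> R.\<close>

definition Lam :: "real \<Rightarrow> nat \<Rightarrow> real" where "Lam \<gamma> N = 128 * real CARD('n) * \<gamma>\<^sup>2 * real N * c2 + jump N + 1"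

text \<open>Weak quasiregularity with its two constants made explicit, since all later constants
  depend on them.\<close>

definition wqr :: "real \<Rightarrow> nat \<Rightarrow> bool" where
  "wqr \<gamma> N \<longleftrightarrow> N \<ge> 2 \<and> \<gamma> \<ge> 1 \<and> (\<forall>a l. l > 0 \<longrightarrow>
        (LINT p : upper_box N a l | lborel. (SUP e \<in> sphere 0 1. (norm (hessian_apply F p e))\<^sup>2))
        \<le> \<gamma>\<^sup>2 * (INF e \<in> sphere 0 1. (LINT p : upper_box N a l | lborel. (norm (hessian_apply F p e))\<^sup>2)))"

lemma energy_isotropy:
  assumes Q: "wqr \<gamma> N" and l: "l > 0" and e: "norm e = 1" "norm e' = 1"
  shows "energy (dir e' c') a l (l / real N) l \<le> \<gamma>\<^sup>2 * real N * energy (dir e c) a l (l / real N) l"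
proof -
  have N: "N > 0" using Q by (auto simp: wqr_def)
  let ?S = "\<lambda>w. integral (upper_box N a l) (\<lambda>p. \<Sum>b\<in>Basis. (partial b w p)\<^sup>2)"
  have "energy (dir e' c') a l (l / real N) l \<le> 2 * l * ?S (dir e' c')"
    by (rule energy_box_bounds(1)[OF dir_harmonic N l])
  also have "\<dots> \<le> 2 * l * (\<gamma>\<^sup>2 * ?S (dir e c))"
    using l isotropy[OF _ N l e, of \<gamma> a c' c] Q by (intro mult_left_mono) (auto simp: wqr_def)
  also have "\<dots> = \<gamma>\<^sup>2 * real N * (2 * (l / real N) * ?S (dir e c))" using N by simp
  also have "\<dots> \<le> \<gamma>\<^sup>2 * real N * energy (dir e c) a l (l / real N) l"
    by (intro mult_left_mono energy_box_bounds(2)[OF dir_harmonic N l]) auto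
  finally show ?thesis .
qed

text \<open>Green's formula for the root and for all stopping cells, subtracted, shows that l^d V(e)
  is the energy between them up to O(\<kappa> R l^d), where V(e) is the stopped second moment along
  e. Exits make the sum of V over the axes at least R^2 / 2, isotropy passes this on to the single
  direction e, the mean is O(\<kappa>), and \<open>negative_part_mass\<close> concludes.\<close>

lemma exit_direction:
  fixes a e :: "real^'n" and n :: nat
  assumes Q: "wqr \<gamma> N" and l: "l > 0" and H: "hess_le \<kappa> l" and kp: "\<kappa> \<ge> 0"
    and R: "R > 0" "Lam \<gamma> N * \<kappa> \<le> R" and e: "norm e = 1"
  defines "S \<equiv> stops (digits N) (\<lambda>\<sigma>. norm (U N a l \<sigma> - U N a l []) > R) n []"
  defines "m \<equiv> \<lambda>\<sigma>. (1 / real (card (digits N :: (real^'n) set))) ^ length \<sigma>"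
  assumes exit: "(\<Sum>\<sigma> | \<sigma> \<in> S \<and> norm (U N a l \<sigma> - U N a l []) > R. m \<sigma>) \<ge> 1/2"
  shows "(\<Sum>\<sigma> | \<sigma> \<in> S \<and> e \<bullet> (U N a l \<sigma> - U N a l []) \<le> - (th \<gamma> N / 16 * R). m \<sigma>) \<ge> th \<gamma> N / 16"
proof -
  define d where "d = real CARD('n)"
  define D where "D = (digits N :: (real^'n) set)"
  define \<Delta> where "\<Delta> = (\<lambda>\<sigma>. U N a l \<sigma> - U N a l [])"
  define g2 where "g2 = \<gamma>\<^sup>2 * real N"
  have N2: "N \<ge> 2" and g1: "\<gamma> \<ge> 1" using Q by (auto simp: wqr_def)
  have N: "N > 0" using N2 by simp
  have d1: "d \<ge> 1" by (simp add: d_def Suc_leI)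
  have g2: "g2 \<ge> 1"
  proof -
    have "1 * 1 \<le> \<gamma>\<^sup>2 * real N" using g1 N2 by (intro mult_mono) auto
    then show ?thesis by (simp add: g2_def)
  qed
  have thv: "th \<gamma> N = 1 / (8 * d * g2)" by (simp add: th_def d_def g2_def mult_ac)
  have thpos: "th \<gamma> N > 0" using d1 g2 by (simp add: thv)
  have jn: "jump N \<ge> 0" by (simp add: jump_def)
  define X where "X = c2 * \<kappa>"
  have X0: "X \<ge> 0" using c2_ge kp by (simp add: X_def)
  have dg: "d * g2 \<ge> 1" using mult_mono[OF d1 g2] d1 by simp
  have R1: "128 * (d * g2) * X \<le> R" "\<kappa> \<le> R" "jump N * \<kappa> \<le> R"
  proof -
    have "Lam \<gamma> N * \<kappa> = 128 * (d * g2) * X + jump N * \<kappa> + \<kappa>" by (simp add: Lam_def X_def d_def g2_def algebra_simps)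
    moreover have "0 \<le> 128 * (d * g2) * X" "0 \<le> jump N * \<kappa>" using dg X0 jn kp by auto
    ultimately show "128 * (d * g2) * X \<le> R" "\<kappa> \<le> R" "jump N * \<kappa> \<le> R"
      using R kp by linarith+
  qed
  have finD: "finite D" by (simp add: D_def finite_digits)
  have Dne: "D \<noteq> {}" using zero_digits[OF N] by (auto simp: D_def)
  have cD: "real (card D) = real N ^ CARD('n)" by (simp add: D_def card_digits)
  have finS: "finite S" unfolding S_def by (rule finite_stops[OF finite_digits])
  have drift: "norm (\<Delta> \<sigma>) \<le> 2 * R" if "\<sigma> \<in> S" for \<sigma>
    unfolding \<Delta>_def by (rule stops_drift(1)[OF H N l R1(3)]) (use that R in \<open>auto simp: S_def\<close>)
  \<comment> \<open>The common bottom height: stopping cells lie at most n levels down, so their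
    sides are at least h.\<close>
  define h where "h = l / real N ^ n"
  have h0: "h > 0" using l N by (simp add: h_def)
  have side: "h \<le> l / real N ^ length \<sigma>" "l / real N ^ length \<sigma> \<le> l" if "\<sigma> \<in> S" for \<sigma>
  proof -
    have "length \<sigma> \<le> n" using stops_structure[OF that[unfolded S_def]] by auto
    then show "h \<le> l / real N ^ length \<sigma>" unfolding h_def
      using N l by (intro divide_left_mono power_increasing) auto
    show "l / real N ^ length \<sigma> \<le> l" using N l by (simp add: divide_le_eq mult_le_cancel_left1)
  qed
  have hl: "h \<le> l" using N l by (simp add: h_def divide_le_eq mult_le_cancel_left1)
  have pw: "(l / real N ^ length \<sigma>) ^ CARD('n) = l ^ CARD('n) * m \<sigma>" for \<sigma> :: "(real^'n) list"
    by (simp add: m_def cD[unfolded D_def] power_divide power_one_over power_mult[symmetric] mult.commute)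
  have m0: "m \<sigma> \<ge> 0" for \<sigma> :: "(real^'n) list" by (simp add: m_def)
  have m1: "(\<Sum>\<sigma>\<in>S. m \<sigma>) = 1"
    using sum_pow_cells[OF finD Dne, of _ n "[]"] unfolding S_def m_def D_def by simp
  have ld: "l ^ CARD('n) > 0" using l by simp
  have sm: "(\<Sum>\<sigma>\<in>S. c * (l ^ CARD('n) * m \<sigma>)) = c * l ^ CARD('n)" for c
  proof -
    have "(\<Sum>\<sigma>\<in>S. c * (l ^ CARD('n) * m \<sigma>)) = c * (l ^ CARD('n) * (\<Sum>\<sigma>\<in>S. m \<sigma>))"
      by (simp only: sum_distrib_left)
    then show ?thesis using m1 by simp
  qed
  \<comment> \<open>Shifted to vanish at the root corner, so that the root contributes only error
    terms.\<close>
  define W where "W = (\<lambda>e. dir e (e \<bullet> U N a l []))"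
  have We: "dir e (e \<bullet> U N a l []) = W e" for e by (simp add: W_def)
  have Wval: "W e (corner N \<sigma> a l, l / real N ^ length \<sigma>) = e \<bullet> \<Delta> \<sigma>" for e \<sigma>
    by (simp add: W_def dir_def \<Delta>_def U_def inner_diff_right)
  have Wroot: "W e (a, l) = 0" for e by (simp add: W_def dir_def U_def)
  define LL where "LL = (\<lambda>e \<sigma>. integral (cell N \<sigma> a l) (\<lambda>x. W e (x, h) - h * partial (0,1) (W e) (x, h)))"
  define QQ where "QQ = (\<lambda>e \<sigma>. integral (cell N \<sigma> a l) (\<lambda>x. (W e (x, h))\<^sup>2 - 2 * h * (W e (x, h) * partial (0,1) (W e) (x, h))))"
  define En where "En = (\<lambda>e \<sigma>. energy (W e) (corner N \<sigma> a l) (l / real N ^ length \<sigma>) h (l / real N ^ length \<sigma>))"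
  have contW: "continuous_on {p. snd p > 0} (W e)" "continuous_on {p. snd p > 0} (partial (0,1) (W e))" for e
    using dir_harmonic[of e "e \<bullet> U N a l []"] unfolding harmonic_half_def W_def by (auto simp: Basis_prod_def)
  \<comment> \<open>Since h is the same for all cells, the bottom integrals over the stopping cells
    add up to the one over the root cube.\<close>
  have LLsum: "(\<Sum>\<sigma>\<in>S. LL e \<sigma>) = LL e []" for e
    unfolding S_def LL_def
  proof (rule sum_stops_eq[OF finite_digits], simp only: append_Nil, rule integral_cell_children[OF N l])
    show "(\<lambda>x. W e (x, h) - h * partial (0, 1) (W e) (x, h)) integrable_on cube b r" for b r
      unfolding cube_def by (intro integrable_continuous continuous_intros continuous_slice[OF _ h0] contW)
  qed
  have QQsum: "(\<Sum>\<sigma>\<in>S. QQ e \<sigma>) = QQ e []" for e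
    unfolding S_def QQ_def
  proof (rule sum_stops_eq[OF finite_digits], simp only: append_Nil, rule integral_cell_children[OF N l])
    show "(\<lambda>x. (W e (x, h))\<^sup>2 - 2 * h * (W e (x, h) * partial (0, 1) (W e) (x, h))) integrable_on cube b r" for b r
      unfolding cube_def by (intro integrable_continuous continuous_intros continuous_slice[OF _ h0] contW)
  qed
  have balL: "\<bar>l ^ CARD('n) * m \<sigma> * (e \<bullet> \<Delta> \<sigma>) - LL e \<sigma>\<bar> \<le> X * (l ^ CARD('n) * m \<sigma>)" if "\<sigma> \<in> S" "norm e \<le> 1" for e \<sigma>
    using balance(1)[OF H that(2) h0 side[OF that(1)], where a="corner N \<sigma> a l" and c="e \<bullet> U N a l []"]
    unfolding We Wval pw LL_def cell_def X_def .
  have balQ: "\<bar>l ^ CARD('n) * m \<sigma> * (e \<bullet> \<Delta> \<sigma>)\<^sup>2 - (QQ e \<sigma> - En e \<sigma>)\<bar> \<le> X * (3 * R) * (l ^ CARD('n) * m \<sigma>)" if "\<sigma> \<in> S" "norm e \<le> 1" for e \<sigma>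
  proof -
    have "\<bar>l ^ CARD('n) * m \<sigma> * (e \<bullet> \<Delta> \<sigma>)\<^sup>2 - (QQ e \<sigma> - En e \<sigma>)\<bar> \<le> X * (\<bar>e \<bullet> \<Delta> \<sigma>\<bar> + \<kappa>) * (l ^ CARD('n) * m \<sigma>)"
      using balance(2)[OF H that(2) h0 side[OF that(1)], where a="corner N \<sigma> a l" and c="e \<bullet> U N a l []"]
      unfolding We Wval pw QQ_def En_def cell_def X_def .
    also have "\<dots> \<le> X * (3 * R) * (l ^ CARD('n) * m \<sigma>)"
    proof -
      have "\<bar>e \<bullet> \<Delta> \<sigma>\<bar> \<le> norm e * norm (\<Delta> \<sigma>)" by (rule Cauchy_Schwarz_ineq2)
      also have "\<dots> \<le> 1 * (2 * R)" using that drift by (intro mult_mono) auto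
      finally have "\<bar>e \<bullet> \<Delta> \<sigma>\<bar> + \<kappa> \<le> 3 * R" using R1 by simp
      then show ?thesis using X0 m0 ld by (intro mult_right_mono mult_left_mono) auto
    qed
    finally show ?thesis .
  qed
  have rootL: "\<bar>LL e []\<bar> \<le> X * l ^ CARD('n)" if "norm e \<le> 1" for e
    using balance(1)[OF H that h0 hl order_refl, where a=a and c="e \<bullet> U N a l []"]
    unfolding We Wroot LL_def cell_Nil X_def by simp
  have rootQ: "\<bar>QQ e [] - En e []\<bar> \<le> X * R * l ^ CARD('n)" if "norm e \<le> 1" for e
  proof -
    have "\<bar>QQ e [] - En e []\<bar> \<le> X * \<kappa> * l ^ CARD('n)"
      using balance(2)[OF H that h0 hl order_refl, where a=a and c="e \<bullet> U N a l []"]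
      unfolding We Wroot QQ_def En_def cell_Nil X_def by simp
    also have "\<dots> \<le> X * R * l ^ CARD('n)" using R1 X0 ld by (intro mult_right_mono mult_left_mono) auto
    finally show ?thesis .
  qed
  \<comment> \<open>Energy of the region above the stopping cells, which consists of the top boxes
    of the nodes strictly above them.\<close>
  define ED where "ED = (\<lambda>e. En e [] - (\<Sum>\<sigma>\<in>S. En e \<sigma>))"
  define V where "V = (\<lambda>e. \<Sum>\<sigma>\<in>S. m \<sigma> * (e \<bullet> \<Delta> \<sigma>)\<^sup>2)"
  have VE: "\<bar>l ^ CARD('n) * V e - ED e\<bar> \<le> 4 * X * R * l ^ CARD('n)" if "norm e \<le> 1" for e
  proof -
    have "\<bar>(\<Sum>\<sigma>\<in>S. l ^ CARD('n) * m \<sigma> * (e \<bullet> \<Delta> \<sigma>)\<^sup>2 - (QQ e \<sigma> - En e \<sigma>))\<bar> \<le> (\<Sum>\<sigma>\<in>S. X * (3 * R) * (l ^ CARD('n) * m \<sigma>))"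
      by (rule order_trans[OF sum_abs sum_mono]) (rule balQ[OF _ that])
    also have "\<dots> = X * (3 * R) * l ^ CARD('n)" by (rule sm)
    also have "(\<Sum>\<sigma>\<in>S. l ^ CARD('n) * m \<sigma> * (e \<bullet> \<Delta> \<sigma>)\<^sup>2 - (QQ e \<sigma> - En e \<sigma>)) = l ^ CARD('n) * V e - (QQ e [] - (\<Sum>\<sigma>\<in>S. En e \<sigma>))"
      unfolding sum_subtractf QQsum V_def by (simp add: sum_distrib_left mult_ac)
    finally show ?thesis using rootQ[OF that] unfolding ED_def by (simp add: abs_le_iff algebra_simps)
  qed
  \<comment> \<open>Optional stopping for \<open>g2 * En e - En e'\<close>: splitting a node
    releases the contribution of its top box, which is nonnegative by isotropy.\<close>
  have iso: "ED e' \<le> g2 * ED e" if "norm e' = 1" for e'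
  proof -
    have "(\<Sum>\<sigma>\<in>S. g2 * En e \<sigma> - En e' \<sigma>) \<le> g2 * En e [] - En e' []"
      unfolding S_def
    proof (rule sum_stops_le[OF finite_digits])
      fix u :: "(real^'n) list" assume u: "set u \<subseteq> digits N" "length u < n"
      define s where "s = l / real N ^ length u"
      define b where "b = corner N u a l"
      have s: "s > 0" using N l by (simp add: s_def)
      have hs: "h \<le> s / real N"
      proof -
        have "s / real N = l / real N ^ Suc (length u)" by (simp add: s_def mult.commute)
        moreover have "h \<le> l / real N ^ Suc (length u)" unfolding h_def
          using N l u(2) by (intro divide_left_mono power_increasing) auto
        ultimately show ?thesis by simp
      qed
      have En_u: "En e'' u = energy (W e'') b s (s / real N) s + (\<Sum>v\<in>digits N. En e'' (u @ [v]))" for e''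
      proof -
        have "En e'' u = energy (W e'') b s h s" by (simp add: En_def b_def s_def)
        also have "\<dots> = energy (W e'') b s (s / real N) s + (\<Sum>v\<in>digits N. energy (W e'') (b + (s / real N) *\<^sub>R v) (s / real N) h (s / real N))"
          unfolding W_def by (rule energy_children[OF dir_harmonic N s h0 hs])
        also have "(\<Sum>v\<in>digits N. energy (W e'') (b + (s / real N) *\<^sub>R v) (s / real N) h (s / real N)) = (\<Sum>v\<in>digits N. En e'' (u @ [v]))"
          by (rule sum.cong[OF refl]) (simp add: En_def b_def s_def corner_snoc mult.commute)
        finally show ?thesis .
      qed
      have "energy (W e') b s (s / real N) s \<le> g2 * energy (W e) b s (s / real N) s"
        unfolding W_def g2_def by (rule energy_isotropy[OF Q s e that])
      then show "(\<Sum>v\<in>digits N. g2 * En e (([] @ u) @ [v]) - En e' (([] @ u) @ [v])) \<le> g2 * En e ([] @ u) - En e' ([] @ u)"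
        using En_u[of e] En_u[of e'] by (simp add: sum_subtractf sum_distrib_left[symmetric] distrib_left)
    qed
    then show ?thesis unfolding ED_def by (simp add: sum_subtractf sum_distrib_left[symmetric] right_diff_distrib)
  qed
  \<comment> \<open>Exited cells have |\<Delta>| > R and total mass at least 1/2, and the squared
    norm is the sum over the coordinate axes.\<close>
  have total: "R\<^sup>2 / 2 \<le> (\<Sum>i\<in>UNIV. V (axis i 1))"
  proof -
    have nn: "(norm (\<Delta> \<sigma>))\<^sup>2 = (\<Sum>i\<in>UNIV. (axis i 1 \<bullet> \<Delta> \<sigma>)\<^sup>2)" for \<sigma>
      by (simp add: norm_vec_def L2_set_def sum_nonneg inner_axis' )
    have "R\<^sup>2 * (1/2) \<le> R\<^sup>2 * (\<Sum>\<sigma> | \<sigma> \<in> S \<and> norm (\<Delta> \<sigma>) > R. m \<sigma>)"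
      using exit by (intro mult_left_mono) (auto simp: \<Delta>_def)
    also have "\<dots> \<le> (\<Sum>\<sigma> | \<sigma> \<in> S \<and> norm (\<Delta> \<sigma>) > R. m \<sigma> * (norm (\<Delta> \<sigma>))\<^sup>2)"
      unfolding sum_distrib_left
    proof (rule sum_mono)
      fix \<sigma> assume "\<sigma> \<in> {\<sigma> \<in> S. norm (\<Delta> \<sigma>) > R}"
      then have "R\<^sup>2 \<le> (norm (\<Delta> \<sigma>))\<^sup>2" using R by (intro power_mono) auto
      then show "R\<^sup>2 * m \<sigma> \<le> m \<sigma> * (norm (\<Delta> \<sigma>))\<^sup>2" using m0[of \<sigma>] by (simp add: mult.commute mult_left_mono)
    qed
    also have "\<dots> \<le> (\<Sum>\<sigma>\<in>S. m \<sigma> * (norm (\<Delta> \<sigma>))\<^sup>2)" by (rule sum_mono2) (use finS m0 in auto)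
    also have "\<dots> = (\<Sum>i\<in>UNIV. V (axis i 1))"
      unfolding nn V_def sum_distrib_left by (rule sum.swap)
    finally show ?thesis by simp
  qed
  have EDe: "R\<^sup>2 / 4 * l ^ CARD('n) \<le> d * g2 * ED e"
  proof -
    have "l ^ CARD('n) * (R\<^sup>2 / 2) \<le> l ^ CARD('n) * (\<Sum>i\<in>UNIV. V (axis i 1))" using total ld by (intro mult_left_mono) auto
    also have "\<dots> \<le> (\<Sum>i\<in>(UNIV :: 'n set). g2 * ED e + 4 * X * R * l ^ CARD('n))"
      unfolding sum_distrib_left
    proof (rule sum_mono)
      fix i :: 'n
      have "norm (axis i (1::real)) = 1" by simp
      then show "l ^ CARD('n) * V (axis i 1) \<le> g2 * ED e + 4 * X * R * l ^ CARD('n)"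
        using VE[of "axis i 1"] iso[of "axis i 1"] by (simp add: abs_le_iff)
    qed
    also have "\<dots> = d * g2 * ED e + 4 * d * X * R * l ^ CARD('n)" by (simp add: d_def algebra_simps)
    finally have 1: "l ^ CARD('n) * (R\<^sup>2 / 2) \<le> d * g2 * ED e + 4 * d * X * R * l ^ CARD('n)" .
    have "16 * d * X \<le> R"
    proof -
      have "d * 1 \<le> d * g2" using d1 g2 by (intro mult_left_mono) auto
      then have "16 * d * X \<le> 128 * (d * g2) * X" using X0 d1 by (intro mult_right_mono) auto
      then show ?thesis using R1 by linarith
    qed
    then have "(16 * d * X) * (R * l ^ CARD('n)) \<le> R * (R * l ^ CARD('n))" using R ld by (intro mult_right_mono) auto
    then have "4 * d * X * R * l ^ CARD('n) \<le> R\<^sup>2 / 4 * l ^ CARD('n)" by (simp add: power2_eq_square mult_ac)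
    with 1 show ?thesis by (simp add: algebra_simps)
  qed
  have Vlow: "th \<gamma> N * R\<^sup>2 \<le> V e"
  proof -
    have "R\<^sup>2 / 4 * l ^ CARD('n) \<le> d * g2 * (l ^ CARD('n) * V e + 4 * X * R * l ^ CARD('n))"
      using EDe VE[of e] e dg by (intro order_trans[OF EDe] mult_left_mono) (auto simp: abs_le_iff)
    then have "l ^ CARD('n) * (R\<^sup>2 / 4) \<le> l ^ CARD('n) * (d * g2 * V e + 4 * (d * g2) * X * R)" by (simp add: algebra_simps)
    then have 1: "R\<^sup>2 / 4 \<le> d * g2 * V e + 4 * (d * g2) * X * R" using ld by (simp only: mult_le_cancel_left_pos)
    have "(32 * (d * g2) * X) * R \<le> R * R"
    proof (intro mult_right_mono)
      have "0 \<le> (d * g2) * X" using dg X0 by simp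
      then show "32 * (d * g2) * X \<le> R" using R1(1) by (simp add: mult.assoc)
    qed (use R in simp)
    then have "4 * (d * g2) * X * R \<le> R\<^sup>2 / 8" by (simp add: power2_eq_square)
    with 1 have "R\<^sup>2 \<le> 8 * (d * g2) * V e" by simp
    then show ?thesis unfolding thv using d1 g2 by (simp add: divide_le_eq mult_ac)
  qed
  have mean: "\<bar>\<Sum>\<sigma>\<in>S. m \<sigma> * (e \<bullet> \<Delta> \<sigma>)\<bar> \<le> th \<gamma> N / 8 * R"
  proof -
    have "\<bar>(\<Sum>\<sigma>\<in>S. l ^ CARD('n) * m \<sigma> * (e \<bullet> \<Delta> \<sigma>) - LL e \<sigma>)\<bar> \<le> (\<Sum>\<sigma>\<in>S. X * (l ^ CARD('n) * m \<sigma>))"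
      by (rule order_trans[OF sum_abs sum_mono]) (rule balL, use e in auto)
    also have "\<dots> = X * l ^ CARD('n)" by (rule sm)
    also have "(\<Sum>\<sigma>\<in>S. l ^ CARD('n) * m \<sigma> * (e \<bullet> \<Delta> \<sigma>) - LL e \<sigma>) = l ^ CARD('n) * (\<Sum>\<sigma>\<in>S. m \<sigma> * (e \<bullet> \<Delta> \<sigma>)) - LL e []"
      unfolding sum_subtractf LLsum by (simp add: sum_distrib_left mult_ac)
    finally have "\<bar>l ^ CARD('n) * (\<Sum>\<sigma>\<in>S. m \<sigma> * (e \<bullet> \<Delta> \<sigma>))\<bar> \<le> l ^ CARD('n) * (2 * X)"
      using rootL[of e] e by (simp add: abs_le_iff algebra_simps)
    then have "l ^ CARD('n) * \<bar>\<Sum>\<sigma>\<in>S. m \<sigma> * (e \<bullet> \<Delta> \<sigma>)\<bar> \<le> l ^ CARD('n) * (2 * X)" using ld by (simp add: abs_mult)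
    then have "\<bar>\<Sum>\<sigma>\<in>S. m \<sigma> * (e \<bullet> \<Delta> \<sigma>)\<bar> \<le> 2 * X" using ld by (simp only: mult_le_cancel_left_pos)
    also have "2 * X \<le> th \<gamma> N / 8 * R" unfolding thv using R1(1) d1 g2 by (simp add: field_simps)
    finally show ?thesis .
  qed
  have \<Delta>e: "U N a l \<sigma> - U N a l [] = \<Delta> \<sigma>" for \<sigma> by (simp add: \<Delta>_def)
  show ?thesis unfolding \<Delta>e
  proof (rule negative_part_mass[where X="\<lambda>\<sigma>. e \<bullet> \<Delta> \<sigma>", OF finS m0 m1 _ R(1) thpos])
    fix \<sigma> assume s: "\<sigma> \<in> S"
    have "\<bar>e \<bullet> \<Delta> \<sigma>\<bar> \<le> norm e * norm (\<Delta> \<sigma>)" by (rule Cauchy_Schwarz_ineq2)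
    then show "\<bar>e \<bullet> \<Delta> \<sigma>\<bar> \<le> 2 * R" using drift[OF s] e by simp
  qed (use Vlow mean in \<open>auto simp: V_def\<close>)
qed

end

section \<open>Selection of subcubes\<close>

context cantor_tree begin

lemma gen_add: "gen (i + j) x = (\<Union>y\<in>gen i x. gen j y)"
  by (induction i arbitrary: x) auto

lemma gen_ext:
  assumes "x \<in> G" "y \<in> gen j x"
  shows "\<exists>u. wd y = wd x @ u \<and> set u \<subseteq> D \<and> j * m \<le> length u"
  using assms
proof (induction j arbitrary: x)
  case 0 then show ?case by simp
next
  case (Suc j)
  then obtain z where z: "z \<in> ch x" "y \<in> gen j z" by auto
  obtain u where u: "wd z = wd x @ u" "set u \<subseteq> D" "m \<le> length u" using ch_ext[OF Suc.prems(1) z(1)] by blast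
  obtain u' where u': "wd y = wd z @ u'" "set u' \<subseteq> D" "j * m \<le> length u'"
    using Suc.IH[of z] ch(1)[OF Suc.prems(1)] z by blast
  show ?case by (rule exI[of _ "u @ u'"]) (use u u' in auto)
qed

end

lemma digits_weight: "N \<ge> 2 \<Longrightarrow> (real N powr (-s)) * real (card (digits N :: (real^'n) set)) = real N powr (real CARD('n) - s)"
  by (simp add: card_digits powr_realpow[symmetric] powr_add[symmetric])

text \<open>\<open>cover_mass\<close> at the root supplies hypothesis \<open>cover\<close> with
  \<eta> = c: the root word is empty, so no covering word lies strictly above it.\<close>

lemma cantor_hausdorff:
  fixes wd :: "'x \<Rightarrow> (real^'n) list" and a :: "real^'n"
  assumes tree: "cantor_tree (digits N) wd ch G c (real N powr (-s)) m"
    and x0: "x0 \<in> G" "wd x0 = []" and N: "N \<ge> 2" and l: "l > 0" and s: "s > 0"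
    and A: "\<And>x. (\<And>j. \<exists>y\<in>cantor_tree.gen ch j x0. x \<in> cell N (wd y) a l) \<Longrightarrow> x \<in> A"
  shows "hausdorff_measure s A \<noteq> 0"
proof -
  interpret cantor_tree "digits N" wd ch G c "real N powr (-s)" m by (rule tree)
  have N0: "N > 0" using N by simp
  have wdD: "set (wd y) \<subseteq> digits N" if "y \<in> gen j x0" for y j
    using gen_ext[OF x0(1) that] x0(2) by auto
  show ?thesis
  proof (rule hausdorff_measure_pos[where \<G>="\<lambda>j. wd ` gen j x0" and a=a and l=l and N=N and \<eta>=c])
    show "finite (wd ` gen j x0)" for j using finite_gen[OF x0(1)] by simp
    show "set w \<subseteq> digits N" if "w \<in> wd ` gen j x0" for j w using that wdD by auto
    show "(\<Union>w\<in>wd ` gen (Suc j) x0. cell N w a l) \<subseteq> (\<Union>w\<in>wd ` gen j x0. cell N w a l)" for j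
    proof clarify
      fix x y assume y: "y \<in> gen (Suc j) x0" "x \<in> cell N (wd y) a l"
      have "gen (j + 1) x0 = (\<Union>z\<in>gen j x0. gen 1 z)" by (rule gen_add)
      then obtain z where z: "z \<in> gen j x0" "y \<in> ch z" using y(1) by auto
      have "z \<in> G" using gen_G[OF x0(1)] z(1) by blast
      then obtain u where u: "wd y = wd z @ u" "set u \<subseteq> digits N" using ch_ext z(2) by blast
      then have "x \<in> cell N (wd z) a l" using cell_append_subset[OF N0 l u(2), of "wd z" a] y(2) by auto
      then show "x \<in> (\<Union>w\<in>wd ` gen j x0. cell N w a l)" using z(1) by blast
    qed
    show "(\<Inter>j. \<Union>w\<in>wd ` gen j x0. cell N w a l) \<subseteq> A" using A by auto
    fix j \<W> L0 assume W: "finite \<W>"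
      and cov: "\<And>L w z. L0 \<le> L \<Longrightarrow> w \<in> wd ` gen j x0 \<Longrightarrow> z \<in> ext (digits N) L w \<Longrightarrow> \<exists>W\<in>\<W>. prefix W z"
    obtain L1 where L1: "\<And>y. y \<in> gen j x0 \<Longrightarrow> length (wd y) \<le> L1"
      using finite_nat_set_iff_bounded_le[of "(\<lambda>y. length (wd y)) ` gen j x0"] finite_gen[OF x0(1), of j] by auto
    have "c * (real N powr (-s)) ^ length (wd x0) \<le> (\<Sum>W | W \<in> \<W> \<and> prefix (wd x0) W. (real N powr (-s)) ^ length W)"
    proof (rule cover_mass[OF x0(1) W, where L="max L0 L1" and j=j])
      show "\<exists>W\<in>\<W>. prefix W z" if "y \<in> gen j x0" "z \<in> ext (digits N) (max L0 L1) (wd y)" for y z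
        by (rule cov[of "max L0 L1" "wd y"]) (use that in auto)
      show "length (wd y) \<le> max L0 L1" if "y \<in> gen j x0" for y using L1[OF that] by simp
      show "W = wd x0" if "prefix W (wd x0)" for W using that x0(2) by simp
    qed
    then show "c \<le> (\<Sum>W\<in>\<W>. (real N powr (-s)) ^ length W)" by (simp add: x0(2))
  qed (use N l s c in auto)
qed

text \<open>For families that keep half of the descendants of w at every level
  \<open>kraft_cover\<close> alone bounds the mass of a cover from below, and for s < d the weight
  N^(-s) per level is at least the mass N^(-d).\<close>

lemma persistent_hausdorff:
  fixes w :: "(real^'n) list" and a :: "real^'n"
  assumes N: "N \<ge> 2" and l: "l > 0" and s: "0 < s" "s < real CARD('n)" and w: "set w \<subseteq> digits N"
    and S: "\<And>n u. u \<in> S n \<Longrightarrow> set u \<subseteq> digits N \<and> length u = n"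
    and dec: "\<And>n u. u \<in> S (Suc n) \<Longrightarrow> take n u \<in> S n"
    and mass: "\<And>n. 1/2 \<le> (\<Sum>u\<in>S n. (1 / real (card (digits N :: (real^'n) set))) ^ length u)"
    and A: "\<And>x. (\<And>n. \<exists>u\<in>S n. x \<in> cell N (w @ u) a l) \<Longrightarrow> x \<in> A"
  shows "hausdorff_measure s A \<noteq> 0"
proof -
  define D where "D = (digits N :: (real^'n) set)"
  define b where "b = real (card D)"
  define q where "q = real N powr (-s)"
  have N0: "N > 0" using N by simp
  have D: "finite D" "D \<noteq> {}" using zero_digits[OF N0] by (auto simp: D_def finite_digits)
  have b: "b > 0" using D by (simp add: b_def card_gt_0_iff)
  have finS: "finite (S n)" for n
    by (rule finite_subset[OF _ finite_lists_length_eq[OF finite_digits, of N n]]) (use S in auto)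
  have qb: "q * b = real N powr (real CARD('n) - s)" using digits_weight[OF N, of s, where 'n='n] by (simp add: q_def b_def D_def)
  have "q * b \<ge> 1" unfolding qb using N s by (intro ge_one_powr_ge_zero) auto
  then have qge: "1 / b \<le> q" using b by (simp add: divide_le_eq)
  show ?thesis
  proof (rule hausdorff_measure_pos[where \<G>="\<lambda>n. (\<lambda>u. w @ u) ` S n" and a=a and l=l and N=N and \<eta>="1/2 * (1/b) ^ length w"])
    show "finite ((\<lambda>u. w @ u) ` S n)" for n using finS by simp
    show "set v \<subseteq> digits N" if "v \<in> (\<lambda>u. w @ u) ` S n" for n v
    proof -
      from that obtain u where "v = w @ u" "u \<in> S n" by auto
      then show ?thesis using S[of u n] w by auto
    qed
    show "(\<Union>v\<in>(\<lambda>u. w @ u) ` S (Suc n). cell N v a l) \<subseteq> (\<Union>v\<in>(\<lambda>u. w @ u) ` S n. cell N v a l)" for n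
    proof clarify
      fix x u assume u: "u \<in> S (Suc n)" "x \<in> cell N (w @ u) a l"
      have "w @ u = (w @ take n u) @ drop n u" by simp
      moreover have "set (drop n u) \<subseteq> digits N" using S[OF u(1)] set_drop_subset[of n u] by auto
      ultimately have "x \<in> cell N (w @ take n u) a l" using cell_append_subset[OF N0 l, of "drop n u" "w @ take n u" a] u(2) by auto
      then show "x \<in> (\<Union>v\<in>(\<lambda>u. w @ u) ` S n. cell N v a l)" using dec[OF u(1)] by blast
    qed
    show "(\<Inter>n. \<Union>v\<in>(\<lambda>u. w @ u) ` S n. cell N v a l) \<subseteq> A" using A by auto
    fix n \<W> L0 assume W: "finite \<W>"
      and cov: "\<And>L v z. L0 \<le> L \<Longrightarrow> v \<in> (\<lambda>u. w @ u) ` S n \<Longrightarrow> z \<in> ext (digits N) L v \<Longrightarrow> \<exists>W\<in>\<W>. prefix W z"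
    define L where "L = L0 + length w + n"
    define X where "X = (\<Union>u\<in>S n. ext D L (w @ u))"
    have len: "length (w @ u) = length w + n" if "u \<in> S n" for u using S[OF that] by simp
    have "X \<subseteq> (\<Union>W\<in>\<W>. ext D L W)"
    proof
      fix z assume "z \<in> X"
      then obtain u where u: "u \<in> S n" "z \<in> ext D L (w @ u)" by (auto simp: X_def)
      then obtain W where W: "W \<in> \<W>" "prefix W z" using cov[of L "w @ u" z] by (auto simp: L_def D_def)
      obtain t where t: "z = W @ t" using W(2) by (auto simp: prefix_def)
      have "set z \<subseteq> D" "length z = L" using u S[OF u(1)] w by (auto simp: ext_def D_def)
      then have "z \<in> ext D L W" using t by (auto simp: ext_def)
      then show "z \<in> (\<Union>W\<in>\<W>. ext D L W)" using W(1) by blast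
    qed
    from kraft_cover[OF D W this] have k: "real (card X) \<le> b ^ L * (\<Sum>W\<in>\<W>. (1/b) ^ length W)" by (simp add: b_def)
    have "card X = (\<Sum>u\<in>S n. card (ext D L (w @ u)))"
      unfolding X_def
    proof (rule card_UN_disjoint[OF finS])
      show "\<forall>u\<in>S n. finite (ext D L (w @ u))" using card_ext(1)[OF D(1)] len by (auto simp: L_def)
      show "\<forall>u\<in>S n. \<forall>v\<in>S n. u \<noteq> v \<longrightarrow> ext D L (w @ u) \<inter> ext D L (w @ v) = {}"
      proof (intro ballI impI)
        fix u v assume uv: "u \<in> S n" "v \<in> S n" "u \<noteq> v"
        have "length u = length v" using S uv by simp
        then show "ext D L (w @ u) \<inter> ext D L (w @ v) = {}" using uv(3) by (auto simp: ext_def)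
      qed
    qed
    moreover have "real (card (ext D L (w @ u))) = b ^ L * (1/b) ^ length (w @ u)" if u: "u \<in> S n" for u
    proof -
      have le: "length (w @ u) \<le> L" using len[OF u] by (simp add: L_def)
      have "real (card (ext D L (w @ u))) = b ^ (L - length (w @ u))" by (simp only: card_ext(2)[OF D(1) le] b_def of_nat_power)
      then show ?thesis unfolding power_diff_inverse[OF b le] .
    qed
    ultimately have "real (card X) = (\<Sum>u\<in>S n. b ^ L * (1/b) ^ length (w @ u))" by simp
    also have "\<dots> = b ^ L * ((1/b) ^ length w * (\<Sum>u\<in>S n. (1/b) ^ length u))"
      by (simp add: sum_distrib_left power_add mult_ac)
    finally have "b ^ L * ((1/b) ^ length w * (\<Sum>u\<in>S n. (1/b) ^ length u)) \<le> b ^ L * (\<Sum>W\<in>\<W>. (1/b) ^ length W)" using k by simp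
    then have "(1/b) ^ length w * (\<Sum>u\<in>S n. (1/b) ^ length u) \<le> (\<Sum>W\<in>\<W>. (1/b) ^ length W)" using b by simp
    moreover have "(1/b) ^ length w * (1/2) \<le> (1/b) ^ length w * (\<Sum>u\<in>S n. (1/b) ^ length u)"
      using mass[of n] b by (intro mult_left_mono) (auto simp: b_def D_def)
    moreover have "(\<Sum>W\<in>\<W>. (1/b) ^ length W) \<le> (\<Sum>W\<in>\<W>. q ^ length W)"
      using qge b by (intro sum_mono power_mono) auto
    ultimately show "1/2 * (1/b) ^ length w \<le> (\<Sum>W\<in>\<W>. (real N powr (-s)) ^ length W)" by (simp add: q_def)
  qed (use N l s b in auto)
qed

context bounded_continuous begin

lemma U_append: "U N a l (w @ u) = U N (corner N w a l) (l / real N ^ length w) u"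
  by (simp add: U_def corner_append power_add)

lemma norm_le_directions:
  fixes v :: "real^'n"
  assumes "\<And>e. norm e \<le> 1 \<Longrightarrow> \<bar>e \<bullet> v\<bar> \<le> M" shows "norm v \<le> M"
proof -
  have "norm (sgn v) \<le> 1" by (simp add: norm_sgn)
  moreover have "sgn v \<bullet> v = norm v" by (cases "v = 0") (auto simp: sgn_div_norm dot_square_norm power2_eq_square)
  ultimately show ?thesis using assms[of "sgn v"] by simp
qed

lemma grad_cell:
  assumes H: "hess_le \<kappa> (l / real N ^ length v)" and N: "N > 0" and l: "l > 0" and x: "x \<in> cell N v a l"
  shows "norm (grad (x, l / real N ^ length v) - U N a l v) \<le> cc * \<kappa>"
proof (rule norm_le_directions)
  fix e :: "real^'n" assume e: "norm e \<le> 1"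
  define s where "s = l / real N ^ length v"
  have s: "s > 0" using N l by (simp add: s_def)
  have "\<bar>dir e 0 (x, s) - dir e 0 (corner N v a l, s)\<bar> \<le> cc * \<kappa>"
  proof (rule dir_horizontal[OF H[folded s_def] e s order_refl])
    fix j
    have "corner N v a l $ j \<le> x $ j \<and> x $ j \<le> corner N v a l $ j + s"
      using x unfolding cell_def mem_cube s_def by blast
    then show "\<bar>x $ j - corner N v a l $ j\<bar> \<le> 2 * s" using s by auto
  qed
  then show "\<bar>e \<bullet> (grad (x, l / real N ^ length v) - U N a l v)\<bar> \<le> cc * \<kappa>"
    by (simp add: dir_def U_def s_def inner_diff_right)
qed

lemma grad_height:
  assumes H: "hess_le \<kappa> l" and t: "0 < t" "t \<le> s" "s \<le> l"
  shows "norm (grad (x, s) - grad (x, t)) \<le> 2 * (cc * \<kappa>) * sqrt (s / t)"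
proof (rule norm_le_directions)
  fix e :: "real^'n" assume e: "norm e \<le> 1"
  show "\<bar>e \<bullet> (grad (x, s) - grad (x, t))\<bar> \<le> 2 * (cc * \<kappa>) * sqrt (s / t)"
    using dir_vertical[OF H e t, of 0 x] by (simp add: dir_def inner_diff_right)
qed

lemma side_le: "N > 0 \<Longrightarrow> l > 0 \<Longrightarrow> l / real N ^ k \<le> l"
  by (simp add: divide_le_eq mult_le_cancel_left1)

text \<open>Serves as a lower bound for the number of levels that it takes to move a given
  distance.\<close>

lemma U_drift:
  assumes H: "hess_le \<kappa> l" and N: "N > 0" and l: "l > 0" and u: "set u \<subseteq> digits N"
  shows "norm (U N a l u - U N a l []) \<le> jump N * \<kappa> * real (length u)"
  using u
proof (induction u rule: rev_induct)
  case Nil then show ?case by simp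
next
  case (snoc v u)
  have "norm (U N a l (u @ [v]) - U N a l u) \<le> jump N * \<kappa>"
    by (rule U_jump[OF hess_le_mono[OF H side_le[OF N l]] N l]) (use snoc.prems in simp)
  moreover have "norm (U N a l (u @ [v]) - U N a l []) \<le> norm (U N a l (u @ [v]) - U N a l u) + norm (U N a l u - U N a l [])"
    using norm_triangle_ineq[of "U N a l (u @ [v]) - U N a l u" "U N a l u - U N a l []"] by simp
  ultimately show ?case using snoc by (simp add: distrib_left)
qed

text \<open>The fraction of mass and also, in units of R, the inward progress granted by
  \<open>exit_direction\<close>.\<close>

definition rho :: "real \<Rightarrow> nat \<Rightarrow> real" where "rho \<gamma> N = th \<gamma> N / 16"

lemma rho_bounds: assumes "wqr \<gamma> N" shows "0 < rho \<gamma> N" "rho \<gamma> N \<le> 1/2"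
proof -
  have g: "\<gamma> \<ge> 1" "N \<ge> 2" using assms by (auto simp: wqr_def)
  define X where "X = real CARD('n) * \<gamma>\<^sup>2 * real N"
  have "1 * 1 * 1 \<le> X" unfolding X_def using g by (intro mult_mono) (auto simp: Suc_leI)
  then have X: "1 \<le> X" by simp
  have "rho \<gamma> N = 1 / (128 * X)" by (simp add: rho_def th_def X_def mult.assoc)
  then show "0 < rho \<gamma> N" "rho \<gamma> N \<le> 1/2" using X by (auto simp: divide_le_eq)
qed

text \<open>
  From a vector of norm \<open>r \<le> M = 4 R / \<rho>\<close>, a step \<open>\<Delta>\<close> of length at most \<open>2 R\<close> pointing inward
  (\<open>e \<bullet> \<Delta> \<le> - \<rho> R\<close>) stays in the ball of radius \<open>M\<close>.
\<close>

lemma inward_step: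
  fixes v \<Delta> e :: "real^'n"
  assumes v: "v = norm v *\<^sub>R e" "norm v \<le> 4 / \<rho> * R" and D: "norm \<Delta> \<le> 2 * R" "e \<bullet> \<Delta> \<le> - (\<rho> * R)"
    and R: "R > 0" and \<rho>: "0 < \<rho>" "\<rho> \<le> 1"
  shows "norm (v + \<Delta>) \<le> 4 / \<rho> * R"
\<comment> \<open>Near the centre the triangle inequality suffices, as 2R is at most 2 R / \<rho>.
  Further out, twice the inner product is at most -4 R^2 and outweighs |\<Delta>|^2, so the norm
  does not increase.\<close>
proof (cases "norm v \<le> 2 / \<rho> * R")
  case True
  have "2 * R \<le> 2 / \<rho> * R" using R \<rho> by (simp add: field_simps)
  then have "norm v + norm \<Delta> \<le> 2 / \<rho> * R + 2 / \<rho> * R" using True D(1) by linarith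
  also have "\<dots> = 4 / \<rho> * R" by simp
  finally show ?thesis using norm_triangle_ineq[of v \<Delta>] by linarith
next
  case False
  have "v \<bullet> \<Delta> = norm v * (e \<bullet> \<Delta>)" by (subst v(1)) simp
  also have "\<dots> \<le> norm v * (- (\<rho> * R))" using D(2) by (intro mult_left_mono) auto
  also have "\<dots> \<le> (2 / \<rho> * R) * (- (\<rho> * R))" using False R \<rho> by (intro mult_right_mono_neg) auto
  also have "\<dots> = - (2 * R\<^sup>2)" using \<rho> by (simp add: power2_eq_square)
  finally have 1: "v \<bullet> \<Delta> \<le> - (2 * R\<^sup>2)" .
  have 2: "(norm \<Delta>)\<^sup>2 \<le> (2 * R)\<^sup>2" using D(1) by (intro power_mono) auto
  have "(norm (v + \<Delta>))\<^sup>2 = (norm v)\<^sup>2 + 2 * (v \<bullet> \<Delta>) + (norm \<Delta>)\<^sup>2"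
    by (simp add: power2_norm_eq_inner inner_add_left inner_add_right inner_commute)
  also have "\<dots> \<le> (norm v)\<^sup>2" using 1 2 by (simp add: power_mult_distrib)
  finally have "norm (v + \<Delta>) \<le> norm v" by (rule power2_le_imp_le) simp
  then show ?thesis using v(2) by linarith
qed

text \<open>All prefixes are tested, not only the endpoint: the families are then nested under
  \<open>take\<close>, and U is controlled at every intermediate level.\<close>

definition stay :: "nat \<Rightarrow> real^'n \<Rightarrow> real \<Rightarrow> real \<Rightarrow> (real^'n) list \<Rightarrow> nat \<Rightarrow> (real^'n) list set" where
  "stay N a l R w n = {u. set u \<subseteq> digits N \<and> length u = n \<and> (\<forall>j\<le>n. norm (U N a l (w @ take j u) - U N a l w) \<le> R)}"

text \<open>If for some n the exited words carry half of the mass, \<open>exit_direction\<close>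
  applies. Otherwise for every n the words that have not exited carry more than half, and these
  belong to \<open>stay\<close>. In the first case the word length is bounded below because the
  e-component moves by \<rho> R in steps of at most \<open>jump N * \<kappa>\<close>.\<close>

lemma step_dichotomy:
  fixes a z :: "real^'n" and w :: "(real^'n) list"
  assumes Q: "wqr \<gamma> N" and l: "l > 0" and H: "hess_le \<kappa> (l / real N ^ length w)" and kp: "\<kappa> \<ge> 0"
    and R: "R > 0" "Lam \<gamma> N * \<kappa> \<le> R" and z: "norm (U N a l w - z) \<le> 4 / rho \<gamma> N * R"
  defines "mm \<equiv> \<lambda>u::(real^'n) list. (1 / real (card (digits N :: (real^'n) set))) ^ length u"
  shows "(\<exists>S. finite S \<and> (\<forall>u\<in>S. set u \<subseteq> digits N \<and> norm (U N a l (w @ u) - z) \<le> 4 / rho \<gamma> N * R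
         \<and> rho \<gamma> N * R \<le> jump N * \<kappa> * real (length u)
         \<and> (\<forall>\<tau>. prefix \<tau> u \<longrightarrow> norm (U N a l (w @ \<tau>) - U N a l w) \<le> 2 * R))
       \<and> (\<forall>u\<in>S. \<forall>v\<in>S. prefix u v \<longrightarrow> u = v) \<and> rho \<gamma> N \<le> (\<Sum>u\<in>S. mm u))
    \<or> (\<forall>n. 1/2 \<le> (\<Sum>u\<in>stay N a l R w n. mm u))"
proof -
  define b where "b = corner N w a l"
  define s where "s = l / real N ^ length w"
  have N2: "N \<ge> 2" using Q by (simp add: wqr_def)
  have N: "N > 0" using N2 by simp
  have s: "s > 0" using l N by (simp add: s_def)
  have Ub: "U N a l (w @ u) = U N b s u" for u by (simp add: U_append b_def s_def)
  have Uw: "U N a l w = U N b s []" using Ub[of "[]"] by simp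
  have fd: "finite (digits N :: (real^'n) set)" "(digits N :: (real^'n) set) \<noteq> {}"
    using zero_digits[OF N] by (auto simp: finite_digits)
  define P where "P = (\<lambda>\<sigma>. norm (U N b s \<sigma> - U N b s []) > R)"
  have jn: "jump N * \<kappa> \<le> R"
  proof -
    have "jump N \<le> Lam \<gamma> N" using c2_ge by (simp add: Lam_def)
    then have "jump N * \<kappa> \<le> Lam \<gamma> N * \<kappa>" using kp by (rule mult_right_mono)
    then show ?thesis using R by linarith
  qed
  note H' = H[folded s_def]
  show ?thesis
  proof (cases "\<exists>n. 1/2 \<le> (\<Sum>\<sigma> | \<sigma> \<in> stops (digits N) P n [] \<and> P \<sigma>. mm \<sigma>)")
    case True
    then obtain n where n: "1/2 \<le> (\<Sum>\<sigma> | \<sigma> \<in> stops (digits N) P n [] \<and> P \<sigma>. mm \<sigma>)" by blast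
    define v where "v = U N b s [] - z"
    \<comment> \<open>Unit vector from the centre z to the present value; at the centre itself any
      unit vector will do.\<close>
    obtain e where e: "norm e = 1" "v = norm v *\<^sub>R e"
    proof (cases "v = 0")
      case True
      show ?thesis by (rule that[of "axis undefined 1"]) (use True in auto)
    next
      case False
      show ?thesis by (rule that[of "v /\<^sub>R norm v"]) (use False in auto)
    qed
    define S where "S = {\<sigma> \<in> stops (digits N) P n []. e \<bullet> (U N b s \<sigma> - U N b s []) \<le> - (rho \<gamma> N * R)}"
    have s1: "rho \<gamma> N \<le> (\<Sum>\<sigma>\<in>S. mm \<sigma>)"
      using exit_direction[OF Q s H' kp R e(1), where n=n and a=b] n unfolding S_def P_def rho_def mm_def by simp
    have s2: "finite S" unfolding S_def using finite_stops[OF fd(1)] by simp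
    have s3: "\<forall>u\<in>S. \<forall>v\<in>S. prefix u v \<longrightarrow> u = v" unfolding S_def using stops_antichain by blast
    have s4: "set u \<subseteq> digits N \<and> norm (U N a l (w @ u) - z) \<le> 4 / rho \<gamma> N * R
         \<and> rho \<gamma> N * R \<le> jump N * \<kappa> * real (length u)
         \<and> (\<forall>\<tau>. prefix \<tau> u \<longrightarrow> norm (U N a l (w @ \<tau>) - U N a l w) \<le> 2 * R)" if uS: "u \<in> S" for u
    proof (intro conjI allI impI)
      have us: "u \<in> stops (digits N) P n []" and eu: "e \<bullet> (U N b s u - U N b s []) \<le> - (rho \<gamma> N * R)"
        using uS by (auto simp: S_def)
      note dr = stops_drift[OF H' N s jn less_imp_le[OF R(1)] us[unfolded P_def]]
      show ud: "set u \<subseteq> digits N" using stops_structure[OF us] by auto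
      have "norm (v + (U N b s u - U N b s [])) \<le> 4 / rho \<gamma> N * R"
        by (rule inward_step[OF e(2) _ dr(1) eu R(1)]) (use z rho_bounds[OF Q] in \<open>auto simp: v_def Uw\<close>)
      then show "norm (U N a l (w @ u) - z) \<le> 4 / rho \<gamma> N * R" by (simp add: v_def Ub)
      have "rho \<gamma> N * R \<le> \<bar>e \<bullet> (U N b s u - U N b s [])\<bar>" using eu by linarith
      also have "\<dots> \<le> norm e * norm (U N b s u - U N b s [])" by (rule Cauchy_Schwarz_ineq2)
      also have "\<dots> \<le> jump N * \<kappa> * real (length u)" using U_drift[OF H' N s ud] e(1) by simp
      finally show "rho \<gamma> N * R \<le> jump N * \<kappa> * real (length u)" .
      show "norm (U N a l (w @ \<tau>) - U N a l w) \<le> 2 * R" if "prefix \<tau> u" for \<tau>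
        using dr(2)[OF that] by (simp add: Ub Uw)
    qed
    show ?thesis
      by (intro disjI1 exI[of _ S] conjI[OF s2 conjI[OF _ conjI[OF s3 s1]]] ballI s4)
  next
    case False
    have "1/2 \<le> (\<Sum>u\<in>stay N a l R w n. mm u)" for n
    proof -
      let ?T = "stops (digits N) P n []"
      have "(\<Sum>\<sigma>\<in>?T. mm \<sigma>) = 1" using sum_pow_cells[OF fd, of P n "[]"] by (simp add: mm_def)
      moreover have "(\<Sum>\<sigma>\<in>?T. mm \<sigma>) = (\<Sum>\<sigma> | \<sigma> \<in> ?T \<and> P \<sigma>. mm \<sigma>) + (\<Sum>\<sigma> | \<sigma> \<in> ?T \<and> \<not> P \<sigma>. mm \<sigma>)"
      proof -
        have "(\<Sum>\<sigma>\<in>?T. mm \<sigma>) = (\<Sum>\<sigma>\<in>{\<sigma> \<in> ?T. P \<sigma>} \<union> {\<sigma> \<in> ?T. \<not> P \<sigma>}. mm \<sigma>)"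
          by (rule sum.cong) auto
        also have "\<dots> = (\<Sum>\<sigma> | \<sigma> \<in> ?T \<and> P \<sigma>. mm \<sigma>) + (\<Sum>\<sigma> | \<sigma> \<in> ?T \<and> \<not> P \<sigma>. mm \<sigma>)"
          by (rule sum.union_disjoint) (auto simp: finite_stops[OF fd(1)])
        finally show ?thesis .
      qed
      moreover have "(\<Sum>\<sigma> | \<sigma> \<in> ?T \<and> P \<sigma>. mm \<sigma>) < 1/2" using False by (simp add: not_le)
      moreover have "(\<Sum>\<sigma> | \<sigma> \<in> ?T \<and> \<not> P \<sigma>. mm \<sigma>) \<le> (\<Sum>u\<in>stay N a l R w n. mm u)"
      proof (rule sum_mono2)
        show "finite (stay N a l R w n)"
          by (rule finite_subset[OF _ finite_lists_length_eq[OF fd(1), of n]]) (auto simp: stay_def)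
        show "{\<sigma> \<in> ?T. \<not> P \<sigma>} \<subseteq> stay N a l R w n"
        proof
          fix \<sigma> assume "\<sigma> \<in> {\<sigma> \<in> ?T. \<not> P \<sigma>}"
          then have s1: "\<sigma> \<in> ?T" "\<not> P \<sigma>" by auto
          from stops_structure[OF s1(1)] s1(2) have st: "set \<sigma> \<subseteq> digits N" "length \<sigma> = n" "\<And>j. j < n \<Longrightarrow> \<not> P (take j \<sigma>)" by auto
          have "\<not> P (take j \<sigma>)" if "j \<le> n" for j using st s1(2) that by (cases "j = n") auto
          then show "\<sigma> \<in> stay N a l R w n" using st by (auto simp: stay_def Ub Uw P_def not_less)
        qed
      qed (simp add: mm_def)
      ultimately show ?thesis by linarith
    qed
    then show ?thesis by blast
  qed
qed

end

context bounded_continuous begin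

text \<open>The height |h| lies between two consecutive levels, so the gradient there is within
  O(\<kappa>) of U on a cell containing x and hence bounded; \<open>increment_approx\<close> turns
  this into a bound for the difference quotient.\<close>

lemma lip_from_cells:
  assumes H: "hess_le \<kappa> l" and N: "N \<ge> 2" and l: "l > 0"
    and b: "\<And>k. \<exists>v. length v = k \<and> x \<in> cell N v a l \<and> norm (U N a l v - z) \<le> M"
  shows "x \<in> lip_points f"
proof -
  have N0: "N > 0" using N by simp
  have k0: "\<kappa> \<ge> 0" by (rule hess_le_nonneg[OF H l])
  have M0: "M \<ge> 0" using b[of 0] by (auto intro: order_trans[OF norm_ge_zero])
  define K where "K = norm z + M + cc * \<kappa> + 2 * (cc * \<kappa>) * sqrt (real N) + (2 * (real CARD('n) + 1)\<^sup>2 + 8) * \<kappa>"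
  have q: "\<bar>f (x + h) - f x\<bar> / norm h \<le> K" if h: "h \<noteq> 0" "norm h \<le> l" for h
  proof -
    obtain k where k: "l / real N ^ Suc k < norm h" "norm h \<le> l / real N ^ k"
      using grid_level[of "norm h" l N] h N by auto
    obtain v where v: "length v = k" "x \<in> cell N v a l" "norm (U N a l v - z) \<le> M" using b by blast
    define s where "s = l / real N ^ k"
    have sl: "s \<le> l" unfolding s_def by (rule side_le[OF N0 l])
    have "norm (grad (x, s) - U N a l v) \<le> cc * \<kappa>"
      using grad_cell[OF _ N0 l v(2), of \<kappa>] hess_le_mono[OF H sl] by (simp add: v(1) s_def)
    moreover have "norm (grad (x, s) - grad (x, norm h)) \<le> 2 * (cc * \<kappa>) * sqrt (real N)"
    proof -
      have "norm (grad (x, s) - grad (x, norm h)) \<le> 2 * (cc * \<kappa>) * sqrt (s / norm h)"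
        by (rule grad_height[OF H _ _ sl]) (use h k in \<open>auto simp: s_def\<close>)
      also have "\<dots> \<le> 2 * (cc * \<kappa>) * sqrt (real N)"
      proof (intro mult_left_mono real_sqrt_le_mono)
        show "s / norm h \<le> real N" using k(1) h N0 by (simp add: s_def field_simps)
      qed (use cc_ge k0 in auto)
      finally show ?thesis .
    qed
    moreover have "norm (grad (x, norm h)) \<le> norm (grad (x, s) - grad (x, norm h)) + norm (grad (x, s) - U N a l v) + norm (U N a l v - z) + norm z"
    proof -
      have "grad (x, norm h) = (grad (x, s) - U N a l v) - (grad (x, s) - grad (x, norm h)) + ((U N a l v - z) + z)" by simp
      then have "norm (grad (x, norm h)) \<le> norm ((grad (x, s) - U N a l v) - (grad (x, s) - grad (x, norm h))) + norm ((U N a l v - z) + z)"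
        by (metis norm_triangle_ineq)
      then show ?thesis using norm_triangle_ineq4[of "grad (x, s) - U N a l v" "grad (x, s) - grad (x, norm h)"] norm_triangle_ineq[of "U N a l v - z" z] by linarith
    qed
    ultimately have g: "norm (grad (x, norm h)) \<le> norm z + M + cc * \<kappa> + 2 * (cc * \<kappa>) * sqrt (real N)" using v(3) by linarith
    have "\<bar>f (x + h) - f x\<bar> \<le> \<bar>grad (x, norm h) \<bullet> h\<bar> + (2 * (real CARD('n) + 1)\<^sup>2 + 8) * \<kappa> * norm h"
      using increment_approx[OF H h, of x] by linarith
    also have "\<bar>grad (x, norm h) \<bullet> h\<bar> \<le> (norm z + M + cc * \<kappa> + 2 * (cc * \<kappa>) * sqrt (real N)) * norm h"
      by (rule order_trans[OF Cauchy_Schwarz_ineq2]) (intro mult_right_mono g, simp)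
    finally have "\<bar>f (x + h) - f x\<bar> \<le> K * norm h" by (simp add: K_def algebra_simps)
    then show ?thesis using h by (simp add: divide_le_eq)
  qed
  have "Limsup (at 0) (\<lambda>h. ereal (\<bar>f (x + h) - f x\<bar> / norm h)) \<le> ereal K"
  proof (rule Limsup_bounded)
    show "\<forall>\<^sub>F h in at 0. ereal (\<bar>f (x + h) - f x\<bar> / norm h) \<le> ereal K"
      unfolding eventually_at using l q by (intro exI[of _ l]) (auto simp: dist_norm)
  qed
  also have "\<dots> < \<infinity>" by simp
  finally show ?thesis by (simp add: lip_points_def)
qed

text \<open>A Cauchy condition along cells containing x. The words may depend on both levels, since
  x can lie in several closed cells of one level and no infinite word is fixed. The gradients over x
  converge, and the error of \<open>increment_approx\<close> is o(|h|) because \<kappa> can be taken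
  arbitrarily small near the boundary.\<close>

lemma diff_from_cells:
  assumes V: "\<And>\<kappa>. \<kappa> > 0 \<Longrightarrow> \<exists>l0>0. hess_le \<kappa> l0" and N: "N \<ge> 2" and l: "l > 0"
    and b: "\<And>\<epsilon>. \<epsilon> > 0 \<Longrightarrow> \<exists>L. \<forall>k\<ge>L. \<forall>k'\<ge>L. \<exists>v v'. length v = k \<and> length v' = k' \<and>
       x \<in> cell N v a l \<and> x \<in> cell N v' a l \<and> norm (U N a l v - U N a l v') \<le> \<epsilon>"
  shows "x \<in> diff_points f"
proof -
  have N0: "N > 0" using N by simp
  define g where "g = (\<lambda>k. grad (x, l / real N ^ k))"
  have small: "\<exists>L. \<forall>k\<ge>L. l / real N ^ k \<le> l0" if "l0 > 0" for l0
  proof -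
    have "(\<lambda>k. l * (1 / real N) ^ k) \<longlonglongrightarrow> l * 0" using N by (intro tendsto_mult_left LIMSEQ_power_zero) auto
    then have "\<forall>\<^sub>F k in sequentially. l * (1 / real N) ^ k < l0" using that by (intro order_tendstoD) auto
    then show ?thesis by (auto simp: eventually_sequentially power_one_over intro: less_imp_le)
  qed
  have "Cauchy g"
  proof (rule CauchyI)
    fix e :: real assume e: "e > 0"
    define \<kappa> where "\<kappa> = e / (4 * cc)"
    have kp: "\<kappa> > 0" "cc * \<kappa> = e / 4" using e cc_ge by (auto simp: \<kappa>_def)
    obtain l0 where l0: "l0 > 0" "hess_le \<kappa> l0" using V[OF kp(1)] by blast
    obtain L1 where L1: "\<And>k. k \<ge> L1 \<Longrightarrow> l / real N ^ k \<le> l0" using small[OF l0(1)] by blast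
    obtain L2 where L2: "\<forall>k\<ge>L2. \<forall>k'\<ge>L2. \<exists>v v'. length v = k \<and> length v' = k' \<and>
       x \<in> cell N v a l \<and> x \<in> cell N v' a l \<and> norm (U N a l v - U N a l v') \<le> e / 4" using b[of "e/4"] e by auto
    show "\<exists>M. \<forall>m\<ge>M. \<forall>n\<ge>M. norm (g m - g n) < e"
    proof (intro exI allI impI)
      fix k k' assume k: "max L1 L2 \<le> k" "max L1 L2 \<le> k'"
      then obtain v v' where v: "length v = k" "length v' = k'" "x \<in> cell N v a l" "x \<in> cell N v' a l" "norm (U N a l v - U N a l v') \<le> e / 4"
        using L2 by (meson max.bounded_iff)
      have 1: "norm (g k - U N a l v) \<le> e / 4"
        using grad_cell[OF _ N0 l v(3), of \<kappa>] hess_le_mono[OF l0(2) L1[of k]] k kp v(1) by (simp add: g_def)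
      have 2: "norm (g k' - U N a l v') \<le> e / 4"
        using grad_cell[OF _ N0 l v(4), of \<kappa>] hess_le_mono[OF l0(2) L1[of k']] k kp v(2) by (simp add: g_def)
      have "g k - g k' = (g k - U N a l v) - (g k' - U N a l v') + (U N a l v - U N a l v')" by simp
      then have "norm (g k - g k') \<le> norm ((g k - U N a l v) - (g k' - U N a l v')) + norm (U N a l v - U N a l v')"
        by (metis norm_triangle_ineq)
      then show "norm (g k - g k') < e"
        using norm_triangle_ineq4[of "g k - U N a l v" "g k' - U N a l v'"] 1 2 v(5) e by linarith
    qed
  qed
  then obtain G where G: "g \<longlonglongrightarrow> G" using Cauchy_convergent convergent_def by blast
  \<comment> \<open>Collects the two errors proportional to \<kappa>: the descent from level k to
    height |h|, and \<open>increment_approx\<close>.\<close>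
  define C where "C = 2 * cc * sqrt (real N) + (2 * (real CARD('n) + 1)\<^sup>2 + 8)"
  have C: "C > 0" using cc_ge unfolding C_def by (intro add_nonneg_pos mult_nonneg_nonneg) auto
  have "((\<lambda>h. norm (f (x + h) - f x - G \<bullet> h) / norm h) \<longlongrightarrow> 0) (at 0)"
    unfolding LIM_eq
  proof (intro allI impI)
    fix e :: real assume e: "e > 0"
    define \<kappa> where "\<kappa> = e / (4 * C)"
    have kp: "\<kappa> > 0" "C * \<kappa> = e / 4" using e C by (auto simp: \<kappa>_def)
    obtain l0 where l0: "l0 > 0" "hess_le \<kappa> l0" using V[OF kp(1)] by blast
    obtain L1 where L1: "\<And>k. k \<ge> L1 \<Longrightarrow> l / real N ^ k \<le> l0" using small[OF l0(1)] by blast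
    obtain L2 where L2: "\<And>k. k \<ge> L2 \<Longrightarrow> norm (g k - G) < e / 4"
      using G e unfolding LIMSEQ_iff by (metis zero_less_divide_iff zero_less_numeral)
    define L where "L = max L1 L2"
    have hL: "hess_le \<kappa> (l / real N ^ L)" by (rule hess_le_mono[OF l0(2) L1]) (simp add: L_def)
    have bound: "norm (f (x + h) - f x - G \<bullet> h) / norm h \<le> e / 2" if h: "h \<noteq> 0" "norm h < l / real N ^ L" for h
    proof -
      have hl: "norm h \<le> l" using h(2) side_le[OF N0 l, of L] by linarith
      obtain k where k: "l / real N ^ Suc k < norm h" "norm h \<le> l / real N ^ k"
        using grid_level[of "norm h" l N] h hl N by auto
      have "k \<ge> L"
      proof (rule ccontr)
        assume "\<not> k \<ge> L"
        then have "l / real N ^ L \<le> l / real N ^ Suc k" using l N by (intro divide_left_mono power_increasing) auto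
        then show False using k(1) h(2) by linarith
      qed
      define s where "s = l / real N ^ k"
      have sL: "s \<le> l / real N ^ L" unfolding s_def using \<open>k \<ge> L\<close> l N by (intro divide_left_mono power_increasing) auto
      have "norm (grad (x, s) - grad (x, norm h)) \<le> 2 * (cc * \<kappa>) * sqrt (s / norm h)"
        by (rule grad_height[OF hL _ _ sL]) (use h k in \<open>auto simp: s_def\<close>)
      also have "\<dots> \<le> 2 * (cc * \<kappa>) * sqrt (real N)"
      proof (intro mult_left_mono real_sqrt_le_mono)
        show "s / norm h \<le> real N" using k(1) h N0 by (simp add: s_def field_simps)
      qed (use cc_ge kp in auto)
      finally have 1: "norm (g k - grad (x, norm h)) \<le> 2 * (cc * \<kappa>) * sqrt (real N)" by (simp add: g_def s_def)
      have 2: "norm (g k - G) < e / 4" using L2 \<open>k \<ge> L\<close> by (simp add: L_def)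
      have 3: "\<bar>f (x + h) - f x - grad (x, norm h) \<bullet> h\<bar> \<le> (2 * (real CARD('n) + 1)\<^sup>2 + 8) * \<kappa> * norm h"
        by (rule increment_approx[OF hL h(1)]) (use h in simp)
      have "grad (x, norm h) - G = (g k - G) - (g k - grad (x, norm h))" by simp
      then have 4: "norm (grad (x, norm h) - G) \<le> e / 4 + 2 * (cc * \<kappa>) * sqrt (real N)"
        using norm_triangle_ineq4[of "g k - G" "g k - grad (x, norm h)"] 1 2 by simp
      have "\<bar>(grad (x, norm h) - G) \<bullet> h\<bar> \<le> (e / 4 + 2 * (cc * \<kappa>) * sqrt (real N)) * norm h"
        by (rule order_trans[OF Cauchy_Schwarz_ineq2]) (intro mult_right_mono 4, simp)
      then have "\<bar>f (x + h) - f x - G \<bullet> h\<bar> \<le> (2 * (real CARD('n) + 1)\<^sup>2 + 8) * \<kappa> * norm h + (e / 4 + 2 * (cc * \<kappa>) * sqrt (real N)) * norm h"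
        using 3 by (simp add: inner_diff_left)
      also have "\<dots> = (e / 4 + C * \<kappa>) * norm h" by (simp add: C_def algebra_simps)
      also have "\<dots> = e / 2 * norm h" by (simp add: kp)
      finally show ?thesis using h by (simp add: divide_le_eq)
    qed
    show "\<exists>s>0. \<forall>h. h \<noteq> 0 \<and> norm (h - 0) < s \<longrightarrow> norm (norm (f (x + h) - f x - G \<bullet> h) / norm h - 0) < e"
    proof (intro exI[of _ "l / real N ^ L"] conjI allI impI)
      show "0 < l / real N ^ L" using l N0 by simp
      fix h :: "real^'n" assume "h \<noteq> 0 \<and> norm (h - 0) < l / real N ^ L"
      then have "norm (f (x + h) - f x - G \<bullet> h) / norm h \<le> e / 2" using bound[of h] by simp
      then have "norm (f (x + h) - f x - G \<bullet> h) / norm h < e" using e by linarith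
      then show "norm (norm (f (x + h) - f x - G \<bullet> h) / norm h - 0) < e" by simp
    qed
  qed
  then have "(f has_derivative (\<lambda>h. G \<bullet> h)) (at x)"
    unfolding has_derivative_at by (simp add: bounded_linear_inner_right)
  then show ?thesis by (auto simp: diff_points_def differentiable_def)
qed

text \<open>N^(d-s) > 1 because s < d, so its powers beat 1 / c. The successor in the witness makes
  m at least 1, so that every generation descends.\<close>

lemma contraction_steps:
  assumes N: "N \<ge> 2" and s: "s < real CARD('n)" and c: "c > 0"
  shows "\<exists>m\<ge>1. c * (real N powr (-s) * real (card (digits N :: (real^'n) set))) ^ m \<ge> 1"
proof -
  have "real N powr (real CARD('n) - s) > 1" using N s by simp
  then obtain n where "1 / c < (real N powr (real CARD('n) - s)) ^ n" using real_arch_pow by blast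
  then have "1 < c * (real N powr (real CARD('n) - s)) ^ n" using c by (simp add: divide_less_eq mult.commute)
  moreover have "c * (real N powr (real CARD('n) - s)) ^ n \<le> c * (real N powr (real CARD('n) - s)) ^ Suc n"
    using \<open>real N powr (real CARD('n) - s) > 1\<close> c by (intro mult_left_mono power_increasing) auto
  ultimately have "1 \<le> c * (real N powr (real CARD('n) - s)) ^ Suc n" by linarith
  then show ?thesis unfolding digits_weight[OF N] by (intro exI[of _ "Suc n"]) simp
qed

text \<open>The centre stays fixed at the root value of U. Either some admissible cell has a
  persistent half below it, which already gives positive measure, or the exit alternative holds at
  every admissible cell and the selection never ends.\<close>

lemma zygmund_part:
  fixes a :: "real^'n"
  assumes Q: "wqr \<gamma> N" and H: "hess_le \<kappa> l" and l: "l > 0" and s: "0 < s" "s < real CARD('n)"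
  shows "hausdorff_measure s (lip_points f \<inter> cube a l) \<noteq> 0"
proof -
  have N: "N \<ge> 2" using Q by (simp add: wqr_def)
  have N0: "N > 0" using N by simp
  have kp: "\<kappa> \<ge> 0" by (rule hess_le_nonneg[OF H l])
  define \<rho> where "\<rho> = rho \<gamma> N"
  have \<rho>: "0 < \<rho>" "\<rho> \<le> 1/2" using rho_bounds[OF Q] by (auto simp: \<rho>_def)
  obtain m where m: "m \<ge> 1" "\<rho> * (real N powr (-s) * real (card (digits N :: (real^'n) set))) ^ m \<ge> 1"
    using contraction_steps[OF N s(2) \<rho>(1)] by blast
  have jn: "jump N \<ge> 0" by (simp add: jump_def)
  have Lm: "Lam \<gamma> N \<ge> 0" using c2_ge jn by (simp add: Lam_def)
  \<comment> \<open>The first summand makes \<open>step_dichotomy\<close> applicable, the second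
    makes \<rho> R exceed the distance that U can move within m levels, so that selected subcubes
    are at least m levels deeper.\<close>
  define R where "R = Lam \<gamma> N * \<kappa> + (jump N * \<kappa> * real m + 1) / \<rho>"
  have R: "R > 0" "Lam \<gamma> N * \<kappa> \<le> R" "jump N * \<kappa> * real m < \<rho> * R"
  proof -
    have 0: "0 < (jump N * \<kappa> * real m + 1) / \<rho>" "0 \<le> Lam \<gamma> N * \<kappa>" using jn kp \<rho> Lm by (auto intro!: divide_pos_pos add_nonneg_pos)
    then show "R > 0" "Lam \<gamma> N * \<kappa> \<le> R" by (auto simp: R_def)
    have "\<rho> * R = \<rho> * (Lam \<gamma> N * \<kappa>) + (jump N * \<kappa> * real m + 1)" using \<rho>(1) by (simp add: R_def field_simps)
    moreover have "0 \<le> \<rho> * (Lam \<gamma> N * \<kappa>)" using 0 \<rho> by simp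
    ultimately show "jump N * \<kappa> * real m < \<rho> * R" by linarith
  qed
  define z where "z = U N a l []"
  define M where "M = 4 / \<rho> * R"
  have M0: "M > 0" using R \<rho> by (simp add: M_def)
  define G where "G = {w. set w \<subseteq> digits N \<and> norm (U N a l w - z) \<le> M}"
  have Hw: "hess_le \<kappa> (l / real N ^ length w)" for w :: "(real^'n) list" by (rule hess_le_mono[OF H side_le[OF N0 l]])
  let ?mm = "\<lambda>u::(real^'n) list. (1 / real (card (digits N :: (real^'n) set))) ^ length u"
  have rootG: "[] \<in> G" using M0 by (simp add: G_def z_def)
  have in_cube: "x \<in> cube a l" if "x \<in> cell N w a l" "set w \<subseteq> digits N" for x w
    using cell_subset_cube[OF N0 l that(2), of a] that(1) by blast
  show ?thesis
  proof (cases "\<exists>w\<in>G. \<forall>n. 1/2 \<le> (\<Sum>u\<in>stay N a l R w n. ?mm u)")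
    case True
    then obtain w where w: "set w \<subseteq> digits N" "norm (U N a l w - z) \<le> M" "\<And>n. 1/2 \<le> (\<Sum>u\<in>stay N a l R w n. ?mm u)"
      by (auto simp: G_def)
    show ?thesis
    proof (rule persistent_hausdorff[OF N l s w(1), where S="stay N a l R w" and a=a])
      show "set u \<subseteq> digits N \<and> length u = n" if "u \<in> stay N a l R w n" for u n using that by (simp add: stay_def)
      show "take n u \<in> stay N a l R w n" if "u \<in> stay N a l R w (Suc n)" for n u
        using that set_take_subset[of n u] by (auto simp: stay_def min_def split: if_splits)
      fix x assume x: "\<And>n. \<exists>u\<in>stay N a l R w n. x \<in> cell N (w @ u) a l"
      have "x \<in> lip_points f"
      proof (rule lip_from_cells[OF hess_le_mono[OF H side_le[OF N0 l, of "length w"]] N])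
        show "l / real N ^ length w > 0" using l N0 by simp
        fix k
        obtain u where u: "u \<in> stay N a l R w k" "x \<in> cell N (w @ u) a l" using x by blast
        have "norm (U N a l (w @ take k u) - U N a l w) \<le> R" using u(1) by (auto simp: stay_def)
        then have "norm (U N a l (w @ u) - U N a l w) \<le> R" using u(1) by (auto simp: stay_def)
        then show "\<exists>v. length v = k \<and> x \<in> cell N v (corner N w a l) (l / real N ^ length w) \<and> norm (U N (corner N w a l) (l / real N ^ length w) v - U N a l w) \<le> R"
          using u by (intro exI[of _ u]) (auto simp: stay_def U_append cell_append)
      qed
      moreover obtain u where "u \<in> stay N a l R w 0" "x \<in> cell N (w @ u) a l" using x by blast
      then have "x \<in> cube a l" using in_cube[of x "w @ u"] w(1) by (auto simp: stay_def)
      ultimately show "x \<in> lip_points f \<inter> cube a l" by blast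
    qed (rule w(3))
  next
    case False
    define good where "good = (\<lambda>w S. finite S \<and> (\<forall>u\<in>S. set u \<subseteq> digits N \<and> norm (U N a l (w @ u) - z) \<le> M
         \<and> \<rho> * R \<le> jump N * \<kappa> * real (length u)
         \<and> (\<forall>\<tau>. prefix \<tau> u \<longrightarrow> norm (U N a l (w @ \<tau>) - U N a l w) \<le> 2 * R))
       \<and> (\<forall>u\<in>S. \<forall>v\<in>S. prefix u v \<longrightarrow> u = v) \<and> \<rho> \<le> (\<Sum>u\<in>S. ?mm u))"
    have "\<exists>S. good w S" if "w \<in> G" for w
      using step_dichotomy[OF Q l Hw kp R(1,2), of a w z] that False unfolding good_def G_def M_def \<rho>_def by blast
    then obtain S where S: "\<And>w. w \<in> G \<Longrightarrow> good w (S w)" by metis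
    define ch where "ch = (\<lambda>w. (\<lambda>u. w @ u) ` S w)"
    have lenm: "m \<le> length u" if "w \<in> G" "u \<in> S w" for w u
    proof (rule ccontr)
      assume "\<not> m \<le> length u"
      then have "jump N * \<kappa> * real (length u) \<le> jump N * \<kappa> * real m" using jn kp by (intro mult_left_mono) auto
      moreover have "\<rho> * R \<le> jump N * \<kappa> * real (length u)" using S[OF that(1)] that(2) by (auto simp: good_def)
      ultimately show False using R(3) by linarith
    qed
    have tree: "cantor_tree (digits N) id ch G \<rho> (real N powr (-s)) m"
    proof
      show "finite (digits N :: (real^'n) set)" by (rule finite_digits)
      show "(digits N :: (real^'n) set) \<noteq> {}" using zero_digits[OF N0] by auto
      show "0 < real N powr - s" using N by simp
      show "1 \<le> real N powr - s * real (card (digits N :: (real^'n) set))"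
        unfolding digits_weight[OF N] using N s by (intro ge_one_powr_ge_zero) auto
      show "0 < \<rho>" "\<rho> \<le> 1" "1 \<le> \<rho> * (real N powr - s * real (card (digits N :: (real^'n) set))) ^ m" using \<rho> m by auto
      fix w assume w: "w \<in> G"
      have wd: "set w \<subseteq> digits N" using w by (simp add: G_def)
      note g = S[OF w, unfolded good_def]
      have "w @ u \<in> G" if "u \<in> S w" for u
      proof -
        have "set u \<subseteq> digits N \<and> norm (U N a l (w @ u) - z) \<le> M" using g that by blast
        then show ?thesis using wd by (simp add: G_def)
      qed
      then show "ch w \<subseteq> G" by (auto simp: ch_def)
      show "finite (ch w)" using g by (simp add: ch_def)
      show "\<exists>u. id y = id w @ u \<and> set u \<subseteq> digits N \<and> m \<le> length u" if "y \<in> ch w" for y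
        using that g lenm[OF w] by (auto simp: ch_def)
      show "y = z'" if "y \<in> ch w" "z' \<in> ch w" "prefix (id y) (id z')" for y z'
        using that g by (auto simp: ch_def)
      have "(\<Sum>y\<in>ch w. ?mm (id y)) = (\<Sum>u\<in>S w. ?mm (w @ u))"
        unfolding ch_def by (subst sum.reindex) (auto simp: inj_on_def)
      also have "\<dots> = ?mm w * (\<Sum>u\<in>S w. ?mm u)" by (simp add: power_add sum_distrib_left)
      finally have "(\<Sum>y\<in>ch w. ?mm (id y)) = ?mm w * (\<Sum>u\<in>S w. ?mm u)" .
      moreover have "?mm w * \<rho> \<le> ?mm w * (\<Sum>u\<in>S w. ?mm u)"
        by (rule mult_left_mono) (use g in \<open>blast, simp\<close>)
      ultimately show "\<rho> * ?mm (id w) \<le> (\<Sum>y\<in>ch w. ?mm (id y))" by (simp add: mult.commute)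
    qed
    interpret T: cantor_tree "digits N" id ch G \<rho> "real N powr (-s)" m by (rule tree)
    \<comment> \<open>\<open>lip_from_cells\<close> needs a bound at every level, also between
      generations: there U is within 2R of its value at the last selected cell, which is within M of
      z.\<close>
    have path: "\<forall>\<tau>. prefix \<tau> y \<longrightarrow> prefix \<tau> w \<or> norm (U N a l \<tau> - z) \<le> M + 2 * R" if "w \<in> G" "y \<in> T.gen j w" for w y j
      using that
    proof (induction j arbitrary: w)
      case 0 then show ?case by simp
    next
      case (Suc j)
      then obtain v where v: "v \<in> ch w" "y \<in> T.gen j v" by auto
      obtain u where u: "v = w @ u" "u \<in> S w" using v(1) by (auto simp: ch_def)
      have vG: "v \<in> G" using T.ch(1)[OF Suc.prems(1)] v(1) by blast
      have short: "norm (U N a l (w @ \<tau>) - z) \<le> M + 2 * R" if "prefix \<tau> u" for \<tau>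
      proof -
        have "norm (U N a l (w @ \<tau>) - U N a l w) \<le> 2 * R"
          using S[OF Suc.prems(1)] u(2) that unfolding good_def by blast
        moreover have "norm (U N a l w - z) \<le> M" using Suc.prems(1) by (simp add: G_def)
        moreover have "norm (U N a l (w @ \<tau>) - z) \<le> norm (U N a l (w @ \<tau>) - U N a l w) + norm (U N a l w - z)"
          using norm_triangle_ineq[of "U N a l (w @ \<tau>) - U N a l w" "U N a l w - z"] by simp
        ultimately show ?thesis by linarith
      qed
      show ?case
      proof (intro allI impI)
        fix \<tau> assume t: "prefix \<tau> y"
        from Suc.IH[OF vG v(2)] t consider "prefix \<tau> (w @ u)" | "norm (U N a l \<tau> - z) \<le> M + 2 * R" unfolding u(1) by blast
        then show "prefix \<tau> w \<or> norm (U N a l \<tau> - z) \<le> M + 2 * R"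
        proof cases
          case 1
          then have "prefix \<tau> w \<or> (\<exists>\<tau>'. \<tau> = w @ \<tau>' \<and> prefix \<tau>' u)" by (simp add: prefix_append)
          then show ?thesis using short by blast
        qed simp
      qed
    qed
    show ?thesis
    proof (rule cantor_hausdorff[OF tree rootG _ N l s(1), where a=a])
      fix x assume x: "\<And>j. \<exists>y\<in>T.gen j []. x \<in> cell N (id y) a l"
      have ext: "set y \<subseteq> digits N \<and> j \<le> length y" if yj: "y \<in> T.gen j []" for y j
      proof -
        obtain u where u: "id y = id [] @ u" "set u \<subseteq> digits N" "j * m \<le> length u" using T.gen_ext[OF rootG yj] by blast
        have "j * 1 \<le> j * m" using m(1) by (intro mult_left_mono) auto
        then have "j \<le> length u" using u(3) by linarith
        then show ?thesis using u by simp
      qed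
      have "x \<in> lip_points f"
      proof (rule lip_from_cells[OF H N l])
        fix k
        obtain y where y: "y \<in> T.gen k []" "x \<in> cell N y a l" using x[of k] by auto
        define v where "v = take k y"
        have yv: "y = v @ drop k y" by (simp add: v_def)
        have "set (drop k y) \<subseteq> digits N" using ext[OF y(1)] set_drop_subset[of k y] by auto
        from cell_append_subset[OF N0 l this, of v a] have "x \<in> cell N v a l" using y(2) yv by auto
        moreover have "length v = k" using ext[OF y(1)] by (simp add: v_def)
        moreover have "norm (U N a l v - z) \<le> M + 2 * R"
        proof -
          have "prefix v y" by (simp add: v_def take_is_prefix)
          then have "prefix v [] \<or> norm (U N a l v - z) \<le> M + 2 * R" using path[OF rootG y(1)] by blast
          then show ?thesis using M0 R(1) by (auto simp: z_def)
        qed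
        ultimately show "\<exists>v. length v = k \<and> x \<in> cell N v a l \<and> norm (U N a l v - z) \<le> M + 2 * R" by blast
      qed
      moreover obtain y where "y \<in> T.gen 0 []" "x \<in> cell N y a l" using x[of 0] by auto
      ultimately show "x \<in> lip_points f \<inter> cube a l" by (simp add: cell_Nil)
    qed simp
  qed
qed

end

section \<open>The small Zygmund class\<close>

context bounded_continuous begin

text \<open>A node consists of a word, a phase p and a centre; phase p works with radius R p and is
  available from level K p on. Once level K (p+1) is reached, the phase advances and the centre
  moves. In the persistent alternative the tree goes on: the staying cells n levels down become the
  children, each with its own centre and a higher phase, so that both alternatives feed one Cantor
  construction.\<close>

lemma phase_step:
  fixes a z :: "real^'n" and w :: "(real^'n) list" and R M \<kappa> :: "nat \<Rightarrow> real" and K :: "nat \<Rightarrow> nat"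
  assumes Q: "wqr \<gamma> N" and r: "r > 0" and HK: "\<And>p. hess_le (\<kappa> p) (r / real N ^ K p)"
    and kp: "\<And>p. \<kappa> p \<ge> 0" and R: "\<And>p. R p > 0" "\<And>p. Lam \<gamma> N * \<kappa> p \<le> R p" "\<And>p. jump N * \<kappa> p * real m < rho \<gamma> N * R p"
    and Rdec: "\<And>p. R (Suc p) \<le> R p" and M: "\<And>p. M p = 4 / rho \<gamma> N * R p"
  defines "G \<equiv> {(w, p, z). set w \<subseteq> digits N \<and> K p \<le> length w \<and> norm (U N a r w - z) \<le> M p}"
  assumes x: "(w, p, z) \<in> G"
  shows "\<exists>C. finite C \<and> C \<subseteq> G \<and>
     (\<forall>(w2, p2, z2)\<in>C. (\<exists>u. w2 = w @ u \<and> set u \<subseteq> digits N \<and> m \<le> length u \<and>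
          (\<forall>\<tau>. prefix \<tau> u \<longrightarrow> norm (U N a r (w @ \<tau>) - z) \<le> 2 * R p + M p)) \<and>
        (p2 = p \<and> z2 = z \<or> p < p2 \<and> norm (z2 - z) \<le> 2 * R p + M p) \<and> (K (Suc p) \<le> length w \<longrightarrow> p < p2)) \<and>
     (\<forall>y\<in>C. \<forall>y'\<in>C. prefix (fst y) (fst y') \<longrightarrow> y = y') \<and>
     rho \<gamma> N * (1 / real (card (digits N :: (real^'n) set))) ^ length w \<le> (\<Sum>y\<in>C. (1 / real (card (digits N :: (real^'n) set))) ^ length (fst y))"
proof -
  let ?\<rho> = "rho \<gamma> N"
  let ?mm = "\<lambda>u::(real^'n) list. (1 / real (card (digits N :: (real^'n) set))) ^ length u"
  have N0: "N > 0" using Q by (simp add: wqr_def)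
  have \<rho>: "0 < ?\<rho>" "?\<rho> \<le> 1/2" using rho_bounds[OF Q] by auto
  have M0: "M p > 0" for p using R(1)[of p] \<rho> by (simp add: M)
  have w: "set w \<subseteq> digits N" "K p \<le> length w" "norm (U N a r w - z) \<le> M p" using x by (auto simp: G_def)
  \<comment> \<open>Phase and centre used for this step; recentring at the present value makes the
    ball condition of the new phase trivial.\<close>
  define p' where "p' = (if K (Suc p) \<le> length w then Suc p else p)"
  define z' where "z' = (if K (Suc p) \<le> length w then U N a r w else z)"
  have n1: "K p' \<le> length w" "norm (U N a r w - z') \<le> M p'" "p \<le> p'" "R p' \<le> R p"
    using w M0[of "Suc p"] Rdec[of p] by (auto simp: p'_def z'_def)
  have n2: "K (Suc p) \<le> length w \<Longrightarrow> p < p'" by (simp add: p'_def)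
  have n3: "p' = p \<and> z' = z \<or> p < p' \<and> norm (z' - z) \<le> 2 * R p + M p"
    using w(3) R(1)[of p] by (auto simp: p'_def z'_def)
  have near: "norm (U N a r (w @ \<tau>) - z) \<le> 2 * R p + M p" if "norm (U N a r (w @ \<tau>) - U N a r w) \<le> 2 * R p'" for \<tau>
    using norm_triangle_ineq[of "U N a r (w @ \<tau>) - U N a r w" "U N a r w - z"] that w(3) n1(4) by simp
  have mass: "?\<rho> * ?mm w \<le> (\<Sum>y\<in>(\<lambda>u. (w @ u, P u, Z u)) ` S. ?mm (fst y))" if "?\<rho> \<le> (\<Sum>u\<in>S. ?mm u)" for S P Z
  proof -
    have "(\<Sum>y\<in>(\<lambda>u. (w @ u, P u, Z u)) ` S. ?mm (fst y)) = (\<Sum>u\<in>S. ?mm (w @ u))"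
      by (subst sum.reindex) (auto simp: inj_on_def)
    also have "\<dots> = ?mm w * (\<Sum>u\<in>S. ?mm u)" by (simp add: power_add sum_distrib_left)
    finally have "(\<Sum>y\<in>(\<lambda>u. (w @ u, P u, Z u)) ` S. ?mm (fst y)) = ?mm w * (\<Sum>u\<in>S. ?mm u)" .
    moreover have "?mm w * ?\<rho> \<le> ?mm w * (\<Sum>u\<in>S. ?mm u)"
      by (rule mult_left_mono[OF that]) simp
    ultimately show ?thesis by (simp add: mult.commute)
  qed
  have H: "hess_le (\<kappa> p') (r / real N ^ length w)"
    by (rule hess_le_mono[OF HK]) (use n1(1) r N0 in \<open>intro divide_left_mono power_increasing; simp\<close>)
  note dich = step_dichotomy[OF Q r H kp R(1) R(2) n1(2)[unfolded M], folded M]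
  consider (exit) S where "finite S \<and> (\<forall>u\<in>S. set u \<subseteq> digits N \<and> norm (U N a r (w @ u) - z') \<le> M p'
         \<and> ?\<rho> * R p' \<le> jump N * \<kappa> p' * real (length u)
         \<and> (\<forall>\<tau>. prefix \<tau> u \<longrightarrow> norm (U N a r (w @ \<tau>) - U N a r w) \<le> 2 * R p'))
       \<and> (\<forall>u\<in>S. \<forall>v\<in>S. prefix u v \<longrightarrow> u = v) \<and> ?\<rho> \<le> (\<Sum>u\<in>S. ?mm u)"
    | (stay) "\<forall>n. 1/2 \<le> (\<Sum>u\<in>stay N a r (R p') w n. ?mm u)"
    by (rule disjE[OF dich]) (erule exE, rule that(1), assumption, rule that(2), assumption)
  then show ?thesis
  proof cases
    case exit
    have exit: "finite S" "\<And>u. u \<in> S \<Longrightarrow> set u \<subseteq> digits N \<and> norm (U N a r (w @ u) - z') \<le> M p'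
         \<and> ?\<rho> * R p' \<le> jump N * \<kappa> p' * real (length u)
         \<and> (\<forall>\<tau>. prefix \<tau> u \<longrightarrow> norm (U N a r (w @ \<tau>) - U N a r w) \<le> 2 * R p')"
       "\<And>u v. u \<in> S \<Longrightarrow> v \<in> S \<Longrightarrow> prefix u v \<Longrightarrow> u = v" "?\<rho> \<le> (\<Sum>u\<in>S. ?mm u)"
      using exit by simp_all
    have lenm: "m \<le> length u" if "u \<in> S" for u
    proof (rule ccontr)
      assume "\<not> m \<le> length u"
      then have "jump N * \<kappa> p' * real (length u) \<le> jump N * \<kappa> p' * real m" using kp by (intro mult_left_mono) (auto simp: jump_def)
      moreover have "?\<rho> * R p' \<le> jump N * \<kappa> p' * real (length u)" using exit(2)[OF that] by blast
      ultimately show False using R(3)[of p'] by linarith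
    qed
    show ?thesis
    proof (intro exI[of _ "(\<lambda>u. (w @ u, p', z')) ` S"] conjI)
      show "finite ((\<lambda>u. (w @ u, p', z')) ` S)" using exit(1) by simp
      show "(\<lambda>u. (w @ u, p', z')) ` S \<subseteq> G"
      proof clarify
        fix u assume u: "u \<in> S"
        show "(w @ u, p', z') \<in> G" using exit(2)[OF u] w(1) n1(1) by (simp add: G_def)
      qed
      show "\<forall>(w2, p2, z2)\<in>(\<lambda>u. (w @ u, p', z')) ` S. (\<exists>u. w2 = w @ u \<and> set u \<subseteq> digits N \<and> m \<le> length u \<and>
          (\<forall>\<tau>. prefix \<tau> u \<longrightarrow> norm (U N a r (w @ \<tau>) - z) \<le> 2 * R p + M p)) \<and>
        (p2 = p \<and> z2 = z \<or> p < p2 \<and> norm (z2 - z) \<le> 2 * R p + M p) \<and> (K (Suc p) \<le> length w \<longrightarrow> p < p2)"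
      proof clarify
        fix u assume u: "u \<in> S"
        show "(\<exists>v. w @ u = w @ v \<and> set v \<subseteq> digits N \<and> m \<le> length v \<and>
          (\<forall>\<tau>. prefix \<tau> v \<longrightarrow> norm (U N a r (w @ \<tau>) - z) \<le> 2 * R p + M p)) \<and>
        (p' = p \<and> z' = z \<or> p < p' \<and> norm (z' - z) \<le> 2 * R p + M p) \<and> (K (Suc p) \<le> length w \<longrightarrow> p < p')"
          using exit(2)[OF u] lenm[OF u] near n2 n3 by blast
      qed
      show "\<forall>y\<in>(\<lambda>u. (w @ u, p', z')) ` S. \<forall>y'\<in>(\<lambda>u. (w @ u, p', z')) ` S. prefix (fst y) (fst y') \<longrightarrow> y = y'"
        using exit(3) by auto
    qed (rule mass[OF exit(4)])
  next
    case stay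
    \<comment> \<open>Deep enough both for the m levels required of a child and for the level at
      which phase \<open>Suc p'\<close> becomes available.\<close>
    define n where "n = max m (K (Suc p'))"
    define S where "S = stay N a r (R p') w n"
    have S1: "set u \<subseteq> digits N" "length u = n" if "u \<in> S" for u using that by (auto simp: S_def stay_def)
    have S2: "norm (U N a r (w @ \<tau>) - U N a r w) \<le> 2 * R p'" if "u \<in> S" "prefix \<tau> u" for u \<tau>
    proof -
      have "\<tau> = take (length \<tau>) u" "length \<tau> \<le> n" using that S1(2)[OF that(1)] by (auto simp: prefix_def)
      then have "norm (U N a r (w @ \<tau>) - U N a r w) \<le> R p'" using that(1) by (auto simp: S_def stay_def)
      then show ?thesis using R(1)[of p'] by linarith
    qed
    have near': "norm (U N a r (w @ \<tau>) - z) \<le> 2 * R p + M p" if "u \<in> S" "prefix \<tau> u" for u \<tau>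
      by (rule near[OF S2[OF that]])
    have finS: "finite S"
      by (rule finite_subset[OF _ finite_lists_length_eq[OF finite_digits, of N n]]) (use S1 in auto)
    let ?g = "\<lambda>u. (w @ u, Suc p', U N a r (w @ u))"
    show ?thesis
    proof (intro exI[of _ "?g ` S"] conjI)
      show "finite (?g ` S)" using finS by simp
      show "?g ` S \<subseteq> G"
      proof clarify
        fix u assume u: "u \<in> S"
        show "?g u \<in> G" using S1[OF u] w(1) M0[of "Suc p'"] by (simp add: G_def n_def less_imp_le)
      qed
      show "\<forall>(w2, p2, z2)\<in>?g ` S. (\<exists>u. w2 = w @ u \<and> set u \<subseteq> digits N \<and> m \<le> length u \<and>
          (\<forall>\<tau>. prefix \<tau> u \<longrightarrow> norm (U N a r (w @ \<tau>) - z) \<le> 2 * R p + M p)) \<and>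
        (p2 = p \<and> z2 = z \<or> p < p2 \<and> norm (z2 - z) \<le> 2 * R p + M p) \<and> (K (Suc p) \<le> length w \<longrightarrow> p < p2)"
      proof clarify
        fix u assume u: "u \<in> S"
        have 1: "p < Suc p'" using n1(3) by simp
        have 2: "norm (U N a r (w @ u) - z) \<le> 2 * R p + M p" by (rule near'[OF u]) simp
        have 3: "m \<le> length u" using S1(2)[OF u] by (simp add: n_def)
        show "(\<exists>v. w @ u = w @ v \<and> set v \<subseteq> digits N \<and> m \<le> length v \<and>
          (\<forall>\<tau>. prefix \<tau> v \<longrightarrow> norm (U N a r (w @ \<tau>) - z) \<le> 2 * R p + M p)) \<and>
        (Suc p' = p \<and> U N a r (w @ u) = z \<or> p < Suc p' \<and> norm (U N a r (w @ u) - z) \<le> 2 * R p + M p) \<and> (K (Suc p) \<le> length w \<longrightarrow> p < Suc p')"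
          using S1(1)[OF u] near'[OF u] 1 2 3 by blast
      qed
      show "\<forall>y\<in>?g ` S. \<forall>y'\<in>?g ` S. prefix (fst y) (fst y') \<longrightarrow> y = y'"
      proof (intro ballI impI)
        fix y y' assume y: "y \<in> ?g ` S" "y' \<in> ?g ` S" "prefix (fst y) (fst y')"
        then obtain u v where uv: "u \<in> S" "v \<in> S" "y = ?g u" "y' = ?g v" by blast
        then have "prefix u v" using y(3) by simp
        then obtain zs where zs: "v = u @ zs" by (auto simp: prefix_def)
        then have "u = v" using S1(2)[OF uv(1)] S1(2)[OF uv(2)] by simp
        then show "y = y'" by (simp add: uv)
      qed
      \<comment> \<open>Half of the mass suffices, as the tree only has to keep the fraction \<rho>,
        which is at most 1/2.\<close>
      have "?\<rho> \<le> (\<Sum>u\<in>S. ?mm u)" using stay[rule_format, of n] \<rho> by (simp add: S_def)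
      then show "?\<rho> * ?mm w \<le> (\<Sum>y\<in>?g ` S. ?mm (fst y))" by (rule mass)
    qed
  qed
qed

text \<open>Every branch runs through all phases, and below a node of phase p the values of U stay
  within 2 B p of its centre, where B p halves with each phase; this yields the Cauchy condition of
  \<open>diff_from_cells\<close>.\<close>

lemma small_zygmund_part:
  fixes a :: "real^'n"
  assumes Q: "wqr \<gamma> N" and V: "\<And>\<kappa>. \<kappa> > 0 \<Longrightarrow> \<exists>l0>0. hess_le \<kappa> l0" and l: "l > 0" and s: "0 < s" "s < real CARD('n)"
  shows "hausdorff_measure s (diff_points f \<inter> cube a l) \<noteq> 0"
proof -
  have N: "N \<ge> 2" using Q by (simp add: wqr_def)
  have N0: "N > 0" using N by simp
  define \<rho> where "\<rho> = rho \<gamma> N"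
  have \<rho>: "0 < \<rho>" "\<rho> \<le> 1/2" using rho_bounds[OF Q] by (auto simp: \<rho>_def)
  obtain m where m: "m \<ge> 1" "\<rho> * (real N powr (-s) * real (card (digits N :: (real^'n) set))) ^ m \<ge> 1"
    using contraction_steps[OF N s(2) \<rho>(1)] by blast
  have jn: "jump N \<ge> 0" by (simp add: jump_def)
  have Lm: "Lam \<gamma> N \<ge> 0" using c2_ge jn by (simp add: Lam_def)
  \<comment> \<open>With \<kappa> p = \<rho> R p / X both requirements on R hold in every phase: it
    dominates Lam \<kappa>, and \<rho> R exceeds jump \<kappa> m.\<close>
  define X where "X = Lam \<gamma> N + jump N * real m + 1"
  have X: "X > 0" "Lam \<gamma> N \<le> X" "jump N * real m < X" using jn Lm by (auto simp: X_def intro: add_nonneg_pos)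
  define R where "R = (\<lambda>p. (1/2::real) ^ p)"
  define M where "M = (\<lambda>p. 4 / \<rho> * R p)"
  define \<kappa> where "\<kappa> = (\<lambda>p. \<rho> * R p / X)"
  have R0: "R p > 0" for p by (simp add: R_def)
  have Rd: "R (Suc p) \<le> R p" for p by (simp add: R_def)
  have k0: "\<kappa> p > 0" for p using \<rho> R0 X by (simp add: \<kappa>_def)
  have k1: "Lam \<gamma> N * \<kappa> p \<le> R p" for p
  proof -
    have "Lam \<gamma> N * \<kappa> p \<le> X * \<kappa> p" using X k0[of p] by (intro mult_right_mono) auto
    also have "\<dots> = \<rho> * R p" using X by (simp add: \<kappa>_def)
    also have "\<dots> \<le> 1 * R p" using \<rho> R0[of p] by (intro mult_right_mono) auto
    finally show ?thesis by simp
  qed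
  have k2: "jump N * \<kappa> p * real m < \<rho> * R p" for p
  proof -
    have "jump N * \<kappa> p * real m = (jump N * real m) * \<kappa> p" by simp
    also have "\<dots> < X * \<kappa> p" using X k0[of p] by (intro mult_strict_right_mono) auto
    also have "\<dots> = \<rho> * R p" using X by (simp add: \<kappa>_def)
    finally show ?thesis .
  qed
  obtain l0 where l0: "l0 > 0" "hess_le (\<kappa> 0) l0" using V[OF k0] by blast
  \<comment> \<open>Shrinking the cube lets phase 0 start at its root, that is K 0 = 0; positive
    measure in the smaller cube is enough.\<close>
  define r where "r = min l l0"
  have r: "r > 0" "r \<le> l" "hess_le (\<kappa> 0) r" using l l0 hess_le_mono[OF l0(2), of r] by (auto simp: r_def)
  have "\<exists>k. hess_le (\<kappa> p) (r / real N ^ k) \<and> (p = 0 \<longrightarrow> k = 0)" for p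
  proof (cases "p = 0")
    case True then show ?thesis using r(3) by (intro exI[of _ 0]) simp
  next
    case False
    obtain l1 where l1: "l1 > 0" "hess_le (\<kappa> p) l1" using V[OF k0] by blast
    have "(\<lambda>k. r * (1 / real N) ^ k) \<longlonglongrightarrow> r * 0" using N by (intro tendsto_mult_left LIMSEQ_power_zero) auto
    then have "\<forall>\<^sub>F k in sequentially. r * (1 / real N) ^ k < l1" using l1(1) by (intro order_tendstoD) auto
    then obtain k where "r / real N ^ k \<le> l1" by (auto simp: eventually_sequentially power_one_over intro: less_imp_le)
    then show ?thesis using hess_le_mono[OF l1(2)] False by blast
  qed
  then obtain K where K: "\<And>p. hess_le (\<kappa> p) (r / real N ^ K p)" "K 0 = 0" by metis
  define G where "G = {(w, p, z). set w \<subseteq> digits N \<and> K p \<le> length w \<and> norm (U N a r w - z) \<le> M p}"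
  let ?mm = "\<lambda>u::(real^'n) list. (1 / real (card (digits N :: (real^'n) set))) ^ length u"
  \<comment> \<open>Bounds both the distance of U from the centre during one selection and the shift
    of the centre when the phase advances.\<close>
  define B where "B = (\<lambda>p. 2 * R p + M p)"
  define ok where "ok = (\<lambda>(w, p, z) C. finite C \<and> C \<subseteq> G \<and>
     (\<forall>(w2, p2, z2)\<in>C. (\<exists>u. w2 = w @ u \<and> set u \<subseteq> digits N \<and> m \<le> length u \<and>
          (\<forall>\<tau>. prefix \<tau> u \<longrightarrow> norm (U N a r (w @ \<tau>) - z) \<le> B p)) \<and>
        (p2 = p \<and> z2 = z \<or> p < p2 \<and> norm (z2 - z) \<le> B p) \<and> (K (Suc p) \<le> length w \<longrightarrow> p < p2)) \<and>
     (\<forall>y\<in>C. \<forall>y'\<in>C. prefix (fst y) (fst y') \<longrightarrow> y = y') \<and>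
     \<rho> * ?mm w \<le> (\<Sum>y\<in>C. ?mm (fst y)))"
  have "\<exists>C. ok x C" if "x \<in> G" for x
  proof (cases x)
    case (fields w p z)
    then show ?thesis
      using phase_step[where K=K and \<kappa>=\<kappa> and R=R and M=M and w=w and p=p and z=z and a=a and m=m, OF Q r(1) K(1) less_imp_le[OF k0] R0 k1 k2[unfolded \<rho>_def] Rd] that
      unfolding ok_def fields prod.case B_def \<rho>_def G_def M_def by simp
  qed
  then have "\<forall>x\<in>G. \<exists>C. ok x C" by blast
  from bchoice[OF this] obtain ch where chx: "\<forall>x\<in>G. ok x (ch x)" by (rule exE)
  have chok: "ok (w, p, z) (ch (w, p, z))" if "(w, p, z) \<in> G" for w p z by (rule bspec[OF chx that])
  have chD: "(\<exists>u. w2 = w @ u \<and> set u \<subseteq> digits N \<and> m \<le> length u \<and>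
          (\<forall>\<tau>. prefix \<tau> u \<longrightarrow> norm (U N a r (w @ \<tau>) - z) \<le> B p))"
      "p2 = p \<and> z2 = z \<or> p < p2 \<and> norm (z2 - z) \<le> B p" "K (Suc p) \<le> length w \<Longrightarrow> p < p2"
    if "(w, p, z) \<in> G" "(w2, p2, z2) \<in> ch (w, p, z)" for w p z w2 p2 z2
  proof -
    from chok[OF that(1), unfolded ok_def prod.case, THEN conjunct2, THEN conjunct2, THEN conjunct1]
    have "case (w2, p2, z2) of (w2, p2, z2) \<Rightarrow> (\<exists>u. w2 = w @ u \<and> set u \<subseteq> digits N \<and> m \<le> length u \<and>
          (\<forall>\<tau>. prefix \<tau> u \<longrightarrow> norm (U N a r (w @ \<tau>) - z) \<le> B p)) \<and>
        (p2 = p \<and> z2 = z \<or> p < p2 \<and> norm (z2 - z) \<le> B p) \<and> (K (Suc p) \<le> length w \<longrightarrow> p < p2)"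
      by (rule bspec[OF _ that(2)])
    note c = this[unfolded prod.case]
    show "\<exists>u. w2 = w @ u \<and> set u \<subseteq> digits N \<and> m \<le> length u \<and>
          (\<forall>\<tau>. prefix \<tau> u \<longrightarrow> norm (U N a r (w @ \<tau>) - z) \<le> B p)" by (rule conjunct1[OF c])
    show "p2 = p \<and> z2 = z \<or> p < p2 \<and> norm (z2 - z) \<le> B p" by (rule conjunct1[OF conjunct2[OF c]])
    show "p < p2" if "K (Suc p) \<le> length w" by (rule mp[OF conjunct2[OF conjunct2[OF c]] that])
  qed
  have tree: "cantor_tree (digits N) fst ch G \<rho> (real N powr (-s)) m"
  proof
    show "finite (digits N :: (real^'n) set)" by (rule finite_digits)
    show "(digits N :: (real^'n) set) \<noteq> {}" using zero_digits[OF N0] by auto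
    show "0 < real N powr - s" using N by simp
    show "1 \<le> real N powr - s * real (card (digits N :: (real^'n) set))"
      unfolding digits_weight[OF N] using N s by (intro ge_one_powr_ge_zero) auto
    show "0 < \<rho>" "\<rho> \<le> 1" "1 \<le> \<rho> * (real N powr - s * real (card (digits N :: (real^'n) set))) ^ m" using \<rho> m by auto
    fix x assume x: "x \<in> G"
    obtain w p z where xe: "x = (w, p, z)" by (cases x)
    note g = chok[OF x[unfolded xe], unfolded ok_def prod.case, folded xe]
    show "ch x \<subseteq> G" "finite (ch x)" using g by blast+
    show "\<exists>u. fst y = fst x @ u \<and> set u \<subseteq> digits N \<and> m \<le> length u" if "y \<in> ch x" for y
      using chD(1)[OF x[unfolded xe], of "fst y" "fst (snd y)" "snd (snd y)"] that by (auto simp: xe)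
    show "y = z'" if "y \<in> ch x" "z' \<in> ch x" "prefix (fst y) (fst z')" for y z' using that g by blast
    show "\<rho> * ?mm (fst x) \<le> (\<Sum>y\<in>ch x. ?mm (fst y))" using g by (simp add: xe)
  qed
  interpret T: cantor_tree "digits N" fst ch G \<rho> "real N powr (-s)" m by (rule tree)
  define x0 where "x0 = ([] :: (real^'n) list, 0 :: nat, U N a r [])"
  have root: "x0 \<in> G" using K(2) R0[of 0] \<rho> by (auto simp: x0_def G_def M_def)
  have B0: "B p > 0" "M p \<le> B p" for p using R0[of p] \<rho> by (auto simp: B_def M_def intro!: add_pos_pos)
  have Bh: "B (Suc p) = B p / 2" for p by (simp add: B_def M_def R_def)
  have Bmono: "2 * B p2 \<le> B p" if "p < p2" for p p2
  proof -
    have "decseq B" using B0(1) by (intro decseq_SucI) (simp add: Bh less_imp_le)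
    then have "B p2 \<le> B (Suc p)" using that by (auto simp: decseq_def)
    then show ?thesis by (simp add: Bh)
  qed
  \<comment> \<open>The factor 2 sums a geometric series: if a child has phase p2 > p and a new
    centre, the distance is at most 2 B p2 + B p, and 2 B p2 \<le> B p.\<close>
  have tail: "fst (snd x) \<le> fst (snd y) \<and> (\<forall>\<tau>. prefix (fst x) \<tau> \<longrightarrow> prefix \<tau> (fst y) \<longrightarrow> norm (U N a r \<tau> - snd (snd x)) \<le> 2 * B (fst (snd x)))"
    if "x \<in> G" "y \<in> T.gen j x" for x y j
    using that
  proof (induction j arbitrary: x)
    case 0
    obtain w p z where xe: "x = (w, p, z)" by (cases x)
    have "norm (U N a r w - z) \<le> M p" using 0(1) by (simp add: G_def xe)
    then have "norm (U N a r w - z) \<le> 2 * B p" using B0[of p] by linarith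
    then show ?case using 0(2) by (auto simp: xe dest: prefix_order.antisym)
  next
    case (Suc j)
    obtain w p z where xe: "x = (w, p, z)" by (cases x)
    obtain v where v: "v \<in> ch x" "y \<in> T.gen j v" using Suc.prems(2) by auto
    obtain w2 p2 z2 where ve: "v = (w2, p2, z2)" by (cases v)
    have vG: "v \<in> G" using T.ch(1)[OF Suc.prems(1)] v(1) by blast
    note IH = Suc.IH[OF vG v(2), unfolded ve fst_conv snd_conv]
    note cd = chD[OF Suc.prems(1)[unfolded xe] v(1)[unfolded xe ve]]
    obtain u where u: "w2 = w @ u" "\<And>\<tau>. prefix \<tau> u \<Longrightarrow> norm (U N a r (w @ \<tau>) - z) \<le> B p" using cd(1) by blast
    have wy: "prefix w2 (fst y)" using T.gen_ext[OF vG v(2)] by (auto simp: ve)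
    have "norm (U N a r \<tau> - z) \<le> 2 * B p" if t: "prefix w \<tau>" "prefix \<tau> (fst y)" for \<tau>
    proof (cases "prefix \<tau> w2")
      case True
      then obtain \<tau>' where "\<tau> = w @ \<tau>'" "prefix \<tau>' u" using t(1) u(1) by (auto simp: prefix_def)
      then have "norm (U N a r \<tau> - z) \<le> B p" using u(2) by blast
      then show ?thesis using B0[of p] by linarith
    next
      case False
      then have "prefix w2 \<tau>" using prefix_same_cases[OF wy t(2)] by blast
      then have i: "norm (U N a r \<tau> - z2) \<le> 2 * B p2" using IH t(2) by blast
      from cd(2) show ?thesis
      proof
        assume "p2 = p \<and> z2 = z" then show ?thesis using i by simp
      next
        assume pz: "p < p2 \<and> norm (z2 - z) \<le> B p"
        have "norm (U N a r \<tau> - z) \<le> norm (U N a r \<tau> - z2) + norm (z2 - z)"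
          using norm_triangle_ineq[of "U N a r \<tau> - z2" "z2 - z"] by simp
        then show ?thesis using i pz Bmono[of p p2] by linarith
      qed
    qed
    moreover have "p \<le> fst (snd y)" using IH cd(2) by linarith
    ultimately show ?case by (simp add: xe)
  qed
  \<comment> \<open>A generation descends at least m \<ge> 1 levels, so after K (P+1) further
    generations all words are long enough for phase P+1, and the next selection advances every node
    that is still in phase P.\<close>
  have phases: "\<exists>J. \<forall>y\<in>T.gen J x0. P \<le> fst (snd y)" for P
  proof (induction P)
    case 0 show ?case by simp
  next
    case (Suc P)
    then obtain J where J: "\<And>y. y \<in> T.gen J x0 \<Longrightarrow> P \<le> fst (snd y)" by blast
    have "Suc P \<le> fst (snd y)" if y: "y \<in> T.gen (J + (K (Suc P) + 1)) x0" for y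
    proof -
      obtain x where x: "x \<in> T.gen J x0" "y \<in> T.gen (K (Suc P) + 1) x" using y unfolding T.gen_add[of J] by blast
      obtain v where v: "v \<in> T.gen (K (Suc P)) x" "y \<in> T.gen 1 v" using x(2) unfolding T.gen_add[of "K (Suc P)"] by blast
      have xG: "x \<in> G" using T.gen_G[OF root] x(1) by blast
      have vG: "v \<in> G" using T.gen_G[OF xG] v(1) by blast
      have vP: "P \<le> fst (snd v)" using J[OF x(1)] tail[OF xG v(1)] by linarith
      have yv: "fst (snd v) \<le> fst (snd y)" using tail[OF vG v(2)] by blast
      show ?thesis
      proof (cases "fst (snd v) = P")
        case True
        obtain u where "fst v = fst x @ u" "K (Suc P) * m \<le> length u" using T.gen_ext[OF xG v(1)] by blast
        moreover have "K (Suc P) \<le> K (Suc P) * m" using m(1) by (cases m) auto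
        ultimately have "K (Suc P) \<le> length (fst v)" by (metis length_append le_trans trans_le_add2)
        moreover have "y \<in> ch v" using v(2) by simp
        moreover have "(fst v, P, snd (snd v)) = v" using True by (metis prod.collapse)
        ultimately have "P < fst (snd y)"
          using chD(3)[of "fst v" "fst (snd v)" "snd (snd v)" "fst y" "fst (snd y)" "snd (snd y)"] vG True by simp
        then show ?thesis by simp
      qed (use vP yv in linarith)
    qed
    then show ?case by blast
  qed
  show ?thesis
  proof (rule cantor_hausdorff[OF tree root _ N r(1) s(1), where a=a])
    show "fst x0 = []" by (simp add: x0_def)
    fix x assume x: "\<And>j. \<exists>y\<in>T.gen j x0. x \<in> cell N (fst y) a r"
    have "x \<in> diff_points f"
    proof (rule diff_from_cells[OF V N r(1)])
      fix \<epsilon> :: real assume e: "\<epsilon> > 0"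
      have BP: "B P = B 0 * (1/2) ^ P" for P by (induction P) (auto simp: Bh)
      have "(\<lambda>P. B 0 * (1/2) ^ P) \<longlonglongrightarrow> B 0 * 0" by (intro tendsto_mult_left LIMSEQ_power_zero) auto
      then have "\<forall>\<^sub>F P in sequentially. B 0 * (1/2) ^ P < \<epsilon> / 4" using e by (intro order_tendstoD) auto
      then obtain P where "B 0 * (1/2) ^ P < \<epsilon> / 4" unfolding eventually_sequentially by blast
      then have P: "B P < \<epsilon> / 4" by (simp only: BP[of P])
      obtain J where J: "\<And>y. y \<in> T.gen J x0 \<Longrightarrow> P \<le> fst (snd y)" using phases by blast
      obtain L where L: "\<And>y. y \<in> T.gen J x0 \<Longrightarrow> length (fst y) \<le> L"
        using finite_nat_set_iff_bounded_le[of "(\<lambda>y. length (fst y)) ` T.gen J x0"] T.finite_gen[OF root, of J] by auto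
      show "\<exists>L. \<forall>k\<ge>L. \<forall>k'\<ge>L. \<exists>v v'. length v = k \<and> length v' = k' \<and>
       x \<in> cell N v a r \<and> x \<in> cell N v' a r \<and> norm (U N a r v - U N a r v') \<le> \<epsilon>"
      proof (intro exI[of _ L] allI impI)
        fix k k' assume k: "L \<le> k" "L \<le> k'"
        \<comment> \<open>One word y, deep enough for both levels, provides both cells as its
          prefixes of lengths k and k'.\<close>
        define j where "j = max k k'"
        obtain y where y: "y \<in> T.gen (J + j) x0" "x \<in> cell N (fst y) a r" using x by blast
        obtain v where v: "v \<in> T.gen J x0" "y \<in> T.gen j v" using y(1) unfolding T.gen_add by blast
        have vG: "v \<in> G" using T.gen_G[OF root] v(1) by blast
        obtain u where u: "fst y = fst v @ u" "set u \<subseteq> digits N" "j * m \<le> length u" using T.gen_ext[OF vG v(2)] by blast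
        have "j \<le> j * m" using m(1) by (cases m) auto
        then have "j \<le> length u" using u(3) by (rule order_trans)
        then have ju: "j \<le> length (fst y)" using u(1) by simp
        have yG: "y \<in> G" using T.gen_G[OF vG] v(2) by blast
        then have yd: "set (fst y) \<subseteq> digits N" by (auto simp: G_def)
        have B: "2 * B (fst (snd v)) \<le> \<epsilon> / 2"
        proof (cases "fst (snd v) = P")
          case False
          then have "2 * B (fst (snd v)) \<le> B P" using J[OF v(1)] by (intro Bmono) simp
          then show ?thesis using P B0(1)[of P] by linarith
        qed (use P in simp)
        have c: "length (take i (fst y)) = i \<and> x \<in> cell N (take i (fst y)) a r \<and> norm (U N a r (take i (fst y)) - snd (snd v)) \<le> \<epsilon> / 2"
          if i: "L \<le> i" "i \<le> j" for i
        proof (intro conjI)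
          show "length (take i (fst y)) = i" using i ju by simp
          have "set (drop i (fst y)) \<subseteq> digits N" using yd set_drop_subset[of i "fst y"] by blast
          from cell_append_subset[OF N0 r(1) this, of "take i (fst y)" a] show "x \<in> cell N (take i (fst y)) a r" using y(2) by auto
          have "prefix (fst v) (take i (fst y))" using L[OF v(1)] i by (simp add: u(1) prefix_def)
          then have "norm (U N a r (take i (fst y)) - snd (snd v)) \<le> 2 * B (fst (snd v))"
            using tail[OF vG v(2)] take_is_prefix by blast
          then show "norm (U N a r (take i (fst y)) - snd (snd v)) \<le> \<epsilon> / 2" using B by linarith
        qed
        have ck: "k \<le> j" "k' \<le> j" by (auto simp: j_def)
        have "norm (U N a r (take k (fst y)) - U N a r (take k' (fst y))) \<le> \<epsilon>"
          using norm_triangle_ineq4[of "U N a r (take k (fst y)) - snd (snd v)" "U N a r (take k' (fst y)) - snd (snd v)"]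
            c[OF k(1) ck(1)] c[OF k(2) ck(2)] by simp
        then show "\<exists>v v'. length v = k \<and> length v' = k' \<and>
       x \<in> cell N v a r \<and> x \<in> cell N v' a r \<and> norm (U N a r v - U N a r v') \<le> \<epsilon>"
          using c[OF k(1) ck(1)] c[OF k(2) ck(2)] by blast
      qed
    qed
    moreover obtain y where "y \<in> T.gen 0 x0" "x \<in> cell N (fst y) a r" using x[of 0] by auto
    then have "x \<in> cube a r" by (simp add: cell_Nil x0_def)
    then have "x \<in> cube a l" unfolding mem_cube using r(2) by (meson add_left_mono order_trans)
    ultimately show "x \<in> diff_points f \<inter> cube a l" by blast
  qed
qed

end

lemma second_diff_bound_zygmund:
  assumes "f \<in> zygmund_class"
  shows "\<exists>A\<ge>0. second_diff_bound A 0 f"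
proof -
  define S where "S = (SUP x. SUP h \<in> - {0}. ennreal (second_diff_quot f x h))"
  have S: "S < \<infinity>" using assms by (simp add: zygmund_class_def S_def)
  have "\<bar>f (x + h) + f (x - h) - 2 * f x\<bar> \<le> enn2real S * norm h" for x h
  proof (cases "h = 0")
    case False
    have "ennreal (second_diff_quot f x h) \<le> (SUP h \<in> - {0}. ennreal (second_diff_quot f x h))"
      using False by (intro SUP_upper) simp
    also have "\<dots> \<le> S" unfolding S_def by (intro SUP_upper) simp
    finally have "ennreal (second_diff_quot f x h) \<le> ennreal (enn2real S)" using S by simp
    then have "second_diff_quot f x h \<le> enn2real S" by (simp add: ennreal_le_iff)
    then show ?thesis using False by (simp add: second_diff_quot_def divide_le_eq)
  qed simp
  then show ?thesis by (intro exI[of _ "enn2real S"]) (simp add: second_diff_bound_def)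
qed

text \<open>
  The term \<open>D |h|\<^bsup>3/2\<^esup>\<close> absorbs the steps that are not small, for which only boundedness of \<open>f\<close> is known.
\<close>

lemma second_diff_bound_small_zygmund:
  fixes f :: "'a::real_normed_vector \<Rightarrow> real"
  assumes f: "f \<in> small_zygmund_class" and B: "\<And>x. \<bar>f x\<bar> \<le> B" and \<epsilon>: "\<epsilon> > 0"
  shows "\<exists>D\<ge>0. second_diff_bound \<epsilon> D f"
proof -
  have B0: "B \<ge> 0" using B[of 0] by linarith
  have four: "\<bar>f (x + h) + f (x - h) - 2 * f x\<bar> \<le> 4 * B" for x h
    using B[of "x + h"] B[of "x - h"] B[of x] by linarith
  have "((\<lambda>h. SUP x. second_diff_quot f x h) \<longlongrightarrow> 0) (at 0)" using f by (simp add: small_zygmund_class_def)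
  then obtain \<delta> where \<delta>: "\<delta> > 0" "\<And>h. h \<noteq> 0 \<Longrightarrow> norm h < \<delta> \<Longrightarrow> \<bar>SUP x. second_diff_quot f x h\<bar> < \<epsilon>"
    using \<epsilon> unfolding LIM_eq by (metis diff_zero real_norm_def)
  define D where "D = 4 * B / \<delta> powr (3/2)"
  have D: "D \<ge> 0" using B0 by (simp add: D_def)
  have "\<bar>f (x + h) + f (x - h) - 2 * f x\<bar> \<le> \<epsilon> * norm h + D * norm h powr (3/2)" for x h
  proof (cases "h = 0")
    case False
    show ?thesis
    proof (cases "norm h < \<delta>")
      case True
      have "bdd_above (range (\<lambda>x. second_diff_quot f x h))"
        unfolding bdd_above_def second_diff_quot_def
        by (intro exI[of _ "4 * B / norm h"]) (auto intro!: divide_right_mono four)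
      then have "second_diff_quot f x h \<le> (SUP x. second_diff_quot f x h)" by (intro cSUP_upper) auto
      also have "\<dots> \<le> \<epsilon>" using \<delta>(2)[OF False True] by linarith
      finally have "\<bar>f (x + h) + f (x - h) - 2 * f x\<bar> \<le> \<epsilon> * norm h"
        using False by (simp add: second_diff_quot_def divide_le_eq)
      moreover have "0 \<le> D * norm h powr (3/2)" using D by simp
      ultimately show ?thesis by linarith
    next
      case far: False
      have "D * \<delta> powr (3/2) \<le> D * norm h powr (3/2)"
        using D \<delta>(1) far by (intro mult_left_mono powr_mono2) auto
      moreover have "D * \<delta> powr (3/2) = 4 * B" using \<delta>(1) by (simp add: D_def)
      moreover have "0 \<le> \<epsilon> * norm h" using \<epsilon> by simp
      ultimately show ?thesis using four[of x h] by linarith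
    qed
  qed simp
  then show ?thesis using D unfolding second_diff_bound_def by blast
qed

theorem corollary2:
  fixes f :: "real ^ 'n \<Rightarrow> real"
  assumes "bounded (range f)"
    and "continuous_on UNIV f"
    and "weakly_quasiregular_gradient (poisson_extension f)"
  shows "(f \<in> zygmund_class \<longrightarrow>
            (\<forall>a l. l > 0 \<longrightarrow> hausdorff_dim (lip_points f \<inter> cube a l) = of_nat CARD('n)))
       \<and> (f \<in> small_zygmund_class \<longrightarrow>
            (\<forall>a l. l > 0 \<longrightarrow> hausdorff_dim (diff_points f \<inter> cube a l) = of_nat CARD('n)))"
proof -
  obtain B where B: "\<And>x. \<bar>f x\<bar> \<le> B" using assms(1) by (auto simp: bounded_iff)
  interpret bounded_continuous f B using assms(2) B by unfold_locales
  obtain \<gamma> N where Q: "wqr \<gamma> N" using assms(3) unfolding weakly_quasiregular_gradient_def wqr_def by blast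
  obtain C where C: "C \<ge> 0" "\<And>A D p b c. A \<ge> 0 \<Longrightarrow> D \<ge> 0 \<Longrightarrow> second_diff_bound A D f \<Longrightarrow> snd p > 0 \<Longrightarrow> b \<in> Basis \<Longrightarrow> c \<in> Basis \<Longrightarrow>
     \<bar>partial b (partial c (poisson_extension f)) p\<bar> \<le> C * (A / snd p + D / sqrt (snd p))"
    using hessian_bound by blast
  show ?thesis
  proof (intro conjI impI allI)
    fix a :: "real^'n" and l :: real
    assume z: "f \<in> zygmund_class" and l: "l > 0"
    obtain A where A: "A \<ge> 0" "second_diff_bound A 0 f" using second_diff_bound_zygmund[OF z] by blast
    \<comment> \<open>With D = 0 the Hessian bound is C A / y at every height, so l may be
      arbitrary.\<close>
    have H: "hess_le (C * A) l"
      unfolding hess_le_def using C(2)[OF A(1) order_refl A(2)] by fastforce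
    show "hausdorff_dim (lip_points f \<inter> cube a l) = of_nat CARD('n)"
      by (rule hausdorff_dim_eqI[of _ a l]) (use zygmund_part[OF Q H l] l in auto)
  next
    fix a :: "real^'n" and l :: real
    assume z: "f \<in> small_zygmund_class" and l: "l > 0"
    have V: "\<exists>l0>0. hess_le \<kappa> l0" if k: "\<kappa> > 0" for \<kappa>
    proof -
      \<comment> \<open>Half of \<kappa> is reserved for the A-term and half for the D-term; the
        latter equals C D sqrt(y) / y and is small enough below height t^2.\<close>
      define \<epsilon> where "\<epsilon> = \<kappa> / (2 * (C + 1))"
      have e: "\<epsilon> > 0" "C * \<epsilon> \<le> \<kappa> / 2" using k C(1) by (auto simp: \<epsilon>_def field_simps)
      obtain D where D: "D \<ge> 0" "second_diff_bound \<epsilon> D f" using second_diff_bound_small_zygmund[OF z B e(1)] by blast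
      define t where "t = \<kappa> / (2 * (C * D + 1))"
      have CD: "C * D \<ge> 0" using C(1) D(1) by simp
      have t: "t > 0" using k CD by (simp add: t_def)
      have CDt: "C * D * t \<le> \<kappa> / 2" using k CD by (simp add: t_def field_simps)
      have "\<bar>partial b (partial c (poisson_extension f)) (x, y)\<bar> \<le> \<kappa> / y"
        if y: "0 < y" "y \<le> t\<^sup>2" and bc: "b \<in> Basis" "c \<in> Basis" for x y b c
      proof -
        have "sqrt y \<le> t" using y t by (intro real_le_lsqrt) auto
        then have "C * D * sqrt y \<le> \<kappa> / 2" using CDt mult_left_mono[of "sqrt y" t "C * D"] CD by linarith
        then have "C * \<epsilon> + C * D * sqrt y \<le> \<kappa>" using e(2) by linarith
        then have "(C * \<epsilon> + C * D * sqrt y) / y \<le> \<kappa> / y" using y by (intro divide_right_mono) auto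
        moreover have "C * (\<epsilon> / y + D / sqrt y) = (C * \<epsilon> + C * D * sqrt y) / y"
        proof -
          have "1 / sqrt y = sqrt y / y" using y by (simp add: real_div_sqrt field_simps)
          then have "D / sqrt y = D * (sqrt y / y)" by (metis mult.right_neutral times_divide_eq_right)
          then show ?thesis by (simp add: add_divide_distrib distrib_left)
        qed
        ultimately show ?thesis using C(2)[of \<epsilon> D "(x, y)" b c] e(1) D y bc by simp
      qed
      then have "hess_le \<kappa> (t\<^sup>2)" unfolding hess_le_def by blast
      then show ?thesis using t by (intro exI[of _ "t\<^sup>2"]) simp
    qed
    show "hausdorff_dim (diff_points f \<inter> cube a l) = of_nat CARD('n)"
      by (rule hausdorff_dim_eqI[of _ a l]) (use small_zygmund_part[OF Q V l] l in auto)
  qed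
qed

end
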